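(* For all $\underline{\boldsymbol f}=[\boldsymbol f_s\mid\boldsymbol f_f]\in\mathcal C^1_{[0,T]}(L^2(\Omega,\mathbb R^{d\times2}))$, $g\in\mathcal C^1_{[0,T]}(L^2(\Omega))$, $\underline{\boldsymbol u}^0\in\mathcal X_1$ and $(\boldsymbol\sigma^0,p^0)\in\mathcal X_2$, there exist unique $\underline{\boldsymbol u}=[\boldsymbol u_s\mid\boldsymbol u_f]\in\mathcal C^1_{[0,T]}(\mathcal H_1)\cap\mathcal C^0_{[0,T]}(\mathcal X_1)$ and $(\boldsymbol\sigma,p)\in\mathcal C^1_{[0,T]}(\mathcal H_2)\cap\mathcal C^0_{[0,T]}(\mathcal X_2)$ solving $$\dot{\underline{\boldsymbol u}}+\big[-\mathbf{div}(\boldsymbol\sigma-\alpha p\,\mathrm I_d)\mid\nabla p\big]R^{-1}+\big[\mathbf 0\mid\beta\boldsymbol u_f\big]R^{-1}=\big[\boldsymbol f_s\mid\boldsymbol f_f\big]R^{-1}\quad\text{in }\Omega\times(0,T],$$ $$(\dot{\boldsymbol\sigma},\dot p)+\big(-\mathcal C\boldsymbol\varepsilon(\boldsymbol u_s),\tfrac1s(\mathrm{div}\,\boldsymbol u_f+\alpha\,\mathrm{div}\,\boldsymbol u_s)\big)=\big(\mathbf 0,\tfrac1s g\big)\quad\text{in }\Omega\times(0,T],$$ with initial conditions $\underline{\boldsymbol u}(0)=\underline{\boldsymbol u}^0$ and $(\boldsymbol\sigma(0),p(0))=(\boldsymbol\sigma^0,p^0)$ in $\Omega$. Moreover, there exists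 a constant $C>0$ such that $$\max_{[0,T]}\|\underline{\boldsymbol u}(t)\|_{\mathcal H_1}+\max_{[0,T]}\|(\boldsymbol\sigma,p)(t)\|_{\mathcal H_2}\le C\Big(\max_{[0,T]}\|\underline{\boldsymbol f}(t)\|_{0,\Omega}+\max_{[0,T]}\|g(t)\|_{0,\Omega}\Big)+\|\underline{\boldsymbol u}^0\|_{\mathcal H_1}+\|(\boldsymbol\sigma^0,p^0)\|_{\mathcal H_2}.$$
   Context: Domain and boundary: $\Omega\subset\mathbb R^d$, $d\in\{2,3\}$, is a bounded polygonal/polyhedral Lipschitz domain with boundary $\Gamma$ and outward unit normal $\boldsymbol n$; $T>0$. $\Gamma=\Gamma_D^s\cup\Gamma_N^s$ and $\Gamma=\Gamma_D^f\cup\Gamma_N^f$ are two disjoint partitions, with $\Gamma_D^s$ and $\Gamma_D^f$ of positive surface measure. Coefficients: $0<\alpha\le1$, $s>0$, $\beta=\eta/\kappa$ with $\eta,\kappa>0$. $\mathcal C$ is a symmetric positive definite fourth-order tensor acting on $\mathbb R^{d\times d}_{\mathrm{sym}}$ (symmetric matrices), with $c^-\boldsymbol\zeta:\boldsymbol\zeta\le\mathcal C\boldsymbol\zeta:\boldsymbol\zeta\le c^+\boldsymbol\zeta:\boldsymbol\zeta$ for some $c^+>c^->0$; $\mathcal A=\mathcal C^{-1}$. $R=\begin{pmatrix}\rho_{11}&\rho_{12}\\ \rho_{12}&\rho_{22}\end{pmatrix}$ with $\rho_{11}=\phi\rho_f+(1-\phi)\rho_s$, $\rho_{12}=\rho_f$,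 $\rho_{22}=\frac{\nu}{\phi}\rho_f$, where $\rho_s,\rho_f>0$, $0<\phi<1$, $\nu>1$; $R$ is symmetric positive definite. Notation: $[\boldsymbol a\mid\boldsymbol b]\in\mathbb R^{d\times2}$ is the matrix with columns $\boldsymbol a,\boldsymbol b$. $\boldsymbol\varepsilon(\boldsymbol v)=\frac12(\nabla\boldsymbol v+(\nabla\boldsymbol v)^{t})$; $\mathbf{div}$ is the row-wise divergence of matrix fields; $\mathrm I_d$ is the identity matrix. $(\cdot,\cdot)_\Omega$ and $\|\cdot\|_{0,\Omega}$ are the $L^2(\Omega)$ inner product and norm (matrix-valued functions use $\boldsymbol\sigma:\boldsymbol\tau=\sum_{i,j}\sigma_{ij}\tau_{ij}$). $\mathcal C^m_{[0,T]}(V)$ is the space of $m$ times continuously (strongly) differentiable functions $[0,T]\to V$; dots denote time derivatives. Spaces: $\mathcal H_1=L^2(\Omega,\mathbb R^{d\times2})$ with $(\underline{\boldsymbol u},\underline{\boldsymbol v})_{\mathcal H_1}=(\underline{\boldsymbol u}R,\underline{\boldsymbol v})_\Omega$; $\mathcal H_2=L^2(\Omega,\mathbb R^{d\times d}_{\mathrm{sym}})\times L^2(\Omega)$ with $((\boldsymbol\sigma,p),(\boldsymbol\tau,q))_{\mathcal H_2}=(\mathcal A\boldsymbol\sigma,\boldsymbol\tau)_\Omega+(sp,q)_\Omega$; $\|\cdot\|_{\mathcal H_1}$, $\|\cdot\|_{\mathcal H_2}$ are the associated norms. $H^1_D(\Omega)=\{q\in H^1(\Omega):q|_{\Gamma_D^f}=0\}$;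 $H^1_D(\Omega,\mathbb R^d)=\{\boldsymbol v\in H^1(\Omega,\mathbb R^d):\boldsymbol v|_{\Gamma_D^s}=\mathbf 0\}$; $H_N(\mathrm{div},\Omega)=\{\boldsymbol v\in L^2(\Omega,\mathbb R^d):\mathrm{div}\,\boldsymbol v\in L^2(\Omega),\ \langle\boldsymbol v\cdot\boldsymbol n,q\rangle_\Gamma=0\ \forall q\in H^1_D(\Omega)\}$; $H_N(\mathbf{div},\Omega,\mathbb R^{d\times d}_{\mathrm{sym}})=\{\boldsymbol\tau\in L^2(\Omega,\mathbb R^{d\times d}_{\mathrm{sym}}):\mathbf{div}\,\boldsymbol\tau\in L^2(\Omega,\mathbb R^d),\ \langle\boldsymbol\tau\boldsymbol n,\boldsymbol v\rangle_\Gamma=0\ \forall\boldsymbol v\in H^1_D(\Omega,\mathbb R^d)\}$, with $\langle\cdot,\cdot\rangle_\Gamma$ the $H^{-1/2}(\Gamma)$–$H^{1/2}(\Gamma)$ duality. $\mathcal X_1=\{[\boldsymbol v_s\mid\boldsymbol v_f]:\boldsymbol v_s\in H^1_D(\Omega,\mathbb R^d),\ \boldsymbol v_f\in H_N(\mathrm{div},\Omega)\}$ with inner product $(\underline{\boldsymbol u},\underline{\boldsymbol v})_{\mathcal H_1}+(\boldsymbol\varepsilon(\boldsymbol u_s),\boldsymbol\varepsilon(\boldsymbol v_s))_\Omega+(\frac1s(\mathrm{div}\,\boldsymbol u_f+\alpha\,\mathrm{div}\,\boldsymbol u_s),\mathrm{div}\,\boldsymbol v_f+\alpha\,\mathrm{div}\,\boldsymbol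 v_s)_\Omega$. $\mathcal X_2=\{(\boldsymbol\tau,q)\in L^2(\Omega,\mathbb R^{d\times d}_{\mathrm{sym}})\times H^1_D(\Omega):\boldsymbol\tau-\alpha q\,\mathrm I_d\in H_N(\mathbf{div},\Omega,\mathbb R^{d\times d}_{\mathrm{sym}})\}$ with inner product $((\boldsymbol\sigma,p),(\boldsymbol\tau,q))_{\mathcal H_2}+([\mathbf{div}(\boldsymbol\sigma-\alpha p\,\mathrm I_d)\mid\nabla p]R^{-1},[\mathbf{div}(\boldsymbol\tau-\alpha q\,\mathrm I_d)\mid\nabla q])_\Omega$.
   Formalization: The printed estimate is false (take f=0, g=0, zero initial stress and pressure, nonzero compactly supported smooth solid velocity); the formal estimate multiplies the initial-data norms by 2 instead of 1, with C still multiplying only the source terms. *)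

theory Defs
  imports "HOL-Analysis.Analysis"
begin

section \<open>Hausdorff measure and surface measure\<close>

text \<open>
  The usual \<open>m\<close>-dimensional Hausdorff measure, normalised so that it agrees with Lebesgue measure
  on \<open>m\<close>-planes. The empty set is given content \<open>0\<close> explicitly because \<open>0 ^ 0 = 1\<close>.
\<close>

definition ball_content :: "nat \<Rightarrow> 'a::metric_space set \<Rightarrow> ennreal" where
  "ball_content m U =
     (if U = {} then 0 else ennreal (unit_ball_vol (real m) * (diameter U / 2) ^ m))"

definition hausdorff_content :: "nat \<Rightarrow> real \<Rightarrow> 'a::metric_space set \<Rightarrow> ennreal" where
  "hausdorff_content m \<delta> A =
     Inf {(\<Sum>i. ball_content m (U i)) |U :: nat \<Rightarrow> 'a set.
            A \<subseteq> (\<Union>i. U i) \<and> (\<forall>i. bounded (U i) \<and> diameter (U i) \<le> \<delta>)}"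

definition hausdorff_outer :: "nat \<Rightarrow> 'a::metric_space set \<Rightarrow> ennreal" where
  "hausdorff_outer m A = (SUP \<delta>\<in>{0<..}. hausdorff_content m \<delta> A)"

definition surface_measure :: "(real ^ 'd) measure" where
  "surface_measure = measure_of UNIV (sets borel) (hausdorff_outer (CARD('d) - 1))"

text \<open>
  \<open>measure_of\<close> yields a measure only where the given set function is one; this is Caratheodory's
  criterion for metric outer measures.
\<close>

lemma hausdorff_content_le:
  assumes "A \<subseteq> (\<Union>i. U i)" "\<And>i. bounded (U i)" "\<And>i. diameter (U i) \<le> \<delta>"
  shows "hausdorff_content m \<delta> A \<le> (\<Sum>i. ball_content m (U i))"
  unfolding hausdorff_content_def using assms by (intro Inf_lower) blast

lemma hausdorff_content_mono: "A \<subseteq> B \<Longrightarrow> hausdorff_content m \<delta> A \<le> hausdorff_content m \<delta> B"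
  unfolding hausdorff_content_def by (intro Inf_superset_mono) blast

lemma hausdorff_content_antimono:
  "\<delta> \<le> \<delta>' \<Longrightarrow> hausdorff_content m \<delta>' A \<le> hausdorff_content m \<delta> A"
  unfolding hausdorff_content_def by (intro Inf_superset_mono) (blast intro: order_trans)

lemma hausdorff_content_close:
  assumes "hausdorff_content m \<delta> A < e"
  obtains U :: "nat \<Rightarrow> 'a::metric_space set"
  where "A \<subseteq> (\<Union>i. U i)" "\<And>i. bounded (U i)" "\<And>i. diameter (U i) \<le> \<delta>"
    "(\<Sum>i. ball_content m (U i)) < e"
  using assms unfolding hausdorff_content_def Inf_less_iff by blast

lemma hausdorff_content_UN:
  "hausdorff_content m \<delta> (\<Union>n. A n) \<le> (\<Sum>n. hausdorff_content m \<delta> (A n :: 'a::metric_space set))"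
proof (rule ennreal_le_epsilon)
  fix e :: real
  assume "0 < e" and fin: "(\<Sum>n. hausdorff_content m \<delta> (A n)) < top"
  then have *: "\<And>n. hausdorff_content m \<delta> (A n) < hausdorff_content m \<delta> (A n) + e * (1/2) ^ Suc n"
    by (auto simp add: less_top dest!: ennreal_suminf_lessD)
  have "\<exists>B :: nat \<Rightarrow> 'a set. A n \<subseteq> (\<Union>i. B i) \<and> (\<forall>i. bounded (B i) \<and> diameter (B i) \<le> \<delta>) \<and>
      (\<Sum>i. ball_content m (B i)) \<le> hausdorff_content m \<delta> (A n) + e * (1/2) ^ Suc n" for n
    by (rule hausdorff_content_close[OF *[of n]]) (blast intro: less_imp_le)
  then obtain B :: "nat \<Rightarrow> nat \<Rightarrow> 'a set" where
    cover: "\<And>n. A n \<subseteq> (\<Union>i. B n i)" and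
    B: "\<And>n i. bounded (B n i)" "\<And>n i. diameter (B n i) \<le> \<delta>" and
    Ble: "\<And>n. (\<Sum>i. ball_content m (B n i)) \<le> hausdorff_content m \<delta> (A n) + e * (1/2) ^ Suc n"
    by metis
  define V where "V = case_prod B o prod_decode"
  have "(\<Union>n. A n) \<subseteq> (\<Union>i. V i)"
    using cover by (auto simp add: V_def subset_eq) (metis prod.case prod_encode_inverse)
  then have "hausdorff_content m \<delta> (\<Union>n. A n) \<le> (\<Sum>i. ball_content m (V i))"
    using B by (intro hausdorff_content_le) (auto simp: V_def split_def)
  also have "\<dots> = (\<Sum>i. (ball_content m \<circ> case_prod B) (prod_decode i))"
    by (simp add: V_def)
  also have "\<dots> = (\<Sum>n. \<Sum>i. ball_content m (B n i))"
    by (intro suminf_ennreal_2dimen) auto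
  also have "\<dots> \<le> (\<Sum>n. hausdorff_content m \<delta> (A n) + e * (1/2) ^ Suc n)"
    by (intro suminf_le allI Ble) auto
  also have "\<dots> = (\<Sum>n. hausdorff_content m \<delta> (A n)) + (\<Sum>n. ennreal e * ennreal ((1/2) ^ Suc n))"
    using \<open>0 < e\<close> by (subst suminf_add[symmetric])
                     (auto simp del: ennreal_suminf_cmult simp add: ennreal_mult[symmetric])
  also have "\<dots> = (\<Sum>n. hausdorff_content m \<delta> (A n)) + e"
    unfolding ennreal_suminf_cmult
    by (subst suminf_ennreal_eq[OF zero_le_power power_half_series]) auto
  finally show "hausdorff_content m \<delta> (\<Union>n. A n) \<le> (\<Sum>n. hausdorff_content m \<delta> (A n)) + e" .
qed

lemma hausdorff_content_le_outer: "0 < \<delta> \<Longrightarrow> hausdorff_content m \<delta> A \<le> hausdorff_outer m A"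
  unfolding hausdorff_outer_def by (intro SUP_upper) auto

lemma hausdorff_outer_mono: "A \<subseteq> B \<Longrightarrow> hausdorff_outer m A \<le> hausdorff_outer m B"
  unfolding hausdorff_outer_def by (intro SUP_mono) (blast intro: hausdorff_content_mono)

lemma hausdorff_outer_empty [simp]: "hausdorff_outer m {} = 0"
proof -
  have "hausdorff_content m \<delta> ({} :: 'a set) \<le> 0" if "0 < \<delta>" for \<delta>
    using hausdorff_content_le[of "{}" "\<lambda>_. {}" \<delta> m] that by (simp add: ball_content_def)
  then show ?thesis unfolding hausdorff_outer_def by (intro antisym SUP_least) auto
qed

lemma hausdorff_outer_UN: "hausdorff_outer m (\<Union>n. A n) \<le> (\<Sum>n. hausdorff_outer m (A n))"
  unfolding hausdorff_outer_def[of m "\<Union>n. A n"]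
proof (rule SUP_least)
  fix \<delta> :: real assume "\<delta> \<in> {0<..}"
  have "hausdorff_content m \<delta> (\<Union>n. A n) \<le> (\<Sum>n. hausdorff_content m \<delta> (A n))"
    by (rule hausdorff_content_UN)
  also have "\<dots> \<le> (\<Sum>n. hausdorff_outer m (A n))"
    using \<open>\<delta> \<in> _\<close> by (intro suminf_le hausdorff_content_le_outer) auto
  finally show "hausdorff_content m \<delta> (\<Union>n. A n) \<le> (\<Sum>n. hausdorff_outer m (A n))" .
qed

lemma hausdorff_outer_Un: "hausdorff_outer m (A \<union> B) \<le> hausdorff_outer m A + hausdorff_outer m B"
proof -
  have "A \<union> B = (\<Union>n. binaryset A B n)"
    by (auto simp: UN_binaryset_eq)
  moreover have "(\<Sum>n. hausdorff_outer m (binaryset A B n)) = hausdorff_outer m A + hausdorff_outer m B"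
    by (subst suminf_binaryset_eq) auto
  ultimately show ?thesis by (metis hausdorff_outer_UN)
qed

lemma hausdorff_outer_separated:
  fixes A B :: "'a::metric_space set"
  assumes "0 < e" and sep: "\<And>x y. x \<in> A \<Longrightarrow> y \<in> B \<Longrightarrow> e \<le> dist x y"
  shows "hausdorff_outer m A + hausdorff_outer m B \<le> hausdorff_outer m (A \<union> B)"
proof -
  have *: "hausdorff_content m \<delta> A + hausdorff_content m \<delta> B \<le> hausdorff_content m \<delta> (A \<union> B)"
    if "0 < \<delta>" "\<delta> < e" for \<delta>
    unfolding hausdorff_content_def[of m \<delta> "A \<union> B"]
  proof (rule Inf_greatest, clarify)
    fix U :: "nat \<Rightarrow> 'a set"
    assume U: "A \<union> B \<subseteq> (\<Union>i. U i)" "\<forall>i. bounded (U i) \<and> diameter (U i) \<le> \<delta>"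
    define V where "V i = (if U i \<inter> A = {} then {} else U i)" for i
    define W where "W i = (if U i \<inter> B = {} then {} else U i)" for i
    have disj: "U i \<inter> A = {} \<or> U i \<inter> B = {}" for i
    proof (rule ccontr)
      assume "\<not> ?thesis"
      then obtain x y where xy: "x \<in> U i" "x \<in> A" "y \<in> U i" "y \<in> B" by auto
      then have "dist x y \<le> diameter (U i)" using U(2) by (intro diameter_bounded_bound) auto
      moreover have "diameter (U i) \<le> \<delta>" using U(2) by blast
      moreover have "e \<le> dist x y" using sep xy by blast
      ultimately show False using that(2) by linarith
    qed
    have "hausdorff_content m \<delta> A \<le> (\<Sum>i. ball_content m (V i))"
    proof (rule hausdorff_content_le)
      show "A \<subseteq> (\<Union>i. V i)" using U(1) by (fastforce simp: V_def)
      show "bounded (V i)" "diameter (V i) \<le> \<delta>" for i using U(2) that by (auto simp: V_def)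
    qed
    moreover have "hausdorff_content m \<delta> B \<le> (\<Sum>i. ball_content m (W i))"
    proof (rule hausdorff_content_le)
      show "B \<subseteq> (\<Union>i. W i)" using U(1) by (fastforce simp: W_def)
      show "bounded (W i)" "diameter (W i) \<le> \<delta>" for i using U(2) that by (auto simp: W_def)
    qed
    ultimately have "hausdorff_content m \<delta> A + hausdorff_content m \<delta> B
        \<le> (\<Sum>i. ball_content m (V i)) + (\<Sum>i. ball_content m (W i))"
      by (rule add_mono)
    also have "\<dots> = (\<Sum>i. ball_content m (V i) + ball_content m (W i))"
      by (rule suminf_add) auto
    also have "\<dots> \<le> (\<Sum>i. ball_content m (U i))"
      using disj by (intro suminf_le) (auto simp: V_def W_def ball_content_def)
    finally show "hausdorff_content m \<delta> A + hausdorff_content m \<delta> B \<le> (\<Sum>i. ball_content m (U i))" .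
  qed
  have lim: "hausdorff_outer m S = (SUP n. hausdorff_content m (e / (real n + 2)) S)" for S :: "'a set"
    unfolding hausdorff_outer_def
  proof (rule antisym)
    show "(SUP \<delta>\<in>{0<..}. hausdorff_content m \<delta> S) \<le> (SUP n. hausdorff_content m (e / (real n + 2)) S)"
    proof (rule SUP_mono)
      fix \<delta> :: real assume "\<delta> \<in> {0<..}"
      obtain n :: nat where "e / \<delta> < real n" using reals_Archimedean2 by blast
      then have "e / (real n + 2) \<le> \<delta>"
        using \<open>\<delta> \<in> _\<close> by (simp add: field_simps)
      then show "\<exists>n\<in>UNIV. hausdorff_content m \<delta> S \<le> hausdorff_content m (e / (real n + 2)) S"
        by (blast intro: hausdorff_content_antimono)
    qed
    show "(SUP n. hausdorff_content m (e / (real n + 2)) S) \<le> (SUP \<delta>\<in>{0<..}. hausdorff_content m \<delta> S)"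
      using \<open>0 < e\<close> by (intro SUP_mono) (auto intro!: bexI)
  qed
  have inc: "incseq (\<lambda>n. hausdorff_content m (e / (real n + 2)) S)" for S :: "'a set"
    using \<open>0 < e\<close> by (auto intro!: incseq_SucI hausdorff_content_antimono simp: field_simps)
  have "hausdorff_outer m A + hausdorff_outer m B
      = (SUP n. hausdorff_content m (e / (real n + 2)) A + hausdorff_content m (e / (real n + 2)) B)"
    unfolding lim by (rule ennreal_SUP_add[symmetric]) (rule inc)+
  also have "\<dots> \<le> hausdorff_outer m (A \<union> B)"
    unfolding lim using \<open>0 < e\<close> by (intro SUP_mono' *) (auto simp: field_simps add_pos_nonneg)
  finally show ?thesis .
qed

lemma hausdorff_outer_closed_split:
  fixes F X :: "'a::metric_space set"
  assumes "closed F"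
  shows "hausdorff_outer m (X \<inter> F) + hausdorff_outer m (X - F) = hausdorff_outer m X"
proof (rule antisym)
  let ?O = "hausdorff_outer m :: 'a set \<Rightarrow> ennreal"
  show "?O X \<le> ?O (X \<inter> F) + ?O (X - F)"
    using hausdorff_outer_Un[of m "X \<inter> F" "X - F"] by (simp add: Int_Diff_Un)
  show "?O (X \<inter> F) + ?O (X - F) \<le> ?O X"
  proof (cases "F = {} \<or> ?O X = top")
    case True then show ?thesis by auto
  next
    case False
    define P where "P n = {x \<in> X. 1 / (real n + 1) \<le> infdist x F}" for n
    define r where "r k = ?O (P (k + 2) - P (k + 1))" for k
    have P_mono: "P n \<subseteq> P k" if "n \<le> k" for n k
    proof -
      have "1 / (real k + 1) \<le> 1 / (real n + 1)" using that by (intro divide_left_mono) auto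
      then show ?thesis by (auto simp: P_def)
    qed
    have PX: "P n \<subseteq> X" for n by (auto simp: P_def)
    have sepF: "?O (X \<inter> F) + ?O (P n) \<le> ?O X" for n
    proof -
      have "?O (X \<inter> F) + ?O (P n) \<le> ?O (X \<inter> F \<union> P n)"
      proof (rule hausdorff_outer_separated)
        show "0 < 1 / (real n + 1)" by simp
        show "1 / (real n + 1) \<le> dist x y" if "x \<in> X \<inter> F" "y \<in> P n" for x y
          using that infdist_le[of x F y] by (auto simp: P_def dist_commute)
      qed
      also have "\<dots> \<le> ?O X" using PX by (intro hausdorff_outer_mono) auto
      finally show ?thesis .
    qed
    have step: "?O (P n) + r n \<le> ?O (P (n + 2))" for n
    proof -
      have "?O (P n) + r n \<le> ?O (P n \<union> (P (n + 2) - P (n + 1)))"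
        unfolding r_def
      proof (rule hausdorff_outer_separated)
        show "0 < 1 / (real n + 1) - 1 / (real n + 2)" by (simp add: divide_strict_left_mono)
        show "1 / (real n + 1) - 1 / (real n + 2) \<le> dist x y"
          if "x \<in> P n" "y \<in> P (n + 2) - P (n + 1)" for x y
          using that infdist_triangle[of x F y] by (auto simp: P_def add.commute)
      qed
      also have "\<dots> \<le> ?O (P (n + 2))"
        using P_mono[of n "n + 2"] by (intro hausdorff_outer_mono) auto
      finally show ?thesis .
    qed
    have sums: "(\<Sum>k<n. r k) \<le> ?O (P n) + ?O (P (n + 1))" for n
    proof (induction n)
      case (Suc n)
      have "(\<Sum>k<Suc n. r k) \<le> ?O (P (n + 1)) + (?O (P n) + r n)"
        using add_right_mono[OF Suc, of "r n"] by (simp add: algebra_simps)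
      also have "\<dots> \<le> ?O (P (n + 1)) + ?O (P (n + 2))" by (intro add_left_mono step)
      finally show ?case by simp
    qed simp
    have "suminf r \<le> ?O X + ?O X"
    proof (rule suminf_le_const)
      show "(\<Sum>k<n. r k) \<le> ?O X + ?O X" for n
        by (rule order_trans[OF sums]) (intro add_mono hausdorff_outer_mono PX)
    qed auto
    then have fin: "suminf r \<noteq> top" using False by (auto simp: top_unique)
    have cover: "X - F \<subseteq> P (n + 1) \<union> (\<Union>k. P (k + n + 2) - P (k + n + 1))" for n
    proof
      fix x assume x: "x \<in> X - F"
      then have "0 < infdist x F"
        using \<open>closed F\<close> False by (simp add: infdist_pos_not_in_closed)
      then obtain j where j: "1 / (real j + 1) \<le> infdist x F"
        using reals_Archimedean[of "infdist x F"] by (auto simp: inverse_eq_divide add.commute intro: less_imp_le)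
      then have ex: "x \<in> P j" using x by (auto simp: P_def)
      define i where "i = (LEAST i. x \<in> P i)"
      have i: "x \<in> P i" unfolding i_def using ex by (rule LeastI)
      show "x \<in> P (n + 1) \<union> (\<Union>k. P (k + n + 2) - P (k + n + 1))"
      proof (cases "i \<le> n + 1")
        case True then show ?thesis using P_mono i by blast
      next
        case False
        then obtain k where k: "i = k + n + 2" using that[of "i - n - 2"] by linarith
        have "x \<notin> P (k + n + 1)" using not_less_Least[of "k + n + 1" "\<lambda>i. x \<in> P i"] k unfolding i_def[symmetric] by linarith
        then show ?thesis using i k by blast
      qed
    qed
    have "(\<Sum>k<n. r k) + (?O (X \<inter> F) + ?O (X - F)) \<le> ?O X + suminf r" for n
    proof -
      have "?O (X - F) \<le> ?O (P (n + 1) \<union> (\<Union>k. P (k + n + 2) - P (k + n + 1)))"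
        by (intro hausdorff_outer_mono cover)
      also have "\<dots> \<le> ?O (P (n + 1)) + ?O (\<Union>k. P (k + n + 2) - P (k + n + 1))"
        by (rule hausdorff_outer_Un)
      also have "\<dots> \<le> ?O (P (n + 1)) + (\<Sum>k. r (k + n))"
        unfolding r_def by (intro add_left_mono hausdorff_outer_UN)
      finally have "(\<Sum>k<n. r k) + (?O (X \<inter> F) + ?O (X - F))
          \<le> (\<Sum>k<n. r k) + (?O (X \<inter> F) + (?O (P (n + 1)) + (\<Sum>k. r (k + n))))"
        by (intro add_left_mono)
      also have "\<dots> = (?O (X \<inter> F) + ?O (P (n + 1))) + ((\<Sum>k. r (k + n)) + (\<Sum>k<n. r k))"
        by (simp add: algebra_simps)
      also have "(\<Sum>k. r (k + n)) + (\<Sum>k<n. r k) = suminf r"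
        by (rule suminf_offset[symmetric]) auto
      also have "(?O (X \<inter> F) + ?O (P (n + 1))) + suminf r \<le> ?O X + suminf r"
        by (intro add_right_mono sepF)
      finally show ?thesis .
    qed
    then have "suminf r + (?O (X \<inter> F) + ?O (X - F)) \<le> suminf r + ?O X"
      by (subst (2) add.commute) (rule ennreal_suminf_bound_add)
    then show ?thesis using fin by (simp add: ennreal_add_left_cancel_le)
  qed
qed

lemma measure_space_hausdorff:
  "measure_space UNIV (sets borel) (hausdorff_outer m :: 'a::metric_space set \<Rightarrow> ennreal)"
proof -
  let ?L = "lambda_system UNIV (Pow UNIV) (hausdorff_outer m :: 'a set \<Rightarrow> ennreal)"
  have "outer_measure_space (Pow UNIV) (hausdorff_outer m :: 'a set \<Rightarrow> ennreal)"
    by (auto simp: outer_measure_space_def positive_def increasing_def countably_subadditive_def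
        intro: hausdorff_outer_mono hausdorff_outer_UN)
  then have ms: "measure_space UNIV ?L (hausdorff_outer m)"
    by (rule sigma_algebra.caratheodory_lemma[OF sigma_algebra_Pow])
  then have sa: "sigma_algebra UNIV ?L" by (simp add: measure_space_def)
  have "F \<in> ?L" if "closed F" for F
  proof -
    have "hausdorff_outer m (F \<inter> X) + hausdorff_outer m ((UNIV - F) \<inter> X) = hausdorff_outer m X" for X
    proof -
      have "F \<inter> X = X \<inter> F" "(UNIV - F) \<inter> X = X - F" by blast+
      then show ?thesis using hausdorff_outer_closed_split[OF that, of m X] by simp
    qed
    then show ?thesis unfolding lambda_system_def by blast
  qed
  then have "sigma_sets UNIV (Collect closed) \<subseteq> ?L"
    by (intro sigma_algebra.sigma_sets_subset[OF sa]) blast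
  then have "sets borel \<subseteq> ?L"
    unfolding borel_eq_closed by (subst sets_measure_of) auto
  then show ?thesis
    using sets.sigma_algebra_axioms[of "borel :: 'a measure"]
    by (intro measure_down[OF ms]) (simp_all only: space_borel)
qed

lemma
  shows sets_surface_measure [simp, measurable_cong]: "sets (surface_measure :: (real ^ 'd) measure) = sets borel"
    and space_surface_measure [simp]: "space (surface_measure :: (real ^ 'd) measure) = UNIV"
    and emeasure_surface_measure:
      "S \<in> sets borel \<Longrightarrow> emeasure surface_measure (S :: (real ^ 'd) set) = hausdorff_outer (CARD('d) - 1) S"
proof -
  have sig: "sigma_sets UNIV (sets borel) = (sets borel :: (real ^ 'd) set set)"
    using sets.sigma_sets_eq[of "borel :: (real ^ 'd) measure"] by (simp only: space_borel)
  show *: "sets (surface_measure :: (real ^ 'd) measure) = sets borel"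
    unfolding surface_measure_def by (subst sets_measure_of) (simp_all only: sig Pow_UNIV subset_UNIV)
  show "space (surface_measure :: (real ^ 'd) measure) = UNIV"
    unfolding surface_measure_def by (rule space_measure_of) (simp only: Pow_UNIV subset_UNIV)
  have ms: "measure_space UNIV (sets borel) (hausdorff_outer (CARD('d) - 1) :: (real ^ 'd) set \<Rightarrow> ennreal)"
    by (rule measure_space_hausdorff)
  assume S: "S \<in> sets borel"
  show "emeasure surface_measure S = hausdorff_outer (CARD('d) - 1) S"
  proof (rule emeasure_measure_of)
    show "surface_measure = measure_of UNIV (sets borel) (hausdorff_outer (CARD('d) - 1) :: (real ^ 'd) set \<Rightarrow> ennreal)"
      by (rule surface_measure_def)
    show "S \<in> sets surface_measure" unfolding * by (rule S)
    show "positive (sets surface_measure) (hausdorff_outer (CARD('d) - 1) :: (real ^ 'd) set \<Rightarrow> ennreal)"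
      and "countably_additive (sets surface_measure) (hausdorff_outer (CARD('d) - 1) :: (real ^ 'd) set \<Rightarrow> ennreal)"
      using ms unfolding * measure_space_def by blast+
  qed (rule Pow_UNIV[THEN equalityD2, THEN subset_trans[OF subset_UNIV]])
qed


section \<open>Domains\<close>

text \<open>
  Near each boundary point the domain is the open epigraph, in some direction \<open>e\<close>, of a Lipschitz
  function \<open>\<gamma>\<close> of the coordinates orthogonal to \<open>e\<close>.
\<close>

definition lipschitz_boundary :: "(real ^ 'd) set \<Rightarrow> bool" where
  "lipschitz_boundary \<Omega> \<longleftrightarrow>
     (\<forall>x\<in>frontier \<Omega>. \<exists>r>0. \<exists>e. norm e = 1 \<and>
        (\<exists>\<gamma> :: real ^ 'd \<Rightarrow> real. \<exists>L. L-lipschitz_on UNIV \<gamma> \<and>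
           \<Omega> \<inter> ball x r = {y \<in> ball x r. \<gamma> (y - (y \<bullet> e) *\<^sub>R e) < y \<bullet> e}))"

definition polyhedral_lipschitz_domain :: "(real ^ 'd) set \<Rightarrow> bool" where
  "polyhedral_lipschitz_domain \<Omega> \<longleftrightarrow>
     \<Omega> \<noteq> {} \<and> open \<Omega> \<and> connected \<Omega> \<and> bounded \<Omega> \<and> lipschitz_boundary \<Omega> \<and>
     (\<exists>\<P>. finite \<P> \<and> (\<forall>P\<in>\<P>. polytope P) \<and> closure \<Omega> = \<Union>\<P>)"

definition boundary_partition :: "(real ^ 'd) set \<Rightarrow> (real ^ 'd) set \<Rightarrow> (real ^ 'd) set \<Rightarrow> bool" where
  "boundary_partition \<Omega> \<Gamma>D \<Gamma>N \<longleftrightarrow>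
     \<Gamma>D \<in> sets borel \<and> \<Gamma>N \<in> sets borel \<and> \<Gamma>D \<union> \<Gamma>N = frontier \<Omega> \<and> \<Gamma>D \<inter> \<Gamma>N = {}"


section \<open>Square integrable functions\<close>

text \<open>
  Elements of \<open>L\<^sup>2(\<Omega>)\<close> are represented by functions on the whole space of which only the
  values a.e. in \<open>\<Omega>\<close> matter; equality in \<open>L\<^sup>2(\<Omega>)\<close> is \<open>AE x in lebesgue_on \<Omega>. u x = v x\<close>.
  On \<open>real ^ 'n ^ 'm\<close> the library inner product is the Frobenius product
  \<open>\<sigma> : \<tau>\<close>, and \<open>norm\<close> is the Frobenius norm.
\<close>

definition L2 :: "(real ^ 'd) set \<Rightarrow> (real ^ 'd \<Rightarrow> 'b::euclidean_space) set" where
  "L2 \<Omega> = {u. u \<in> borel_measurable (lebesgue_on \<Omega>) \<and>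
               integrable (lebesgue_on \<Omega>) (\<lambda>x. (norm (u x))\<^sup>2)}"

definition l2_inner ::
  "(real ^ 'd) set \<Rightarrow> (real ^ 'd \<Rightarrow> 'b::euclidean_space) \<Rightarrow> (real ^ 'd \<Rightarrow> 'b) \<Rightarrow> real" where
  "l2_inner \<Omega> u v = (LINT x|lebesgue_on \<Omega>. u x \<bullet> v x)"

definition l2_norm :: "(real ^ 'd) set \<Rightarrow> (real ^ 'd \<Rightarrow> 'b::euclidean_space) \<Rightarrow> real" where
  "l2_norm \<Omega> u = sqrt (l2_inner \<Omega> u u)"

definition sym_mats :: "(real ^ 'd ^ 'd) set" where
  "sym_mats = {\<zeta>. transpose \<zeta> = \<zeta>}"

definition L2_sym :: "(real ^ 'd) set \<Rightarrow> (real ^ 'd \<Rightarrow> real ^ 'd ^ 'd) set" where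
  "L2_sym \<Omega> = {\<tau> \<in> L2 \<Omega>. AE x in lebesgue_on \<Omega>. \<tau> x \<in> sym_mats}"


section \<open>Smooth functions and weak derivatives\<close>

definition partial_deriv :: "'d \<Rightarrow> (real ^ 'd \<Rightarrow> real) \<Rightarrow> real ^ 'd \<Rightarrow> real" where
  "partial_deriv i f x = frechet_derivative f (at x) (axis i 1)"

primrec Ck :: "nat \<Rightarrow> (real ^ 'd \<Rightarrow> real) \<Rightarrow> bool" where
  "Ck 0 f = continuous_on UNIV f"
| "Ck (Suc k) f = ((\<forall>x. f differentiable (at x)) \<and> (\<forall>i. Ck k (partial_deriv i f)))"

definition smooth :: "(real ^ 'd \<Rightarrow> real) \<Rightarrow> bool" where
  "smooth f \<longleftrightarrow> (\<forall>k. Ck k f)"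

definition test_fun :: "(real ^ 'd) set \<Rightarrow> (real ^ 'd \<Rightarrow> real) \<Rightarrow> bool" where
  "test_fun \<Omega> \<phi> \<longleftrightarrow> smooth \<phi> \<and> (\<exists>K. compact K \<and> K \<subseteq> \<Omega> \<and> (\<forall>x. x \<notin> K \<longrightarrow> \<phi> x = 0))"

definition is_weak_grad :: "(real ^ 'd) set \<Rightarrow> (real ^ 'd \<Rightarrow> real) \<Rightarrow> (real ^ 'd \<Rightarrow> real ^ 'd) \<Rightarrow> bool" where
  "is_weak_grad \<Omega> q G \<longleftrightarrow> G \<in> L2 \<Omega> \<and>
     (\<forall>\<phi> i. test_fun \<Omega> \<phi> \<longrightarrow>
        (LINT x|lebesgue_on \<Omega>. q x * partial_deriv i \<phi> x) = - (LINT x|lebesgue_on \<Omega>. G x $ i * \<phi> x))"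

definition is_weak_div :: "(real ^ 'd) set \<Rightarrow> (real ^ 'd \<Rightarrow> real ^ 'd) \<Rightarrow> (real ^ 'd \<Rightarrow> real) \<Rightarrow> bool" where
  "is_weak_div \<Omega> v w \<longleftrightarrow> w \<in> L2 \<Omega> \<and>
     (\<forall>\<phi>. test_fun \<Omega> \<phi> \<longrightarrow>
        (LINT x|lebesgue_on \<Omega>. (\<Sum>i\<in>UNIV. v x $ i * partial_deriv i \<phi> x))
          = - (LINT x|lebesgue_on \<Omega>. w x * \<phi> x))"

text \<open>
  Weak derivatives are unique a.e. in \<open>\<Omega>\<close>; the operators below pick a representative and are
  only meaningful on \<open>H1\<close> and \<open>Hdiv\<close>, respectively.
\<close>

definition weak_grad :: "(real ^ 'd) set \<Rightarrow> (real ^ 'd \<Rightarrow> real) \<Rightarrow> real ^ 'd \<Rightarrow> real ^ 'd" where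
  "weak_grad \<Omega> q = (SOME G. is_weak_grad \<Omega> q G)"

definition weak_div :: "(real ^ 'd) set \<Rightarrow> (real ^ 'd \<Rightarrow> real ^ 'd) \<Rightarrow> real ^ 'd \<Rightarrow> real" where
  "weak_div \<Omega> v = (SOME w. is_weak_div \<Omega> v w)"

definition H1 :: "(real ^ 'd) set \<Rightarrow> (real ^ 'd \<Rightarrow> real) set" where
  "H1 \<Omega> = {q \<in> L2 \<Omega>. \<exists>G. is_weak_grad \<Omega> q G}"

definition Hdiv :: "(real ^ 'd) set \<Rightarrow> (real ^ 'd \<Rightarrow> real ^ 'd) set" where
  "Hdiv \<Omega> = {v \<in> L2 \<Omega>. \<exists>w. is_weak_div \<Omega> v w}"

definition h1_norm :: "(real ^ 'd) set \<Rightarrow> (real ^ 'd \<Rightarrow> real) \<Rightarrow> real" where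
  "h1_norm \<Omega> q = sqrt ((l2_norm \<Omega> q)\<^sup>2 + (l2_norm \<Omega> (weak_grad \<Omega> q))\<^sup>2)"

definition jacobian :: "(real ^ 'd) set \<Rightarrow> (real ^ 'd \<Rightarrow> real ^ 'd) \<Rightarrow> real ^ 'd \<Rightarrow> real ^ 'd ^ 'd" where
  "jacobian \<Omega> v x = (\<chi> i. weak_grad \<Omega> (\<lambda>y. v y $ i) x)"

definition strain :: "(real ^ 'd) set \<Rightarrow> (real ^ 'd \<Rightarrow> real ^ 'd) \<Rightarrow> real ^ 'd \<Rightarrow> real ^ 'd ^ 'd" where
  "strain \<Omega> v x = (1 / 2) *\<^sub>R (jacobian \<Omega> v x + transpose (jacobian \<Omega> v x))"

definition row_div :: "(real ^ 'd) set \<Rightarrow> (real ^ 'd \<Rightarrow> real ^ 'd ^ 'd) \<Rightarrow> real ^ 'd \<Rightarrow> real ^ 'd" where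
  "row_div \<Omega> \<tau> x = (\<chi> i. weak_div \<Omega> (\<lambda>y. row i (\<tau> y)) x)"


section \<open>Traces and boundary conditions\<close>

text \<open>
  The trace is the continuous extension, from \<open>H\<^sup>1(\<Omega>)\<close> to \<open>L\<^sup>2(S)\<close> for the
  surface measure, of restriction of smooth functions to a part \<open>S\<close> of the boundary:
  \<open>q\<close> has trace \<open>w\<close> on \<open>S\<close> if some functions smooth up to the boundary converge to \<open>q\<close> in
  \<open>H\<^sup>1(\<Omega>)\<close> while their restrictions converge to \<open>w\<close> in \<open>L\<^sup>2(S)\<close>.
\<close>

definition has_trace ::
  "(real ^ 'd) set \<Rightarrow> (real ^ 'd) set \<Rightarrow> (real ^ 'd \<Rightarrow> real) \<Rightarrow> (real ^ 'd \<Rightarrow> real) \<Rightarrow> bool" where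
  "has_trace \<Omega> S q w \<longleftrightarrow> w \<in> borel_measurable borel \<and>
     (\<exists>\<phi> :: nat \<Rightarrow> real ^ 'd \<Rightarrow> real. (\<forall>n. smooth (\<phi> n)) \<and>
        (\<lambda>n. h1_norm \<Omega> (\<lambda>x. \<phi> n x - q x)) \<longlonglongrightarrow> 0 \<and>
        (\<lambda>n. \<integral>\<^sup>+x\<in>S. ennreal ((\<phi> n x - w x)\<^sup>2) \<partial>surface_measure) \<longlonglongrightarrow> 0)"

definition H1_D :: "(real ^ 'd) set \<Rightarrow> (real ^ 'd) set \<Rightarrow> (real ^ 'd \<Rightarrow> real) set" where
  "H1_D \<Omega> \<Gamma>D = {q \<in> H1 \<Omega>. has_trace \<Omega> \<Gamma>D q (\<lambda>_. 0)}"

definition H1_D_vec :: "(real ^ 'd) set \<Rightarrow> (real ^ 'd) set \<Rightarrow> (real ^ 'd \<Rightarrow> real ^ 'd) set" where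
  "H1_D_vec \<Omega> \<Gamma>D = {v. \<forall>i. (\<lambda>x. v x $ i) \<in> H1_D \<Omega> \<Gamma>D}"

text \<open>
  The normal trace \<open>v \<bullet> n \<in> H\<^sup>-\<^sup>1\<^sup>/\<^sup>2(\<Gamma>)\<close> of a field in \<open>H(div, \<Omega>)\<close> is by definition the functional
  on traces of \<open>H\<^sup>1(\<Omega>)\<close> functions given by Green's formula, and similarly, row by row, for matrix fields.
\<close>

definition normal_pairing :: "(real ^ 'd) set \<Rightarrow> (real ^ 'd \<Rightarrow> real ^ 'd) \<Rightarrow> (real ^ 'd \<Rightarrow> real) \<Rightarrow> real" where
  "normal_pairing \<Omega> v q = l2_inner \<Omega> v (weak_grad \<Omega> q) + l2_inner \<Omega> (weak_div \<Omega> v) q"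

definition normal_pairing_mat ::
  "(real ^ 'd) set \<Rightarrow> (real ^ 'd \<Rightarrow> real ^ 'd ^ 'd) \<Rightarrow> (real ^ 'd \<Rightarrow> real ^ 'd) \<Rightarrow> real" where
  "normal_pairing_mat \<Omega> \<tau> v = l2_inner \<Omega> \<tau> (jacobian \<Omega> v) + l2_inner \<Omega> (row_div \<Omega> \<tau>) v"

definition HN_div :: "(real ^ 'd) set \<Rightarrow> (real ^ 'd) set \<Rightarrow> (real ^ 'd \<Rightarrow> real ^ 'd) set" where
  "HN_div \<Omega> \<Gamma>fD = {v \<in> Hdiv \<Omega>. \<forall>q\<in>H1_D \<Omega> \<Gamma>fD. normal_pairing \<Omega> v q = 0}"

definition HN_div_sym :: "(real ^ 'd) set \<Rightarrow> (real ^ 'd) set \<Rightarrow> (real ^ 'd \<Rightarrow> real ^ 'd ^ 'd) set" where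
  "HN_div_sym \<Omega> \<Gamma>sD =
     {\<tau> \<in> L2_sym \<Omega>. (\<forall>i. (\<lambda>x. row i (\<tau> x)) \<in> Hdiv \<Omega>) \<and>
                      (\<forall>v\<in>H1_D_vec \<Omega> \<Gamma>sD. normal_pairing_mat \<Omega> \<tau> v = 0)}"


section \<open>Coefficients\<close>

definition spd_tensor :: "real \<Rightarrow> real \<Rightarrow> (real ^ 'd ^ 'd \<Rightarrow> real ^ 'd ^ 'd) \<Rightarrow> bool" where
  "spd_tensor cm cp \<C> \<longleftrightarrow>
     (\<forall>\<zeta>\<in>sym_mats. \<C> \<zeta> \<in> sym_mats) \<and>
     (\<forall>\<zeta>\<in>sym_mats. \<forall>\<xi>\<in>sym_mats. \<C> (\<zeta> + \<xi>) = \<C> \<zeta> + \<C> \<xi>) \<and>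
     (\<forall>c. \<forall>\<zeta>\<in>sym_mats. \<C> (c *\<^sub>R \<zeta>) = c *\<^sub>R \<C> \<zeta>) \<and>
     (\<forall>\<zeta>\<in>sym_mats. \<forall>\<xi>\<in>sym_mats. \<C> \<zeta> \<bullet> \<xi> = \<zeta> \<bullet> \<C> \<xi>) \<and>
     (\<forall>\<zeta>\<in>sym_mats. cm * (\<zeta> \<bullet> \<zeta>) \<le> \<C> \<zeta> \<bullet> \<zeta> \<and> \<C> \<zeta> \<bullet> \<zeta> \<le> cp * (\<zeta> \<bullet> \<zeta>))"

definition compliance :: "(real ^ 'd ^ 'd \<Rightarrow> real ^ 'd ^ 'd) \<Rightarrow> real ^ 'd ^ 'd \<Rightarrow> real ^ 'd ^ 'd" where
  "compliance \<C> = inv_into sym_mats \<C>"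

definition density_matrix :: "real \<Rightarrow> real \<Rightarrow> real \<Rightarrow> real \<Rightarrow> real ^ 2 ^ 2" where
  "density_matrix \<phi> \<nu> \<rho>s \<rho>f =
     vector [vector [\<phi> * \<rho>f + (1 - \<phi>) * \<rho>s, \<rho>f],
             vector [\<rho>f, \<nu> / \<phi> * \<rho>f]]"


section \<open>Energy and graph spaces\<close>

text \<open>
  A \<open>d \<times> 2\<close> matrix has type \<open>real ^ 2 ^ 'd\<close>; \<open>cols a b\<close> is \<open>[a | b]\<close>. Pairs \<open>(\<tau>, q)\<close> of functions
  are represented by one function with values in \<open>(real ^ 'd ^ 'd) \<times> real\<close>.
\<close>

definition cols :: "real ^ 'd \<Rightarrow> real ^ 'd \<Rightarrow> real ^ 2 ^ 'd" where
  "cols a b = (\<chi> i j. if j = 1 then a $ i else b $ i)"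

definition col_s :: "(real ^ 'd \<Rightarrow> real ^ 2 ^ 'd) \<Rightarrow> real ^ 'd \<Rightarrow> real ^ 'd" where
  "col_s u x = column 1 (u x)"

definition col_f :: "(real ^ 'd \<Rightarrow> real ^ 2 ^ 'd) \<Rightarrow> real ^ 'd \<Rightarrow> real ^ 'd" where
  "col_f u x = column 2 (u x)"

definition total_stress :: "real \<Rightarrow> (real ^ 'd \<Rightarrow> (real ^ 'd ^ 'd) \<times> real) \<Rightarrow> real ^ 'd \<Rightarrow> real ^ 'd ^ 'd" where
  "total_stress \<alpha> w x = fst (w x) - (\<alpha> * snd (w x)) *\<^sub>R mat 1"

definition fluid_content :: "(real ^ 'd) set \<Rightarrow> real \<Rightarrow> (real ^ 'd \<Rightarrow> real ^ 2 ^ 'd) \<Rightarrow> real ^ 'd \<Rightarrow> real" where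
  "fluid_content \<Omega> \<alpha> u x = weak_div \<Omega> (col_f u) x + \<alpha> * weak_div \<Omega> (col_s u) x"

definition HH1 :: "(real ^ 'd) set \<Rightarrow> (real ^ 'd \<Rightarrow> real ^ 2 ^ 'd) set" where
  "HH1 \<Omega> = L2 \<Omega>"

definition HH1_inner ::
  "(real ^ 'd) set \<Rightarrow> real ^ 2 ^ 2 \<Rightarrow> (real ^ 'd \<Rightarrow> real ^ 2 ^ 'd) \<Rightarrow> (real ^ 'd \<Rightarrow> real ^ 2 ^ 'd) \<Rightarrow> real" where
  "HH1_inner \<Omega> R u v = l2_inner \<Omega> (\<lambda>x. u x ** R) v"

definition HH1_norm :: "(real ^ 'd) set \<Rightarrow> real ^ 2 ^ 2 \<Rightarrow> (real ^ 'd \<Rightarrow> real ^ 2 ^ 'd) \<Rightarrow> real" where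
  "HH1_norm \<Omega> R u = sqrt (HH1_inner \<Omega> R u u)"

definition HH2 :: "(real ^ 'd) set \<Rightarrow> (real ^ 'd \<Rightarrow> (real ^ 'd ^ 'd) \<times> real) set" where
  "HH2 \<Omega> = {w. (\<lambda>x. fst (w x)) \<in> L2_sym \<Omega> \<and> (\<lambda>x. snd (w x)) \<in> L2 \<Omega>}"

definition HH2_inner ::
  "(real ^ 'd) set \<Rightarrow> (real ^ 'd ^ 'd \<Rightarrow> real ^ 'd ^ 'd) \<Rightarrow> real \<Rightarrow>
   (real ^ 'd \<Rightarrow> (real ^ 'd ^ 'd) \<times> real) \<Rightarrow> (real ^ 'd \<Rightarrow> (real ^ 'd ^ 'd) \<times> real) \<Rightarrow> real" where
  "HH2_inner \<Omega> \<C> s w z =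
     l2_inner \<Omega> (\<lambda>x. compliance \<C> (fst (w x))) (\<lambda>x. fst (z x)) +
     l2_inner \<Omega> (\<lambda>x. s * snd (w x)) (\<lambda>x. snd (z x))"

definition HH2_norm ::
  "(real ^ 'd) set \<Rightarrow> (real ^ 'd ^ 'd \<Rightarrow> real ^ 'd ^ 'd) \<Rightarrow> real \<Rightarrow>
   (real ^ 'd \<Rightarrow> (real ^ 'd ^ 'd) \<times> real) \<Rightarrow> real" where
  "HH2_norm \<Omega> \<C> s w = sqrt (HH2_inner \<Omega> \<C> s w w)"

definition XX1 ::
  "(real ^ 'd) set \<Rightarrow> (real ^ 'd) set \<Rightarrow> (real ^ 'd) set \<Rightarrow> (real ^ 'd \<Rightarrow> real ^ 2 ^ 'd) set" where
  "XX1 \<Omega> \<Gamma>sD \<Gamma>fD = {u. col_s u \<in> H1_D_vec \<Omega> \<Gamma>sD \<and> col_f u \<in> HN_div \<Omega> \<Gamma>fD}"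

definition XX1_inner ::
  "(real ^ 'd) set \<Rightarrow> real ^ 2 ^ 2 \<Rightarrow> real \<Rightarrow> real \<Rightarrow>
   (real ^ 'd \<Rightarrow> real ^ 2 ^ 'd) \<Rightarrow> (real ^ 'd \<Rightarrow> real ^ 2 ^ 'd) \<Rightarrow> real" where
  "XX1_inner \<Omega> R s \<alpha> u v =
     HH1_inner \<Omega> R u v + l2_inner \<Omega> (strain \<Omega> (col_s u)) (strain \<Omega> (col_s v)) +
     l2_inner \<Omega> (\<lambda>x. 1 / s * fluid_content \<Omega> \<alpha> u x) (fluid_content \<Omega> \<alpha> v)"

definition XX1_norm ::
  "(real ^ 'd) set \<Rightarrow> real ^ 2 ^ 2 \<Rightarrow> real \<Rightarrow> real \<Rightarrow> (real ^ 'd \<Rightarrow> real ^ 2 ^ 'd) \<Rightarrow> real" where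
  "XX1_norm \<Omega> R s \<alpha> u = sqrt (XX1_inner \<Omega> R s \<alpha> u u)"

definition XX2 ::
  "(real ^ 'd) set \<Rightarrow> (real ^ 'd) set \<Rightarrow> (real ^ 'd) set \<Rightarrow> real \<Rightarrow>
   (real ^ 'd \<Rightarrow> (real ^ 'd ^ 'd) \<times> real) set" where
  "XX2 \<Omega> \<Gamma>sD \<Gamma>fD \<alpha> =
     {w. (\<lambda>x. fst (w x)) \<in> L2_sym \<Omega> \<and> (\<lambda>x. snd (w x)) \<in> H1_D \<Omega> \<Gamma>fD \<and>
         total_stress \<alpha> w \<in> HN_div_sym \<Omega> \<Gamma>sD}"

definition XX2_flux ::
  "(real ^ 'd) set \<Rightarrow> real \<Rightarrow> (real ^ 'd \<Rightarrow> (real ^ 'd ^ 'd) \<times> real) \<Rightarrow> real ^ 'd \<Rightarrow> real ^ 2 ^ 'd" where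
  "XX2_flux \<Omega> \<alpha> w x = cols (row_div \<Omega> (total_stress \<alpha> w) x) (weak_grad \<Omega> (\<lambda>y. snd (w y)) x)"

definition XX2_inner ::
  "(real ^ 'd) set \<Rightarrow> real ^ 2 ^ 2 \<Rightarrow> (real ^ 'd ^ 'd \<Rightarrow> real ^ 'd ^ 'd) \<Rightarrow> real \<Rightarrow> real \<Rightarrow>
   (real ^ 'd \<Rightarrow> (real ^ 'd ^ 'd) \<times> real) \<Rightarrow> (real ^ 'd \<Rightarrow> (real ^ 'd ^ 'd) \<times> real) \<Rightarrow> real" where
  "XX2_inner \<Omega> R \<C> s \<alpha> w z =
     HH2_inner \<Omega> \<C> s w z +
     l2_inner \<Omega> (\<lambda>x. XX2_flux \<Omega> \<alpha> w x ** matrix_inv R) (XX2_flux \<Omega> \<alpha> z)"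

definition XX2_norm ::
  "(real ^ 'd) set \<Rightarrow> real ^ 2 ^ 2 \<Rightarrow> (real ^ 'd ^ 'd \<Rightarrow> real ^ 'd ^ 'd) \<Rightarrow> real \<Rightarrow> real \<Rightarrow>
   (real ^ 'd \<Rightarrow> (real ^ 'd ^ 'd) \<times> real) \<Rightarrow> real" where
  "XX2_norm \<Omega> R \<C> s \<alpha> w = sqrt (XX2_inner \<Omega> R \<C> s \<alpha> w w)"


section \<open>Functions of time\<close>

text \<open>
  For a space \<open>V\<close> of functions with norm \<open>N\<close>: strong derivative at \<open>t\<close> in \<open>[0, T]\<close> (one-sided at
  the end points) and the space of \<open>m\<close> times continuously differentiable functions from \<open>[0, T]\<close> to \<open>V\<close>.
\<close>

definition has_time_deriv ::
  "real \<Rightarrow> (('a \<Rightarrow> 'b) \<Rightarrow> real) \<Rightarrow> (real \<Rightarrow> 'a \<Rightarrow> 'b::real_vector) \<Rightarrow> ('a \<Rightarrow> 'b) \<Rightarrow> real \<Rightarrow> bool" where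
  "has_time_deriv T N w w' t \<longleftrightarrow>
     ((\<lambda>r. N (\<lambda>x. (1 / (r - t)) *\<^sub>R (w r x - w t x) - w' x)) \<longlongrightarrow> 0) (at t within {0..T})"

primrec C_time ::
  "nat \<Rightarrow> real \<Rightarrow> ('a \<Rightarrow> 'b) set \<Rightarrow> (('a \<Rightarrow> 'b) \<Rightarrow> real) \<Rightarrow> (real \<Rightarrow> 'a \<Rightarrow> 'b::real_vector) \<Rightarrow> bool" where
  "C_time 0 T V N w \<longleftrightarrow>
     (\<forall>t\<in>{0..T}. w t \<in> V) \<and>
     (\<forall>t\<in>{0..T}. ((\<lambda>r. N (\<lambda>x. w r x - w t x)) \<longlongrightarrow> 0) (at t within {0..T}))"
| "C_time (Suc m) T V N w \<longleftrightarrow>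
     (\<forall>t\<in>{0..T}. w t \<in> V) \<and>
     (\<exists>w'. C_time m T V N w' \<and> (\<forall>t\<in>{0..T}. has_time_deriv T N w (w' t) t))"


section \<open>The evolution problem\<close>

definition is_solution ::
  "real \<Rightarrow> (real ^ 'd) set \<Rightarrow> (real ^ 'd) set \<Rightarrow> (real ^ 'd) set \<Rightarrow>
   real ^ 2 ^ 2 \<Rightarrow> (real ^ 'd ^ 'd \<Rightarrow> real ^ 'd ^ 'd) \<Rightarrow> real \<Rightarrow> real \<Rightarrow> real \<Rightarrow>
   (real \<Rightarrow> real ^ 'd \<Rightarrow> real ^ 2 ^ 'd) \<Rightarrow> (real \<Rightarrow> real ^ 'd \<Rightarrow> real) \<Rightarrow>
   (real ^ 'd \<Rightarrow> real ^ 2 ^ 'd) \<Rightarrow> (real ^ 'd \<Rightarrow> (real ^ 'd ^ 'd) \<times> real) \<Rightarrow>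
   (real \<Rightarrow> real ^ 'd \<Rightarrow> real ^ 2 ^ 'd) \<Rightarrow> (real \<Rightarrow> real ^ 'd \<Rightarrow> (real ^ 'd ^ 'd) \<times> real) \<Rightarrow> bool" where
  "is_solution T \<Omega> \<Gamma>sD \<Gamma>fD R \<C> s \<alpha> \<beta> f g u0 w0 u w \<longleftrightarrow>
     C_time 1 T (HH1 \<Omega>) (HH1_norm \<Omega> R) u \<and>
     C_time 0 T (XX1 \<Omega> \<Gamma>sD \<Gamma>fD) (XX1_norm \<Omega> R s \<alpha>) u \<and>
     C_time 1 T (HH2 \<Omega>) (HH2_norm \<Omega> \<C> s) w \<and>
     C_time 0 T (XX2 \<Omega> \<Gamma>sD \<Gamma>fD \<alpha>) (XX2_norm \<Omega> R \<C> s \<alpha>) w \<and>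
     (\<exists>u' w'. \<forall>t\<in>{0<..T}.
        u' t \<in> HH1 \<Omega> \<and> has_time_deriv T (HH1_norm \<Omega> R) u (u' t) t \<and>
        w' t \<in> HH2 \<Omega> \<and> has_time_deriv T (HH2_norm \<Omega> \<C> s) w (w' t) t \<and>
        (AE x in lebesgue_on \<Omega>.
           u' t x
           + cols (- row_div \<Omega> (total_stress \<alpha> (w t)) x) (weak_grad \<Omega> (\<lambda>y. snd (w t y)) x) ** matrix_inv R
           + cols 0 (\<beta> *\<^sub>R col_f (u t) x) ** matrix_inv R
           = f t x ** matrix_inv R) \<and>
        (AE x in lebesgue_on \<Omega>.
           w' t x + (- \<C> (strain \<Omega> (col_s (u t)) x), 1 / s * fluid_content \<Omega> \<alpha> (u t) x)
           = (0, 1 / s * g t x))) \<and>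
     (AE x in lebesgue_on \<Omega>. u 0 x = u0 x) \<and>
     (AE x in lebesgue_on \<Omega>. w 0 x = w0 x)"

end

theory Submission
 imports Defs
begin

text \<open>
  In the energy inner product the system reads \<open>X' + A X = F\<close> with \<open>A\<close> linear and monotone (the damping term has the
  right sign). The solution is the limit of the Yosida approximations, and the energy identity for a difference of
  solutions gives uniqueness and the a priori bound.

  The work lies in showing that \<open>1 + r A\<close> is onto for \<open>r > 0\<close>. In \<open>L2\<close> of pairs (function, weak derivative) the
  essential boundary conditions cut out closed subspaces, and the fields with vanishing normal trace, paired with their
  divergence, are the orthogonal complement of the gradient graph of \<open>H1_D\<close>. The resolvent equation is therefore
  solved by one orthogonal projection, for a weighted inner product, onto the graph of \<open>u \<mapsto> (strain, fluid content)\<close>.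

  That this graph is closed is Korn's second inequality. Above a Lipschitz graph, average \<open>v\<close> over balls whose radius is
  comparable to the distance to the graph and vanishes on it. The strain of the average is controlled by the strain of \<open>v\<close>, and
  \<open>v\<close> minus its average extends by zero, so that the whole-space inequality applies to it. The derivative of the averaged
  gradient in the transversal direction is controlled by averaged strains divided by the radius, and Hardy's inequality
  recovers the averaged gradient itself. A partition of unity gives the inequality on the domain.
\<close>

abbreviation (input) LO where "LO \<equiv> lebesgue_on"
abbreviation (input) ind where "ind \<equiv> indicator"
abbreviation (input) cont where "cont \<equiv> continuous_on UNIV"
abbreviation (input) pd where "pd \<equiv> partial_deriv"
abbreviation (input) LB_int (binder "LB " 10) where "LB_int f \<equiv> integral\<^sup>L lborel f"
abbreviation (input) NB_int (binder "NB " 10) where "NB_int f \<equiv> integral\<^sup>N lborel f"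
abbreviation (input) SU_sum (binder "SU " 10) where "SU_sum f \<equiv> sum f UNIV"
abbreviation (input) "SQ S f \<equiv> \<integral>\<^sup>+x\<in>S. ennreal ((f x)\<^sup>2) \<partial>surface_measure"
notation (input) inner (infix "<.>" 70) and scaleR (infixr "*." 75)
notation (input) tendsto (infixr "--->" 55) and LIMSEQ ("((_)/ ----> (_))" [60, 60] 60)


section \<open>Calculus of \<open>Ck\<close> functions\<close>

definition grad :: "(real^'d => real) => real^'d => real^'d" where
 "grad f x = (\<chi> i. pd i f x)"

lemma pd_eq: assumes "(f has_derivative f') (at x)" shows "pd i f x = f' (axis i 1)"
 unfolding partial_deriv_def using frechet_derivative_at[OF assms] by simp

lemma grad_eq: assumes "(f has_derivative (%h. G<.>h)) (at x)" shows "grad f x = G"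
 unfolding grad_def using pd_eq[OF assms] by (simp add: vec_eq_iff inner_axis)

lemma grad_nth [simp]: "grad f x$i = pd i f x" by (simp add: grad_def)

lemma has_derivative_grad:
 fixes f :: "real^'d => real" assumes "f differentiable (at x)" shows "(f has_derivative (%h. grad f x<.>h)) (at x)"
proof -
 let ?D = "frechet_derivative f (at x)"
 have D: "(f has_derivative ?D) (at x)" using assms by (simp add: frechet_derivative_works)
 interpret linear ?D using D has_derivative_linear by blast
 have "?D h = grad f x<.>h" for h
 proof -
  have "?D h = ?D (SU i. (h$i)*.axis i 1)" using basis_expansion[of h] by (simp add: scalar_mult_eq_scaleR)
  also have "... = (SU i. h$i*pd i f x)" by (simp add: sum scale partial_deriv_def)
  finally show ?thesis by (simp add: inner_vec_def mult.commute)
 qed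
 hence "?D = (%h. grad f x<.>h)" by blast
 with D show ?thesis by simp
qed

lemma Ck_SucI: assumes "!!x. (f has_derivative (%h. G x<.>h)) (at x)" "!!i. Ck k (%x. G x$i)" shows "Ck (Suc k) f"
proof -
 have "pd i f = (%x. G x$i)" for i using grad_eq[OF assms(1)] by (metis grad_nth)
 with assms show ?thesis by (auto simp: differentiable_def)
qed

lemma Ck_diffable: "Ck (Suc k) f ==> f differentiable (at x)" by simp

lemma Ck_deriv: "Ck (Suc k) f ==> (f has_derivative (%h. grad f x<.>h)) (at x)" by (simp add: has_derivative_grad)

lemma Ck_partial: "Ck (Suc k) f ==> Ck k (pd i f)" by simp

lemma Ck_Suc_cont: "Ck (Suc k) f ==> cont f" by (auto intro!: continuous_at_imp_continuous_on differentiable_imp_continuous_within)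

lemma Ck_continuous: assumes "Ck k f" shows "cont f"
proof (cases k)
 case 0 with assms show ?thesis by simp
next
 case (Suc j)
 show ?thesis using assms unfolding Suc by (rule Ck_Suc_cont)
qed

lemma Ck_Suc_le: "Ck (Suc k) f ==> Ck k f"
proof (induction k arbitrary: f)
 case 0 show ?case using Ck_Suc_cont[OF 0] by simp
next
 case (Suc k) thus ?case by (metis Ck.simps(2))
qed

lemma Ck_mono: "Ck k f ==> j <= k ==> Ck j f" by (induction k) (auto simp del: Ck.simps simp: le_Suc_eq dest: Ck_Suc_le)

lemma smooth_Ck: "smooth f ==> Ck k f" by (simp add: smooth_def)

lemma Ck_const [intro!, simp]: "Ck k (%x. c)"
proof (induction k arbitrary: c)
 case (Suc k)
 show ?case by (rule Ck_SucI[where G="%_. 0"]) (use Suc in auto)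
qed auto

lemma Ck_add [intro]: "Ck k f ==> Ck k g ==> Ck k (%x. f x+g x)"
proof (induction k arbitrary: f g)
 case 0 thus ?case by (simp add: continuous_on_add)
next
 case (Suc k)
 show ?case
 proof (rule Ck_SucI[where G="%x. grad f x+grad g x"])
  show "((%x. f x+g x) has_derivative (%h. (grad f x+grad g x)<.>h)) (at x)" for x
   using has_derivative_add[OF Ck_deriv[OF Suc.prems(1)] Ck_deriv[OF Suc.prems(2)], of x] by (simp add: inner_add_left)
  show "Ck k (%x. (grad f x+grad g x)$i)" for i using Suc.prems Suc.IH by simp
 qed
qed

lemma Ck_mult [intro]: "Ck k f ==> Ck k g ==> Ck k (%x. f x*g x)"
proof (induction k arbitrary: f g)
 case 0 thus ?case by (simp add: continuous_on_mult)
next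
 case (Suc k)
 show ?case
 proof (rule Ck_SucI[where G="%x. f x*.grad g x+g x*.grad f x"])
  show "((%x. f x*g x) has_derivative (%h. (f x*.grad g x+g x*.grad f x)<.>h)) (at x)" for x
   using has_derivative_mult[OF Ck_deriv[OF Suc.prems(1)] Ck_deriv[OF Suc.prems(2)], of x] by (simp add: inner_add_left mult.commute)
  show "Ck k (%x. (f x*.grad g x+g x*.grad f x)$i)" for i using Suc.prems Ck_Suc_le[OF Suc.prems(1)] Ck_Suc_le[OF Suc.prems(2)]
   by (auto intro!: Ck_add Suc.IH)
 qed
qed

lemma Ck_cmult [intro]: "Ck k f ==> Ck k (%x. c*f x)" by (intro Ck_mult) auto

lemma Ck_uminus [intro]: "Ck k f ==> Ck k (%x. - f x)" using Ck_cmult[of k f "-1"] by simp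

lemma Ck_diff [intro]: "Ck k f ==> Ck k g ==> Ck k (%x. f x-g x)" using Ck_add[OF _ Ck_uminus, of k f g] by simp

lemma Ck_sum [intro]: "(!!i. i : I ==> Ck k (f i)) ==> Ck k (%x. \<Sum>i\<in>I. f i x)"
 by (induction I rule: infinite_finite_induct) (auto intro!: Ck_add)

lemma Ck_prod [intro]: "(!!i. i : I ==> Ck k (f i)) ==> Ck k (%x. \<Prod>i\<in>I. f i x)"
 by (induction I rule: infinite_finite_induct) (auto intro!: Ck_mult)

lemma Ck_power [intro]: "Ck k f ==> Ck k (%x. f x^n)" by (induction n) (auto intro!: Ck_mult)

lemma Ck_inner [intro!, simp]: "Ck k (%x. x<.>e)"
proof (cases k)
 case (Suc j)
 show ?thesis unfolding Suc by (rule Ck_SucI[where G="%_. e"]) (auto intro!: derivative_eq_intros simp: inner_commute)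
qed (simp add: continuous_on_inner)

lemma Ck_nth [intro!, simp]: "Ck k (%x. x$i)" using Ck_inner[of k "axis i 1"] by (simp add: inner_axis)

lemma Ck_compose:
 fixes f :: "real^'n => real" and \<Phi> :: "real^'d => real^'n" assumes "Ck k f" "!!l. Ck k (%x. \<Phi> x$l)" shows "Ck k (%x. f (\<Phi> x))"
 using assms
proof (induction k arbitrary: f)
 case 0
 have "cont \<Phi>" using 0(2) continuous_on_vec_lambda[of UNIV "%l x. \<Phi> x$l"] by (simp add: vec_lambda_eta)
 thus ?case using 0(1) continuous_on_compose2[of UNIV f UNIV \<Phi>] by simp
next
 case (Suc k)
 show ?case
 proof (rule Ck_SucI[where G="%x. SU l. pd l f (\<Phi> x)*.grad (%x. \<Phi> x$l) x"])
  fix x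
  have "(\<Phi> has_derivative (%h. \<chi> l. grad (%x. \<Phi> x$l) x<.>h)) (at x)" unfolding has_derivative_componentwise_within[of \<Phi>]
   using Ck_deriv[OF Suc.prems(2)] by (auto simp: Basis_vec_def inner_axis)
  from diff_chain_at[OF this Ck_deriv[OF Suc.prems(1)]]
  show "((%x. f (\<Phi> x)) has_derivative
    (%h. (SU l. pd l f (\<Phi> x)*.grad (%x. \<Phi> x$l) x)<.>h)) (at x)" by (simp add: o_def inner_vec_def[of "grad f _"] inner_sum_left)
 next
  fix i
  have "Ck k (%x. \<Phi> x$l)" for l using Suc.prems(2) Ck_Suc_le by blast
  moreover have "Ck k (pd i (%x. \<Phi> x$l))" for l using Suc.prems(2)[of l] by (rule Ck_partial)
  moreover have "Ck k (pd l f)" for l using Suc.prems(1) by (rule Ck_partial)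
  ultimately show "Ck k (%x. (SU l. pd l f (\<Phi> x)*.grad (%x. \<Phi> x$l) x)$i)" using Suc.IH by (auto intro!: Ck_sum Ck_mult)
 qed
qed

lemma has_derivative_grad_compose:
 fixes f :: "real => real" assumes "(f has_field_derivative D) (at (h x))" "(h has_derivative (%k. G<.>k)) (at x)"
 shows "((%x. f (h x)) has_derivative (%k. (D*.G)<.>k)) (at x)" using diff_chain_at[OF assms(2) assms(1)[unfolded has_field_derivative_def]]
 by (simp add: o_def)

lemma Ck_inverse: assumes "Ck k f" "!!x. f x ~= 0" shows "Ck k (%x. inverse (f x))" using assms(1)
proof (induction k)
 case 0 thus ?case using assms(2) by (simp add: continuous_on_inverse)
next
 case (Suc k)
 show ?case
 proof (rule Ck_SucI)
  show "((%x. inverse (f x)) has_derivative (%h. ((- (inverse (f x)*inverse (f x)))*.grad f x)<.>h)) (at x)" for x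
   by (rule has_derivative_grad_compose[OF _ Ck_deriv[OF Suc.prems]])
    (use assms(2) in \<open>auto intro!: derivative_eq_intros simp: power2_eq_square\<close>)
  have "Ck k (%x. inverse (f x))" using Suc Ck_Suc_le by blast
  thus "Ck k (%x. ((- (inverse (f x)*inverse (f x)))*.grad f x)$i)" for i using Ck_partial[OF Suc.prems] by (auto intro!: Ck_mult)
 qed
qed

lemma has_field_derivative_pos_power:
 "((%t. (max 0 t)^Suc (Suc n)) has_field_derivative real (Suc (Suc n))*(max 0 t)^Suc n) (at (t::real))"
proof -
 consider "t < 0" | "t = 0" | "t > 0" by linarith
 thus ?thesis
 proof cases
  case 1
  have "((%_. 0) has_field_derivative real (Suc (Suc n))*(max 0 t)^Suc n) (at t)" using 1 by (auto intro!: derivative_eq_intros)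
  moreover have "eventually (%x. x : {..<0}) (nhds t)" using 1 by (intro eventually_nhds_in_open) auto
  ultimately show ?thesis by (subst DERIV_cong_ev[where f="_" and g="%_. 0"]) (auto elim!: eventually_mono)
 next
  case 3
  have "((%t. t^Suc (Suc n)) has_field_derivative real (Suc (Suc n))*(max 0 t)^Suc n) (at t)" using 3 DERIV_pow[of "Suc (Suc n)" t UNIV] by simp
  moreover have "eventually (%x. x : {0<..}) (nhds t)" using 3 by (intro eventually_nhds_in_open) auto
  ultimately show ?thesis by (subst DERIV_cong_ev[where f="_" and g="%t. t^Suc (Suc n)"]) (auto elim!: eventually_mono)
 next
  case 2
  have "(%h. (max 0 h)^Suc (Suc n)/h) \<midarrow>0\<rightarrow> (0::real)"
  proof (rule Lim_null_comparison)
   show "\<forall>\<^sub>F h in at 0. norm ((max 0 h)^Suc (Suc n)/h) <= abs(h)^Suc n" for h :: real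
   proof (intro always_eventually allI)
    fix h :: real
    show "norm ((max 0 h)^Suc (Suc n)/h) <= abs(h)^Suc n"
    proof (cases "h > 0")
     case False
     have "0 <= abs(h)^Suc n" by (rule zero_le_power) simp
     moreover have "max 0 h = 0" using False by simp
     ultimately show ?thesis by (simp del: power_Suc add: zero_power)
    qed (simp add: max_def)
   qed
   have "((%h. abs(h)^Suc n) ---> \<bar>0::real\<bar>^Suc n) (at 0)" by (intro tendsto_intros)
   thus "((%h. abs(h)^Suc n) ---> (0::real)) (at 0)" by simp
  qed
  thus ?thesis using 2 by (simp add: DERIV_def)
 qed
qed

lemma Ck_pos_power: "Ck k h ==> Ck k (%x. (max 0 (h x))^(Suc k))"
proof (induction k)
 case 0 thus ?case by (simp add: continuous_on_max)
next
 case (Suc k)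
 show ?case
 proof (rule Ck_SucI)
  show "((%x. (max 0 (h x))^Suc (Suc k)) has_derivative
   (%y. ((real (Suc (Suc k))*(max 0 (h x))^Suc k)*.grad h x)<.>y)) (at x)" for x
   by (rule has_derivative_grad_compose[OF has_field_derivative_pos_power Ck_deriv[OF Suc.prems]])
  show "Ck k (%x. ((real (Suc (Suc k))*(max 0 (h x))^Suc k)*.grad h x)$i)" for i using Suc.IH[OF Ck_Suc_le[OF Suc.prems]] Ck_partial[OF Suc.prems]
   by (auto intro!: Ck_mult simp del: power_Suc)
 qed
qed

subsection \<open>Bump functions\<close>

definition flat :: "nat => real => real" where
 "flat m t = (if t <= 0 then 0 else (1/t)^m*exp (- (1/t)))"

lemma exp_ge_monomial:
 fixes x :: real assumes "0 <= x" shows "x^n/fact n <= exp x"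
proof -
 have "(\<Sum>k\<in>{n}. x^k /\<^sub>R fact k) <= (\<Sum>k. x^k /\<^sub>R fact k)" using assms by (intro sum_le_suminf summable_exp_generic) auto
 thus ?thesis by (simp add: exp_def divide_inverse mult.commute)
qed

lemma flat_bound: "abs(flat m t) <= fact (m+2)*t^2"
proof (cases "t <= 0")
 case False
 hence t: "t > 0" by simp
 have "(1/t)^(m+2)/fact (m+2) <= exp (1/t)" by (rule exp_ge_monomial) (use t in simp)
 hence "(1/t)^(m+2)*exp (-(1/t)) <= fact (m+2)"
 proof -
  assume "(1/t)^(m+2)/fact (m+2) <= exp (1/t)"
  hence "(1/t)^(m+2) <= exp (1/t)*fact (m+2)" using pos_divide_le_eq[of "fact (m+2) :: real"] fact_gt_zero by blast
  hence "(1/t)^(m+2)*exp (-(1/t)) <= exp (1/t)*fact (m+2)*exp (-(1/t))" by (rule mult_right_mono) simp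
  also have "... = fact (m+2)" by (metis exp_minus_inverse mult.assoc mult.commute mult_1)
  finally show ?thesis .
 qed
 hence "t^2*((1/t)^(m+2)*exp (-(1/t))) <= t^2*fact (m+2)" by (intro mult_left_mono) auto
 moreover have "t^2*((1/t)^(m+2)*exp (-(1/t))) = flat m t" using t by (simp add: flat_def power_add field_simps power2_eq_square)
 moreover have "flat m t >= 0" using t by (simp add: flat_def)
 ultimately show ?thesis by (simp add: mult.commute)
qed (simp add: flat_def)

lemma flat_deriv: "(flat m has_field_derivative (- real m*flat (m+1) t+flat (m+2) t)) (at t)"
proof -
 consider "t < 0" | "t = 0" | "t > 0" by linarith
 thus ?thesis
 proof cases
  case 1
  have "((%_. 0) has_field_derivative (- real m*flat (m+1) t+flat (m+2) t)) (at t)" using 1 by (auto intro!: derivative_eq_intros simp: flat_def)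
  moreover have "eventually (%x. x : {..<0}) (nhds t)" using 1 by (intro eventually_nhds_in_open) auto
  ultimately show ?thesis by (subst DERIV_cong_ev[where f="_" and g="%_. 0"]) (auto elim!: eventually_mono simp: flat_def)
 next
  case 3
  have "((%t. (1/t)^m*exp (- (1/t))) has_field_derivative (- real m*flat (m+1) t+flat (m+2) t)) (at t)"
  proof -
   have inv: "((%t. 1/t) has_field_derivative-((1/t)^2)) (at t)" using 3 by (auto intro!: derivative_eq_intros simp: power2_eq_square)
   have e: "((%t. exp (- (1/t))) has_field_derivative exp (- (1/t))*(1/t)^2) (at t)"
    by (rule DERIV_cong[OF DERIV_chain2[OF DERIV_exp DERIV_minus[OF inv]]]) simp
   have u: "flat j t = (1/t)^j*exp (- (1/t))" for j using 3 by (simp add: flat_def)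
   show ?thesis unfolding u by (rule DERIV_cong[OF DERIV_mult[OF DERIV_power[OF inv, of m] e]])
     (cases m; simp add: power2_eq_square algebra_simps flip: add_divide_distrib)
  qed
  moreover have "eventually (%x. x : {0<..}) (nhds t)" using 3 by (intro eventually_nhds_in_open) auto
  ultimately show ?thesis by (subst DERIV_cong_ev[where f="_" and g="%t. (1/t)^m*exp (- (1/t))"]) (auto elim!: eventually_mono simp: flat_def)
 next
  case 2
  have "(%h. flat m h/h) \<midarrow>0\<rightarrow> (0::real)"
  proof (rule Lim_null_comparison)
   show "\<forall>\<^sub>F h in at 0. norm (flat m h/h) <= fact (m+2)*abs(h)"
   proof (intro always_eventually allI)
    fix h :: real
    have "abs(flat m h) / abs(h) <= fact (m+2)*h^2 / abs(h)" by (intro divide_right_mono flat_bound) auto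
    also have "h^2 = abs(h)*abs(h)" by (simp add: power2_eq_square)
    also have "fact (m+2)*(abs(h)*abs(h)) / abs(h) = fact (m+2)*abs(h)" using nonzero_mult_div_cancel_right[of "abs(h)" "fact (m+2)*abs(h)"]
     by (cases "h = 0") (simp, simp only: mult.assoc abs_eq_0 simp_thms)
    finally show "norm (flat m h/h) <= fact (m+2)*abs(h)" by (simp only: real_norm_def abs_divide)
   qed
   have "((%h. fact (m+2)*abs(h)) ---> fact (m+2)*abs(0::real)) (at 0)" by (intro tendsto_intros)
   thus "((%h. fact (m+2)*abs(h)) ---> (0::real)) (at 0)" by simp
  qed
  moreover have "flat j 0 = 0" for j by (simp add: flat_def)
  ultimately show ?thesis using 2 by (simp add: DERIV_def)
 qed
qed

lemma Ck_flat: "Ck k h ==> Ck k (%x. flat m (h x))"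
proof (induction k arbitrary: m)
 case 0
 have "cont (flat m)" using flat_deriv by (meson DERIV_isCont continuous_at_imp_continuous_on)
 thus ?case using 0 continuous_on_compose2[of UNIV "flat m" UNIV h] by simp
next
 case (Suc k)
 show ?case
 proof (rule Ck_SucI)
  show "((%x. flat m (h x)) has_derivative
   (%y. ((- real m*flat (m+1) (h x)+flat (m+2) (h x))*.grad h x)<.>y)) (at x)" for x
   by (rule has_derivative_grad_compose[OF flat_deriv Ck_deriv[OF Suc.prems]])
  show "Ck k (%x. ((- real m*flat (m+1) (h x)+flat (m+2) (h x))*.grad h x)$i)" for i using Suc.IH[OF Ck_Suc_le[OF Suc.prems]] Ck_partial[OF Suc.prems]
   by (auto intro!: Ck_mult Ck_add Ck_cmult Ck_uminus)
 qed
qed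

definition box_bump :: "real^'d => real^'d => nat => real^'d => real" where
 "box_bump a b n x = (\<Prod>i\<in>UNIV. flat 0 (real n*(x$i-a$i))*flat 0 (real n*(b$i-x$i)))"

lemma flat0: "0 <= flat 0 t" "flat 0 t <= 1" "t <= 0 ==> flat 0 t = 0" by (auto simp: flat_def)

lemma smooth_box_bump: "smooth (box_bump a b n)" unfolding smooth_def box_bump_def by (auto intro!: Ck_prod Ck_mult Ck_flat Ck_cmult Ck_diff)

lemma box_bump_outside: "x \<notin> cbox a b ==> box_bump a b n x = 0"
proof -
 assume "x \<notin> cbox a b"
 then obtain i where "x$i < a$i \<or> b$i < x$i" by (auto simp: mem_box_cart not_le)
 thus ?thesis unfolding box_bump_def by (intro prod_zero bexI[of _ i]) (auto intro!: flat0(3) mult_nonneg_nonpos)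
qed

lemma box_bump_bounds: "0 <= box_bump a b n x" "box_bump a b n x <= 1" unfolding box_bump_def
 by (auto intro!: prod_nonneg prod_le_1 mult_nonneg_nonneg mult_le_one simp: flat0)

lemma flat_lim: "t > 0 ==> (%n. flat 0 (real n*t)) ----> 1"
proof -
 assume t: "t > 0"
 have "(%n. 1/t*(1/real n)) ----> 1/t*0" by (intro tendsto_mult tendsto_const lim_1_over_n)
 hence "(%n. exp (- (1/t*(1/real n)))) ----> exp (- (1/t*0))" by (intro tendsto_intros)
 moreover have "eventually (%n. exp (- (1/t*(1/real n))) = flat 0 (real n*t)) sequentially"
  using eventually_gt_at_top[of 0] by eventually_elim (use t in \<open>auto simp: flat_def mult_le_0_iff field_simps\<close>)
 ultimately show ?thesis by (simp add: tendsto_cong)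
qed

lemma box_bump_lim: "(%n. box_bump a b n x) ----> ind (box a b) x"
proof (cases "x : box a b")
 case True
 hence "(%n. box_bump a b n x) ----> (\<Prod>i\<in>(UNIV::'a set). 1*1)" unfolding box_bump_def
  by (intro tendsto_prod tendsto_mult flat_lim) (use True in \<open>simp_all add: mem_box_cart\<close>)
 thus ?thesis using True by simp
next
 case False
 then obtain i where "x$i <= a$i \<or> b$i <= x$i" unfolding mem_box_cart by (meson not_less)
 hence "box_bump a b n x = 0" for n unfolding box_bump_def by (intro prod_zero bexI[of _ i]) (auto intro!: flat0(3) mult_nonneg_nonpos)
 thus ?thesis using False by simp
qed

lemma test_fun_box_bump: "cbox a b \<subseteq> Om ==> test_fun Om (box_bump a b n)"
 unfolding test_fun_def using smooth_box_bump box_bump_outside[of _ a b n] compact_cbox[of a b] by metis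

lemma pd_const [simp]: "pd i (%x. c) x = 0" by (rule pd_eq[of _ "%_. 0", simplified]) simp

lemma pd_add:
 "f differentiable (at x) ==> g differentiable (at x) ==>
  pd i (%x. f x+g x) x = pd i f x+pd i g x" using pd_eq[OF has_derivative_add[OF has_derivative_grad has_derivative_grad]]
 by (fastforce simp: inner_axis)

lemma pd_diff:
 "f differentiable (at x) ==> g differentiable (at x) ==>
  pd i (%x. f x-g x) x = pd i f x-pd i g x" using pd_eq[OF has_derivative_diff[OF has_derivative_grad has_derivative_grad]]
 by (fastforce simp: inner_axis)

lemma pd_mult:
 "f differentiable (at x) ==> g differentiable (at x) ==>
  pd i (%x. f x*g x) x = f x*pd i g x+pd i f x*g x" using pd_eq[OF has_derivative_mult[OF has_derivative_grad has_derivative_grad]]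
 by (fastforce simp: inner_axis)

lemma pd_cmult:
 "f differentiable (at x) ==> pd i (%x. c*f x) x = c*pd i f x" using pd_mult[of "%_. c" x f i] by simp

lemma DERIV_along_line:
 fixes f :: "real^'d => real" assumes "!!x. f differentiable (at x)" shows "((%r. f (x+r*.e)) has_field_derivative grad f (x+r*.e)<.>e) (at r)"
proof -
 have l: "((%r. x+r*.e) has_derivative (%h. h*.e)) (at r)" by (auto intro!: derivative_eq_intros)
 have "((%r. f (x+r*.e)) has_derivative (%h. grad f (x+r*.e)<.>(h*.e))) (at r)"
  using diff_chain_at[OF l has_derivative_grad[OF assms]] by (simp add: o_def)
 thus ?thesis by (simp add: has_field_derivative_def mult_commute_abs)
qed

lemma MVT_along_line:
 fixes f :: "real^'d => real" assumes "!!x. f differentiable (at x)" "0 < t"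
 obtains r where "0 < r" "r < t" "f (x+t*.e)-f x = t*(grad f (x+r*.e)<.>e)" using MVT2[OF assms(2) DERIV_along_line[OF assms(1), of x e]] by auto

lemma pd_commute:
 fixes f :: "real^'d => real" assumes f: "Ck 2 f" shows "pd i (pd j f) x = pd j (pd i f) x"
proof -
 let ?e = "%i. axis i 1 :: real^'d"
 have f2: "Ck (Suc (Suc 0)) f" using f by (simp only: numeral_2_eq_2)
 have d: "!!x. f differentiable (at x)" and dd: "!!x i. pd i f differentiable (at x)" and c: "!!i j. cont (pd i (pd j f))" using f2 by auto
 have key: "EX r q. 0 < r & r < t & 0 < q & q < t &
   f (x+t *. ?e i+t *. ?e j)-f (x+t *. ?e i)-f (x+t *. ?e j)+f x
    = t*(t*pd j (pd i f) (x+r *. ?e i+q *. ?e j))" if t: "0 < t" for t i j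
 proof -
  let ?u = "%r. f ((x+t *. ?e j)+r *. ?e i)-f (x+r *. ?e i)"
  have "(?u has_field_derivative (grad f ((x+t *. ?e j)+r *. ?e i) <.> ?e i-grad f (x+r *. ?e i) <.> ?e i)) (at r)" for r
   by (intro DERIV_diff DERIV_along_line d)
  from MVT2[OF t this] obtain r where r: "0 < r" "r < t" and
   u: "?u t - ?u 0 = t*(pd i f ((x+t *. ?e j)+r *. ?e i)-pd i f (x+r *. ?e i))" by (auto simp: inner_axis)
  obtain q where q: "0 < q" "q < t" and
   v: "pd i f ((x+r *. ?e i)+t *. ?e j)-pd i f (x+r *. ?e i)
    = t*(grad (pd i f) ((x+r *. ?e i)+q *. ?e j) <.> ?e j)" using MVT_along_line[OF dd t] by blast
  show ?thesis using r q u v by (intro exI[of _ r] exI[of _ q]) (simp add: inner_axis algebra_simps)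
 qed
 have lim: "((%n. pd j (pd i f) (x+r n *. ?e i+q n *. ?e j))
   ----> pd j (pd i f) x)" if "!!n. 0 < r n & r n < 1/Suc n" "!!n. 0 < q n & q n < 1/Suc n" for r q i j
 proof -
  have r: "r ----> 0" by (rule tendsto_sandwich[OF _ _ tendsto_const LIMSEQ_Suc[OF lim_1_over_n]])
    (use that(1) less_imp_le in \<open>auto intro!: always_eventually simp: less_imp_le\<close>)
  have q: "q ----> 0" by (rule tendsto_sandwich[OF _ _ tendsto_const LIMSEQ_Suc[OF lim_1_over_n]])
    (use that(2) less_imp_le in \<open>auto intro!: always_eventually simp: less_imp_le\<close>)
  have "(%n. x+r n *. ?e i+q n *. ?e j) ----> x+0 *. ?e i+0 *. ?e j" by (intro tendsto_intros r q)
  hence "(%n. x+r n *. ?e i+q n *. ?e j) ----> x" by simp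
  from continuous_on_tendsto_compose[OF c this] show ?thesis by simp
 qed
 have pos: "0 < 1/real (Suc n)" for n by simp
 have "EX r q r' q'. (ALL n. 0 < r n & r n < 1/Suc n) & (ALL n. 0 < q n & q n < 1/Suc n) &
  (ALL n. 0 < r' n & r' n < 1/Suc n) & (ALL n. 0 < q' n & q' n < 1/Suc n) & (ALL n. pd j (pd i f) (x+r n *. ?e i+q n *. ?e j) =
   pd i (pd j f) (x+r' n *. ?e j+q' n *. ?e i))"
 proof -
  have "EX r q r' q'. (0 < r & r < 1/Suc n) & (0 < q & q < 1/Suc n) & (0 < r' & r' < 1/Suc n) & (0 < q' & q' < 1/Suc n) &
  pd j (pd i f) (x+r *. ?e i+q *. ?e j) =
   pd i (pd j f) (x+r' *. ?e j+q' *. ?e i)" for n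
  proof -
   obtain r q where 1: "0 < r" "r < 1/Suc n" "0 < q" "q < 1/Suc n"
    "f (x+(1/Suc n) *. ?e i+(1/Suc n) *. ?e j)-f (x+(1/Suc n) *. ?e i)-f (x+(1/Suc n) *. ?e j)+f x
    = (1/Suc n)*((1/Suc n)*pd j (pd i f) (x+r *. ?e i+q *. ?e j))" using key[OF pos[of n], of i j] by blast
   obtain r' q' where 2: "0 < r'" "r' < 1/Suc n" "0 < q'" "q' < 1/Suc n"
    "f (x+(1/Suc n) *. ?e j+(1/Suc n) *. ?e i)-f (x+(1/Suc n) *. ?e j)-f (x+(1/Suc n) *. ?e i)+f x
    = (1/Suc n)*((1/Suc n)*pd i (pd j f) (x+r' *. ?e j+q' *. ?e i))" using key[OF pos[of n], of j i] by blast
   have "f (x+(1/Suc n) *. ?e i+(1/Suc n) *. ?e j) = f (x+(1/Suc n) *. ?e j+(1/Suc n) *. ?e i)" by (simp only: add_ac)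
   hence "(1/Suc n)*((1/Suc n)*pd j (pd i f) (x+r *. ?e i+q *. ?e j)) = (1/Suc n)*((1/Suc n)*pd i (pd j f) (x+r' *. ?e j+q' *. ?e i))"
    using 1(5) 2(5) by linarith
   hence "pd j (pd i f) (x+r *. ?e i+q *. ?e j) =
    pd i (pd j f) (x+r' *. ?e j+q' *. ?e i)" using pos[of n] by (metis less_irrefl mult_left_cancel)
   thus ?thesis using 1(1-4) 2(1-4) by blast
  qed
  thus ?thesis by metis
 qed
 then obtain r q r' q' where *: "!!n. 0 < r n & r n < 1/Suc n" "!!n. 0 < q n & q n < 1/Suc n"
  "!!n. 0 < r' n & r' n < 1/Suc n" "!!n. 0 < q' n & q' n < 1/Suc n"
  "!!n. pd j (pd i f) (x+r n *. ?e i+q n *. ?e j) =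
   pd i (pd j f) (x+r' n *. ?e j+q' n *. ?e i)" by blast
 show ?thesis using LIMSEQ_unique[OF lim[OF *(1,2), of j i] lim[OF *(3,4), of i j, folded *(5)]] by simp
qed

subsection \<open>Functions with bounded support\<close>

definition csupp :: "('a::real_normed_vector => 'b::zero) => bool" where
 "csupp f \<longleftrightarrow> (EX R. ALL x. R < norm x --> f x = 0)"

lemma csuppI: "(!!x. R < norm x ==> f x = 0) ==> csupp f" unfolding csupp_def by blast

lemma csupp_mono: "csupp f ==> (!!x. f x = 0 ==> g x = 0) ==> csupp g" unfolding csupp_def by metis

lemma csupp_mult1: "csupp f ==> csupp (%x. f x*g x :: real)" by (erule csupp_mono) simp

lemma csupp_mult2: "csupp g ==> csupp (%x. f x*g x :: real)" by (erule csupp_mono) simp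

lemma csupp_add:
 fixes f g :: "'a::real_normed_vector => 'b::comm_monoid_add" assumes "csupp f" "csupp g" shows "csupp (%x. f x+g x)"
proof -
 obtain R S where "!!x. R < norm x ==> f x = 0" "!!x. S < norm x ==> g x = 0" using assms unfolding csupp_def by blast
 thus ?thesis by (intro csuppI[of "max R S"]) simp
qed

lemma csupp_diff:
 fixes f g :: "'a::real_normed_vector => 'b::group_add" assumes "csupp f" "csupp g" shows "csupp (%x. f x-g x)"
proof -
 obtain R S where "!!x. R < norm x ==> f x = 0" "!!x. S < norm x ==> g x = 0" using assms unfolding csupp_def by blast
 thus ?thesis by (intro csuppI[of "max R S"]) simp
qed

lemma csupp_sum: "(!!i. i : I ==> csupp (f i)) ==> csupp (%x. \<Sum>i\<in>I. f i x :: real)"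
proof (induction I rule: infinite_finite_induct)
 case (insert i I)
 thus ?case by (simp add: csupp_add)
qed (auto intro: csuppI[of 0])

lemma pd_local:
 fixes f :: "real^'d => real" assumes "open S" "x : S" "!!y. y : S ==> f y = g y" shows "pd i f x = pd i g x"
proof -
 have "frechet_derivative f (at x) = frechet_derivative g (at x)" unfolding frechet_derivative_def by (rule arg_cong[of _ _ Eps], rule ext)
   (metis assms has_derivative_transform_within_open)
 thus ?thesis by (simp add: partial_deriv_def)
qed

lemma csupp_pd:
 fixes f :: "real^'d => real" assumes "csupp f" shows "csupp (pd i f)"
proof -
 obtain R where R: "!!x. R < norm x ==> f x = 0" using assms unfolding csupp_def by blast
 have "open {x :: real^'d. R < norm x}" by (intro open_Collect_less continuous_intros)
 hence "pd i f x = pd i (%_. 0) x" if "R < norm x" for x by (rule pd_local) (use R that in auto)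
 thus ?thesis by (intro csuppI[of R]) simp
qed

lemma csupp_integrable:
 fixes f :: "real^'d => real" assumes "cont f" "csupp f" shows "integrable lborel f"
proof -
 obtain R where R: "!!x. R < norm x ==> f x = 0" using assms unfolding csupp_def by blast
 have "integrable lborel (%x. ind (cball 0 R) x*.f x)" by (intro borel_integrable_compact compact_cball) (use assms continuous_on_subset in blast)
 moreover have "(%x. ind (cball 0 R) x*.f x) = f" using R by (auto simp: fun_eq_iff indicator_def not_le)
 ultimately show ?thesis by simp
qed

lemma csupp_bounded:
 fixes f :: "'a::euclidean_space => real" assumes "cont f" "csupp f"
 obtains B where "0 < B" "!!x. abs(f x) <= B"
proof -
 obtain R where R: "!!x. R < norm x ==> f x = 0" using assms unfolding csupp_def by blast
 have "compact (f ` cball 0 R)" using assms by (intro compact_continuous_image) (auto intro: continuous_on_subset)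
 then obtain B where B: "0 < B" "!!x. x : cball 0 R ==> \<bar>f x\<bar> <= B" using compact_imp_bounded bounded_pos[of "f ` cball 0 R"] by auto
 have "abs(f x) <= B" for x using B R[of x] by (cases "R < norm x") auto
 thus ?thesis using that B(1) by blast
qed

lemma lborel_integral_translate:
 fixes f :: "'a::euclidean_space => real" assumes "f : borel_measurable borel" shows "(LB x. f (x+c)) = (LB x. f x)"
 using assms by (subst lborel_distr_plus[symmetric, of c], subst integral_distr) (auto simp: add.commute)

lemma csupp_translate: "csupp f ==> csupp (%x. f (x+c))"
proof -
 assume "csupp f"
 then obtain R where R: "!!x. R < norm x ==> f x = 0" unfolding csupp_def by blast
 have "f (x+c) = 0" if "R+norm c < norm x" for x using R[of "x+c"] that norm_triangle_ineq4[of "x+c" c] by force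
 thus ?thesis by (rule csuppI)
qed

lemma integral_pd_0:
 fixes g :: "real^'d => real" assumes g: "Ck 1 g" "csupp g" shows "(LB x. pd i g x) = 0"
proof -
 let ?e = "axis i 1 :: real^'d" and ?t = "%n. 1/real (Suc n)"
 have d: "!!x. g differentiable (at x)" and c: "cont (pd i g)" using g by auto
 have gc: "cont g" using g(1) by (rule Ck_continuous)
 obtain B where B: "0 < B" "!!x. abs(pd i g x) <= B" using csupp_bounded[OF c csupp_pd[OF g(2)]] by blast
 obtain R where R: "!!x. R < norm x ==> g x = 0" using g unfolding csupp_def by blast
 define G where "G n x = (g (x + ?t n *. ?e)-g x)/?t n" for n x
 have gm: "g : borel_measurable borel" using gc borel_measurable_continuous_onI by blast
 have [measurable]: "G n : borel_measurable borel" for n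
  unfolding G_def by (intro borel_measurable_continuous_onI continuous_intros continuous_on_compose2[OF gc]) auto
 have "(%n. (LB x. G n x)) ----> (LB x. pd i g x)"
 proof (rule integral_dominated_convergence[where w="%x. B*ind (cball 0 (R+1)) x"])
  show "pd i g : borel_measurable lborel" "G n : borel_measurable lborel" for n using c borel_measurable_continuous_onI by auto
  show "integrable lborel (%x :: real^'d. B*ind (cball 0 (R+1)) x :: real)" using emeasure_compact_finite[of "cball (0::real^'d) (R+1)"]
    by (intro integrable_mult_right integrable_real_indicator) auto
  show "AE x in lborel. (%n. G n x) ----> pd i g x"
  proof (intro AE_I2)
   fix x
   have "((%r. g (x+r *. ?e)) has_field_derivative pd i g x) (at 0)" using DERIV_along_line[OF d, of x ?e 0] by (simp add: inner_axis)
   hence "((%h. (g (x+h *. ?e)-g x)/h) ---> pd i g x) (at 0)" by (simp add: DERIV_def)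
   moreover have "filterlim ?t (at 0) sequentially" unfolding filterlim_at using LIMSEQ_Suc[OF lim_1_over_n] by auto
   ultimately show "(%n. G n x) ----> pd i g x" unfolding G_def by (rule filterlim_compose)
  qed
  show "AE x in lborel. norm (G n x) <= B*ind (cball 0 (R+1)) x" for n
  proof (intro AE_I2)
   fix x
   have t: "0 < ?t n" "?t n <= 1" by auto
   show "norm (G n x) <= B*ind (cball 0 (R+1)) x"
   proof (cases "x : cball 0 (R+1)")
    case True
    obtain r where "g (x + ?t n *. ?e)-g x = ?t n*(grad g (x+r *. ?e) <.> ?e)" using MVT_along_line[OF d t(1)] by blast
    hence "G n x = pd i g (x+r *. ?e)" by (simp add: G_def inner_axis)
    thus ?thesis using B True by simp
   next
    case False
    hence x: "R+1 < norm x" by simp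
    have "norm x-norm (?t n *. ?e) <= norm (x + ?t n *. ?e)" using norm_triangle_ineq4[of "x + ?t n *. ?e" "?t n *. ?e"] by simp
    moreover have "norm (?t n *. ?e) <= 1" using t by (simp add: norm_axis_1)
    ultimately have "R < norm (x + ?t n *. ?e)" "R < norm x" using x by linarith+
    hence "g (x + ?t n *. ?e) = 0" "g x = 0" using R by blast+
    thus ?thesis using False by (simp add: G_def)
   qed
  qed
 qed
 moreover have "(LB x. G n x) = 0" for n
 proof -
  have "integrable lborel (%x. g (x + ?t n *. ?e))" by (intro csupp_integrable csupp_translate g continuous_on_compose2[OF gc] continuous_intros) auto
  thus ?thesis using lborel_integral_translate[OF gm, of "?t n *. ?e"] csupp_integrable[OF gc g(2)] by (simp add: G_def)
 qed
 ultimately show ?thesis by (simp add: LIMSEQ_const_iff)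
qed

lemma integral_by_parts:
 fixes f g :: "real^'d => real" assumes "Ck 1 f" "Ck 1 g" "csupp f \<or> csupp g" shows "(LB x. f x*pd i g x) = - (LB x. pd i f x*g x)"
proof -
 have cs: "csupp (%x. f x*g x)" "csupp (%x. f x*pd i g x)"
  "csupp (%x. pd i f x*g x)" using assms(3) by (auto intro: csupp_mult1 csupp_mult2 csupp_pd)
 have c: "cont f" "cont g" "cont (pd i f)"
   "cont (pd i g)" using assms Ck_continuous[of 1] by auto
 have "(LB x. pd i (%x. f x*g x) x) = 0" by (intro integral_pd_0 Ck_mult assms cs)
 moreover have "pd i (%x. f x*g x) = (%x. f x*pd i g x+pd i f x*g x)" using assms by (intro ext pd_mult) auto
 moreover have "integrable lborel (%x. f x*pd i g x)" "integrable lborel (%x. pd i f x*g x)" by (intro csupp_integrable continuous_on_mult c cs)+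
 ultimately show ?thesis by simp
qed

lemma One_nth: "(One :: real^'d)$i = 1" using inner_sum_left_Basis[of "axis i 1 :: real^'d"] by (simp add: cart_eq_inner_axis axis_in_Basis_iff)

lemma fundamental_lemma:
 fixes Om :: "(real^'d) set" assumes Om: "open Om" and g: "integrable (LO Om) g" and z: "!!ph. test_fun Om ph ==> (LINT x|LO Om. g x*ph x) = 0"
 shows "AE x in LO Om. g x = (0::real)"
proof -
 let ?G = "%x. ind Om x*.g x"
 have Omm: "Om : sets lebesgue" using Om by auto
 have G: "integrable lebesgue ?G" using g Omm by (simp add: integrable_restrict_space)
 hence Gi: "?G integrable_on cbox a b" for a b by (intro integrable_on_subcbox[OF integrable_on_lebesgue[OF G]]) auto
 have box: "integral (cbox a b) ?G = 0" if ab: "cbox a b \<subseteq> Om" for a b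
 proof -
  have "(%n. LINT x|LO Om. g x*box_bump a b n x) ----> (LINT x|LO Om. g x*ind (box a b) x)"
  proof (rule integral_dominated_convergence[where w="%x. abs(g x)"])
   have bm: "box_bump a b n : borel_measurable (LO Om)" for n using Ck_continuous[OF smooth_Ck[OF smooth_box_bump]] Omm
    by (intro continuous_imp_measurable_on_sets_lebesgue) (auto intro: continuous_on_subset)
   show "(%x. g x*box_bump a b n x) : borel_measurable (LO Om)" for n using g bm by auto
   show "(%x. g x*ind (box a b) x) : borel_measurable (LO Om)"
    by (rule borel_measurable_times[OF borel_measurable_integrable[OF g] measurable_restrict_space1]) (auto intro!: borel_measurable_indicator)
   show "AE x in LO Om. (%n. g x*box_bump a b n x) ----> g x*ind (box a b) x" by (intro AE_I2 tendsto_intros box_bump_lim)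
   show "AE x in LO Om. norm (g x*box_bump a b n x) <= abs(g x)" for n
    using box_bump_bounds[of a b n] by (intro AE_I2) (auto simp: abs_mult intro!: mult_left_le)
  qed (use g in auto)
  hence "(LINT x|LO Om. g x*ind (box a b) x) = 0" using z[OF test_fun_box_bump[OF ab]] by (simp add: LIMSEQ_const_iff)
  hence "(LINT x:box a b|lebesgue. ?G x) = 0" using Omm by (simp add: integral_restrict_space set_lebesgue_integral_def mult_ac)
  moreover have "set_integrable lebesgue (box a b) ?G" using integrable_mult_indicator[OF _ G, of "box a b"] by (simp add: set_integrable_def)
  ultimately have "integral (box a b) ?G = 0" using set_lebesgue_integral_eq_integral(2) by metis
  thus ?thesis by (simp add: integral_open_interval)
 qed
 obtain N where N: "negligible N" and
  lim: "!!x e. \<lbrakk>x \<notin> N; 0 < e\<rbrakk> \<Longrightarrow> EX d>0. ALL h. 0 < h & h < d -->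
   norm (integral (cbox x (x+h*.One)) ?G /\<^sub>R h^DIM(real^'d) - ?G x) < e" using integrable_ccontinuous_explicit[OF Gi] by blast
 have null: "g x = 0" if x: "x : Om" "x \<notin> N" for x
 proof (rule ccontr)
  assume "g x ~= 0"
  then obtain d where d: "d > 0" "!!h. 0 < h ==> h < d ==>
   norm (integral (cbox x (x+h*.One)) ?G /\<^sub>R h^DIM(real^'d) - ?G x) < \<bar>g x\<bar>" using lim[OF x(2), of "abs(g x)"] by auto
  obtain e where e: "e > 0" "cball x e \<subseteq> Om" using Om x(1) open_contains_cball by blast
  let ?h = "min (d/2) (e/real CARD('d))"
  have c: "CARD('d) > 0" by simp
  have "cbox x (x + ?h*.One) \<subseteq> cball x e"
  proof
   fix y assume y: "y : cbox x (x + ?h*.One)"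
   have "norm (y-x) <= (SU i. abs((y-x)$i))" by (rule norm_le_l1_cart)
   also have "... <= (\<Sum>i\<in>(UNIV::'d set). ?h)"
   proof (rule sum_mono)
    fix i :: 'd
    have "(x + ?h*.One)$i = x$i + ?h" by (simp only: vector_add_component vector_scaleR_component real_scaleR_def mult_1_right One_nth)
    hence "x$i <= y$i & y$i <= x$i + ?h" using y unfolding mem_box_cart by metis
    thus "abs((y-x)$i) <= ?h" unfolding vector_minus_component by linarith
   qed
   also have "... <= e" using e(1) c by (simp add: min_def field_simps)
   finally show "y : cball x e" by (simp add: dist_norm norm_minus_commute)
  qed
  with box[of x "x + ?h*.One"] e have "integral (cbox x (x + ?h*.One)) ?G = 0" by blast
  moreover have "0 < ?h" using d(1) e(1) by simp
  moreover have "?h < d" using d(1) by (intro min.strict_coboundedI1) simp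
  ultimately show False using d(2)[of ?h] x(1) by simp
 qed
 have "AE x in lebesgue. x \<notin> N" using N by (intro AE_not_in) (simp add: negligible_iff_null_sets)
 hence "AE x in LO Om. x \<notin> N" using Omm by (subst AE_restrict_space_iff) auto
 moreover have "AE x in LO Om. x : Om" by (rule AE_I2) (use Omm in \<open>auto simp: space_restrict_space\<close>)
 ultimately show ?thesis by eventually_elim (rule null)
qed

section \<open>Averages at a variable scale\<close>

definition pcut :: "nat => real^'d => real" where
 "pcut m y = (max 0 (1-y<.>y))^m"

lemma Ck_pcut: "Ck k (pcut (Suc k))"
proof -
 have "Ck k (%y :: real^'a. 1-y<.>y)" unfolding inner_vec_def inner_real_def by (intro Ck_diff Ck_const Ck_sum Ck_mult Ck_nth)
 thus ?thesis unfolding pcut_def by (rule Ck_pos_power)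
qed

lemma pd_pcut:
 "pd i (pcut (Suc (Suc n))) y = - (2*real (Suc (Suc n)))*(y$i*pcut (Suc n) y)"
proof -
 have "((%y. 1-y<.>y) has_derivative (%k. (- 2*.y)<.>k)) (at y)" by (auto intro!: derivative_eq_intros simp: inner_commute)
 from has_derivative_grad_compose[OF has_field_derivative_pos_power this, of n]
 have "pd i (pcut (Suc (Suc n))) y
   = ((real (Suc (Suc n))*max 0 (1-y<.>y)^Suc n)*.(- 2*.y))<.>axis i 1" unfolding pcut_def by (rule pd_eq)
 thus ?thesis by (simp add: inner_axis pcut_def algebra_simps)
qed

lemma pcut_outside: "1 <= norm y ==> pcut (Suc m) y = 0"
proof -
 assume "1 <= norm y"
 hence "1^2 <= (norm y)^2" by (intro power_mono) auto
 hence "max 0 (1-y<.>y) = 0" by (simp add: power2_norm_eq_inner)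
 thus ?thesis by (simp add: pcut_def)
qed

lemma pcut_nonneg: "0 <= pcut m y" by (simp add: pcut_def)

definition ker :: "(real^'d => real) => bool" where
 "ker k \<longleftrightarrow> cont k & (ALL y. 1 < norm y --> k y = 0)"

lemma ker_csupp: "ker k ==> csupp k" by (auto simp: ker_def csupp_def)

lemma ker_mult: "ker k ==> cont g ==> ker (%y. k y*g y)" by (auto simp: ker_def intro: continuous_on_mult)

lemma ker_pcut: "ker (pcut (Suc m))" using Ck_continuous[OF Ck_pcut] by (auto simp: ker_def intro: pcut_outside less_imp_le)

lemma ker_cmult: "ker k ==> ker (%y. c*k y)" by (auto simp: ker_def intro: continuous_on_mult_left)

lemma ker_nth: "ker k ==> ker (%y. k y*y$l)" by (intro ker_mult) (auto intro: continuous_on_component)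

lemma ker_partial: "ker k ==> Ck 1 k ==> ker (pd l k)" unfolding ker_def
proof (intro conjI allI impI)
 fix y :: "real^'a" assume k: "cont k & (ALL y. 1 < norm y --> k y = 0)" and y: "1 < norm y"
 have "open {x :: real^'a. 1 < norm x}" by (intro open_Collect_less continuous_intros)
 hence "pd l k y = pd l (%_. 0) y" by (rule pd_local) (use k y in auto)
 thus "pd l k y = 0" by simp
qed auto

lemma unit_cball_subset: "cball 0 1 \<subseteq> cbox (- One) (One :: real^'d)"
proof
 fix y :: "real^'d" assume "y : cball 0 1"
 hence "abs(y$i) <= 1" for i using component_le_norm_cart[of y i] by simp
 thus "y : cbox (- One) One" unfolding mem_box_cart vector_uminus_component One_nth by (auto simp: abs_le_iff minus_le_iff)
qed

lemma ker_integral: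
 fixes k :: "real^'d => real" assumes "ker k" shows "(LB y. k y) = integral (cbox (- One) One) k"
proof -
 have "(LB y. k y) = integral UNIV k" using assms by (intro integral_lborel[symmetric] csupp_integrable ker_csupp) (auto simp: ker_def)
 also have "... = integral UNIV (%y. if y : cbox (- One) One then k y else 0)"
 proof (intro arg_cong[where f="integral UNIV"] ext)
  fix y show "k y = (if y : cbox (- One) One then k y else 0)" using assms unit_cball_subset[where 'd='d] by (force simp: ker_def)
 qed
 finally show ?thesis by (simp only: integral_restrict_UNIV)
qed

definition kav :: "(real^'d => real) => (real^'d => real) => (real^'d => real) => real^'d => real" where
 "kav ro k g x = (LB y. k y*g (x+ro x*.y))"

lemma continuous_grad: "Ck (Suc n) f ==> cont (grad f)" unfolding grad_def by (intro continuous_on_vec_lambda Ck_continuous[of n] Ck_partial)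

lemma kav_ker: "ker k ==> cont g ==> ker (%y. k y*g (x+r*.y))" by (rule ker_mult) (auto intro!: continuous_on_compose2[of UNIV g] continuous_intros)

lemma kav_integrable: "ker k ==> cont g ==> integrable lborel (%y. k y*g (x+r*.y))"
 using kav_ker[of k g x r] by (intro csupp_integrable ker_csupp) (auto simp: ker_def)

lemma kav_cbox:
 "ker k ==> cont g ==> kav ro k g x = integral (cbox (- One) One) (%y. k y*g (x+ro x*.y))" unfolding kav_def by (rule ker_integral[OF kav_ker])

lemma kav_add: "ker k ==> cont f ==> cont g ==>
 kav ro k (%x. f x+g x) x = kav ro k f x+kav ro k g x" unfolding kav_def by (simp add: distrib_left kav_integrable)

lemma kav_diff: "ker k ==> cont f ==> cont g ==>
 kav ro k (%x. f x-g x) x = kav ro k f x-kav ro k g x" unfolding kav_def by (simp add: right_diff_distrib kav_integrable)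

lemma kav_cmult: "kav ro k (%x. c*f x) x = c*kav ro k f x"
proof -
 have "kav ro k (%x. c*f x) x = (LB y. c*(k y*f (x+ro x*.y)))" unfolding kav_def by (simp add: mult_ac)
 thus ?thesis unfolding kav_def by simp
qed

lemma kav_deriv:
 fixes g :: "real^'d => real" assumes k: "ker k" and g: "Ck 1 g" and ro: "Ck 1 ro"
 shows "(kav ro k g has_derivative (%h. (\<chi> j. kav ro k (pd j g) x +
     pd j ro x*(SU l. kav ro (%y. k y*y$l) (pd l g) x))<.>h)) (at x)"
proof -
 let ?B = "cbox (- One) (One :: real^'d)"
 have g': "Ck (Suc 0) g" and ro': "Ck (Suc 0) ro" using g ro by (simp_all only: One_nat_def)
 note cg = Ck_continuous[OF g] and cro = Ck_continuous[OF ro] and cgg = continuous_grad[OF g'] and cgro = continuous_grad[OF ro']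
 have cgp: "cont (pd j g)" for j using g by auto
 have ck: "cont k" using k by (simp add: ker_def)
 let ?G = "%x y. k y*.(grad g (x+ro x*.y)+(grad g (x+ro x*.y)<.>y)*.grad ro x)"
 have cG: "continuous_on (UNIV \<times> ?B) (%(x, y). ?G x y)" unfolding split_beta
  by (intro continuous_intros continuous_on_compose2[OF ck] continuous_on_compose2[OF cgg]
   continuous_on_compose2[OF cro] continuous_on_compose2[OF cgro]) auto
 have cGx: "continuous_on ?B (?G x)" for x by (intro continuous_intros continuous_on_compose2[OF ck] continuous_on_compose2[OF cgg]
   continuous_on_compose2[OF cro] continuous_on_compose2[OF cgro]) auto
 have "((%x. integral ?B (%y. k y*g (x+ro x*.y))) has_derivative
   integral ?B (%y. blinfun_inner_right (?G x y))) (at x within UNIV)"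
 proof (rule leibniz_rule)
  fix x y
  have "((%x. x+ro x*.y) has_derivative (%h. h+(grad ro x<.>h)*.y)) (at x)"
   by (intro has_derivative_add has_derivative_ident has_derivative_scaleR_left Ck_deriv[OF ro'])
  from diff_chain_at[OF this Ck_deriv[OF g']]
  have "((%x. g (x+ro x*.y)) has_derivative
   (%h. grad g (x+ro x*.y)<.>(h+(grad ro x<.>h)*.y))) (at x)" by (simp add: o_def)
  moreover have "(%h. k y*(grad g (x+ro x*.y)<.>(h+(grad ro x<.>h)*.y))) = blinfun_apply (blinfun_inner_right (?G x y))"
   by (rule ext) (simp add: inner_add_left inner_add_right algebra_simps)
  ultimately show "((%x. k y*g (x+ro x*.y)) has_derivative blinfun_apply (blinfun_inner_right (?G x y))) (at x within UNIV)"
   using has_derivative_mult_right[of "%x. g (x+ro x*.y)" _ "at x" "k y"] by fastforce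
 next
  fix x show "(%y. k y*g (x+ro x*.y)) integrable_on ?B"
   by (intro integrable_continuous continuous_intros continuous_on_compose2[OF ck] continuous_on_compose2[OF cg]) auto
  show "continuous_on (UNIV \<times> ?B) (%(x, y). blinfun_inner_right (?G x y))"
   using bounded_linear.continuous_on[OF bounded_linear_blinfun_inner_right cG] by (simp add: split_beta)
 qed auto
 also have "integral ?B (%y. blinfun_inner_right (?G x y)) = blinfun_inner_right (integral ?B (?G x))"
  using integral_linear[OF integrable_continuous[OF cGx] bounded_linear_blinfun_inner_right] by (simp add: o_def)
 also have "integral ?B (?G x) = (\<chi> j. kav ro k (pd j g) x +
     pd j ro x*(SU l. kav ro (%y. k y*y$l) (pd l g) x))" (is "_ = ?R")
 proof (rule vec_eq_iff[THEN iffD2], rule allI)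
  fix j
  have "integral ?B (?G x)$j = integral ?B (%y. ?G x y$j)" by (rule integral_component_eq_cart[symmetric, OF integrable_continuous[OF cGx]])
  also have "(%y. ?G x y$j) = (%y. k y*pd j g (x+ro x*.y) +
    pd j ro x*(SU l. (k y*y$l)*pd l g (x+ro x*.y)))" by (simp add: fun_eq_iff inner_vec_def sum_distrib_left algebra_simps)
  also have "integral ?B ... = (LB y. k y*pd j g (x+ro x*.y) +
    pd j ro x*(SU l. (k y*y$l)*pd l g (x+ro x*.y)))"
  proof (rule ker_integral[symmetric])
   have "ker (%y. k y*(pd j g (x+ro x*.y) +
    pd j ro x*(SU l. y$l*pd l g (x+ro x*.y))))" by (rule ker_mult[OF k]) (intro continuous_intros continuous_on_compose2[OF cgp]; simp)
   thus "ker (%y. k y*pd j g (x+ro x*.y) +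
    pd j ro x*(SU l. (k y*y$l)*pd l g (x+ro x*.y)))" by (simp add: distrib_left sum_distrib_left mult_ac)
  qed
  also have "... = ?R$j" using kav_integrable[OF k cgp] kav_integrable[OF ker_nth[OF k] cgp] by (simp add: kav_def)
  finally show "integral ?B (?G x)$j = ?R$j" .
 qed
 finally show ?thesis by (simp add: kav_cbox[OF k cg, abs_def])
qed

lemma kav_Ck:
 fixes g :: "real^'d => real" assumes "ker k" "Ck n g" "Ck n ro" shows "Ck n (kav ro k g)" using assms
proof (induction n arbitrary: k g)
 case 0
 hence c: "cont g" "cont k" "cont ro" by (auto simp: ker_def)
 have "cont (%x. integral (cbox (- One) One) (%y. k y*g (x+ro x*.y)))" by (rule integral_continuous_on_param, unfold split_beta)
   (intro continuous_intros continuous_on_compose2[OF c(1)] continuous_on_compose2[OF c(2)]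
    continuous_on_compose2[OF c(3)]; auto)
 thus ?case using kav_cbox[OF 0(1) c(1)] by (simp add: fun_eq_iff)
next
 case (Suc n)
 have 1: "Ck 1 g" "Ck 1 ro" using Suc.prems Ck_mono[of "Suc n" _ 1] by auto
 show ?case
 proof (rule Ck_SucI[OF kav_deriv[OF Suc.prems(1) 1]])
  fix j
  have "Ck n (%x. kav ro k (pd j g) x +
     pd j ro x*(SU l. kav ro (%y. k y*y$l) (pd l g) x))"
   by (intro Ck_add Ck_mult Ck_sum Suc.IH Suc.prems ker_nth Ck_partial Ck_Suc_le[OF Suc.prems(3)])
  thus "Ck n (%x. (\<chi> j. kav ro k (pd j g) x +
     pd j ro x*(SU l. kav ro (%y. k y*y$l) (pd l g) x))$j)" by simp
 qed
qed

lemma kav_by_parts: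
 fixes g :: "real^'d => real" assumes k: "ker k" "Ck 1 k" and g: "Ck 1 g" shows "ro x*kav ro k (pd l g) x = - kav ro (pd l k) g x"
proof -
 let ?g = "%y. g (x+ro x*.y)"
 have g': "Ck (Suc 0) g" using g by (simp only: One_nat_def)
 have 1: "Ck 1 ?g" by (rule Ck_compose[OF g], simp only: vector_add_component vector_scaleR_component real_scaleR_def)
   (intro Ck_add Ck_const Ck_cmult Ck_nth)
 have 2: "pd l ?g = (%y. ro x*pd l g (x+ro x*.y))"
 proof
  fix y
  have "((%y. x+ro x*.y) has_derivative (%h. ro x*.h)) (at y)" by (auto intro!: derivative_eq_intros)
  from pd_eq[OF diff_chain_at[OF this Ck_deriv[OF g']], unfolded o_def]
  show "pd l ?g y = ro x*pd l g (x+ro x*.y)" by (simp add: inner_axis)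
 qed
 have "(LB y. k y*pd l ?g y) = - (LB y. pd l k y*?g y)" by (rule integral_by_parts[OF k(2) 1]) (use k ker_csupp in blast)
 moreover have "(LB y. k y*pd l ?g y) = (LB y. ro x*(k y*pd l g (x+ro x*.y)))" unfolding 2 by (simp add: mult_ac)
 ultimately show ?thesis unfolding kav_def by simp
qed

subsection \<open>The kernel\<close>

definition mass :: "'d::finite itself => real" where
 "mass _ = (LB y. pcut 3 (y :: real^'d))"

lemma mass_pos: "0 < mass TYPE('d::finite)"
proof -
 have "0 < 27/64*measure lborel (ball (0 :: real^'d) (1/2))" using content_ball_pos[of "1/2" "0 :: real^'d"] by simp
 also have "... = (LB y. 27/64*ind (ball (0 :: real^'d) (1/2)) y)" by simp
 also have "... <= mass TYPE('d)" unfolding mass_def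
 proof (rule integral_mono)
  show "integrable lborel (%y. 27/64*ind (ball (0 :: real^'d) (1/2)) y :: real)"
   by (intro integrable_mult_right integrable_real_indicator) (use emeasure_lborel_ball_finite in auto)
  show "integrable lborel (pcut 3 :: real^'d => real)" using ker_pcut[of 2] by (intro csupp_integrable ker_csupp) (auto simp: ker_def numeral_eq_Suc)
  fix y :: "real^'d"
  show "27/64*ind (ball 0 (1/2)) y <= pcut 3 y"
  proof (cases "y : ball 0 (1/2)")
   case True
   hence "(norm y)^2 <= (1/2)^2" by (intro power_mono) auto
   moreover have "(1/2 :: real)^2 = 1/4" by (simp add: power2_eq_square)
   moreover have "y<.>y = (norm y)^2" by (simp add: power2_norm_eq_inner)
   ultimately have "3/4 <= max 0 (1-y<.>y)" by linarith
   hence "(3/4)^3 <= pcut 3 y" unfolding pcut_def by (rule power_mono) simp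
   thus ?thesis using True by (simp add: power3_eq_cube)
  qed (simp add: pcut_nonneg)
 qed
 finally show ?thesis .
qed

definition theta :: "real^'d => real" where
 "theta y = pcut 3 y/mass TYPE('d)"

definition Theta :: "real^'d => real" where
 "Theta y = - pcut 4 y/(8*mass TYPE('d))"

lemma theta_alt: "theta = (%y :: real^'d. (1/mass TYPE('d))*pcut (Suc 2) y)" by (simp add: fun_eq_iff theta_def numeral_eq_Suc)

lemma Theta_alt: "Theta = (%y :: real^'d. (- 1/(8*mass TYPE('d)))*pcut (Suc 3) y)" by (simp add: fun_eq_iff Theta_def numeral_eq_Suc)

lemma ker_theta: "ker theta" and Ck_theta: "Ck 2 theta" and ker_Theta: "ker Theta" and Ck_Theta: "Ck 3 Theta"
 unfolding theta_alt Theta_alt by (intro ker_cmult ker_pcut Ck_cmult Ck_pcut)+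

lemma theta_nonneg: "0 <= theta y" by (simp add: theta_def pcut_nonneg less_imp_le[OF mass_pos])

lemma integral_theta: "(LB y. theta (y :: real^'d)) = 1" using mass_pos[where 'd='d] by (simp add: theta_def[abs_def] mass_def)

lemma pd_Theta: "pd l Theta = (%y :: real^'d. theta y*y$l)"
proof
 fix y :: "real^'d"
 have "Ck (Suc 0) (pcut (Suc 3) :: real^'d => real)" by (rule Ck_mono[OF Ck_pcut]) simp
 hence "pd l Theta y = (- 1/(8*mass TYPE('d)))*pd l (pcut (Suc 3)) y" unfolding Theta_alt by (intro pd_cmult Ck_diffable)
 also have "... = theta y*y$l" using mass_pos[where 'd='d] pd_pcut[of l 2 y] by (simp add: theta_def numeral_eq_Suc)
 finally show "pd l Theta y = theta y*y$l" .
qed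

section \<open>Korn's inequality\<close>

lemma korn_whole_space:
 fixes z :: "'d => real^'d => real" assumes z: "!!i. Ck 2 (z i)" and cz: "!!i. csupp (z i)" shows "(SU i. SU j. (LB x. (pd j (z i) x)^2))
  <= 2*(SU i. SU j. (LB x. ((pd j (z i) x+pd i (z j) x)/2)^2))"
proof -
 have z': "Ck (Suc (Suc 0)) (z i)" for i using z by (simp only: numeral_2_eq_2)
 have z1: "Ck 1 (z i)" for i by (rule Ck_mono[OF z]) simp
 have zd: "Ck 1 (pd j (z i))" for i j using Ck_partial[OF z'] by (simp only: One_nat_def)
 have cd: "csupp (pd j (z i))" for i j by (rule csupp_pd[OF cz])
 have c: "cont (pd j (z i))" for i j by (rule Ck_continuous[OF zd])
 have int: "integrable lborel (%x. pd j (z i) x*pd l (z m) x)" for i j l m by (intro csupp_integrable continuous_on_mult c csupp_mult1 cd)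
 have swap: "(LB x. pd j (z i) x*pd i (z j) x)
   = (LB x. pd i (z i) x*pd j (z j) x)" for i j
 proof -
  have "(LB x. pd j (z i) x*pd i (z j) x)
    = - (LB x. z i x*pd j (pd i (z j)) x)" using integral_by_parts[OF z1 zd, of i i j j] cz by simp
  also have "... = - (LB x. z i x*pd i (pd j (z j)) x)" by (simp add: pd_commute[OF z])
  also have "... = (LB x. pd i (z i) x*pd j (z j) x)" using integral_by_parts[OF z1 zd, of i j j i] cz by simp
  finally show ?thesis .
 qed
 have "(SU i. SU j. (LB x. pd i (z i) x*pd j (z j) x))
   = (LB x. (SU i. pd i (z i) x)^2)" using int by (simp add: power2_eq_square sum_product)
 hence nn: "0 <= (SU i. SU j. (LB x. pd i (z i) x*pd j (z j) x))" by simp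
 have "2*(SU i. SU j. (LB x. ((pd j (z i) x+pd i (z j) x)/2)^2))
  = (SU i. SU j. (1/2)*(LB x. (pd j (z i) x)^2)
    + (1/2)*(LB x. (pd i (z j) x)^2)
    + (LB x. pd j (z i) x*pd i (z j) x))"
 proof -
  have "(LB x. ((pd j (z i) x+pd i (z j) x)/2)^2)
   = (1/4)*(LB x. (pd j (z i) x)^2)
    + (1/4)*(LB x. (pd i (z j) x)^2)
    + (1/2)*(LB x. pd j (z i) x*pd i (z j) x)" for i j
  proof -
   have "(%x. ((pd j (z i) x+pd i (z j) x)/2)^2)
    = (%x. (1/4)*(pd j (z i) x*pd j (z i) x)+(1/4)*(pd i (z j) x*pd i (z j) x)
     + (1/2)*(pd j (z i) x*pd i (z j) x))" by (simp add: fun_eq_iff power2_eq_square field_simps)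
   thus ?thesis using int by (simp add: power2_eq_square)
  qed
  thus ?thesis by (simp add: sum_distrib_left distrib_left)
 qed
 also have "... = (SU i. SU j. (1/2)*(LB x. (pd j (z i) x)^2))
   + (SU i. SU j. (1/2)*(LB x. (pd i (z j) x)^2))
   + (SU i. SU j. (LB x. pd i (z i) x*pd j (z j) x))" by (simp add: sum.distrib swap)
 also have "(SU i. SU j. (1/2)*(LB x. (pd i (z j) x)^2))
   = (SU i. SU j. (1/2)*(LB x. (pd j (z i) x)^2))" by (rule sum.swap)
 finally show ?thesis using nn by (simp add: sum_divide_distrib[symmetric])
qed

subsection \<open>Averages and the \<open>L2\<close> norm\<close>

lemma nn_integral_affine:
 fixes f :: "'a::euclidean_space => ennreal" assumes [measurable]: "f : borel_measurable borel" and "c ~= 0"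
 shows "(NB x. f x) = ennreal (abs(c)^DIM('a))*(NB x. f (t+c*.x))" by (subst lborel_affine[OF \<open>c ~= 0\<close>, of t])
  (simp add: nn_integral_density nn_integral_distr nn_integral_cmult ennreal_power)

lemma integral_affine:
 fixes f :: "'a::euclidean_space => real" assumes [measurable]: "f : borel_measurable borel" and "c ~= 0"
 shows "(LB x. f x) = abs(c)^DIM('a)*(LB x. f (t+c*.x))"
proof -
 have "(LB x. f x) = (\<integral>x. f x \<partial>density (distr lborel borel (%x. t+c*.x)) (%_. ennreal (abs(c)^DIM('a))))"
  by (subst lborel_affine[OF \<open>c ~= 0\<close>, of t]) (simp add: ennreal_power)
 also have "... = abs(c)^DIM('a)*(LB x. f (t+c*.x))" by (subst integral_density) (simp_all add: integral_distr)
 finally show ?thesis .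
qed

definition avg_const :: "'a::euclidean_space itself => real" where
 "avg_const _ = unit_ball_vol (real DIM('a))*3^DIM('a)"

lemma avg_const_nonneg: "0 <= avg_const T" by (simp add: avg_const_def)

text \<open>
 The set of \<open>x\<close> with \<open>w \<in> cball x (ro x)\<close> lies in the ball of radius \<open>2 * ro w\<close> about \<open>w\<close>, and \<open>ro\<close> is
 comparable to \<open>ro w\<close> there; so Tonelli's theorem replaces a change of variables.
\<close>

lemma avg_bound:
 fixes ro :: "'a::euclidean_space => real" and G :: "'a => ennreal" assumes lip: "!!x y. abs(ro x-ro y) <= dist x y/2" and nn: "!!x. 0 <= ro x"
  and [measurable]: "ro : borel_measurable borel" "G : borel_measurable borel"
 shows "(NB x. ind {x. 0 < ro x} x*(NB y. ind (cball 0 1) y*G (x+ro x*.y)))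
  <= ennreal (avg_const TYPE('a))*(NB x. ind {x. 0 < ro x} x*G x)"
proof -
 let ?K = "%x w. (if 0 < ro x & dist x w <= ro x then ennreal (1/ro x^DIM('a)) else 0)"
 have inner: "ind {x. 0 < ro x} x*(NB y. ind (cball 0 1) y*G (x+ro x*.y))
   = (NB w. ?K x w*G w)" for x
 proof (cases "0 < ro x")
  case True
  have hm: "(%w. ind (cball x (ro x)) w*G w) : borel_measurable borel" by (intro borel_measurable_times_ennreal borel_measurable_indicator) auto
  have "(NB w. ind (cball x (ro x)) w*G w)
    = ennreal (abs(ro x)^DIM('a))*(NB y. ind (cball x (ro x)) (x+ro x*.y)*G (x+ro x*.y))" by (rule nn_integral_affine[OF hm]) (use True in auto)
  also have "(%y. ind (cball x (ro x)) (x+ro x*.y)*G (x+ro x*.y)) = (%y. ind (cball 0 1) y*G (x+ro x*.y))"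
   using True by (auto simp: fun_eq_iff indicator_def dist_norm)
  finally have "ennreal (1/ro x^DIM('a))*(NB w. ind (cball x (ro x)) w*G w)
    = (ennreal (1/ro x^DIM('a))*ennreal (ro x^DIM('a)))*(NB y. ind (cball 0 1) y*G (x+ro x*.y))" using True by (simp add: mult.assoc)
  also have "ennreal (1/ro x^DIM('a))*ennreal (ro x^DIM('a)) = 1"
   using True by (simp add: ennreal_mult[symmetric] ennreal_1[symmetric] del: ennreal_1)
  finally have "(NB y. ind (cball 0 1) y*G (x+ro x*.y))
    = (NB w. ennreal (1/ro x^DIM('a))*(ind (cball x (ro x)) w*G w))" by (simp add: nn_integral_cmult hm)
  also have "(%w. ennreal (1/ro x^DIM('a))*(ind (cball x (ro x)) w*G w)) = (%w. ?K x w*G w)" using True by (auto simp: fun_eq_iff indicator_def)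
  finally show ?thesis using True by simp
 qed simp
 have "(NB x. (NB w. ?K x w*G w)) = (NB w. (NB x. ?K x w*G w))" by (rule lborel_pair.Fubini'[symmetric]) measurable
 also have "... <= (NB w. ennreal (avg_const TYPE('a))*(ind {x. 0 < ro x} w*G w))"
 proof (rule nn_integral_mono)
  fix w
  have "?K x w*G w <= (if 0 < ro w then ennreal ((3/(2*ro w))^DIM('a))*G w else 0)*ind (cball w (2*ro w)) x" for x
  proof (cases "0 < ro x & dist x w <= ro x")
   case True
   have 1: "ro x <= 2*ro w" "2*ro w <= 3*ro x" using lip[of x w] True by linarith+
   hence w: "0 < ro w" "x : cball w (2*ro w)" using True by (auto simp: dist_commute)
   have "1/ro x <= 3/(2*ro w)" using 1 w True by (simp add: field_simps)
   hence "(1/ro x)^DIM('a) <= (3/(2*ro w))^DIM('a)" using True by (intro power_mono) auto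
   thus ?thesis using w True by (auto intro!: mult_right_mono ennreal_leI simp: power_one_over)
  qed auto
  hence "(NB x. ?K x w*G w) <= (NB x. (if 0 < ro w then ennreal ((3/(2*ro w))^DIM('a))*G w else 0)*ind (cball w (2*ro w)) x)"
   by (intro nn_integral_mono)
  also have "... = (if 0 < ro w then ennreal ((3/(2*ro w))^DIM('a))*G w else 0)*emeasure lborel (cball w (2*ro w))"
   by (rule nn_integral_cmult_indicator) auto
  also have "... = ennreal (avg_const TYPE('a))*(ind {x. 0 < ro x} w*G w)"
  proof (cases "0 < ro w")
   case True
   have "ennreal ((3/(2*ro w))^DIM('a))*emeasure lborel (cball w (2*ro w))
     = ennreal ((3/(2*ro w))^DIM('a)*(unit_ball_vol (real DIM('a))*(2*ro w)^DIM('a)))"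
    using True by (subst emeasure_cball) (simp_all add: ennreal_mult)
   also have "(3/(2*ro w))^DIM('a)*(unit_ball_vol (real DIM('a))*(2*ro w)^DIM('a)) = avg_const TYPE('a)"
    using True by (simp add: avg_const_def power_divide)
   finally show ?thesis using True by (simp add: mult_ac)
  qed simp
  finally show "(NB x. ?K x w*G w) <= ennreal (avg_const TYPE('a))*(ind {x. 0 < ro x} w*G w)" .
 qed
 also have "... = ennreal (avg_const TYPE('a))*(NB x. ind {x. 0 < ro x} x*G x)" by (rule nn_integral_cmult) measurable
 finally show ?thesis unfolding inner .
qed

subsection \<open>Regularised positive parts\<close>

definition sreg :: "real => real => real" where
 "sreg dl t = (max 0 t)^3*inverse (t^2+dl^2)"

definition sreg' :: "real => real => real" where
 "sreg' dl t = ((max 0 t)^4+3*(max 0 t)^2*dl^2)/(t^2+dl^2)^2"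

definition preg :: "real => real => real" where
 "preg dl t = (max 0 t)^5*(inverse (t^2+dl^2))^2"

definition preg' :: "real => real => real" where
 "preg' dl t = ((max 0 t)^6+5*(max 0 t)^4*dl^2)/(t^2+dl^2)^3"

context
 fixes dl :: real assumes dl: "0 < dl"
begin

lemma reg_pos: "0 < t\<^sup>2+dl^2" using dl by (simp add: add_nonneg_pos)

lemma DERIV_reg_inverse:
 "((%t. inverse (t^2+dl^2)) has_field_derivative-(2*t)*(inverse (t^2+dl^2))^2) (at t)"
 using reg_pos[of t] by (auto intro!: derivative_eq_intros simp: power2_eq_square)

lemma DERIV_sreg: "(sreg dl has_field_derivative sreg' dl t) (at t)"
proof -
 define q where "q = t^2+dl^2"
 define m where "m = max 0 t"
 have q: "q > 0" using reg_pos by (simp add: q_def)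
 have m: "m*t = m^2" by (simp add: m_def max_def power2_eq_square)
 have "(sreg dl has_field_derivative (3*m^2*inverse q + - (2*t)*(inverse q)^2*m^3)) (at t)" unfolding sreg_def[abs_def] q_def m_def
  using DERIV_mult[OF has_field_derivative_pos_power[of 1 t] DERIV_reg_inverse[of t]] by (simp add: numeral_eq_Suc)
 moreover have "3*m^2*inverse q + - (2*t)*(inverse q)^2*m^3 = (3*m^2*q-2*(m*t)*m^2)/q^2"
  using q by (simp add: field_simps power2_eq_square power3_eq_cube)
 moreover have "3*m^2*q = 3*(m*t)^2+3*m^2*dl^2" by (simp add: q_def algebra_simps power_mult_distrib)
 ultimately have D: "(sreg dl has_field_derivative (3*(m^2)^2+3*m^2*dl^2-2*m^2*m^2)/q^2) (at t)" unfolding m by simp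
 have "3*(m^2)^2+3*m^2*dl^2-2*m^2*m^2 = m^4+3*m^2*dl^2" by (simp add: power2_eq_square power4_eq_xxxx)
 from D[unfolded this] show ?thesis by (simp add: sreg'_def q_def m_def)
qed

lemma DERIV_preg: "(preg dl has_field_derivative preg' dl t) (at t)"
proof -
 define q where "q = t^2+dl^2"
 define m where "m = max 0 t"
 have q: "q > 0" using reg_pos by (simp add: q_def)
 have m: "m*t = m^2" by (simp add: m_def max_def power2_eq_square)
 have "((%t. (inverse (t^2+dl^2))^2) has_field_derivative 2*inverse q*(- (2*t)*(inverse q)^2)) (at t)"
  using DERIV_power[OF DERIV_reg_inverse[of t], of 2] by (simp add: q_def mult_ac)
 from DERIV_mult[OF has_field_derivative_pos_power[of 3 t] this]
 have "(preg dl has_field_derivative (5*m^4*(inverse q)^2+2*inverse q*(- (2*t)*(inverse q)^2)*m^5)) (at t)"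
  unfolding preg_def[abs_def] q_def m_def by (simp add: numeral_eq_Suc)
 moreover have "5*m^4*(inverse q)^2+2*inverse q*(- (2*t)*(inverse q)^2)*m^5 = (5*m^4*q-4*(m*t)*m^4)/q^3"
  using q by (simp add: field_simps eval_nat_numeral)
 moreover have "5*m^4*q = 5*(m*t)^2*m^2+5*m^4*dl^2" by (simp add: q_def algebra_simps power_mult_distrib eval_nat_numeral)
 ultimately have D: "(preg dl has_field_derivative (5*(m^2)^2*m^2+5*m^4*dl^2-4*m^2*m^4)/q^3) (at t)" unfolding m by simp
 have "5*(m^2)^2*m^2+5*m^4*dl^2-4*m^2*m^4 = m^6+5*m^4*dl^2" by (simp add: eval_nat_numeral)
 from D[unfolded this] show ?thesis by (simp add: preg'_def q_def m_def)
qed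

lemma sreg_nonneg: "0 <= sreg dl t" and preg_nonneg: "0 <= preg dl t" using reg_pos[of t] by (auto simp: sreg_def preg_def intro!: mult_nonneg_nonneg)

lemma sreg_pos_iff: "0 < sreg dl t \<longleftrightarrow> 0 < t" using reg_pos[of t] by (auto simp: sreg_def max_def zero_less_mult_iff)

lemma sreg'_nonpos: "t <= 0 ==> sreg' dl t = 0" by (simp add: sreg'_def)

lemma preg'_nonneg: "0 <= preg' dl t" using reg_pos[of t] by (simp add: preg'_def)

lemma sreg'_bounds: "0 <= sreg' dl t" "sreg' dl t <= 3"
proof -
 define m where "m = max 0 t"
 have "m^2 <= t^2" by (simp add: m_def max_def)
 hence "(m^2+dl^2)^2 <= (t^2+dl^2)^2" by (intro power_mono) auto
 moreover have "m^4+3*m^2*dl^2 <= 3*(m^2+dl^2)^2"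
 proof -
  have "3*(m^2+dl^2)^2 = 3*m^4+6*m^2*dl^2+3*(dl^2)^2" by (simp add: power2_eq_square power4_eq_xxxx algebra_simps)
  moreover have "0 <= m^4" "0 <= m^2*dl^2" "0 <= (dl^2)^2" by auto
  ultimately show ?thesis by linarith
 qed
 ultimately have "m^4+3*m^2*dl^2 <= 3*(t^2+dl^2)^2" by linarith
 thus "sreg' dl t <= 3" unfolding sreg'_def m_def[symmetric] using reg_pos[of t] by (subst pos_divide_le_eq) auto
 show "0 <= sreg' dl t" by (simp add: sreg'_def)
qed

lemma preg_le: "(preg dl t)^2 <= (sreg dl t)^2*preg' dl t"
proof -
 define q where "q = t^2+dl^2"
 define m where "m = max 0 t"
 have q: "q > 0" using reg_pos by (simp add: q_def)
 have mt: "m^2*t^2 = m^4" by (simp add: m_def max_def eval_nat_numeral)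
 have "m^4*q = (m^2*t^2)*m^2+m^4*dl^2" by (simp add: q_def algebra_simps eval_nat_numeral)
 also have "... <= m^6+5*m^4*dl^2"
 proof -
  have "m^4*m^2 = m^6" "0 <= m^4*dl^2" by (simp_all flip: power_add)
  thus ?thesis unfolding mt by linarith
 qed
 finally have "m^4*q/q^3 <= preg' dl t" unfolding preg'_def q_def[symmetric] m_def[symmetric] using q by (intro divide_right_mono) auto
 hence "(m^3*inverse q)^2*(m^4*q/q^3) <= (m^3*inverse q)^2*preg' dl t" by (intro mult_left_mono) auto
 moreover have "(m^3*inverse q)^2*(m^4*q/q^3) = (m^5*(inverse q)^2)^2" using q by (simp add: field_simps eval_nat_numeral)
 ultimately show ?thesis by (simp add: sreg_def preg_def m_def q_def)
qed

lemma preg'_ge: "dl <= t ==> 1/4 <= preg' dl t"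
proof -
 assume t: "dl <= t"
 define q where "q = t^2+dl^2"
 have q: "q > 0" using reg_pos by (simp add: q_def)
 have "dl^2 <= t^2" using t dl by (intro power_mono) auto
 hence "q <= 2*t^2" by (simp add: q_def)
 hence "q^2 <= (2*t^2)^2" using q by (intro power_mono) auto
 hence "q^2*q <= 4*t^4*q" using q by (intro mult_right_mono) (auto simp: eval_nat_numeral)
 also have "4*t^4*q <= 4*(t^6+5*t^4*dl^2)"
 proof -
  have "t^4*q = t^6+t^4*dl^2" by (simp add: q_def distrib_left flip: power_add)
  moreover have "0 <= t^4*dl^2" by simp
  ultimately have "t^4*q <= t^6+5*(t^4*dl^2)" by simp
  thus ?thesis by (simp add: mult.assoc)
 qed
 finally have "1/4*q^3 <= t^6+5*t^4*dl^2" by (simp add: eval_nat_numeral)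
 thus ?thesis using q t dl by (simp add: preg'_def q_def pos_le_divide_eq)
qed

end

locale korn_graph =
 fixes h :: "real^'d => real" and e :: "real^'d" and L dl B :: real and v :: "'d => real^'d => real"
 assumes h: "Ck 2 h" and hL: "!!x. norm (grad h x) <= L" and he: "!!x. grad h x<.>e = 1" and e: "norm e = 1" and dl: "0 < dl" and B0: "0 <= B"
  and B: "!!y :: real^'d. abs(theta y) <= B" "!!(y :: real^'d) l. abs(theta y*y$l) <= B"
   "!!(y :: real^'d) j. abs(pd j theta y) <= B"
   "!!(y :: real^'d) j l. abs(pd j (%y. theta y*y$l) y) <= B" and v: "!!i. Ck 2 (v i)" and cv: "!!i. csupp (v i)"
begin

definition "rho x = sreg dl (h x)*(1/(6*L))"
definition "E i j x = (1/2)*(pd j (v i) x+pd i (v j) x)"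
definition "S x = (SU i. SU j. abs(E i j x))"
definition "Nr x = (LB y. ind (cball 0 1) y*.S (x+rho x*.y))"
definition "J i j = kav rho theta (pd j (v i))"
definition "q i x = (SU l. kav rho (%y. theta y*y$l) (pd l (v i)) x)"
definition "vbar i = kav rho theta (v i)"
definition "z i x = v i x-vbar i x"
definition "D = real CARD('d)"

lemma D1: "1 <= D"
proof -
 have "0 < CARD('d)" by simp
 hence "1 <= CARD('d)" by linarith
 thus ?thesis unfolding D_def by simp
qed

lemma L1: "1 <= L" using norm_cauchy_schwarz[of "grad h 0" e] hL[of 0] he[of 0] e by simp

lemma h2: "Ck (Suc (Suc 0)) h" and v2: "Ck (Suc (Suc 0)) (v i)" using h v by (simp_all only: numeral_2_eq_2)

lemma v1: "Ck 1 (v i)" by (rule Ck_mono[OF v]) simp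

lemma dv1: "Ck 1 (pd j (v i))" using Ck_partial[OF v2] by (simp only: One_nat_def)

lemma dvc: "cont (pd j (v i))" by (rule Ck_continuous[OF dv1])

lemma has_derivative_rho:
 "(rho has_derivative (%k. ((sreg' dl (h x)*(1/(6*L)))*.grad h x)<.>k)) (at x)"
proof -
 have "((%t. sreg dl t*(1/(6*L))) has_field_derivative sreg' dl (h x)*(1/(6*L))) (at (h x))" by (rule DERIV_cmult_right[OF DERIV_sreg[OF dl]])
 from has_derivative_grad_compose[OF this Ck_deriv[OF h2]]
 show ?thesis unfolding rho_def[abs_def] .
qed

lemma grad_rho: "grad rho x = (sreg' dl (h x)*(1/(6*L)))*.grad h x" by (rule grad_eq[OF has_derivative_rho])

lemma Ck_denominator: "Ck 2 (%x. inverse ((h x)^2+dl^2))"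
proof (rule Ck_inverse)
 show "Ck 2 (%x. (h x)^2+dl^2)" by (intro Ck_add Ck_power h Ck_const)
 show "(h x)^2+dl^2 ~= 0" for x using reg_pos[OF dl, of "h x"] by linarith
qed

lemma Ck_rho: "Ck 2 rho"
proof -
 have "Ck 2 (%x. (max 0 (h x))^Suc 2*inverse ((h x)^2+dl^2)*(1/(6*L)))" by (intro Ck_mult Ck_pos_power h Ck_denominator Ck_const)
 moreover have "Suc 2 = 3" by simp
 ultimately show ?thesis unfolding rho_def[abs_def] sreg_def by (simp only:)
qed

lemma rho1: "Ck 1 rho" by (rule Ck_mono[OF Ck_rho]) simp

lemma rhoc: "cont rho" by (rule Ck_continuous[OF Ck_rho])

lemma rho_nonneg: "0 <= rho x" using L1 sreg_nonneg[OF dl] by (simp add: rho_def)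

lemma rho_pos_iff: "0 < rho x \<longleftrightarrow> 0 < h x" using L1 sreg_pos_iff[OF dl, of "h x"] by (simp add: rho_def zero_less_divide_iff)

lemma norm_grad_rho: "norm (grad rho x) <= 1/2"
proof -
 have "norm (grad rho x) = (sreg' dl (h x)*(1/(6*L)))*norm (grad h x)" using L1 sreg'_bounds(1)[OF dl, of "h x"] by (simp add: grad_rho)
 also have "... <= (3*(1/(6*L)))*L" using L1 sreg'_bounds[OF dl, of "h x"] hL by (intro mult_mono) auto
 also have "... = 1/2" using L1 by simp
 finally show ?thesis .
qed

lemma partial_rho: "abs(pd j rho x) <= 1/2" using component_le_norm_cart[of "grad rho x" j] norm_grad_rho[of x] by simp

lemma grad_rho_e: "abs(grad rho x<.>e) <= 1/2" using Cauchy_Schwarz_ineq2[of "grad rho x" e] norm_grad_rho[of x] e by simp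

lemma rho_lip: "abs(rho x-rho y) <= dist x y/2"
proof -
 have "norm (rho x-rho y) <= 1/2*norm (x-y)"
 proof (rule differentiable_bound[of UNIV])
  fix x
  show "(rho has_derivative (%k. grad rho x<.>k)) (at x within UNIV)" using has_derivative_rho[of x] by (simp add: grad_rho)
  have "norm (grad rho x<.>k) <= 1/2*norm k" for k
   by (rule order_trans[OF Cauchy_Schwarz_ineq2[folded real_norm_def] mult_right_mono[OF norm_grad_rho]]) simp
  thus "onorm (%k. grad rho x<.>k) <= 1/2" by (intro onorm_bound) auto
 qed auto
 thus ?thesis by (simp add: dist_norm)
qed

lemma kav_csupp: assumes "ker k" "csupp g" shows "csupp (kav rho k g)"
proof -
 obtain R where R: "!!x. R < norm x ==> g x = 0" using assms(2) unfolding csupp_def by blast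
 have "kav rho k g x = 0" if x: "2*(abs(R) + rho 0) < norm x" for x
 proof -
  have "k y*g (x+rho x*.y) = 0" for y
  proof (cases "1 < norm y")
   case False
   have "rho x <= rho 0+norm x/2" using rho_lip[of x 0] unfolding dist_norm diff_0_right by linarith
   moreover have "norm (rho x*.y) <= rho x" using False rho_nonneg by (simp add: mult_left_le)
   moreover have "norm x <= norm (x+rho x*.y)+norm (rho x*.y)" using norm_triangle_ineq4[of "x+rho x*.y" "rho x*.y"] by simp
   moreover have "R <= abs(R)" by simp
   moreover have "2*abs(R) + 2*rho 0 < norm x" using x by simp
   ultimately have "R < norm (x+rho x*.y)" by linarith
   thus ?thesis using R by simp
  qed (use assms(1) in \<open>simp add: ker_def\<close>)
  hence "(%y. k y*g (x+rho x*.y)) = (%_. 0)" by (rule ext)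
  thus ?thesis unfolding kav_def by (simp only: integral_zero)
 qed
 thus ?thesis by (rule csuppI)
qed

lemma E1: "Ck 1 (E i j)" unfolding E_def[abs_def] by (intro Ck_cmult Ck_add dv1)

lemma Ec: "cont (E i j)" by (rule Ck_continuous[OF E1])

lemma Sc: "cont S" unfolding S_def[abs_def] by (intro continuous_intros Ec)

lemma cS: "csupp S"
proof -
 have "csupp (%x. abs(E i j x))" for i j
 proof -
  have "csupp (%x. pd j (v i) x+pd i (v j) x)" by (intro csupp_add csupp_pd cv)
  thus ?thesis by (rule csupp_mono) (simp add: E_def)
 qed
 thus ?thesis unfolding S_def[abs_def] by (intro csupp_sum)
qed

lemma S_nonneg: "0 <= S x" unfolding S_def by (intro sum_nonneg) auto

lemma E_le_S: "abs(E i j x) <= S x"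
proof -
 have "abs(E i j x) <= (SU j. abs(E i j x))" by (rule member_le_sum) auto
 also have "... <= S x" unfolding S_def by (rule member_le_sum[of i]) (auto intro: sum_nonneg)
 finally show ?thesis .
qed

lemma Nr_integrable: "integrable lborel (%y. ind (cball 0 1) y*.S (x+r*.y))" by (rule borel_integrable_compact)
  (auto intro!: continuous_intros continuous_on_compose2[OF Sc])

lemma Nr_nonneg: "0 <= Nr x" unfolding Nr_def using S_nonneg by (intro integral_nonneg_AE AE_I2) auto

lemma kav_bound: assumes k: "ker k" "!!y. abs(k y) <= K" and g: "cont g" "!!x. abs(g x) <= S x" shows "abs(kav rho k g x) <= K*Nr x"
proof -
 have "abs(kav rho k g x) <= (LB y. abs(k y*g (x+rho x*.y)))" unfolding kav_def using integral_norm_bound[of lborel "%y. k y*g (x+rho x*.y)"] by simp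
 also have "... <= (LB y. K*(ind (cball 0 1) y*.S (x+rho x*.y)))"
 proof (rule integral_mono)
  show "integrable lborel (%y. abs(k y*g (x+rho x*.y)))" by (intro integrable_abs kav_integrable k g)
  show "integrable lborel (%y. K*(ind (cball 0 1) y*.S (x+rho x*.y)))" by (intro integrable_mult_right Nr_integrable)
  fix y
  show "abs(k y*g (x+rho x*.y)) <= K*(ind (cball 0 1) y*.S (x+rho x*.y))"
  proof (cases "1 < norm y")
   case True
   thus ?thesis using k(1) by (simp add: ker_def)
  next
   case False
   have "abs(k y)*abs(g (x+rho x*.y)) <= K*S (x+rho x*.y)" using k(2)[of y] g(2) by (intro mult_mono) auto
   thus ?thesis using False by (simp add: abs_mult)
  qed
 qed
 finally show ?thesis by (simp add: Nr_def)
qed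

lemma measurable_S [measurable]: "S : borel_measurable borel" and measurable_rho [measurable]: "rho : borel_measurable borel"
 using Sc rhoc by (auto intro: borel_measurable_continuous_onI)

lemma measurable_unit_cball [measurable]: "cball 0 1 : sets (borel :: (real^'d) measure)" by auto

lemma measurable_Nr [measurable]: "Nr : borel_measurable borel" unfolding Nr_def[abs_def]
proof (rule lborel.borel_measurable_lebesgue_integral)
 have "sets (borel \<Otimes>\<^sub>M lborel) = sets (borel \<Otimes>\<^sub>M borel :: ((real^'d) \<times> (real^'d)) measure)"
  by (rule sets_pair_measure_cong) auto
 moreover have "(%(x, y). ind (cball 0 1) y*.S (x+rho x*.y)) : borel_measurable (borel \<Otimes>\<^sub>M borel)" by measurable
 ultimately show "(%(x, y). ind (cball 0 1) y*.S (x+rho x*.y)) : borel_measurable (borel \<Otimes>\<^sub>M lborel)"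
  by (simp cong: measurable_cong_sets)
qed

definition "CN = unit_ball_vol D*avg_const TYPE(real^'d)"

lemma CN_nonneg: "0 <= CN" using avg_const_nonneg[of "TYPE(real^'d)"] D1 by (simp add: CN_def)

lemma Nr_sq_bound_nn:
 "(NB x. ind {x. 0 < h x} x*ennreal ((Nr x)^2))
  <= ennreal CN*(NB x. ind {x. 0 < h x} x*ennreal ((S x)^2))"
proof -
 let ?I = "ind (cball 0 1) :: real^'d => ennreal"
 let ?V = "ennreal (unit_ball_vol D)"
 have *: "ennreal ((Nr x)^2) <= ?V*(NB y. ?I y*ennreal ((S (x+rho x*.y))^2))" for x
 proof -
  have "ennreal (Nr x) = (NB y. ennreal (ind (cball 0 1) y*.S (x+rho x*.y)))" unfolding Nr_def using S_nonneg
   by (intro nn_integral_eq_integral[symmetric] Nr_integrable AE_I2) auto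
  also have "... = (NB y. ?I y*(?I y*ennreal (S (x+rho x*.y))))" by (intro nn_integral_cong) (auto simp: indicator_def)
  finally have "ennreal ((Nr x)^2) = (NB y. ?I y*(?I y*ennreal (S (x+rho x*.y))))^2" by (simp add: ennreal_power[symmetric] Nr_nonneg)
  also have "... <= (NB y. (?I y)^2)*(NB y. (?I y*ennreal (S (x+rho x*.y)))^2)" by (rule Cauchy_Schwarz_nn_integral) measurable
  also have "(%y. (?I y)^2) = ?I" by (auto simp: fun_eq_iff indicator_def)
  also have "(NB y. ?I y) = ?V" by (simp add: emeasure_cball D_def)
  also have "(%y. (?I y*ennreal (S (x+rho x*.y)))^2) = (%y. ?I y*ennreal ((S (x+rho x*.y))^2))"
   using S_nonneg by (auto simp: fun_eq_iff indicator_def ennreal_power)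
  finally show ?thesis .
 qed
 have "(NB x. ind {x. 0 < h x} x*ennreal ((Nr x)^2))
  <= (NB x. ind {x. 0 < rho x} x*(?V*(NB y. ?I y*ennreal ((S (x+rho x*.y))^2))))"
  unfolding rho_pos_iff by (intro nn_integral_mono mult_left_mono *) auto
 also have "... = ?V*(NB x. ind {x. 0 < rho x} x*(NB y. ?I y*ennreal ((S (x+rho x*.y))^2)))"
  by (subst nn_integral_cmult[symmetric]) (measurable, simp add: mult_ac)
 also have "... <= ?V*(ennreal (avg_const TYPE(real^'d))*(NB x. ind {x. 0 < rho x} x*ennreal ((S x)^2)))"
  by (intro mult_left_mono avg_bound rho_lip rho_nonneg) auto
 finally show ?thesis unfolding rho_pos_iff using D1 avg_const_nonneg[of "TYPE(real^'d)"] by (simp add: CN_def ennreal_mult mult.assoc)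
qed

lemma hm: "{x. 0 < h x} : sets borel" "{x. dl <= h x} : sets borel"
proof -
 have c: "cont h" by (rule Ck_continuous[OF h])
 have "open {x. 0 < h x}" using c by (intro open_Collect_less continuous_intros)
 thus "{x. 0 < h x} : sets borel" by (rule borel_open)
 have "closed {x. dl <= h x}" using c by (intro closed_Collect_le continuous_intros)
 thus "{x. dl <= h x} : sets borel" by (rule borel_closed)
qed

definition "IS = (LB x. ind {x. 0 < h x} x*(S x)^2)"
definition "IN = (LB x. ind {x. 0 < h x} x*(Nr x)^2)"

lemma ind_integrable: assumes "A : sets borel" "cont f" "csupp f" shows "integrable lborel (%x :: real^'d. ind A x*(f x :: real))"
 using integrable_mult_indicator[OF _ csupp_integrable[OF assms(2,3)], of A] assms(1) by simp

lemma IS_integrable: "integrable lborel (%x. ind {x. 0 < h x} x*(S x)^2)" by (rule ind_integrable[OF hm(1)])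
  (auto intro!: continuous_intros Sc csupp_mono[OF cS])

lemma IN_bound: "integrable lborel (%x. ind {x. 0 < h x} x*(Nr x)^2)" "IN <= CN*IS"
proof -
 note [measurable] = hm
 have eqS: "(NB x. ind {x. 0 < h x} x*ennreal ((S x)^2)) = ennreal IS"
  unfolding IS_def by (subst nn_integral_eq_integral[OF IS_integrable, symmetric]) (auto intro!: nn_integral_cong simp: indicator_def)
 have eqN: "(NB x. ind {x. 0 < h x} x*ennreal ((Nr x)^2))
   = (NB x. ennreal (ind {x. 0 < h x} x*(Nr x)^2))" by (auto intro!: nn_integral_cong simp: indicator_def)
 have b: "(NB x. ennreal (ind {x. 0 < h x} x*(Nr x)^2)) <= ennreal (CN*IS)"
  using Nr_sq_bound_nn CN_nonneg unfolding eqS eqN by (simp add: ennreal_mult')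
 show i: "integrable lborel (%x. ind {x. 0 < h x} x*(Nr x)^2)"
 proof (rule integrableI_nonneg)
  show "(NB x. ennreal (ind {x. 0 < h x} x*(Nr x)^2)) < \<infinity>" using b by (simp add: order_le_less_trans)
 qed auto
 have "0 <= IS" unfolding IS_def by (intro integral_nonneg_AE AE_I2) auto
 thus "IN <= CN*IS" using b CN_nonneg unfolding IN_def by (subst (asm) nn_integral_eq_integral[OF i]) auto
qed

lemma dd_identity:
 "pd l (pd j (v i)) x = pd l (E i j) x+pd j (E i l) x-pd i (E l j) x"
proof -
 have d: "pd b (v a) differentiable (at x)" for a b x using dv1[of b a] by simp
 have pE: "pd m (E a b) x = (1/2)*(pd m (pd b (v a)) x+pd m (pd a (v b)) x)" for m a b
  unfolding E_def[abs_def] using d by (simp add: pd_cmult pd_add del: times_divide_eq_left)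
 show ?thesis unfolding pE using pd_commute[OF v, of l i j x] pd_commute[OF v, of l j i x]
   pd_commute[OF v, of i j l x] by (simp add: field_simps)
qed

lemma kav_dd_bound: assumes k: "ker k" "Ck 1 k" "!!m y. abs(pd m k y) <= K" shows "abs(rho x*kav rho k (pd l (pd j (v i))) x) <= 3*K*Nr x"
proof -
 have Ed: "cont (pd m (E a b))" for m a b using E1[of a b] by simp
 have "(%x. pd l (pd j (v i)) x)
   = (%x. (pd l (E i j) x+pd j (E i l) x)-pd i (E l j) x)" by (rule ext, rule dd_identity)
 hence "kav rho k (pd l (pd j (v i))) x
   = kav rho k (pd l (E i j)) x+kav rho k (pd j (E i l)) x-kav rho k (pd i (E l j)) x"
  using kav_diff[OF k(1), of "%x. pd l (E i j) x+pd j (E i l) x" "pd i (E l j)" rho x]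
   kav_add[OF k(1) Ed Ed, of rho l i j j i l x] Ed by (simp add: continuous_on_add)
 hence "rho x*kav rho k (pd l (pd j (v i))) x
   = - kav rho (pd l k) (E i j) x-kav rho (pd j k) (E i l) x+kav rho (pd i k) (E l j) x"
  using kav_by_parts[OF k(1,2) E1, of rho x] by (simp add: distrib_left right_diff_distrib)
 moreover have kb: "abs(kav rho (pd m k) (E a b) x) <= K*Nr x" for m a b by (rule kav_bound[OF ker_partial[OF k(1,2)] k(3) Ec E_le_S])
 ultimately have "abs(rho x*kav rho k (pd l (pd j (v i))) x) <= 3*(K*Nr x)" using kb[of l i j] kb[of j i l] kb[of i l j] by linarith
 thus ?thesis by (simp add: mult.assoc)
qed

lemma theta1: "Ck 1 (theta :: real^'d => real)" by (rule Ck_mono[OF Ck_theta]) simp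

lemma ker_theta_nth: "ker (%y :: real^'d. theta y*y$l)" by (rule ker_nth[OF ker_theta])

lemma theta_nth1: "Ck 1 (%y :: real^'d. theta y*y$l)" by (intro Ck_mult theta1 Ck_nth)

lemma q_bound: "abs(q i x) <= 3*D*B*Nr x"
proof -
 have Th: "Ck 1 (Theta :: real^'d => real)" by (rule Ck_mono[OF Ck_Theta]) simp
 note bp = kav_by_parts[OF ker_Theta Th dv1, of rho x, unfolded pd_Theta]
 have swap: "kav rho (%y. theta y*y$l) (pd i (v l)) x = kav rho (%y. theta y*y$i) (E l l) x" for l
 proof -
  have "kav rho (%y. theta y*y$l) (pd i (v l)) x = - (rho x*kav rho Theta (pd l (pd i (v l))) x)" using bp[of l i l] by simp
  also have "pd l (pd i (v l)) = pd i (pd l (v l))" using pd_commute[OF v] by (simp add: fun_eq_iff)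
  also have "- (rho x*kav rho Theta (pd i (pd l (v l))) x) = kav rho (%y. theta y*y$i) (pd l (v l)) x" using bp[of i l l] by simp
  also have "pd l (v l) = E l l" by (simp add: E_def fun_eq_iff)
  finally show ?thesis .
 qed
 have eq: "kav rho (%y. theta y*y$l) (pd l (v i)) x
   = 2*kav rho (%y. theta y*y$l) (E i l) x-kav rho (%y. theta y*y$i) (E l l) x" for l
 proof -
  have "pd l (v i) = (%x. 2*E i l x-pd i (v l) x)" by (simp add: E_def fun_eq_iff field_simps)
  hence "kav rho (%y. theta y*y$l) (pd l (v i)) x
   = kav rho (%y. theta y*y$l) (%x. 2*E i l x) x-kav rho (%y. theta y*y$l) (pd i (v l)) x"
   using kav_diff[OF ker_theta_nth continuous_on_mult_left[OF Ec] dvc] by metis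
  thus ?thesis by (simp add: kav_cmult swap)
 qed
 moreover have kb: "abs(kav rho (%y. theta y*y$m) (E a b) x) <= B*Nr x" for m a b by (rule kav_bound[OF ker_theta_nth B(2) Ec E_le_S])
 ultimately have "abs(kav rho (%y. theta y*y$l) (pd l (v i)) x) <= 3*(B*Nr x)" for l using kb[of l i l] kb[of i l l] eq[of l] by linarith
 hence "abs(q i x) <= (\<Sum>l\<in>(UNIV :: 'd set). 3*(B*Nr x))" unfolding q_def by (intro order_trans[OF sum_abs] sum_mono)
 thus ?thesis by (simp add: D_def mult_ac)
qed

lemma J1: "Ck 1 (J i j)" unfolding J_def by (rule kav_Ck[OF ker_theta dv1 rho1])

lemma cJ: "csupp (J i j)" unfolding J_def by (intro kav_csupp ker_theta csupp_pd cv)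

lemma J_e_bound: "abs(rho x*(grad (J i j) x<.>e)) <= 9/2*D*B*Nr x"
proof -
 let ?a = "%l. kav rho theta (pd l (pd j (v i))) x"
 let ?b = "%l. kav rho (%y. theta y*y$l) (pd l (pd j (v i))) x"
 let ?p = "grad rho x<.>e"
 have "grad (J i j) x = (\<chi> m. ?a m+pd m rho x*(SU l. ?b l))" unfolding J_def by (rule grad_eq[OF kav_deriv[OF ker_theta dv1 rho1]])
 moreover define bs where "bs = (SU l. ?b l)"
 ultimately have "grad (J i j) x<.>e = (SU m. (?a m+pd m rho x*bs)*e$m)" by (simp add: inner_vec_def)
 also have "... = (SU m. ?a m*e$m) + ?p*bs" by (simp only: distrib_right sum.distrib) (simp add: inner_vec_def sum_distrib_left mult_ac)
 also have "bs = (SU l. ?b l)" by (rule bs_def)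
 also have "(SU m. ?a m*e$m) + ?p*(SU l. ?b l) = (SU m. ?a m*e$m + ?p*?b m)" by (simp add: sum.distrib sum_distrib_left)
 finally have eq: "rho x*(grad (J i j) x<.>e) = (SU m. (rho x*?a m)*e$m + ?p*(rho x*?b m))" by (simp add: sum_distrib_left algebra_simps)
 have "abs(SU m. (rho x*?a m)*e$m + ?p*(rho x*?b m)) <= (\<Sum>m\<in>(UNIV :: 'd set). 3*B*Nr x+1/2*(3*B*Nr x))"
 proof (intro order_trans[OF sum_abs] sum_mono)
  fix m :: 'd
  have "abs(e$m) <= 1" using component_le_norm_cart[of e m] e by simp
  moreover have "abs(rho x*?a m) <= 3*B*Nr x" by (rule kav_dd_bound[OF ker_theta theta1 B(3)])
  moreover have "0 <= 3*B*Nr x" using B0 Nr_nonneg by simp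
  ultimately have 1: "abs((rho x*?a m)*e$m) <= (3*B*Nr x)*1" unfolding abs_mult[of "rho x*?a m"] by (intro mult_mono) auto
  have 2: "abs(?p*(rho x*?b m)) <= 1/2*(3*B*Nr x)"
   unfolding abs_mult[of ?p] by (intro mult_mono grad_rho_e kav_dd_bound[OF ker_theta_nth theta_nth1 B(4)]) auto
  show "abs((rho x*?a m)*e$m + ?p*(rho x*?b m)) <= 3*B*Nr x+1/2*(3*B*Nr x)"
   using 1 2 abs_triangle_ineq[of "(rho x*?a m)*e$m" "?p*(rho x*?b m)"] by linarith
 qed
 also have "... = D*(3*B*Nr x+1/2*(3*B*Nr x))" by (simp only: sum_constant D_def)
 also have "... = 9/2*D*B*Nr x" by algebra
 finally show ?thesis unfolding eq .
qed

lemma Ck_vbar: "Ck 2 (vbar i)" unfolding vbar_def by (rule kav_Ck[OF ker_theta v Ck_rho])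

lemma partial_vbar: "pd j (vbar i) x = J i j x+pd j rho x*q i x" using grad_eq[OF kav_deriv[OF ker_theta v1 rho1], of i x]
 by (metis (no_types, lifting) J_def grad_nth q_def vbar_def vec_lambda_beta)

lemma Ck_z: "Ck 2 (z i)" unfolding z_def[abs_def] by (intro Ck_diff v Ck_vbar)

lemma cz: "csupp (z i)" unfolding z_def[abs_def] vbar_def by (intro csupp_diff cv kav_csupp ker_theta)

lemma partial_z: "pd j (z i) x = pd j (v i) x-(J i j x+pd j rho x*q i x)"
proof -
 have "pd j (z i) x = pd j (v i) x-pd j (vbar i) x" unfolding z_def[abs_def]
  by (rule pd_diff; rule Ck_diffable[of 1]; rule Ck_mono[OF v] Ck_mono[OF Ck_vbar]; simp)
 thus ?thesis by (simp add: partial_vbar)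
qed

lemma partial_z_out: "h x <= 0 ==> pd j (z i) x = 0"
proof -
 assume x: "h x <= 0"
 hence r: "rho x = 0" using rho_pos_iff[of x] rho_nonneg[of x] by linarith
 have "grad rho x = 0" using sreg'_nonpos[OF dl x] by (simp add: grad_rho)
 hence "pd j rho x = 0" by (metis grad_nth zero_index)
 moreover have "J i j x = pd j (v i) x" using r integral_theta[where 'd='d] by (simp add: J_def kav_def)
 ultimately show ?thesis by (simp add: partial_z)
qed

lemma strain_z: "abs((pd j (z i) x+pd i (z j) x)/2) <= ind {x. 0 < h x} x*(S x+4*D*B*Nr x)"
proof (cases "0 < h x")
 case False
 thus ?thesis by (simp add: partial_z_out)
next
 case True
 have "kav rho theta (E i j) x = (1/2)*(J i j x+J j i x)" unfolding E_def[abs_def] kav_cmult J_def by (subst kav_add[OF ker_theta dvc dvc]) simp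
 hence "(pd j (z i) x+pd i (z j) x)/2
  = E i j x-kav rho theta (E i j) x-(pd j rho x*q i x+pd i rho x*q j x)/2" unfolding partial_z E_def by (simp add: field_simps)
 moreover define P where "P i j = pd j rho x*q i x" for i j
 ultimately have eq: "(pd j (z i) x+pd i (z j) x)/2
  = E i j x-kav rho theta (E i j) x-(P i j+P j i)/2" by simp
 define M where "M = D*(B*Nr x)"
 have kb: "abs(kav rho theta (E i j) x) <= B*Nr x" by (rule kav_bound[OF ker_theta B(1) Ec E_le_S])
 have pq: "abs(P i j) <= 1/2*(3*M)" for i j
 proof -
  have "abs(P i j) <= 1/2*(3*D*B*Nr x)" unfolding P_def abs_mult by (intro mult_mono partial_rho q_bound) auto
  thus ?thesis by (simp add: M_def mult.assoc)
 qed
 have BN: "0 <= B*Nr x" using B0 Nr_nonneg[of x] by simp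
 have M1: "1*(B*Nr x) <= M" unfolding M_def by (rule mult_right_mono[OF D1 BN])
 have "abs(a-k-(p+p')/2) <= s+4*m"
  if "abs(a) <= s" "abs(k) <= n" "abs(p) <= 1/2*(3*m)" "abs(p') <= 1/2*(3*m)" "0 <= n" "1*n <= m" for a k p p' s n m :: real
 proof -
  have "abs((p+p')/2) <= 1/2*(3*m)" using that(3,4) by (auto simp: abs_le_iff)
  moreover have "abs(a-k-(p+p')/2) <= abs(a) + abs(k) + abs((p+p')/2)" by linarith
  ultimately show ?thesis using that(1,2,5,6) by linarith
 qed
 from this[OF E_le_S kb pq pq BN M1]
 have "abs((pd j (z i) x+pd i (z j) x)/2) <= S x+4*M" unfolding eq .
 thus ?thesis using True by (simp add: mult.assoc M_def)
qed

end

lemma integral_grad_dir_0: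
 fixes F :: "real^'d => real" assumes F: "Ck 1 F" "csupp F" shows "integrable lborel (%x. grad F x<.>e)" "(LB x. grad F x<.>e) = 0"
proof -
 have c: "cont (pd i F)" for i using F(1) by auto
 have i: "integrable lborel (pd i F)" for i by (intro csupp_integrable c csupp_pd F)
 have eq: "(%x. grad F x<.>e) = (%x. SU i. pd i F x*e$i)" by (simp add: inner_vec_def)
 show "integrable lborel (%x. grad F x<.>e)" unfolding eq using i by simp
 show "(LB x. grad F x<.>e) = 0" unfolding eq using i by (simp add: integral_pd_0[OF F])
qed

context korn_graph
begin

definition "C2 = 27*D*B*L"

lemma preg_has_derivative:
 "((%x. preg dl (h x)) has_derivative (%k. (preg' dl (h x)*.grad h x)<.>k)) (at x)"
 by (rule has_derivative_grad_compose[OF DERIV_preg[OF dl] Ck_deriv[OF h2]])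

lemma Ck_preg: "Ck 1 (%x. preg dl (h x))"
proof -
 have h1: "Ck 1 h" by (rule Ck_mono[OF h]) simp
 have a: "Ck 1 (%x. (max 0 (h x))^Suc 1)" by (rule Ck_pos_power[OF h1])
 have b: "Ck 1 (%x. (max 0 (h x))^Suc 2)" by (rule Ck_mono[OF Ck_pos_power[OF h]]) simp
 have c: "Ck 1 (%x. inverse ((h x)^2+dl^2))" by (rule Ck_mono[OF Ck_denominator]) simp
 have "Ck 1 (%x. (max 0 (h x))^Suc 1*(max 0 (h x))^Suc 2*(inverse ((h x)^2+dl^2))^2)" by (rule Ck_mult[OF Ck_mult[OF a b] Ck_power[OF c]])
 moreover have "(%x. (max 0 (h x))^Suc 1*(max 0 (h x))^Suc 2*(inverse ((h x)^2+dl^2))^2) = (%x. preg dl (h x))"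
  by (simp add: preg_def fun_eq_iff eval_nat_numeral)
 ultimately show ?thesis by simp
qed

lemma Jc: "cont (J i j)" by (rule Ck_continuous[OF J1])

lemma hardy:
 "integrable lborel (%x. preg' dl (h x)*(J i j x)^2)"
 "(LB x. preg' dl (h x)*(J i j x)^2) <= 4*C2^2*IN"
proof -
 let ?J = "J i j"
 let ?g = "%x. grad ?J x<.>e"
 let ?F = "%x. preg dl (h x)*(?J x*?J x)"
 have F: "Ck 1 ?F" "csupp ?F" by (intro Ck_mult Ck_preg J1) (intro csupp_mult2 cJ)
 have J': "Ck (Suc 0) ?J" using J1 by (simp only: One_nat_def)
 have gF: "grad ?F x = preg dl (h x)*.((2*?J x)*.grad ?J x)+(?J x*?J x)*.(preg' dl (h x)*.grad h x)" for x
 proof (rule grad_eq)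
  show "(?F has_derivative (%k. (preg dl (h x)*.((2*?J x)*.grad ?J x)+(?J x*?J x)*.(preg' dl (h x)*.grad h x))<.>k)) (at x)"
   by (rule has_derivative_eq_rhs[OF has_derivative_mult[OF preg_has_derivative has_derivative_mult[OF Ck_deriv[OF J'] Ck_deriv[OF J']]]])
    (simp add: fun_eq_iff inner_add_left algebra_simps)
 qed
 have gFe: "grad ?F x<.>e = 2*(preg dl (h x)*?J x*?g x)+preg' dl (h x)*(?J x)^2" for x
  unfolding gF using he[of x] by (simp add: inner_add_left power2_eq_square)
 have gJc: "cont (%x. ?g x)" by (intro continuous_intros continuous_grad[OF J'])
 have i1: "integrable lborel (%x. 2*(preg dl (h x)*?J x*?g x))"
  by (intro integrable_mult_right csupp_integrable continuous_on_mult gJc Jc Ck_continuous[OF Ck_preg] csupp_mult1 csupp_mult2 cJ)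
 have "integrable lborel (%x. grad ?F x<.>e-2*(preg dl (h x)*?J x*?g x))" by (intro Bochner_Integration.integrable_diff integral_grad_dir_0 F i1)
 thus i2: "integrable lborel (%x. preg' dl (h x)*(?J x)^2)" unfolding gFe by simp
 have "0 = (LB x. 2*(preg dl (h x)*?J x*?g x))+(LB x. preg' dl (h x)*(?J x)^2)" using integral_grad_dir_0(2)[OF F, of e] i1 i2 unfolding gFe by simp
 hence "(LB x. preg' dl (h x)*(?J x)^2) = (LB x. - (2*(preg dl (h x)*?J x*?g x)))" by simp
 also have "... <= (LB x. 1/2*(preg' dl (h x)*(?J x)^2)+2*C2^2*(ind {x. 0 < h x} x*(Nr x)^2))"
 proof (rule integral_mono)
  fix x
  let ?p = "preg dl (h x)" and ?P = "preg' dl (h x)" and ?s = "sreg dl (h x)"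
  have P0: "0 <= ?P" by (rule preg'_nonneg[OF dl])
  show "- (2*(?p*?J x*?g x)) <= 1/2*(?P*(?J x)^2)+2*C2^2*(ind {x. 0 < h x} x*(Nr x)^2)"
  proof (cases "0 < h x")
   case False
   hence "?p = 0" by (simp add: preg_def max_def)
   thus ?thesis using P0 False by simp
  next
   case True
   have "?s*?g x = 6*L*(rho x*?g x)" using L1 by (simp add: rho_def)
   hence "abs(?s*?g x) = abs(6*L*(rho x*?g x))" by (rule arg_cong)
   also have "... = 6*L*abs(rho x*?g x)" using L1 by (simp add: abs_mult)
   also have "... <= 6*L*(9/2*D*B*Nr x)" using L1 J_e_bound by (intro mult_left_mono) auto
   also have "... = C2*Nr x" by (simp add: C2_def)
   finally have s: "abs(?s*?g x) <= C2*Nr x" .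
   define a where "a = sqrt ?P*abs(?J x)"
   define b where "b = C2*Nr x"
   have "(?p*?g x)^2 = ?p\<^sup>2*(?g x)^2" by (simp add: power_mult_distrib)
   also have "... <= (?s\<^sup>2*?P)*(?g x)^2" by (intro mult_right_mono preg_le[OF dl]) auto
   also have "... = ?P*\<bar>?s*?g x\<bar>\<^sup>2" by (simp add: power_mult_distrib mult_ac)
   also have "... <= ?P*b^2" unfolding b_def by (intro mult_left_mono power_mono s P0) auto
   finally have "abs(?p*?g x) <= sqrt (?P*b^2)" by (intro real_le_rsqrt) simp
   also have "... = sqrt ?P*b" using s by (simp add: real_sqrt_mult b_def)
   finally have "abs(?J x)*abs(?p*?g x) <= abs(?J x)*(sqrt ?P*b)" by (intro mult_left_mono) auto
   hence "abs(?p*?J x*?g x) <= a*b" by (simp add: a_def abs_mult mult_ac)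
   moreover have "2*(a*b) <= 1/2*a^2+2*b^2" using zero_le_power2[of "a-2*b"] by (simp add: power2_diff power_mult_distrib)
   moreover have "a^2 = ?P*(?J x)^2" using P0 by (simp add: a_def power_mult_distrib)
   moreover have "b^2 = C2^2*(Nr x)^2" by (simp add: b_def power_mult_distrib)
   ultimately have "- (2*(?p*?J x*?g x)) <= 1/2*(?P*(?J x)^2)+2*(C2^2*(Nr x)^2)" by linarith
   thus ?thesis using True by simp
  qed
 qed (use i1 i2 IN_bound(1) in \<open>simp_all del: integrable_mult_right_iff\<close>)
 also have "... = 1/2*(LB x. preg' dl (h x)*(?J x)^2)+2*C2^2*IN" using i2 IN_bound(1) by (simp add: IN_def)
 finally show "(LB x. preg' dl (h x)*(?J x)^2) <= 4*C2^2*IN" by simp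
qed

lemma strain_z_int:
 "(LB x. ((pd j (z i) x+pd i (z j) x)/2)^2) <= 2*IS+32*D^2*B^2*IN"
proof -
 have z2: "Ck (Suc (Suc 0)) (z i)" for i using Ck_z by (simp only: numeral_2_eq_2)
 have zc: "cont (pd j (z i))" for i j by (rule Ck_continuous[OF Ck_partial[OF z2]])
 have "(LB x. ((pd j (z i) x+pd i (z j) x)/2)^2)
  <= (LB x. 2*(ind {x. 0 < h x} x*(S x)^2)+32*D^2*B^2*(ind {x. 0 < h x} x*(Nr x)^2))"
 proof (rule integral_mono)
  have "csupp (%x. (pd j (z i) x+pd i (z j) x)*((pd j (z i) x+pd i (z j) x)*(1/4)))" by (intro csupp_mult1 csupp_add csupp_pd cz)
  thus "integrable lborel (%x. ((pd j (z i) x+pd i (z j) x)/2)^2)" by (intro csupp_integrable continuous_intros zc) (auto elim!: csupp_mono)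
  show "integrable lborel (%x. 2*(ind {x. 0 < h x} x*(S x)^2)+32*D^2*B^2*(ind {x. 0 < h x} x*(Nr x)^2))"
   by (intro Bochner_Integration.integrable_add integrable_mult_right IS_integrable IN_bound)
  fix x
  let ?m = "4*D*B*Nr x"
  have "((pd j (z i) x+pd i (z j) x)/2)^2 <= (ind {x. 0 < h x} x*(S x + ?m))^2" using strain_z[of j i x] by (metis abs_ge_zero power2_abs power_mono)
  also have "... = ind {x. 0 < h x} x*(S x + ?m)^2" by (simp add: indicator_def)
  also have "... <= ind {x. 0 < h x} x*(2*(S x)^2+2*?m\<^sup>2)"
   using zero_le_power2[of "S x - ?m"] by (intro mult_left_mono) (simp_all add: power2_sum power2_diff)
  also have "... = 2*(ind {x. 0 < h x} x*(S x)^2)+32*D^2*B^2*(ind {x. 0 < h x} x*(Nr x)^2)" by (simp add: power_mult_distrib algebra_simps)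
  finally show "((pd j (z i) x+pd i (z j) x)/2)^2
   <= 2*(ind {x. 0 < h x} x*(S x)^2)+32*D^2*B^2*(ind {x. 0 < h x} x*(Nr x)^2)" .
 qed
 also have "... = 2*IS+32*D^2*B^2*IN" using IS_integrable IN_bound(1) by (simp add: IS_def IN_def)
 finally show ?thesis .
qed

lemma dv_int:
 "(LB x. ind {x. dl <= h x} x*(pd j (v i) x)^2)
  <= 3*(LB x. (pd j (z i) x)^2)+(48*C2^2+27/4*D^2*B^2)*IN"
proof -
 have z2: "Ck (Suc (Suc 0)) (z i)" for i using Ck_z by (simp only: numeral_2_eq_2)
 have zc: "cont (pd j (z i))" for i j by (rule Ck_continuous[OF Ck_partial[OF z2]])
 have zi: "integrable lborel (%x. (pd j (z i) x)^2)" by (rule csupp_integrable) (auto intro!: continuous_intros zc csupp_mono[OF csupp_pd[OF cz]])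
 have "(LB x. ind {x. dl <= h x} x*(pd j (v i) x)^2)
  <= (LB x. 3*(pd j (z i) x)^2+12*(preg' dl (h x)*(J i j x)^2)
   + 27/4*D^2*B^2*(ind {x. 0 < h x} x*(Nr x)^2))"
 proof (rule integral_mono)
  show "integrable lborel (%x. ind {x. dl <= h x} x*(pd j (v i) x)^2)"
   by (rule ind_integrable[OF hm(2)]) (auto intro!: continuous_intros dvc csupp_mono[OF csupp_pd[OF cv]])
  show "integrable lborel (%x. 3*(pd j (z i) x)^2+12*(preg' dl (h x)*(J i j x)^2)
   + 27/4*D^2*B^2*(ind {x. 0 < h x} x*(Nr x)^2))" by (intro Bochner_Integration.integrable_add integrable_mult_right zi hardy IN_bound)
  fix x
  let ?a = "pd j (z i) x" and ?c = "pd j rho x*q i x"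
  show "ind {x. dl <= h x} x*(pd j (v i) x)^2
   <= 3*?a\<^sup>2+12*(preg' dl (h x)*(J i j x)^2)+27/4*D^2*B^2*(ind {x. 0 < h x} x*(Nr x)^2)"
  proof (cases "dl <= h x")
   case False
   thus ?thesis using preg'_nonneg[OF dl, of "h x"] by simp
  next
   case True
   have "pd j (v i) x = ?a+J i j x + ?c" by (simp add: partial_z)
   moreover have "(a+b+c)^2 <= 3*a^2+3*b^2+3*c^2" for a b c :: real using zero_le_power2[of "a-b"] zero_le_power2[of "b-c"] zero_le_power2[of "a-c"]
    by (simp add: power2_eq_square algebra_simps)
   ultimately have "(pd j (v i) x)^2 <= 3*?a\<^sup>2+3*(J i j x)^2+3*?c\<^sup>2" by metis
   moreover have "1/4*(J i j x)^2 <= preg' dl (h x)*(J i j x)^2" by (intro mult_right_mono preg'_ge[OF dl True]) auto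
   moreover have "?c\<^sup>2 <= 9/4*D^2*B^2*(Nr x)^2"
   proof -
    have "abs(?c) <= 1/2*(3*D*B*Nr x)" unfolding abs_mult by (intro mult_mono partial_rho q_bound) auto
    hence "\<bar>?c\<bar>\<^sup>2 <= (1/2*(3*D*B*Nr x))^2" by (intro power_mono) auto
    thus ?thesis by (simp add: power_mult_distrib power_divide)
   qed
   moreover have "0 < h x" using True dl by linarith
   ultimately show ?thesis using True by simp
  qed
 qed
 also have "... = 3*(LB x. (pd j (z i) x)^2)+12*(LB x. preg' dl (h x)*(J i j x)^2)
   + 27/4*D^2*B^2*IN" using zi hardy(1) IN_bound(1) by (simp add: IN_def)
 also have "... <= 3*(LB x. (pd j (z i) x)^2)+(48*C2^2+27/4*D^2*B^2)*IN" using hardy(2)[of i j] by (simp add: algebra_simps)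
 finally show ?thesis .
qed

lemma korn_smooth_graph:
 "(SU i. SU j. (LB x. ind {x. dl <= h x} x*(pd j (v i) x)^2))
  <= (D^2*(12+(192*D^2*B^2+(48*C2^2+27/4*D^2*B^2))*CN))*IS"
proof -
 let ?c = "48*C2^2+27/4*D^2*B^2"
 have DD: "(\<Sum>i\<in>(UNIV::'d set). \<Sum>j\<in>(UNIV::'d set). c) = D^2*c" for c :: real by (simp add: D_def power2_eq_square)
 have "(SU i. SU j. (LB x. ind {x. dl <= h x} x*(pd j (v i) x)^2))
  <= (SU i. SU j. 3*(LB x. (pd j (z i) x)^2) + ?c*IN)" by (intro sum_mono dv_int)
 also have "... = 3*(SU i. SU j. (LB x. (pd j (z i) x)^2))+D^2*(?c*IN)" by (simp only: sum.distrib DD sum_distrib_left)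
 also have "... <= 3*(2*(D^2*(2*IS+32*D^2*B^2*IN)))+D^2*(?c*IN)"
 proof (intro add_right_mono mult_left_mono)
  have "(SU i. SU j. (LB x. (pd j (z i) x)^2))
   <= 2*(SU i. SU j. (LB x. ((pd j (z i) x+pd i (z j) x)/2)^2))" by (rule korn_whole_space[OF Ck_z cz])
  also have "... <= 2*(\<Sum>i\<in>(UNIV::'d set). \<Sum>j\<in>(UNIV::'d set). 2*IS+32*D^2*B^2*IN)"
   by (intro mult_left_mono sum_mono strain_z_int) auto
  finally show "(SU i. SU j. (LB x. (pd j (z i) x)^2))
    <= 2*(D^2*(2*IS+32*D^2*B^2*IN))" unfolding DD .
 qed simp
 also have "... = D^2*(12*IS+(192*D^2*B^2 + ?c)*IN)" by (simp add: algebra_simps)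
 also have "... <= D^2*(12*IS+(192*D^2*B^2 + ?c)*(CN*IS))" by (intro mult_left_mono add_left_mono IN_bound) auto
 also have "... = (D^2*(12+(192*D^2*B^2 + ?c)*CN))*IS" by (simp add: algebra_simps)
 finally show ?thesis .
qed

end

definition kornK :: "'d::finite itself => real => real => real" where
 "kornK _ B L = (real CARD('d))^2*(12+(192*(real CARD('d))^2*B^2 + (48*(27*real CARD('d)*B*L)^2+27/4*(real CARD('d))^2*B^2))
  *(unit_ball_vol (real CARD('d))*avg_const TYPE(real^'d)))"

lemma kornK_nonneg: "0 <= kornK TYPE('d::finite) B L"
 unfolding kornK_def using avg_const_nonneg[of "TYPE(real^'d)"] by (intro mult_nonneg_nonneg add_nonneg_nonneg) auto

lemma (in korn_graph) korn_smooth_graph':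
 "(SU i. SU j. (LB x. ind {x. dl <= h x} x*(pd j (v i) x)^2))
  <= kornK TYPE('d) B L*(LB x. ind {x. 0 < h x} x * (SU i. SU j. abs((1/2)*(pd j (v i) x+pd i (v j) x)))^2)"
 using korn_smooth_graph unfolding kornK_def IS_def S_def E_def C2_def CN_def D_def .

lemma theta_bounds:
 obtains B where "0 <= B" "!!y :: real^'d. abs(theta y) <= B" "!!(y :: real^'d) l. abs(theta y*y$l) <= B"
   "!!(y :: real^'d) j. abs(pd j theta y) <= B"
   "!!(y :: real^'d) j l. abs(pd j (%y. theta y*y$l) y) <= B"
proof -
 have th: "Ck 1 (theta :: real^'d => real)" by (rule Ck_mono[OF Ck_theta]) simp
 have thn: "Ck 1 (%y :: real^'d. theta y*y$l)" for l by (intro Ck_mult th Ck_nth)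
 have bd: "EX b>=0. ALL y. abs(k y) <= b" if "ker k" for k :: "real^'d => real"
  using csupp_bounded[OF _ ker_csupp[OF that]] that unfolding ker_def by (metis less_imp_le)
 obtain b0 where b0: "0 <= b0" "!!y :: real^'d. abs(theta y) <= b0" using bd[OF ker_theta] by blast
 obtain b1 where b1: "!!l. 0 <= b1 l" "!!(y :: real^'d) l. abs(theta y*y$l) <= b1 l" using bd[OF ker_nth[OF ker_theta]] by metis
 obtain b2 where b2: "!!l. 0 <= b2 l" "!!(y :: real^'d) l. abs(pd l theta y) <= b2 l" using bd[OF ker_partial[OF ker_theta th]] by metis
 have "EX b>=0. ALL y. abs(pd j (%y :: real^'d. theta y*y$l) y) <= b" for j l by (rule bd[OF ker_partial[OF ker_nth[OF ker_theta] thn]])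
 then obtain b3 where b3: "!!j l. 0 <= b3 j l" "!!(y :: real^'d) j l. abs(pd j (%y. theta y*y$l) y) <= b3 j l" by metis
 let ?s1 = "SU l. b1 l" and ?s2 = "SU l. b2 l" and ?s3 = "SU j. SU l. b3 j l"
 have le1: "b1 l <= ?s1" for l using b1 by (intro member_le_sum) auto
 have le2: "b2 l <= ?s2" for l using b2 by (intro member_le_sum) auto
 have le3: "b3 j l <= ?s3" for j l
 proof -
  have "b3 j l <= (SU l. b3 j l)" using b3 by (intro member_le_sum) auto
  also have "... <= ?s3" using b3 by (intro member_le_sum[of j]) (auto intro: sum_nonneg)
  finally show ?thesis .
 qed
 have nn: "0 <= ?s1" "0 <= ?s2" "0 <= ?s3" using b1 b2 b3 by (auto intro!: sum_nonneg)
 show ?thesis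
 proof (rule that[of "b0 + ?s1 + ?s2 + ?s3"])
  show "0 <= b0 + ?s1 + ?s2 + ?s3" using b0 nn by linarith
  show "abs(theta y) <= b0 + ?s1 + ?s2 + ?s3" for y :: "real^'d" using b0(2)[of y] nn by linarith
  show "abs(theta y*y$l) <= b0 + ?s1 + ?s2 + ?s3" for y :: "real^'d" and l using b1(2)[of y l] le1[of l] b0(1) nn by linarith
  show "abs(pd j theta y) <= b0 + ?s1 + ?s2 + ?s3" for y :: "real^'d" and j using b2(2)[of j y] le2[of j] b0(1) nn by linarith
  show "abs(pd j (%y. theta y*y$l) y) <= b0 + ?s1 + ?s2 + ?s3" for y :: "real^'d" and j l using b3(2)[of j l y] le3[of j l] b0(1) nn by linarith
 qed
qed

subsection \<open>Mollification\<close>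

lemma integral_cbox_support:
 fixes f :: "real^'d => real" assumes c: "cont f" and s: "!!w. w \<notin> cbox a b ==> f w = 0" shows "(LB w. f w) = integral (cbox a b) f"
proof -
 have eq: "f = (%w. ind (cbox a b) w*.f w)" using s by (auto simp: fun_eq_iff indicator_def)
 have "integrable lborel (%w. ind (cbox a b) w*.f w)" by (intro borel_integrable_compact compact_cbox) (use c continuous_on_subset in blast)
 hence "integrable lborel f" using eq by simp
 hence "(LB w. f w) = integral UNIV f" by (rule integral_lborel[symmetric])
 also have "... = integral UNIV (%w. if w : cbox a b then f w else 0)" by (intro arg_cong[where f="integral UNIV"] ext) (use s in auto)
 finally show ?thesis by (simp only: integral_restrict_UNIV)
qed

lemma kav_const_deriv:
 fixes k :: "real^'d => real" assumes k: "ker k" "Ck 1 k" and H: "cont H" and r: "r ~= 0"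
 shows "(kav (%_. r) k H has_derivative (%h. (\<chi> j. - (1/r)*kav (%_. r) (pd j k) H x)<.>h)) (at x)"
proof -
 let ?D = "abs(r)^DIM(real^'d)"
 have k': "Ck (Suc 0) k" using k(2) by (simp only: One_nat_def)
 have kc: "cont k" and kpc: "cont (pd j k)" for j using Ck_continuous[OF k(2)] k(2) by auto
 define c where "c = abs(r) + 1"
 define a where "a = x-c*.One"
 define b where "b = x+c*.One"
 have tr: "?D*kav (%_. r) \<kappa> H y = integral (cbox a b) (%w. \<kappa> ((1/r)*.(w-y))*H w)"
  if \<kappa>: "ker \<kappa>" and y: "y : ball x 1" for \<kappa> y
 proof -
  have \<kappa>c: "cont \<kappa>" using \<kappa> by (simp add: ker_def)
  have c1: "cont (%w. \<kappa> ((1/r)*.(w-y))*H w)" by (intro continuous_intros H continuous_on_compose2[OF \<kappa>c]) auto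
  have "(LB w. \<kappa> ((1/r)*.(w-y))*H w) = ?D*kav (%_. r) \<kappa> H y"
   using integral_affine[OF borel_measurable_continuous_onI[OF c1] r, of y] r by (simp add: kav_def)
  moreover have "(LB w. \<kappa> ((1/r)*.(w-y))*H w) = integral (cbox a b) (%w. \<kappa> ((1/r)*.(w-y))*H w)"
  proof (rule integral_cbox_support[OF c1])
   fix w assume "w \<notin> cbox a b"
   then obtain i where "\<not> (x$i-c <= w$i & w$i <= x$i+c)" by (auto simp: a_def b_def mem_box_cart One_nth simp del: sum_component)
   hence "c < \<bar>(w-x)$i\<bar>" unfolding vector_minus_component by linarith
   hence "c < norm (w-x)" using component_le_norm_cart[of "w-x" i] by linarith
   moreover have "norm (w-x) <= norm (w-y)+norm (y-x)" using norm_triangle_ineq[of "w-y" "y-x"] by simp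
   moreover have "norm (y-x) < 1" using y by (simp add: dist_norm norm_minus_commute)
   ultimately have "abs(r) < norm (w-y)" by (simp add: c_def)
   hence "1 < norm (w-y) / abs(r)" using r by simp
   also have "... = norm ((1/r)*.(w-y))" by (simp only: norm_scaleR) (simp add: divide_inverse mult.commute)
   finally have "1 < norm ((1/r)*.(w-y))" .
   thus "\<kappa> ((1/r)*.(w-y))*H w = 0" using \<kappa> by (simp add: ker_def)
  qed
  ultimately show ?thesis by simp
 qed
 let ?G = "%y w. (- (1/r)*H w)*.grad k ((1/r)*.(w-y))"
 have gc: "cont (grad k)" by (rule continuous_grad[OF k'])
 have cG: "continuous_on (ball x 1 \<times> cbox a b) (%(y, w). ?G y w)"
  unfolding split_beta by (intro continuous_intros continuous_on_compose2[OF H] continuous_on_compose2[OF gc]) auto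
 have cGx: "continuous_on (cbox a b) (?G y)" for y by (intro continuous_intros continuous_on_compose2[OF H] continuous_on_compose2[OF gc]) auto
 have "((%y. integral (cbox a b) (%w. k ((1/r)*.(w-y))*H w)) has_derivative
   integral (cbox a b) (%w. blinfun_inner_right (?G x w))) (at x within ball x 1)"
 proof (rule leibniz_rule)
  fix y w :: "real^'d"
  have "((%y. (1/r)*.(w-y)) has_derivative (%h. (1/r)*.(0-h))) (at y)" by (intro derivative_intros)
  from diff_chain_at[OF this Ck_deriv[OF k']]
  have "((%y. k ((1/r)*.(w-y))) has_derivative (%h. grad k ((1/r)*.(w-y))<.>((1/r)*.(0-h)))) (at y)" by (simp add: o_def)
  from has_derivative_mult_left[OF this, of "H w"]
  have "((%y. k ((1/r)*.(w-y))*H w) has_derivative (%h. grad k ((1/r)*.(w-y))<.>((1/r)*.(0-h))*H w)) (at y)" .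
  moreover have "(%h. grad k ((1/r)*.(w-y))<.>((1/r)*.(0-h))*H w) = blinfun_apply (blinfun_inner_right (?G y w))" by (rule ext) simp
  ultimately show "((%y. k ((1/r)*.(w-y))*H w) has_derivative blinfun_apply (blinfun_inner_right (?G y w))) (at y within ball x 1)"
   using has_derivative_at_withinI by metis
 next
  show "(%w. k ((1/r)*.(w-y))*H w) integrable_on cbox a b" for y
   by (intro integrable_continuous continuous_intros continuous_on_compose2[OF kc] continuous_on_compose2[OF H]) auto
  show "continuous_on (ball x 1 \<times> cbox a b) (%(y, w). blinfun_inner_right (?G y w))"
   using bounded_linear.continuous_on[OF bounded_linear_blinfun_inner_right cG] by (simp add: split_beta)
 qed auto
 also have "integral (cbox a b) (%w. blinfun_inner_right (?G x w)) = blinfun_inner_right (integral (cbox a b) (?G x))"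
  using integral_linear[OF integrable_continuous[OF cGx] bounded_linear_blinfun_inner_right] by (simp add: o_def)
 also have "integral (cbox a b) (?G x) = ?D*.(\<chi> j. - (1/r)*kav (%_. r) (pd j k) H x)"
 proof (rule vec_eq_iff[THEN iffD2], rule allI)
  fix j
  have "integral (cbox a b) (?G x)$j = integral (cbox a b) (%w. ?G x w$j)"
   by (rule integral_component_eq_cart[symmetric, OF integrable_continuous[OF cGx]])
  also have "... = integral (cbox a b) (%w. - (1/r)*(pd j k ((1/r)*.(w-x))*H w))" by (simp add: mult_ac)
  also have "... = - (1/r)*integral (cbox a b) (%w. pd j k ((1/r)*.(w-x))*H w)" by (rule integral_mult_right)
  also have "... = - (1/r)*(?D*kav (%_. r) (pd j k) H x)" by (subst tr[OF ker_partial[OF k]]) auto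
  finally show "integral (cbox a b) (?G x)$j = (?D*.(\<chi> j. - (1/r)*kav (%_. r) (pd j k) H x))$j" by (simp add: mult_ac)
 qed
 finally have "((%y. integral (cbox a b) (%w. k ((1/r)*.(w-y))*H w)) has_derivative
   (%h. ?D*((\<chi> j. - (1/r)*kav (%_. r) (pd j k) H x)<.>h))) (at x within ball x 1)" by (simp add: inner_scaleR_left[abs_def])
 hence "((%y. ?D*kav (%_. r) k H y) has_derivative
   (%h. ?D*((\<chi> j. - (1/r)*kav (%_. r) (pd j k) H x)<.>h))) (at x within ball x 1)"
  by (rule has_derivative_transform[rotated 2]) (simp, rule tr[OF k(1)])
 hence "((%y. ?D*kav (%_. r) k H y) has_derivative
   (%h. ?D*((\<chi> j. - (1/r)*kav (%_. r) (pd j k) H x)<.>h))) (at x)" by (simp add: at_within_open[of x "ball x 1"])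
 from has_derivative_mult_right[OF this, of "1/?D"] show ?thesis using r by simp
qed

lemma Ck_kav_const:
 fixes k :: "real^'d => real" assumes "ker k" "Ck n k" "cont H" "r ~= 0" "1 <= n" shows "Ck n (kav (%_. r) k H)" using assms(1,2,5)
proof (induction n arbitrary: k)
 case (Suc n)
 have k1: "Ck 1 k" by (rule Ck_mono[OF Suc.prems(2)]) simp
 show ?case
 proof (rule Ck_SucI[OF kav_const_deriv[OF Suc.prems(1) k1 assms(3,4)]])
  fix j
  have kp: "ker (pd j k)" by (rule ker_partial[OF Suc.prems(1) k1])
  have "Ck n (kav (%_. r) (pd j k) H)"
  proof (cases "n = 0")
   case True
   have "cont (pd j k)" using k1 by auto
   have "cont (%x. integral (cbox (- One) One) (%y. pd j k y*H (x+r*.y)))" by (rule integral_continuous_on_param, unfold split_beta)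
     (intro continuous_intros continuous_on_compose2[OF assms(3)] continuous_on_compose2[OF \<open>continuous_on UNIV (pd j k)\<close>]; auto)
   thus ?thesis using True kav_cbox[OF kp assms(3), of "%_. r"] by (simp add: fun_eq_iff)
  next
   case False
   thus ?thesis using Suc.IH[OF kp Ck_partial[OF Suc.prems(2)]] by simp
  qed
  thus "Ck n (%x. (\<chi> j. - (1/r)*kav (%_. r) (pd j k) H x)$j)" by (simp only: vec_lambda_beta) (rule Ck_cmult)
 qed
qed simp

lemma norm_grad_lipschitz:
 fixes f :: "real^'d => real" assumes d: "!!x. f differentiable (at x)" and L: "!!x y. abs(f x-f y) <= L*norm (x-y)" shows "norm (grad f x) <= L"
proof -
 let ?g = "grad f x"
 have "((%t. (f (x+t *. ?g)-f x)/t) ---> ?g <.> ?g) (at 0)" using DERIV_along_line[OF d, of x ?g 0] by (simp add: DERIV_def)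
 moreover have "\<forall>\<^sub>F t in at 0. (f (x+t *. ?g)-f x)/t <= L*norm ?g"
 proof (rule eventually_mono[OF eventually_neq_at_within[of 0]])
  fix t :: real assume t: "t ~= 0"
  have "(f (x+t *. ?g)-f x)/t <= abs(f (x+t *. ?g)-f x) / abs(t)" using abs_ge_self[of "(f (x+t *. ?g)-f x)/t"] by (simp add: abs_divide)
  also have "... <= L*(abs(t)*norm ?g) / abs(t)" using L[of "x+t *. ?g" x] by (intro divide_right_mono) auto
  also have "... = L*norm ?g" using t by simp
  finally show "(f (x+t *. ?g)-f x)/t <= L*norm ?g" .
 qed
 ultimately have "?g <.> ?g <= L*norm ?g" by (rule tendsto_upperbound) simp
 hence "norm ?g*norm ?g <= L*norm ?g" by (simp add: power2_norm_eq_inner flip: power2_eq_square)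
 moreover have "0 <= L" using L[of "axis undefined 1" 0] by (simp add: norm_axis_1)
 ultimately show ?thesis by (cases "norm ?g = 0") auto
qed

subsection \<open>Lipschitz domains\<close>

definition gradsq :: "('d => real^'d => real) => real^'d => real" where
 "gradsq v x = (SU i. SU j. (pd j (v i) x)^2)"

definition epssq :: "('d => real^'d => real) => real^'d => real" where
 "epssq v x = (SU i. SU j. ((pd j (v i) x+pd i (v j) x)/2)^2)"

definition valsq :: "('d => real^'d => real) => real^'d => real" where
 "valsq v x = (SU i. (v i x)^2)"

definition korn_set :: "(real^'d) set => bool" where
 "korn_set A \<longleftrightarrow> A : sets borel & (EX K>=0. ALL w. (ALL i. Ck 2 (w i)) & (ALL i. csupp (w i)) -->
  (LB x. ind A x*gradsq w x) <= K*(LB x. ind A x*epssq w x))"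

lemma Ck2_partial_cont: "Ck 2 (f :: real^'d => real) ==> cont (pd j f)"
 using Ck_continuous[OF Ck_partial[of 1 f j]] by (simp only: numeral_2_eq_2 One_nat_def)

lemma csupp_ind_integrable: assumes "A : sets borel" "cont f" "csupp f" shows "integrable lborel (%x :: real^'d. ind A x*(f x :: real))"
 using integrable_mult_indicator[OF _ csupp_integrable[OF assms(2,3)], of A] assms(1) by simp

lemma korn_set_UNIV: "korn_set (UNIV :: (real^'d) set)" unfolding korn_set_def
proof (intro conjI exI[of _ 2] allI impI)
 fix w :: "'d => real^'d => real" assume w: "(ALL i. Ck 2 (w i)) & (ALL i. csupp (w i))"
 have c: "cont (pd j (w i))" for i j using w Ck2_partial_cont by blast
 have cw: "csupp (w i)" for i using w by blast
 have "csupp (%x. (pd j (w i) x)^2)" for i j by (rule csupp_mono[OF csupp_pd[OF cw]]) simp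
 hence 1: "integrable lborel (%x. (pd j (w i) x)^2)" for i j by (intro csupp_integrable continuous_on_power c)
 have "csupp (%x. pd j (w i) x+pd i (w j) x)" for i j by (intro csupp_add csupp_pd cw)
 hence "csupp (%x. ((pd j (w i) x+pd i (w j) x)/2)^2)" for i j by (rule csupp_mono) simp
 hence 2: "integrable lborel (%x. ((pd j (w i) x+pd i (w j) x)/2)^2)" for i j by (intro csupp_integrable continuous_intros c) auto
 show "(LB x. ind UNIV x*gradsq w x) <= 2*(LB x. ind UNIV x*epssq w x)" using korn_whole_space[of w] w 1 2 by (simp add: gradsq_def epssq_def)
qed auto

lemma sum_abs_sq_le:
 fixes f :: "'d::finite => 'd => real" shows "(SU i. SU j. abs(f i j))^2 <= (real CARD('d))^2*(SU i. SU j. (f i j)^2)"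
proof -
 have *: "(SU i. g i)^2 <= real CARD('d)*(SU i. (g i)^2)" for g :: "'d => real" using Cauchy_Schwarz_ineq_sum[of "%_. 1" g "UNIV :: 'd set"] by simp
 have "(SU i. SU j. abs(f i j))^2 <= real CARD('d)*(SU i. (SU j. abs(f i j))^2)" by (rule *)
 also have "... <= real CARD('d)*(SU i. real CARD('d)*(SU j. \<bar>f i j\<bar>\<^sup>2))" by (intro mult_left_mono sum_mono *) auto
 also have "... = (real CARD('d))^2*(SU i. SU j. (f i j)^2)" by (simp add: sum_distrib_left power2_eq_square mult_ac)
 finally show ?thesis .
qed

lemma integral_theta_cmult: "(LB y. theta (y :: real^'d)*c) = c" using integral_theta[where 'd='d] by simp

lemma theta_outside: "1 < norm y ==> theta y = 0" using ker_theta unfolding ker_def by blast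

lemma kav_theta_compare:
 fixes H H' :: "real^'d => real" assumes c: "cont H" "cont H'" and b: "!!y. norm y <= 1 ==> \<bar>H (x+r*.y)-H' (x' + r*.y)\<bar> <= b"
 shows "abs(kav (%_. r) theta H x-kav (%_. r) theta H' x') <= b"
proof -
 have i: "integrable lborel (%y. theta y*H (x+r*.y))" "integrable lborel (%y. theta y*H' (x' + r*.y))" by (intro kav_integrable ker_theta c)+
 have "kav (%_. r) theta H x-kav (%_. r) theta H' x' = (LB y. theta y*(H (x+r*.y)-H' (x' + r*.y)))"
  unfolding kav_def using i by (simp add: right_diff_distrib)
 also have "abs(...) <= (LB y. abs(theta y*(H (x+r*.y)-H' (x' + r*.y))))"
  using integral_norm_bound[of lborel "%y. theta y*(H (x+r*.y)-H' (x' + r*.y))"] by simp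
 also have "... <= (LB y. theta (y :: real^'d)*b)"
 proof (rule integral_mono)
  show "integrable lborel (%y. abs(theta y*(H (x+r*.y)-H' (x' + r*.y))))" using i by (intro integrable_abs) (simp add: right_diff_distrib)
  show "integrable lborel (%y. theta (y :: real^'d)*b)" using kav_integrable[OF ker_theta continuous_on_const[of UNIV b]] by simp
  fix y :: "real^'d"
  show "abs(theta y*(H (x+r*.y)-H' (x' + r*.y))) <= theta y*b"
  proof (cases "norm y <= 1")
   case True
   thus ?thesis using b[OF True] theta_nonneg[of y] by (simp add: abs_mult mult_left_mono)
  next
   case False
   hence "theta y = 0" by (intro theta_outside) simp
   thus ?thesis by simp
  qed
 qed
 finally show ?thesis unfolding integral_theta_cmult .
qed

lemma kav_theta_const: "kav (%_. r) theta (%_. c) (x :: real^'d) = c" unfolding kav_def by (rule integral_theta_cmult)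

lemma gradsq_integrable:
 fixes w :: "'d => real^'d => real" assumes "!!i. Ck 2 (w i)" shows "cont (gradsq w)" "cont (epssq w)" "cont (valsq w)"
  "(!!i. csupp (w i)) ==> csupp (gradsq w)" "(!!i. csupp (w i)) ==> csupp (epssq w)"
proof -
 note c = Ck2_partial_cont[OF assms]
 show "cont (gradsq w)" unfolding gradsq_def[abs_def] by (intro continuous_intros c)
 show "cont (epssq w)" unfolding epssq_def[abs_def] by (intro continuous_intros c) auto
 show "cont (valsq w)" unfolding valsq_def[abs_def] by (intro continuous_intros Ck_continuous[OF assms])
 assume cw: "!!i. csupp (w i)"
 have "csupp (%x. (pd j (w i) x)^2)" for i j by (rule csupp_mono[OF csupp_pd[OF cw]]) simp
 thus "csupp (gradsq w)" unfolding gradsq_def[abs_def] by (intro csupp_sum)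
 have "csupp (%x. pd j (w i) x+pd i (w j) x)" for i j by (intro csupp_add csupp_pd cw)
 hence "csupp (%x. ((pd j (w i) x+pd i (w j) x)/2)^2)" for i j by (rule csupp_mono) simp
 thus "csupp (epssq w)" unfolding epssq_def[abs_def] by (intro csupp_sum)
qed

lemma korn_set_graph:
 fixes \<gamma> :: "real^'d => real" assumes lip: "M-lipschitz_on UNIV \<gamma>" and e: "norm e = 1"
 shows "korn_set {y. \<gamma> (y-(y<.>e)*.e) < y<.>e}"
proof -
 define H where "H y = y<.>e - \<gamma> (y-(y<.>e)*.e)" for y
 define L where "L = 1+2*M"
 have M0: "0 <= M" using lip by (rule lipschitz_on_nonneg)
 have L: "1 <= L" using M0 by (simp add: L_def)
 have HL: "abs(H x-H y) <= L*norm (x-y)" for x y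
 proof -
  have a: "abs((x-y)<.>e) <= norm (x-y)" using Cauchy_Schwarz_ineq2[of "x-y" e] e by simp
  have "abs(\<gamma> (x-(x<.>e)*.e) - \<gamma> (y-(y<.>e)*.e)) <= M*dist (x-(x<.>e)*.e) (y-(y<.>e)*.e)"
   using lipschitz_onD[OF lip] by (simp add: dist_real_def)
  also have "dist (x-(x<.>e)*.e) (y-(y<.>e)*.e) = norm ((x-y)-((x-y)<.>e)*.e)" by (simp add: dist_norm inner_diff_left scaleR_diff_left algebra_simps)
  also have "... <= norm (x-y)+norm (((x-y)<.>e)*.e)" by (rule norm_triangle_ineq4)
  also have "... <= norm (x-y)+norm (x-y)" using a e by simp
  finally have b: "abs(\<gamma> (x-(x<.>e)*.e) - \<gamma> (y-(y<.>e)*.e)) <= M*(norm (x-y)+norm (x-y))" using M0 by (simp add: mult_left_mono)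
  have "H x-H y = (x-y)<.>e-(\<gamma> (x-(x<.>e)*.e) - \<gamma> (y-(y<.>e)*.e))" by (simp add: H_def inner_diff_left)
  hence "abs(H x-H y) <= norm (x-y)+M*(norm (x-y)+norm (x-y))" using a b by linarith
  thus ?thesis by (simp add: L_def algebra_simps)
 qed
 have Hc: "cont H" unfolding H_def by (intro continuous_intros continuous_on_compose2[OF lipschitz_on_continuous_on[OF lip]]) auto
 have Hshift: "H (x+t*.e) = H x+t" for x t
 proof -
  have "e<.>e = 1" using e by (simp add: norm_eq_1)
  thus ?thesis by (simp add: H_def inner_add_left scaleR_add_left)
 qed
 define r where "r n = 1/(real n+1)" for n :: nat
 have r: "0 < r n" for n by (simp add: r_def)
 define U where "U n = kav (%_. - r n) theta H" for n
 define h where "h n x = U n x-L*r n" for n x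
 have U2: "Ck 2 (U n)" for n unfolding U_def by (rule Ck_kav_const[OF ker_theta Ck_theta Hc]) (use r[of n] in auto)
 have Uclose: "abs(U n x-H x) <= L*r n" for n x
 proof -
  have "abs(kav (%_. - r n) theta H x-kav (%_. - r n) theta (%_. H x) x) <= L*r n"
  proof (rule kav_theta_compare[OF Hc continuous_on_const])
   fix y :: "real^'d" assume y: "norm y <= 1"
   have "abs(H (x + - r n*.y)-H x) <= L*norm (- r n*.y)" using HL[of "x + - r n*.y" x] by simp
   also have "... <= L*r n" using L y r[of n] by (intro mult_left_mono) (auto simp: mult_left_le)
   finally show "abs(H (x + - r n*.y)-H x) <= L*r n" .
  qed
  thus ?thesis by (simp add: U_def kav_theta_const)
 qed
 have UL: "abs(U n x-U n y) <= L*norm (x-y)" for n x y unfolding U_def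
 proof (rule kav_theta_compare[OF Hc Hc])
  fix z :: "real^'d"
  show "abs(H (x + - r n*.z)-H (y + - r n*.z)) <= L*norm (x-y)" using HL[of "x + - r n*.z" "y + - r n*.z"] by simp
 qed
 have Ushift: "U n (x+t*.e) = U n x+t" for n x t
 proof -
  have "H (x+t*.e + - r n*.y) = H (x + - r n*.y)+t" for y using Hshift[of "x + - r n*.y" t] by (simp add: algebra_simps)
  hence "U n (x+t*.e) = kav (%_. - r n) theta (%x. H x+t) x" by (simp add: U_def kav_def)
  also have "... = U n x+t" unfolding U_def by (subst kav_add[OF ker_theta Hc continuous_on_const]) (simp add: kav_theta_const)
  finally show ?thesis .
 qed
 have Ud: "U n differentiable (at x)" for n x by (rule Ck_diffable[of 0]) (rule Ck_mono[OF U2], simp)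
 have h2: "Ck 2 (h n)" for n unfolding h_def[abs_def] by (intro Ck_diff U2 Ck_const)
 have hd: "h n differentiable (at x)" for n x by (rule Ck_diffable[of 0]) (rule Ck_mono[OF h2], simp)
 have hL: "norm (grad (h n) x) <= L" for n x by (rule norm_grad_lipschitz[OF hd]) (use UL in \<open>simp add: h_def\<close>)
 have he: "grad (h n) x<.>e = 1" for n x
 proof (rule DERIV_unique)
  show "((%t. h n (x+t*.e)) has_field_derivative grad (h n) x<.>e) (at 0)" using DERIV_along_line[OF hd, of n x e 0] by simp
  have "(%t. h n (x+t*.e)) = (%t. h n x+t)" by (simp add: h_def Ushift fun_eq_iff)
  thus "((%t. h n (x+t*.e)) has_field_derivative 1) (at 0)" by (auto intro!: derivative_eq_intros)
 qed
 have hH: "3*(L*r n) <= H x ==> L*r n <= h n x" "0 < h n x ==> 0 < H x" for n x using Uclose[of n x] by (auto simp: h_def abs_le_iff)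
 obtain B where B: "0 <= B" "!!y :: real^'d. abs(theta y) <= B" "!!(y :: real^'d) l. abs(theta y*y$l) <= B"
   "!!(y :: real^'d) j. abs(pd j theta y) <= B"
   "!!(y :: real^'d) j l. abs(pd j (%y. theta y*y$l) y) <= B" using theta_bounds[where 'd='d] by blast
 let ?A = "{x. 0 < H x}"
 have Am: "?A : sets borel" by (intro borel_open open_Collect_less continuous_intros Hc)
 have hc: "cont (h n)" for n by (rule Ck_continuous[OF h2])
 have Bm1: "{x. c <= H x} : sets borel" for c by (intro borel_closed closed_Collect_le continuous_on_const Hc)
 have Bm2: "{x. c < h n x} : sets borel" for c n by (intro borel_open open_Collect_less continuous_on_const hc)
 have Bm3: "{x. c <= h n x} : sets borel" for c n by (intro borel_closed closed_Collect_le continuous_on_const hc)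
 note Bm = Bm1 Bm2 Bm3
 let ?K = "kornK TYPE('d) B L*(real CARD('d))^2"
 have K0: "0 <= kornK TYPE('d) B L" by (rule kornK_nonneg)
 have "(LB x. ind ?A x*gradsq w x) <= ?K*(LB x. ind ?A x*epssq w x)"
  if w: "!!i. Ck 2 (w i)" and cw: "!!i. csupp (w i)" for w :: "'d => real^'d => real"
 proof -
  note g = gradsq_integrable[OF w]
  have gi: "integrable lborel (%x. ind A x*gradsq w x)" if "A : sets borel" for A by (rule csupp_ind_integrable[OF that g(1) g(4)[OF cw]])
  have ei: "integrable lborel (%x. ind A x*epssq w x)" if "A : sets borel" for A by (rule csupp_ind_integrable[OF that g(2) g(5)[OF cw]])
  have gnn: "0 <= gradsq w x" "0 <= epssq w x" for x unfolding gradsq_def epssq_def by (auto intro!: sum_nonneg)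
  have pc: "cont (%x. (pd j (w i) x)^2)" "csupp (%x. (pd j (w i) x)^2)" for i j
   by (intro continuous_intros Ck2_partial_cont w) (rule csupp_mono[OF csupp_pd[OF cw]], simp)
  define S where "S x = (SU i. SU j. abs((1/2)*(pd j (w i) x+pd i (w j) x)))" for x
  have Sle: "(S x)^2 <= (real CARD('d))^2*epssq w x" for x
   unfolding S_def epssq_def using sum_abs_sq_le[of "%i j. (1/2)*(pd j (w i) x+pd i (w j) x)"] by simp
  have Sc: "cont (%x. (S x)^2)" unfolding S_def by (intro continuous_intros Ck2_partial_cont w)
  have Scs: "csupp (%x. (S x)^2)"
  proof (rule csupp_mono[OF g(5)[OF cw]])
   fix x assume "epssq w x = 0"
   thus "(S x)^2 = 0" using Sle[of x] by (simp add: order_antisym)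
  qed
  have main: "(LB x. ind {x. 3*(L*r n) <= H x} x*gradsq w x) <= ?K*(LB x. ind ?A x*epssq w x)" for n
  proof -
   have "korn_graph (h n) e L (L*r n) B w" by unfold_locales (use h2 hL he e L r B w cw in auto)
   note kg = korn_graph.korn_smooth_graph'[OF this]
   have "(LB x. ind {x. 3*(L*r n) <= H x} x*gradsq w x) <= (LB x. ind {x. L*r n <= h n x} x*gradsq w x)"
    by (intro integral_mono gi Bm mult_right_mono gnn) (auto simp: indicator_def dest: hH(1))
   also have "... = (SU i. SU j. (LB x. ind {x. L*r n <= h n x} x*(pd j (w i) x)^2))"
   proof -
    have ii: "integrable lborel (%x. ind {x. L*r n <= h n x} x*(pd j (w i) x)^2)" for i j by (rule csupp_ind_integrable[OF Bm3 pc])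
    show ?thesis unfolding gradsq_def sum_distrib_left by (simp only: Bochner_Integration.integral_sum[OF Bochner_Integration.integrable_sum[OF ii]]
       Bochner_Integration.integral_sum[OF ii])
   qed
   also have "... <= kornK TYPE('d) B L*(LB x. ind {x. 0 < h n x} x*(S x)^2)" using kg unfolding S_def .
   also have "... <= kornK TYPE('d) B L*(LB x. (real CARD('d))^2*(ind ?A x*epssq w x))"
   proof (intro mult_left_mono K0 integral_mono)
    show "integrable lborel (%x. ind {x. 0 < h n x} x*(S x)^2)" by (rule csupp_ind_integrable[OF Bm(2) Sc Scs])
    show "integrable lborel (%x. (real CARD('d))^2*(ind ?A x*epssq w x))" by (intro integrable_mult_right ei Am)
    show "ind {x. 0 < h n x} x*(S x)^2 <= (real CARD('d))^2*(ind ?A x*epssq w x)" for x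
     using Sle[of x] hH(2)[of n x] gnn(2)[of x] by (auto simp: indicator_def)
   qed
   finally show ?thesis by (simp add: mult.assoc)
  qed
  have "(%n. (LB x. ind {x. 3*(L*r n) <= H x} x*gradsq w x)) ----> (LB x. ind ?A x*gradsq w x)"
  proof (rule integral_dominated_convergence[where w="%x. gradsq w x"])
   show "integrable lborel (gradsq w)" by (rule csupp_integrable[OF g(1) g(4)[OF cw]])
   show "(%x. ind ?A x*gradsq w x) : borel_measurable lborel" using gi[OF Am] by blast
   show "(%x. ind {x. 3*(L*r n) <= H x} x*gradsq w x) : borel_measurable lborel" for n using gi[OF Bm(1)] by blast
   show "AE x in lborel. norm (ind {x. 3*(L*r n) <= H x} x*gradsq w x) <= gradsq w x" for n using gnn by (intro AE_I2) (auto simp: indicator_def)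
   show "AE x in lborel. (%n. ind {x. 3*(L*r n) <= H x} x*gradsq w x) ----> ind ?A x*gradsq w x"
   proof (intro AE_I2 tendsto_mult tendsto_const)
    fix x
    have pos: "0 < 3*(L*r n)" for n using L r[of n] by simp
    show "(%n. ind {x. 3*(L*r n) <= H x} x) ----> (ind ?A x :: real)"
    proof (cases "0 < H x")
     case True
     have "r ----> 0" unfolding r_def using LIMSEQ_Suc[OF lim_1_over_n] by (simp add: add.commute)
     hence "(%n. 3*(L*r n)) ----> 3*(L*0)" by (intro tendsto_intros)
     hence "eventually (%n. 3*(L*r n) < H x) sequentially" using True by (intro order_tendstoD(2)) auto
     hence "eventually (%n. ind {x. 3*(L*r n) <= H x} x = (1 :: real)) sequentially" by eventually_elim auto
     thus ?thesis using True by (simp add: tendsto_eventually)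
    next
     case False
     hence "ind {x. 3*(L*r n) <= H x} x = (0 :: real)" for n using pos[of n] by (auto simp: indicator_def)
     thus ?thesis using False by simp
    qed
   qed
  qed
  thus ?thesis by (rule LIMSEQ_le_const2) (use main in blast)
 qed
 moreover have "{y. \<gamma> (y-(y<.>e)*.e) < y<.>e} = ?A" by (auto simp: H_def)
 ultimately show ?thesis unfolding korn_set_def using Am K0 by (auto intro!: exI[of _ ?K])
qed

lemma bounded_ind_integrable:
 fixes f :: "real^'d => real" assumes A: "A : sets borel" "bounded A" and f: "cont f" shows "integrable lborel (%x. ind A x*f x)"
proof -
 obtain R where "ALL x:A. norm x <= R" using A(2) bounded_iff by blast
 hence R: "A \<subseteq> cball 0 R" by auto
 have "integrable lborel (%x. ind (cball 0 R) x*.f x)" by (intro borel_integrable_compact compact_cball) (use f continuous_on_subset in blast)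
 from integrable_mult_indicator[OF _ this, of A]
 have "integrable lborel (%x. ind A x*.(ind (cball 0 R) x*.f x))" using A(1) by simp
 moreover have "(%x. ind A x*.(ind (cball 0 R) x*.f x)) = (%x. ind A x*f x)" using R by (auto simp: fun_eq_iff indicator_def)
 ultimately show ?thesis by simp
qed

lemma korn_local:
 fixes Om A :: "(real^'d) set" assumes A: "korn_set A" and Om: "open Om" "bounded Om" and r: "0 < r"
  and eq: "Om \<inter> ball x0 r = A \<inter> ball x0 r"
 shows "EX K>=0. ALL v. (ALL i. Ck 2 (v i)) --> (LB x. ind (Om \<inter> ball x0 (r/2)) x*gradsq v x)
  <= K*((LB x. ind Om x*epssq v x)+(LB x. ind Om x * valsq v x))"
proof -
 obtain KA where Am: "A : sets borel" and KA: "0 <= KA" "!!w. (!!i. Ck 2 (w i)) ==> (!!i. csupp (w i)) ==>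
  (LB x. ind A x*gradsq w x) <= KA*(LB x. ind A x*epssq w x)" using A unfolding korn_set_def by blast
 define ze where "ze x = pcut 3 ((1/r)*.(x-x0))" for x
 define b where "b = 6/r"
 have b0: "0 <= b" using r by (simp add: b_def)
 have ze2: "Ck 2 ze"
 proof -
  have "Ck 2 (%x. pcut (Suc 2) ((1/r)*.(x-x0)))"
   by (rule Ck_compose[OF Ck_pcut], simp only: vector_scaleR_component vector_minus_component real_scaleR_def)
    (intro Ck_cmult Ck_diff Ck_nth Ck_const)
  thus ?thesis unfolding ze_def[abs_def] by (simp add: numeral_3_eq_3 numeral_2_eq_2 del: Ck.simps)
 qed
 have ze01: "0 <= ze x" "ze x <= 1" for x unfolding ze_def pcut_def by (auto intro!: power_le_one)
 have dze: "pd j ze x = (1/r)*(- 6*(((1/r)*.(x-x0))$j*pcut 2 ((1/r)*.(x-x0))))" for j x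
 proof -
  let ?y = "(1/r)*.(x-x0)"
  have "((%x. (1/r)*.(x-x0)) has_derivative (%h. (1/r)*.(h-0))) (at x)" by (intro derivative_intros)
  moreover have "Ck (Suc 0) (pcut 3 :: real^'d => real)"
   using Ck_mono[OF Ck_pcut, of "Suc 0" 2] by (simp add: numeral_3_eq_3 numeral_2_eq_2 del: Ck.simps)
  ultimately have "((%x. pcut 3 ((1/r)*.(x-x0))) has_derivative (%h. grad (pcut 3) ?y<.>((1/r)*.(h-0)))) (at x)"
   using diff_chain_at[OF _ Ck_deriv] by (fastforce simp: o_def)
  hence "pd j ze x = grad (pcut 3) ?y<.>((1/r)*.(axis j 1-0))" unfolding ze_def[abs_def] by (rule pd_eq)
  also have "... = (1/r)*pd j (pcut 3) ?y" by (simp add: inner_axis)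
  also have "pd j (pcut 3) ?y = - 6*(?y$j*pcut 2 ?y)" using pd_pcut[of j 1 ?y] by (simp add: numeral_3_eq_3 numeral_2_eq_2)
  finally show ?thesis .
 qed
 have out: "ze x = 0" "pd j ze x = 0" if "x \<notin> ball x0 r" for x j
 proof -
  have y: "1 <= norm ((1/r)*.(x-x0))" using that r unfolding norm_scaleR by (simp add: dist_norm norm_minus_commute pos_le_divide_eq)
  have "pcut 3 ((1/r)*.(x-x0)) = 0" "pcut 2 ((1/r)*.(x-x0)) = 0" using pcut_outside[OF y, of 2] pcut_outside[OF y, of 1]
   by (simp_all only: numeral_3_eq_3 numeral_2_eq_2 One_nat_def)
  thus "ze x = 0" "pd j ze x = 0" by (simp_all add: ze_def dze)
 qed
 have db: "abs(pd j ze x) <= b" for j x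
 proof (cases "x : ball x0 r")
  case False thus ?thesis using out(2) b0 by simp
 next
  case True
  let ?y = "(1/r)*.(x-x0)"
  have "norm ?y <= 1" using True r unfolding norm_scaleR by (simp add: dist_norm norm_minus_commute pos_divide_le_eq)
  hence "abs(?y$j) <= 1" using component_le_norm_cart[of ?y j] by linarith
  moreover have "abs(pcut 2 ?y) <= 1" unfolding pcut_def by (auto intro!: power_le_one)
  ultimately have "abs(?y$j)*abs(pcut 2 ?y) <= 1*1" by (intro mult_mono) auto
  hence yp: "abs(?y$j*pcut 2 ?y) <= 1" by (simp only: abs_mult mult_1)
  have "abs(pd j ze x) = b*abs(?y$j*pcut 2 ?y)" unfolding dze abs_mult[of "1/r"] abs_mult[of "- 6"] b_def using r by simp
  also have "... <= b*1" by (rule mult_left_mono[OF yp b0])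
  finally show ?thesis by simp
 qed
 have db2: "(pd j ze x)^2 <= b^2" for j x using power_mono[OF db[of j x] abs_ge_zero, of 2] by simp
 have zehalf: "1/4 <= ze x" if "x : ball x0 (r/2)" for x
 proof -
  let ?y = "(1/r)*.(x-x0)"
  have "norm ?y <= 1/2" using that r unfolding norm_scaleR by (simp add: dist_norm norm_minus_commute field_simps)
  hence "(norm ?y)^2 <= (1/2)^2" by (intro power_mono) auto
  moreover have "(1/2 :: real)^2 = 1/4" by (simp add: power2_eq_square)
  moreover have "?y <.> ?y = (norm ?y)^2" by (simp only: power2_norm_eq_inner)
  ultimately have "3/4 <= max 0 (1 - ?y <.> ?y)" by linarith
  hence "(3/4)^3 <= ze x" unfolding ze_def pcut_def by (rule power_mono) simp
  moreover have "(3/4 :: real)^3 = 27/64" by (simp add: power3_eq_cube)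
  ultimately show ?thesis by linarith
 qed
 let ?d = "real CARD('d)"
 let ?K = "32*(KA*(2+2*(?d*b^2)))+32*(?d*b^2)"
 have "(LB x. ind (Om \<inter> ball x0 (r/2)) x*gradsq v x)
  <= ?K*((LB x. ind Om x*epssq v x)+(LB x. ind Om x * valsq v x))" if v: "!!i. Ck 2 (v i)" for v :: "'d => real^'d => real"
 proof -
  define w where "w i x = ze x * v i x" for i x
  have w2: "Ck 2 (w i)" for i unfolding w_def[abs_def] by (intro Ck_mult ze2 v)
  have cw: "csupp (w i)" for i
  proof (rule csuppI[of "norm x0+r"])
   fix x :: "real^'d" assume "norm x0+r < norm x"
   hence "x \<notin> ball x0 r" using norm_triangle_ineq2[of x x0] by (auto simp: dist_norm norm_minus_commute)
   thus "w i x = 0" by (simp add: w_def out)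
  qed
  have dw: "pd j (w i) x = ze x*pd j (v i) x+pd j ze x * v i x" for i j x
   unfolding w_def[abs_def] by (rule pd_mult; rule Ck_diffable[of 1]; use ze2 v in \<open>simp only: numeral_2_eq_2 One_nat_def\<close>)
  note gv = gradsq_integrable[OF v] and gw = gradsq_integrable[OF w2]
  have Omm: "Om : sets borel" "Om \<inter> ball x0 (r/2) : sets borel" "bounded (Om \<inter> ball x0 (r/2))" using Om by (auto intro: bounded_Int)
  note iv = bounded_ind_integrable[OF Omm(1) Om(2)]
  define IE where "IE = (LB x. ind Om x*epssq v x)"
  define IV where "IV = (LB x. ind Om x * valsq v x)"
  have nn: "0 <= epssq u x" "0 <= valsq u x" "0 <= gradsq u x" for u and x :: "real^'d"
   unfolding epssq_def valsq_def gradsq_def by (auto intro!: sum_nonneg)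
  have IEV: "0 <= IE" "0 <= IV" unfolding IE_def IV_def using nn by (auto intro!: integral_nonneg_AE)
  have eps_w: "ind A x*epssq w x <= 2*(ind Om x*epssq v x)+2*(?d*b^2)*(ind Om x * valsq v x)" for x
  proof (cases "x : ball x0 r")
   case False
   hence "epssq w x = 0" unfolding epssq_def by (simp add: dw out)
   thus ?thesis using nn by simp
  next
   case True
   have "epssq w x <= (SU i. SU j. 2*((pd j (v i) x+pd i (v j) x)/2)^2+b^2*((v i x)^2+(v j x)^2))" unfolding epssq_def
   proof (intro sum_mono)
    fix i j :: 'd
    let ?E = "(pd j (v i) x+pd i (v j) x)/2"
    let ?p = "pd j ze x * v i x" and ?q = "pd i ze x * v j x"
    have "(pd j (w i) x+pd i (w j) x)/2 = ze x*?E+(?p + ?q)/2" by (simp add: dw field_simps)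
    moreover have "(a+(p+q)/2)^2 <= 2*a^2+p^2+q^2" for a p q :: real using zero_le_power2[of "a-(p+q)/2"] zero_le_power2[of "p-q"]
     by (simp add: power2_eq_square field_simps)
    ultimately have "((pd j (w i) x+pd i (w j) x)/2)^2 <= 2*(ze x*?E)^2 + ?p\<^sup>2 + ?q\<^sup>2" by metis
    moreover have "(ze x*?E)^2 <= ?E\<^sup>2"
     unfolding power_mult_distrib by (rule mult_left_le_one_le) (use ze01[of x] in \<open>auto intro: power_le_one\<close>)
    moreover have "?p\<^sup>2 <= b^2*(v i x)^2" "?q\<^sup>2 <= b^2*(v j x)^2"
     unfolding power_mult_distrib by (intro mult_right_mono db2 zero_le_power2)+
    ultimately show "((pd j (w i) x+pd i (w j) x)/2)^2 <= 2*?E\<^sup>2+b^2*((v i x)^2+(v j x)^2)" unfolding distrib_left by linarith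
   qed
   also have "... = 2*epssq v x+2*(?d*b^2) * valsq v x" unfolding epssq_def valsq_def
    by (simp add: sum.distrib distrib_left sum_distrib_left[symmetric] algebra_simps)
   finally have "epssq w x <= 2*epssq v x+2*(?d*b^2) * valsq v x" .
   moreover have "x : A \<longleftrightarrow> x : Om" using eq True by blast
   ultimately show ?thesis using nn by (auto simp: indicator_def)
  qed
  have grad_v: "ind (Om \<inter> ball x0 (r/2)) x*gradsq v x <= 32*(ind A x*gradsq w x)+32*(?d*b^2)*(ind Om x * valsq v x)" for x
  proof (cases "x : Om \<inter> ball x0 (r/2)")
   case False
   hence "ind (Om \<inter> ball x0 (r/2)) x = (0 :: real)" by (rule indicator_simps(2))
   moreover have "0 <= 32*(ind A x*gradsq w x)+32*(?d*b^2)*(ind Om x * valsq v x)" by (intro add_nonneg_nonneg mult_nonneg_nonneg nn) auto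
   ultimately show ?thesis by simp
  next
   case True
   hence "x : ball x0 r" using r by auto
   hence xA: "x : A" using eq True by blast
   have "gradsq v x <= (SU i. SU j. 32*(pd j (w i) x)^2+32*b^2*(v i x)^2)" unfolding gradsq_def
   proof (intro sum_mono)
    fix i j :: 'd
    let ?a = "pd j (v i) x" and ?c = "pd j (w i) x" and ?p = "pd j ze x * v i x"
    have "abs(1/4) <= abs(ze x)" using zehalf[of x] True by simp
    hence "(1/4)^2 <= (ze x)^2" unfolding abs_le_square_iff .
    moreover have "(1/4 :: real)^2 = 1/16" by (simp add: power2_eq_square)
    ultimately have "1/16 <= (ze x)^2" by simp
    hence "1/16*?a\<^sup>2 <= (ze x)^2*?a\<^sup>2" by (rule mult_right_mono) simp
    moreover have "(ze x)^2*?a\<^sup>2 = (?c - ?p)^2" by (simp add: dw power_mult_distrib)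
    moreover have "(?c - ?p)^2 <= 2*?c\<^sup>2+2*?p\<^sup>2" using zero_le_power2[of "?c + ?p"] by (simp add: power2_sum power2_diff)
    moreover have "?p\<^sup>2 <= b^2*(v i x)^2" unfolding power_mult_distrib by (intro mult_right_mono db2 zero_le_power2)
    ultimately have "1/16*?a\<^sup>2 <= 2*?c\<^sup>2+2*(b^2*(v i x)^2)" by linarith
    thus "?a\<^sup>2 <= 32*?c\<^sup>2+32*b^2*(v i x)^2" by simp
   qed
   also have "... = 32*gradsq w x+32*(?d*b^2) * valsq v x" unfolding gradsq_def valsq_def
    by (simp add: sum.distrib sum_distrib_left[symmetric] mult_ac)
   finally show ?thesis using True xA by simp
  qed
  have Aw: "integrable lborel (%x. ind A x*epssq w x)" "integrable lborel (%x. ind A x*gradsq w x)"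
   by (rule csupp_ind_integrable[OF Am gw(2) gw(5)[OF cw]] csupp_ind_integrable[OF Am gw(1) gw(4)[OF cw]])+
  have "(LB x. ind A x*epssq w x) <= (LB x. 2*(ind Om x*epssq v x)+2*(?d*b^2)*(ind Om x * valsq v x))"
   by (intro integral_mono Aw eps_w Bochner_Integration.integrable_add integrable_mult_right iv gv)
  also have "... = 2*IE+2*(?d*b^2)*IV" using iv[OF gv(2)] iv[OF gv(3)] by (simp add: IE_def IV_def)
  also have "... <= (2+2*(?d*b^2))*(IE+IV)" using IEV by (simp add: distrib_left distrib_right)
  finally have Ew: "(LB x. ind A x*epssq w x) <= (2+2*(?d*b^2))*(IE+IV)" .
  have "(LB x. ind (Om \<inter> ball x0 (r/2)) x*gradsq v x)
    <= (LB x. 32*(ind A x*gradsq w x)+32*(?d*b^2)*(ind Om x * valsq v x))"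
   by (intro integral_mono Aw grad_v Bochner_Integration.integrable_add integrable_mult_right iv gv bounded_ind_integrable Omm)
  also have "... = 32*(LB x. ind A x*gradsq w x)+32*(?d*b^2)*IV" using Aw iv[OF gv(3)] by (simp add: IV_def)
  also have "... <= 32*(KA*((2+2*(?d*b^2))*(IE+IV)))+32*(?d*b^2)*(IE+IV)"
   using IEV by (intro add_mono mult_left_mono order_trans[OF KA(2)[OF w2 cw]] Ew KA(1)) auto
  also have "... = ?K*(IE+IV)" by (simp add: algebra_simps)
  finally show ?thesis unfolding IE_def IV_def .
 qed
 moreover have "0 <= ?K" using KA(1) by simp
 ultimately show ?thesis by blast
qed

theorem korn_domain:
 fixes Om :: "(real^'d) set" assumes Om: "open Om" "bounded Om" "lipschitz_boundary Om"
 obtains K where "0 <= K" "!!v. (!!i. Ck 2 (v i)) ==> (LB x. ind Om x*gradsq v x)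
  <= K*((LB x. ind Om x*epssq v x)+(LB x. ind Om x * valsq v x))"
proof -
 define P where "P x0 r K \<longleftrightarrow> 0 < r & 0 <= K & (ALL v. (ALL i. Ck 2 (v i)) --> (LB x. ind (Om \<inter> ball x0 (r/2)) x*gradsq v x)
  <= K*((LB x. ind Om x*epssq v x)+(LB x. ind Om x * valsq v x)))" for x0 r K
 have "EX r K. P x0 r K" if x0: "x0 : closure Om" for x0
 proof (cases "x0 : Om")
  case True
  then obtain r where r: "r > 0" "ball x0 r \<subseteq> Om" using Om(1) open_contains_ball by blast
  hence "Om \<inter> ball x0 r = UNIV \<inter> ball x0 r" by blast
  from korn_local[OF korn_set_UNIV Om(1,2) r(1) this] show ?thesis using r(1) unfolding P_def by blast
 next
  case False
  hence "x0 : frontier Om" using x0 Om(1) by (simp add: frontier_def interior_open)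
  then obtain r e \<gamma> M where r: "r > 0" "norm e = 1" "M-lipschitz_on UNIV (\<gamma> :: real^'d => real)"
   "Om \<inter> ball x0 r = {y : ball x0 r. \<gamma> (y-(y<.>e)*.e) < y<.>e}" using Om(3) unfolding lipschitz_boundary_def by blast
  hence "Om \<inter> ball x0 r = {y. \<gamma> (y-(y<.>e)*.e) < y<.>e} \<inter> ball x0 r" by blast
  from korn_local[OF korn_set_graph[OF r(3,2)] Om(1,2) r(1) this] show ?thesis using r(1) unfolding P_def by blast
 qed
 then obtain r K where rK: "!!x0. x0 : closure Om ==> P x0 (r x0) (K x0)" by metis
 have r: "r x0 > 0" and K: "K x0 >= 0"
  "!!v. (ALL i. Ck 2 (v i)) ==> (LB x. ind (Om \<inter> ball x0 (r x0/2)) x*gradsq v x)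
  <= K x0*((LB x. ind Om x*epssq v x)+(LB x. ind Om x * valsq v x))" if "x0 : closure Om" for x0 using rK[OF that] unfolding P_def by blast+
 have "compact (closure Om)" using Om(2) by (simp add: compact_closure)
 moreover have "closure Om \<subseteq> (\<Union>x\<in>closure Om. ball x (r x/2))" using r by force
 ultimately obtain C where C: "C \<subseteq> closure Om" "finite C" "closure Om \<subseteq> (\<Union>x\<in>C. ball x (r x/2))"
  using compactE_image[of "closure Om" "closure Om" "%x. ball x (r x/2)"] by auto
 show ?thesis
 proof (rule that[of "\<Sum>x\<in>C. K x"])
  show "0 <= (\<Sum>x\<in>C. K x)" using C K(1) by (auto intro!: sum_nonneg)
  fix v :: "'d => real^'d => real" assume v: "!!i. Ck 2 (v i)"
  have nn: "0 <= gradsq v x" for x unfolding gradsq_def by (auto intro!: sum_nonneg)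
  have i: "integrable lborel (%x. ind (Om \<inter> ball y (r y/2)) x*gradsq v x)" for y
   using Om by (intro bounded_ind_integrable gradsq_integrable v) (auto intro: bounded_Int)
  have "(LB x. ind Om x*gradsq v x) <= (LB x. (\<Sum>y\<in>C. ind (Om \<inter> ball y (r y/2)) x*gradsq v x))"
  proof (rule integral_mono)
   show "integrable lborel (%x. ind Om x*gradsq v x)" using Om by (intro bounded_ind_integrable gradsq_integrable v) auto
   show "integrable lborel (%x. \<Sum>y\<in>C. ind (Om \<inter> ball y (r y/2)) x*gradsq v x)" using i by simp
   fix x
   show "ind Om x*gradsq v x <= (\<Sum>y\<in>C. ind (Om \<inter> ball y (r y/2)) x*gradsq v x)"
   proof (cases "x : Om")
    case True
    then obtain y where y: "y : C" "x : ball y (r y/2)" using C(3) closure_subset by blast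
    have "ind Om x*gradsq v x = ind (Om \<inter> ball y (r y/2)) x*gradsq v x" using True y by simp
    also have "... <= (\<Sum>y\<in>C. ind (Om \<inter> ball y (r y/2)) x*gradsq v x)" using nn by (intro member_le_sum[OF y(1)] C(2)) auto
    finally show ?thesis .
   qed (use nn in \<open>auto intro!: sum_nonneg\<close>)
  qed
  also have "... = (\<Sum>y\<in>C. (LB x. ind (Om \<inter> ball y (r y/2)) x*gradsq v x))" using i by simp
  also have "... <= (\<Sum>y\<in>C. K y*((LB x. ind Om x*epssq v x)+(LB x. ind Om x * valsq v x)))" using C(1) v by (intro sum_mono K(2)) auto
  finally show "(LB x. ind Om x*gradsq v x)
  <= (\<Sum>x\<in>C. K x)*((LB x. ind Om x*epssq v x)+(LB x. ind Om x * valsq v x))" by (simp add: sum_distrib_right)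
 qed
qed

section \<open>Bounded operators as a Banach algebra\<close>

typedef (overloaded) ('a::real_normed_vector) endo = "UNIV :: ('a \<Rightarrow>\<^sub>L 'a) set" ..

setup_lifting type_definition_endo

instantiation endo :: (real_normed_vector) real_normed_vector
begin

lift_definition zero_endo :: "'a endo" is 0 .
lift_definition plus_endo :: "'a endo => 'a endo => 'a endo" is "(+)" .
lift_definition minus_endo :: "'a endo => 'a endo => 'a endo" is "(-)" .
lift_definition uminus_endo :: "'a endo => 'a endo" is "uminus" .
lift_definition scaleR_endo :: "real => 'a endo => 'a endo" is "(*\<^sub>R)" .
lift_definition norm_endo :: "'a endo => real" is norm .

definition dist_endo :: "'a endo => 'a endo => real" where "dist_endo a b = norm (a-b)"
definition sgn_endo :: "'a endo => 'a endo" where "sgn_endo x = scaleR (inverse (norm x)) x"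
definition uniformity_endo :: "('a endo \<times> 'a endo) filter" where
 "uniformity_endo = (INF e\<in>{0<..}. principal {(x, y). dist x y < e})"
definition open_endo :: "'a endo set => bool" where
 "open_endo U = (ALL x:U. eventually (%(x', y). x' = x --> y : U) uniformity)"

instance by standard (simp_all add: dist_endo_def sgn_endo_def uniformity_endo_def open_endo_def,
  (transfer, simp add: algebra_simps norm_triangle_ineq)+)

end

instantiation endo :: ("{real_normed_vector, perfect_space}") real_normed_algebra_1
begin

lift_definition one_endo :: "'a endo" is id_blinfun .
lift_definition times_endo :: "'a endo => 'a endo => 'a endo" is blinfun_compose .

instance
proof
 fix a b c :: "'a endo" and r :: real
 show "a*b*c = a*(b*c)" by transfer (rule blinfun_eqI, simp)
 show "(a+b)*c = a*c+b*c" by transfer (rule blinfun_eqI, simp add: blinfun.bilinear_simps)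
 show "a*(b+c) = a*b+a*c" by transfer (rule blinfun_eqI, simp add: blinfun.bilinear_simps)
 show "r*.a*b = r*.(a*b)" by transfer (rule blinfun_eqI, simp add: blinfun.bilinear_simps)
 show "a*r*.b = r*.(a*b)" by transfer (rule blinfun_eqI, simp add: blinfun.bilinear_simps)
 show "1*a = a" by transfer (rule blinfun_eqI, simp)
 show "a*1 = a" by transfer (rule blinfun_eqI, simp)
 show "norm (a*b) <= norm a*norm b" by transfer (rule norm_blinfun_compose)
 show "norm (1 :: 'a endo) = 1" by transfer (rule norm_blinfun_id)
 show "(0 :: 'a endo) ~= 1"
 proof
  assume "(0 :: 'a endo) = 1"
  hence "norm (1 :: 'a endo) = 0" by (metis norm_zero)
  moreover have "norm (1 :: 'a endo) = 1" by transfer (rule norm_blinfun_id)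
  ultimately show False by simp
 qed
qed

end

instance endo :: (banach) banach
proof
 fix X :: "nat => 'a endo" assume X: "Cauchy X"
 have d: "dist (Rep_endo a) (Rep_endo b) = dist a b" for a b :: "'a endo" unfolding dist_norm by (simp add: norm_endo.rep_eq minus_endo.rep_eq)
 have "Cauchy (%n. Rep_endo (X n))" using X by (simp add: Cauchy_def d)
 then obtain L where L: "(%n. Rep_endo (X n)) ----> L" using Cauchy_convergent convergentD by blast
 have "X ----> Abs_endo L"
 proof (rule metric_LIMSEQ_I)
  fix e :: real assume "0 < e"
  from metric_LIMSEQ_D[OF L this]
  show "EX no. ALL n>=no. dist (X n) (Abs_endo L) < e" by (simp add: d[symmetric] Abs_endo_inverse)
 qed
 thus "convergent X" by (rule convergentI)
qed

lift_definition app :: "'a::real_normed_vector endo => 'a => 'a" is blinfun_apply .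

lemma bounded_bilinear_app: "bounded_bilinear app"
proof (rule bounded_bilinear.intro)
 fix a a' :: "'a endo" and b b' :: 'a and r :: real
 show "app (a+a') b = app a b+app a' b" by transfer (rule blinfun.add_left)
 show "app a (b+b') = app a b+app a b'" by transfer (rule blinfun.add_right)
 show "app (r*.a) b = r*.app a b" by transfer (rule blinfun.scaleR_left)
 show "app a (r*.b) = r*.app a b" by transfer (rule blinfun.scaleR_right)
 show "EX K. ALL a (b :: 'a). norm (app a b) <= norm a*norm b*K" by (rule exI[of _ 1], transfer) (simp add: norm_blinfun)
qed

lemma app_mult: "app (a*b) x = app a (app b x)" by transfer simp

lemma app_one [simp]: "app 1 x = x" by transfer simp

lemma app_lift: assumes "bounded_linear f" shows "EX a. ALL x. app a x = f x"
 by (rule exI[of _ "Abs_endo (Blinfun f)"]) (simp add: app.rep_eq Abs_endo_inverse bounded_linear_Blinfun_apply[OF assms])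

lemma endo_eqI: "(!!x. app a x = app b x) ==> a = b" by transfer (rule blinfun_eqI)

section \<open>Equivalent inner products\<close>

locale inner_form =
 fixes ip :: "'h::banach => 'h => real" and m :: real assumes bil: "bounded_bilinear ip" and sym: "ip x y = ip y x"
  and m: "0 < m" and coercive: "m*(norm x)^2 <= ip x x"
begin

sublocale ip: bounded_bilinear ip by (rule bil)

lemmas ip_simps = ip.add_left ip.add_right ip.diff_left ip.diff_right ip.scaleR_left ip.scaleR_right
 ip.minus_left ip.minus_right ip.zero_left ip.zero_right

definition "ipn x = sqrt (ip x x)"

lemma ip_nonneg: "0 <= ip x x" using coercive[of x] m by (smt (verit, best) mult_nonneg_nonneg zero_le_power2)

lemma ipn_nonneg: "0 <= ipn x" by (simp add: ipn_def ip_nonneg)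

lemma ipn_sq: "(ipn x)^2 = ip x x" by (simp add: ipn_def ip_nonneg)

lemma ip_zero_iff: "ip x x = 0 \<longleftrightarrow> x = 0"
proof
 assume "ip x x = 0"
 hence "m*(norm x)^2 <= 0" using coercive[of x] by simp
 hence "(norm x)^2 <= 0" using m by (simp add: mult_le_0_iff)
 thus "x = 0" by simp
qed (simp add: ip_simps)

lemma ip_cauchy_schwarz: "ip x y <= ipn x*ipn y"
proof (cases "ip y y = 0")
 case True
 thus ?thesis using ip_zero_iff[of y] by (simp add: ip_simps ipn_def)
next
 case False
 hence pos: "0 < ip y y" using ip_nonneg[of y] by linarith
 let ?t = "ip x y/ip y y"
 have "0 <= ip (x - ?t*.y) (x - ?t*.y)" by (rule ip_nonneg)
 also have "... = ip x x-(ip x y)^2/ip y y" using pos by (simp add: ip_simps sym[of y x] power2_eq_square field_simps)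
 finally have "(ip x y)^2 <= ip x x*ip y y" using pos by (simp add: field_simps)
 hence "(ip x y)^2 <= (ipn x*ipn y)^2" by (simp add: power_mult_distrib ipn_sq)
 thus ?thesis by (rule power2_le_imp_le) (simp add: ipn_nonneg)
qed

lemma ipn_triangle: "ipn (x+y) <= ipn x+ipn y"
proof (rule power2_le_imp_le)
 have "(ipn (x+y))^2 = ip x x+2*ip x y+ip y y" by (simp add: ipn_sq ip_simps sym[of y x])
 also have "... <= (ipn x+ipn y)^2" using ip_cauchy_schwarz[of x y] by (simp add: power2_sum ipn_sq)
 finally show "(ipn (x+y))^2 <= (ipn x+ipn y)^2" .
qed (simp add: ipn_nonneg)

lemma norm_le_ipn: "norm x <= ipn x/sqrt m"
proof -
 have "(sqrt m*norm x)^2 <= (ipn x)^2" using coercive[of x] m by (simp add: power_mult_distrib ipn_sq)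
 hence "sqrt m*norm x <= ipn x" by (rule power2_le_imp_le) (rule ipn_nonneg)
 thus ?thesis using m by (simp add: field_simps)
qed

lemma ipn_le_norm: obtains c where "0 < c" "!!x. ipn x <= c*norm x"
proof -
 obtain K where K: "0 < K" "!!x y. norm (ip x y) <= norm x*norm y*K" using ip.pos_bounded by blast
 have "ipn x <= sqrt K*norm x" for x
 proof (rule power2_le_imp_le)
  show "(ipn x)^2 <= (sqrt K*norm x)^2"
  proof -
   have "ip x x <= norm x*norm x*K" using K(2)[of x x] by (simp add: abs_le_iff)
   moreover have "(sqrt K*norm x)^2 = norm x*norm x*K" unfolding power_mult_distrib using K(1) by (simp add: power2_eq_square)
   ultimately show ?thesis unfolding ipn_sq by simp
  qed
 qed (use K(1) in simp)
 thus ?thesis using that[of "sqrt K"] K(1) by simp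
qed

lemma ipn_tendsto: "(f ---> a) F ==> ((%x. ipn (f x)) ---> ipn a) F" unfolding ipn_def by (intro tendsto_real_sqrt ip.tendsto)

lemma ip_sq_diff: "ip (a-b) (a-b) = ip a a-2*ip a b+ip b b" by (simp add: ip_simps sym[of b a])

lemma ip_sq_add: "ip (a+b) (a+b) = ip a a+2*ip a b+ip b b" by (simp add: ip_simps sym[of b a])

lemma projection: assumes V: "subspace V" "closed V"
 obtains p where "p : V" "!!v. v : V ==> ip (y-p) v = 0"
proof -
 have V0: "0 : V" using V(1) by (rule subspace_0)
 define d where "d = Inf ((%v. ip (y-v) (y-v)) ` V)"
 have bdd: "bdd_below ((%v. ip (y-v) (y-v)) ` V)" by (rule bdd_belowI[of _ 0]) (auto simp: ip_nonneg)
 have dle: "d <= ip (y-v) (y-v)" if "v : V" for v unfolding d_def using that bdd by (intro cInf_lower) auto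
 have "EX v:V. ip (y-v) (y-v) < d+1/Suc n" for n
 proof -
  have "d < d+1/Suc n" by simp
  then obtain z where "z : (%v. ip (y-v) (y-v)) ` V" "z < d+1/Suc n" unfolding d_def using cInf_lessD[of "(%v. ip (y-v) (y-v)) ` V"] V0 by blast
  thus ?thesis by auto
 qed
 then obtain u where u: "!!n. u n : V" "!!n. ip (y-u n) (y-u n) < d+1/Suc n" by metis
 have par: "ip (u n-u k) (u n-u k) <= 2/Suc n+2/Suc k" for n k
 proof -
  let ?a = "y-u n" and ?b = "y-u k"
  have "(1/2)*.(u n+u k) : V" using V(1) u by (intro subspace_mul subspace_add)
  hence "d <= ip (y-(1/2)*.(u n+u k)) (y-(1/2)*.(u n+u k))" by (rule dle)
  also have "y-(1/2)*.(u n+u k) = (1/2)*.(?a + ?b)"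
  proof -
   have "?a + ?b = (y+y)-(u n+u k)" by simp
   thus ?thesis by (simp only: scaleR_diff_right scaleR_half_double)
  qed
  also have "ip ... ... = (1/4)*(ip ?a ?a+2*ip ?a ?b+ip ?b ?b)" by (simp only: ip.scaleR_left ip.scaleR_right ip_sq_add) simp
  finally have 1: "4*d <= ip ?a ?a+2*ip ?a ?b+ip ?b ?b" by simp
  have "u n-u k = ?b - ?a" by simp
  hence "ip (u n-u k) (u n-u k) = ip ?b ?b-2*ip ?b ?a+ip ?a ?a" by (simp only: ip_sq_diff)
  moreover have "ip ?b ?a = ip ?a ?b" by (rule sym)
  moreover have "1/real (Suc n)*2 = 2/real (Suc n)" "1/real (Suc k)*2 = 2/real (Suc k)" by simp_all
  ultimately show ?thesis using 1 u(2)[of n] u(2)[of k] by linarith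
 qed
 have "Cauchy u"
 proof (rule metric_CauchyI)
  fix e :: real assume e: "0 < e"
  obtain N where N: "4/(m*e^2) < real N" using reals_Archimedean2 by blast
  have "dist (u n) (u k) < e" if "N <= n" "N <= k" for n k
  proof -
   have "m*(norm (u n-u k))^2 <= 2/Suc n+2/Suc k" using coercive par order_trans by blast
   also have "... <= 2/Suc N+2/Suc N" using that by (intro add_mono divide_left_mono) auto
   also have "2/real (Suc N)+2/real (Suc N) = 4/real (Suc N)" by (simp only: add_divide_distrib[symmetric]) simp
   also have "... < m*e^2"
   proof -
    have "4 < real N*(m*e^2)" using N e m by (simp add: field_simps)
    also have "... <= real (Suc N)*(m*e^2)" using m by (intro mult_right_mono) auto
    finally show ?thesis by (subst pos_divide_less_eq) (simp_all only: of_nat_0_less_iff zero_less_Suc mult.commute)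
   qed
   finally have "(norm (u n-u k))^2 < e\<^sup>2" using m by simp
   thus ?thesis using e by (simp add: dist_norm power2_less_imp_less)
  qed
  thus "EX N. ALL n>=N. ALL k>=N. dist (u n) (u k) < e" by blast
 qed
 then obtain p where p: "u ----> p" using Cauchy_convergent convergentD by blast
 have pV: "p : V" using V(2) u(1) p by (rule closed_sequentially)
 have "(%n. ip (y-u n) (y-u n)) ----> ip (y-p) (y-p)" by (intro ip.tendsto tendsto_intros p)
 moreover have "(%n. d+1/Suc n) ----> d+0" by (intro tendsto_intros LIMSEQ_Suc[OF lim_1_over_n])
 ultimately have "ip (y-p) (y-p) <= d+0" by (rule LIMSEQ_le) (intro exI[of _ 0] allI impI less_imp_le u(2))
 hence min: "ip (y-p) (y-p) <= d" by simp
 have "ip (y-p) v = 0" if v: "v : V" for v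
 proof (cases "v = 0")
  case False
  hence pos: "0 < ip v v" using ip_zero_iff[of v] ip_nonneg[of v] by linarith
  let ?t = "ip (y-p) v/ip v v"
  have "p + ?t*.v : V" using V(1) pV v by (intro subspace_add subspace_mul)
  hence "ip (y-p) (y-p) <= ip (y-(p + ?t*.v)) (y-(p + ?t*.v))" using min dle by (meson order_trans)
  also have "y-(p + ?t*.v) = (y-p) - ?t*.v" by simp
  also have "ip ... ... = ip (y-p) (y-p)-(ip (y-p) v)^2/ip v v"
  proof -
   have "ip ((y-p) - ?t*.v) ((y-p) - ?t*.v) = ip (y-p) (y-p)-2*(?t*ip (y-p) v) + ?t*(?t*ip v v)"
    by (simp only: ip_sq_diff ip.scaleR_left ip.scaleR_right real_scaleR_def)
   also have "?t*ip v v = ip (y-p) v" using pos by simp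
   finally show ?thesis by (simp only: power2_eq_square) simp
  qed
  finally have "(ip (y-p) v)^2/ip v v <= 0" by simp
  thus ?thesis using pos by (simp add: divide_le_0_iff)
 qed (simp add: ip_simps)
 thus ?thesis using that pV by blast
qed

end

section \<open>Evolution equations for maximal monotone operators\<close>

lemma uniform_limit_compact_of_pointwise:
 fixes S :: "nat => real => 'h::banach endo" assumes bd: "!!n t x. t : A ==> norm (app (S n t) x) <= C*norm x"
  and lim: "!!x. uniformly_Cauchy_on A (%n t. app (S n t) x)" and K: "compact K" and e: "0 < e"
 shows "EX N. ALL n>=N. ALL k>=N. ALL t:A. ALL x:K. norm (app (S n t) x-app (S k t) x) < e"
proof (cases "A = {}")
 case False
 interpret app: bounded_bilinear app by (rule bounded_bilinear_app)
 define C' where "C' = max C 1"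
 have "norm (app (S n t) x) <= C'*norm x" if "t : A" for n t x by (rule order_trans[OF bd[OF that] mult_right_mono]) (auto simp: C'_def)
 moreover have "1 <= C'" by (simp add: C'_def)
 ultimately have C': "1 <= C'" "!!n t x. t : A ==> norm (app (S n t) x) <= C'*norm x" by blast+
 define d where "d = e/(3*C')"
 have d: "0 < d" using e C'(1) by (simp add: d_def)
 obtain F where F: "finite F" "F \<subseteq> K" "K \<subseteq> (\<Union>x\<in>F. ball x d)"
 proof (rule compactE_image[OF K, of K "%x. ball x d"])
  show "K \<subseteq> (\<Union>x\<in>K. ball x d)" using d by auto
 qed auto
 have "EX N. ALL t:A. ALL n>=N. ALL k>=N. dist (app (S n t) x) (app (S k t) x) < e/3" for x
  using lim[of x, unfolded uniformly_Cauchy_on_def, THEN spec, of "e/3", THEN mp] e by simp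
 then obtain N where N: "!!x t n k. t : A ==> N x <= n ==> N x <= k ==> dist (app (S n t) x) (app (S k t) x) < e/3" by metis
 have "norm (app (S n t) x-app (S k t) x) < e"
  if n: "Max (insert 0 (N ` F)) <= n" "Max (insert 0 (N ` F)) <= k" and t: "t : A" and x: "x : K" for n k t x
 proof -
  obtain y where y: "y : F" "dist y x < d" using F(3) x by auto
  have "N y <= Max (insert 0 (N ` F))" using F(1) y(1) by (intro Max_ge) auto
  hence b: "norm (app (S n t) y-app (S k t) y) < e/3" using N[OF t, of y n k] n by (simp add: dist_norm)
  have c: "norm (app (S j t) (x-y)) < e/3" for j
  proof -
   have "norm (app (S j t) (x-y)) <= C'*norm (x-y)" by (rule C'(2)[OF t])
   also have "... < C'*d" using C'(1) y(2) by (simp add: dist_norm norm_minus_commute)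
   also have "... = e/3" using C'(1) by (simp add: d_def)
   finally show ?thesis .
  qed
  have eq: "app (S n t) x-app (S k t) x = app (S n t) (x-y)+(app (S n t) y-app (S k t) y)-app (S k t) (x-y)" by (simp add: app.diff_right)
  have "norm (a+b-c) <= norm a+norm b+norm c" for a b c :: 'h using norm_triangle_ineq4[of "a+b" c] norm_triangle_ineq[of a b] by linarith
  hence "norm (app (S n t) x-app (S k t) x) <= norm (app (S n t) (x-y))+norm (app (S n t) y-app (S k t) y)+norm (app (S k t) (x-y))" unfolding eq .
  thus ?thesis using b c[of n] c[of k] by linarith
 qed
 thus ?thesis by blast
qed simp

lemma exp_commuting:
 fixes a b :: "'a::{real_normed_algebra_1, banach}" assumes "a*b = b*a" shows "exp a*b = b*exp a" using power_commuting_commutes[OF assms]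
 by (simp add: exp_def suminf_mult[symmetric] suminf_mult2 summable_exp_generic)

locale max_monotone = inner_form ip m for ip :: "'h::{banach, perfect_space} => 'h => real" and m +
 fixes D :: "'h set" and M :: "'h => 'h" assumes D: "subspace D" and M_add: "!!x y. x : D ==> y : D ==> M (x+y) = M x+M y"
  and M_scale: "!!a x. x : D ==> M (a*.x) = a*.M x" and mono: "!!x. x : D ==> 0 <= ip (M x) x" and range: "!!l y. 0 < l ==> EX x:D. x+l*.M x = y"
begin

lemma M_diff: "x : D ==> y : D ==> M (x-y) = M x-M y" using M_add[of x "- y"] M_scale[of y "-1"] subspace_neg[OF D, of y] by simp

lemma resolvent_bound: assumes "0 < l" "x : D" shows "ipn x <= ipn (x+l*.M x)"
proof (cases "x = 0")
 case True
 hence "ipn x = 0" by (simp add: ipn_def ip_simps)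
 thus ?thesis by (metis ipn_nonneg)
next
 case False
 hence pos: "0 < ipn x" using ip_zero_iff[of x] ip_nonneg[of x] by (simp add: ipn_def)
 have "ipn x*ipn x = ip x x" using ipn_sq[of x] by (simp add: power2_eq_square)
 also have "... <= ip (x+l*.M x) x" using mono[OF assms(2)] assms(1) by (simp add: ip_simps)
 also have "... <= ipn (x+l*.M x)*ipn x" by (rule ip_cauchy_schwarz)
 finally show ?thesis using pos by simp
qed

definition "res l y = (SOME x. x : D & x+l*.M x = y)"

lemma res: assumes "0 < l" shows "res l y : D" "res l y+l*.M (res l y) = y"
proof -
 have "EX x. x : D & x+l*.M x = y" using range[OF assms, of y] by blast
 from someI_ex[OF this] show "res l y : D" "res l y+l*.M (res l y) = y" by (simp_all add: res_def)
qed

lemma res_unique: assumes l: "0 < l" and x: "x : D" "x+l*.M x = y" shows "res l y = x"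
proof -
 have d: "res l y-x : D" using res(1)[OF l] x(1) D by (intro subspace_diff)
 have "(res l y-x)+l*.M (res l y-x) = 0" using res[OF l, of y] x by (simp add: M_diff scaleR_diff_right algebra_simps)
 hence "ipn (res l y-x) <= 0" using resolvent_bound[OF l d] by (simp add: ipn_def ip_simps)
 hence "ip (res l y-x) (res l y-x) = 0" using ipn_sq ipn_nonneg by (metis order_antisym power_zero_numeral)
 thus ?thesis using ip_zero_iff by simp
qed

lemma bl_res: assumes l: "0 < l" shows "bounded_linear (res l)"
proof -
 obtain c where c: "0 < c" "!!x. ipn x <= c*norm x" using ipn_le_norm by blast
 show ?thesis
 proof (rule bounded_linear_intro)
  fix x y and a :: real
  show "res l (x+y) = res l x+res l y" using res[OF l, of x] res[OF l, of y] D
   by (intro res_unique[OF l] subspace_add) (simp_all add: M_add scaleR_add_right algebra_simps)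
  have "a*.res l x+l*.M (a*.res l x) = a*.(res l x+l*.M (res l x))" using res(1)[OF l] by (simp add: M_scale scaleR_add_right mult.commute)
  thus "res l (a*.x) = a*.res l x" using res[OF l, of x] D by (intro res_unique[OF l] subspace_scale) simp_all
  have "norm (res l x) <= ipn (res l x)/sqrt m" by (rule norm_le_ipn)
  also have "... <= ipn x/sqrt m" using resolvent_bound[OF l res(1)[OF l], of x] res(2)[OF l, of x] m by (intro divide_right_mono) auto
  also have "... <= (c*norm x)/sqrt m" using c(2) m by (intro divide_right_mono) auto
  finally show "norm (res l x) <= norm x*(c/sqrt m)" by (simp add: mult.commute)
 qed
qed

definition "R l = (SOME a. ALL x. app a x = res l x)"

lemma app_R: "0 < l ==> app (R l) x = res l x" unfolding R_def using someI_ex[OF app_lift[OF bl_res]] by blast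

lemma R_commute: assumes l: "0 < l" "0 < k" shows "R l*R k = R k*R l"
proof (rule endo_eqI)
 fix y
 let ?x = "res k y" let ?z = "res l ?x"
 note x = res[OF l(2), of y] and z = res[OF l(1), of ?x]
 have "l*.M ?z = ?x - ?z" using z(2) by (simp add: algebra_simps)
 hence "M ?z = (1/l)*.(?x - ?z)" using l(1) by (metis divide_inverse less_irrefl mult_1 right_inverse scaleR_one scaleR_scaleR inverse_eq_divide vector_fraction_eq_iff)
 hence Mz: "M ?z : D" using x(1) z(1) D by (simp add: subspace_diff subspace_scale)
 let ?w = "?z+k*.M ?z"
 have w: "?w : D" using z(1) Mz D by (intro subspace_add subspace_scale)
 have "?w+l*.M ?w = (?z+l*.M ?z)+k*.M (?z+l*.M ?z)" using z(1) Mz D by (simp add: M_add M_scale subspace_scale scaleR_add_right algebra_simps)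
 also have "... = y" using x(2) z(2) by simp
 finally have "res l y = ?w" by (rule res_unique[OF l(1) w])
 moreover have "res k ?w = ?z" by (rule res_unique[OF l(2) z(1) refl])
 ultimately show "app (R l*R k) y = app (R k*R l) y" using l by (simp add: app_mult app_R)
qed

definition "Y l = (1/l)*.(1-R l)"

sublocale app: bounded_bilinear "app :: 'h endo => 'h => 'h" by (rule bounded_bilinear_app)

lemma app_Y: assumes l: "0 < l" shows "app (Y l) x = M (res l x)"
proof -
 have "app (Y l) x = (1/l)*.(x-res l x)" using l by (simp add: Y_def app.scaleR_left app.diff_left app_R)
 also have "x-res l x = l*.M (res l x)" using res(2)[OF l, of x] by (metis add_diff_cancel_left')
 finally show ?thesis using l by simp
qed

lemma app_Y_D: assumes l: "0 < l" and x: "x : D" shows "app (Y l) x = res l (M x)"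
proof -
 have "res l (x+l*.M x) = x" by (rule res_unique[OF l x refl])
 hence "res l x+l*.res l (M x) = x" using bl_res[OF l] by (simp add: linear_simps bounded_linear.linear)
 hence "x-res l x = l*.res l (M x)" by (metis add_diff_cancel_left')
 moreover have "app (Y l) x = (1/l)*.(x-res l x)" using l by (simp add: Y_def app.scaleR_left app.diff_left app_R)
 ultimately show ?thesis using l by simp
qed

lemma Y_mono: assumes l: "0 < l" shows "0 <= ip (app (Y l) x) x"
proof -
 let ?y = "res l x"
 have "ip (app (Y l) x) x = ip (M ?y) (?y+l*.M ?y)" using res(2)[OF l, of x] l by (simp add: app_Y)
 also have "... = ip (M ?y) ?y+l*ip (M ?y) (M ?y)" by (simp add: ip_simps)
 finally show ?thesis using mono[OF res(1)[OF l]] ip_nonneg l by simp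
qed

lemma Y_commute: "0 < l ==> 0 < k ==> Y l*Y k = Y k*Y l" using R_commute[of l k] by (simp add: Y_def algebra_simps)

definition "S l t = exp ((- t)*.Y l)"

lemma S_deriv: "((%t. S l t) has_vector_derivative-(Y l*S l t)) (at t within A)"
proof -
 have "((%t. exp (t*.(- Y l))) has_vector_derivative (- Y l)*exp (t*.(- Y l))) (at t)" by (rule exp_scaleR_has_vector_derivative_left)
 thus ?thesis by (simp add: S_def has_vector_derivative_at_within)
qed

lemma S_cont: "continuous_on A (S l)" unfolding continuous_on_eq_continuous_within using has_vector_derivative_continuous[OF S_deriv] by blast

lemma S_app_deriv: "((%t. app (S l t) x) has_vector_derivative-app (Y l) (app (S l t) x)) (at t within A)"
 using bounded_linear.has_vector_derivative[OF app.bounded_linear_left[of x] S_deriv[of l t A]] by (simp add: app.minus_left app_mult)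

lemma S_0 [simp]: "S l 0 = 1" by (simp add: S_def)

lemma S_inverse: "S l t*S l (- t) = 1" "S l (- t)*S l t = 1"
 using exp_minus_inverse[of "t*.Y l"] exp_minus_inverse[of "- (t*.Y l)"] by (simp_all add: S_def)

lemma S_contraction: assumes l: "0 < l" and t: "0 <= t" shows "ipn (app (S l t) x) <= ipn x"
proof -
 let ?f = "%t. app (S l t) x"
 have "(%t. ip (?f t) (?f t)) t <= (%t. ip (?f t) (?f t)) 0"
 proof (rule DERIV_nonpos_imp_nonincreasing[OF t])
  fix r assume "0 <= r" "r <= t"
  have "((%t. ip (?f t) (?f t)) has_vector_derivative ip (?f r) (- app (Y l) (?f r))+ip (- app (Y l) (?f r)) (?f r)) (at r)"
   by (rule ip.has_vector_derivative[OF S_app_deriv S_app_deriv])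
  hence "((%t. ip (?f t) (?f t)) has_field_derivative-2*ip (app (Y l) (?f r)) (?f r)) (at r)"
   by (simp add: has_real_derivative_iff_has_vector_derivative ip_simps sym[of "?f r" "app (Y l) (?f r)"])
  thus "EX y. ((%t. ip (?f t) (?f t)) has_field_derivative y) (at r) & y <= 0" using Y_mono[OF l, of "?f r"] by (intro exI conjI) auto
 qed
 thus ?thesis by (simp add: ipn_def)
qed

text \<open>Differentiating \<open>S l (t - r) * S k r\<close> in \<open>r\<close> compares the two Yosida semigroups.\<close>

lemma S_difference: assumes l: "0 < l" "0 < k" and t: "0 <= t" shows "ipn (app (S l t) x-app (S k t) x) <= t*ipn (app (Y l) x-app (Y k) x)"
proof (cases "t = 0")
 case False
 hence t: "0 < t" using t by simp
 let ?f = "%r. app (S l (t-r)) (app (S k r) x)"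
 let ?u = "app (Y l) x-app (Y k) x"
 define v where "v = app (S l t) x-app (S k t) x"
 have comm: "Y l*S k r = S k r*Y l" for r unfolding S_def by (rule exp_commuting[symmetric]) (simp add: Y_commute[OF l])
 have fd: "(?f has_vector_derivative app (S l (t-r)) (app (S k r) ?u)) (at r)" for r
 proof -
  have g: "((%r. t-r) has_vector_derivative -1) (at r)"
   by (auto intro!: derivative_eq_intros simp: has_real_derivative_iff_has_vector_derivative[symmetric])
  have "((%r. S l (t-r)) has_vector_derivative Y l*S l (t-r)) (at r)" using vector_diff_chain_at[OF g S_deriv[of l "t-r" UNIV]] by (simp add: o_def)
  from app.has_vector_derivative[OF this S_app_deriv[of k x r UNIV]]
  have "(?f has_vector_derivative app (S l (t-r)) (- app (Y k) (app (S k r) x))+app (Y l*S l (t-r)) (app (S k r) x)) (at r)" .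
  moreover have "Y l*S l (t-r) = S l (t-r)*Y l" unfolding S_def by (rule exp_times_scaleR_commute[symmetric])
  moreover have "app (Y l) (app (S k r) x) = app (S k r) (app (Y l) x)" using comm[of r] by (metis app_mult)
  moreover have "app (Y k) (app (S k r) x) = app (S k r) (app (Y k) x)" using exp_times_scaleR_commute[of "- r" "Y k"] by (metis S_def app_mult)
  ultimately show ?thesis by (simp add: app_mult app.minus_right app.diff_right)
 qed
 have bd: "ipn (app (S l (t-r)) (app (S k r) ?u)) <= ipn ?u" if "0 <= r" "r <= t" for r
  using S_contraction[OF l(1), of "t-r"] S_contraction[OF l(2), of r] that by (metis diff_ge_0_iff_ge order_trans)
 have dv: "((%r. ip (?f r) v) has_field_derivative ip (app (S l (t-r)) (app (S k r) ?u)) v) (at r)" for r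
  using bounded_linear.has_vector_derivative[OF ip.bounded_linear_left[of v] fd[of r]] by (simp add: has_real_derivative_iff_has_vector_derivative)
 obtain z where z: "0 < z" "z < t" "ip (?f t) v-ip (?f 0) v = (t-0)*ip (app (S l (t-z)) (app (S k z) ?u)) v" using MVT2[OF t dv] by blast
 have "ipn v * ipn v = - (ip (?f t) v-ip (?f 0) v)" using ipn_sq[of v] by (simp add: v_def power2_eq_square ip_simps)
 also have "... = t*ip (- app (S l (t-z)) (app (S k z) ?u)) v" using z(3) by (simp add: ip_simps)
 also have "... <= t*(ipn (- app (S l (t-z)) (app (S k z) ?u))*ipn v)" using t by (intro mult_left_mono ip_cauchy_schwarz) auto
 also have "ipn (- app (S l (t-z)) (app (S k z) ?u)) = ipn (app (S l (t-z)) (app (S k z) ?u))" by (simp add: ipn_def ip_simps)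
 also have "t*(ipn (app (S l (t-z)) (app (S k z) ?u))*ipn v) <= t*(ipn ?u*ipn v)"
  using t z bd[of z] ipn_nonneg by (intro mult_left_mono mult_right_mono) auto
 finally have "ipn v * ipn v <= (t*ipn ?u)*ipn v" by (simp add: mult.assoc)
 moreover have "0 <= t*ipn ?u" using t ipn_nonneg by simp
 ultimately show ?thesis using ipn_nonneg[of v] unfolding v_def[symmetric] by (cases "ipn v = 0") (auto simp: mult_le_cancel_right)
qed (simp add: ipn_def ip_simps)

lemma uniform_bound:
 obtains C where "1 <= C" "!!l t x. 0 < l ==> 0 <= t ==> norm (app (S l t) x) <= C*norm x"
  "!!l x. 0 < l ==> norm (res l x) <= C*norm x" "!!x. norm x <= C*ipn x"  "!!x. ipn x <= C*norm x"
proof -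
 obtain c where c: "0 < c" "!!x. ipn x <= c*norm x" using ipn_le_norm by blast
 define C where "C = max 1 (max (c/sqrt m) (max (1/sqrt m) c))"
 have C: "1 <= C" "c/sqrt m <= C" "1/sqrt m <= C" "c <= C" by (auto simp: C_def)
 have *: "norm y <= C*norm x" if "ipn y <= ipn x" for x y
 proof -
  have "norm y <= ipn y/sqrt m" by (rule norm_le_ipn)
  also have "... <= (c*norm x)/sqrt m" using that c(2)[of x] m by (intro divide_right_mono) auto
  also have "... <= C*norm x" using mult_right_mono[OF C(2), of "norm x"] by simp
  finally show ?thesis .
 qed
 show ?thesis
 proof (rule that[of C])
  show "norm (app (S l t) x) <= C*norm x" if "0 < l" "0 <= t" for l t x by (rule *[OF S_contraction[OF that]])
  show "norm (res l x) <= C*norm x" if "0 < l" for l x using resolvent_bound[OF that res(1)[OF that], of x] res(2)[OF that, of x] by (intro *) simp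
  show "norm x <= C*ipn x" for x using norm_le_ipn[of x] mult_right_mono[OF C(3) ipn_nonneg[of x]] by simp
  show "ipn x <= C*norm x" for x using c(2)[of x] mult_right_mono[OF C(4), of "norm x"] by simp
 qed (rule C)
qed

lemma D_dense: "closure D = UNIV"
proof (rule ccontr)
 assume "closure D ~= UNIV"
 then obtain y where y: "y \<notin> closure D" by blast
 have "subspace (closure D)"
 proof (rule subspaceI)
  show "0 : closure D" using subspace_0[OF D] closure_subset by blast
 next
  fix u w assume "u : closure D" "w : closure D"
  then obtain a b where ab: "!!n. a n : D" "a ----> u" "!!n. b n : D" "b ----> w" unfolding closure_sequential by blast
  hence "!!n. a n+b n : D" "(%n. a n+b n) ----> u+w" using D by (auto intro: subspace_add tendsto_add)
  thus "u+w : closure D" unfolding closure_sequential by (intro exI[of _ "%n. a n+b n"] conjI allI)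
 next
  fix c u assume "u : closure D"
  then obtain a where a: "!!n. a n : D" "a ----> u" unfolding closure_sequential by blast
  hence "!!n. c*.a n : D" "(%n. c*.a n) ----> c*.u" using D by (auto intro: subspace_scale tendsto_scaleR)
  thus "c*.u : closure D" unfolding closure_sequential by (intro exI[of _ "%n. c*.a n"] conjI allI)
 qed
 then obtain p where p: "p : closure D" "!!v. v : closure D ==> ip (y-p) v = 0" using projection[of "closure D" y] by auto
 obtain x where x: "x : D" "x+1*.M x = y-p" using range[of 1 "y-p"] by auto
 have "ip (y-p) x = 0" using p(2) x(1) closure_subset by blast
 hence "ip x x+ip (M x) x = 0" using x(2) by (metis ip.add_left scaleR_one)
 hence "ip x x = 0" using mono[OF x(1)] ip_nonneg[of x] by linarith
 hence "x = 0" by (simp add: ip_zero_iff)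
 hence "M x = 0" using M_scale[OF subspace_0[OF D], of 0] by simp
 hence "y = p" using x(2) \<open>x = 0\<close> by simp
 with p(1) y show False by simp
qed

definition "lam n = 1/real (Suc n)"

lemma lam_pos: "0 < lam n" by (simp add: lam_def)

lemma lam_lim: "lam ----> 0" unfolding lam_def[abs_def] by (rule LIMSEQ_Suc[OF lim_1_over_n])

lemma res_lim: "(%n. res (lam n) y) ----> y"
proof (rule LIMSEQ_I)
 fix e :: real assume e: "0 < e"
 obtain C where C: "1 <= C" "!!l x. 0 < l ==> norm (res l x) <= C*norm x" using uniform_bound by metis
 have "0 < e/(4*C)" using e C(1) by simp
 then obtain x where x: "x : D" "dist x y < e/(4*C)" using D_dense closure_approachable by (metis UNIV_I)
 have "(%n. lam n*(C*norm (M x))) ----> 0*(C*norm (M x))" by (intro tendsto_mult lam_lim tendsto_const)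
 hence "(%n. lam n*(C*norm (M x))) ----> 0" by simp
 then obtain N where N: "!!n. N <= n ==> norm (lam n*(C*norm (M x))-0) < e/4" using LIMSEQ_D e by (metis divide_pos_pos zero_less_numeral)
 have "norm (res (lam n) y-y) < e" if "N <= n" for n
 proof -
  interpret r: bounded_linear "res (lam n)" by (rule bl_res[OF lam_pos])
  have "x-res (lam n) x = lam n*.res (lam n) (M x)"
  proof -
   have "res (lam n) (x+lam n*.M x) = x" by (rule res_unique[OF lam_pos x(1) refl])
   thus ?thesis by (metis add_diff_cancel_left' r.add r.scaleR)
  qed
  hence "norm (x-res (lam n) x) = lam n*norm (res (lam n) (M x))" using lam_pos[of n] by simp
  also have "... <= lam n*(C*norm (M x))" using lam_pos[of n] by (intro mult_left_mono C(2)) auto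
  also have "... < e/4" using N[OF that] by (simp add: abs_less_iff)
  finally have 1: "norm (x-res (lam n) x) < e/4" .
  have "C*norm (x-y) < C*(e/(4*C))" using x(2) C(1) by (intro mult_strict_left_mono) (auto simp: dist_norm)
  hence 3: "C*norm (x-y) < e/4" using C(1) by simp
  hence 2: "norm (res (lam n) (y-x)) < e/4" using C(2)[OF lam_pos, of n "y-x"] by (simp add: norm_minus_commute)
  have "1*norm (x-y) <= C*norm (x-y)" by (rule mult_right_mono[OF C(1)]) simp
  hence 4: "norm (x-y) < e/4" using 3 by simp
  have eq: "res (lam n) y-y = res (lam n) (y-x)-(x-res (lam n) x)+(x-y)" by (simp add: r.diff)
  have "norm (a-b+c) <= norm a+norm b+norm c" for a b c :: 'h using norm_triangle_ineq[of "a-b" c] norm_triangle_ineq4[of a b] by linarith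
  hence "norm (res (lam n) y-y) <= norm (res (lam n) (y-x))+norm (x-res (lam n) x)+norm (x-y)" unfolding eq .
  thus ?thesis using 1 2 4 e by linarith
 qed
 thus "EX N. ALL n>=N. norm (res (lam n) y-y) < e" by blast
qed

end

context max_monotone
begin

lemma S_add: "S l (a+b) = S l a*S l b"
proof -
 have "- (a+b)*.Y l = (- a)*.Y l+(- b)*.Y l" by (simp add: scaleR_left_diff_distrib)
 thus ?thesis unfolding S_def by (simp only:) (rule exp_add_commuting, simp)
qed

lemma Y_lim: assumes x: "x : D" shows "(%n. app (Y (lam n)) x) ----> M x" using res_lim[of "M x"] by (simp add: app_Y_D[OF lam_pos x])

lemma S_uniformly_Cauchy: assumes T: "0 <= T" shows "uniformly_Cauchy_on {0..T} (%n t. app (S (lam n) t) x)"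
proof -
 obtain C where C: "1 <= C" "!!l t x. 0 < l ==> 0 <= t ==> norm (app (S l t) x) <= C*norm x"
  "!!x. norm x <= C*ipn x"  "!!x. ipn x <= C*norm x" using uniform_bound by metis
 have inD: "EX N. ALL n>=N. ALL k>=N. ALL t:{0..T}. norm (app (S (lam n) t) x-app (S (lam k) t) x) < e" if x: "x : D" and e: "0 < e" for x e
 proof -
  define d where "d = e/(C*(T*C)+1)"
  have p: "0 < C*(T*C)+1" using C(1) T by (intro add_nonneg_pos) auto
  have d: "0 < d" using e p by (simp add: d_def)
  have "Cauchy (%n. app (Y (lam n)) x)" by (rule LIMSEQ_imp_Cauchy[OF Y_lim[OF x]])
  then obtain N where N: "!!n k. N <= n ==> N <= k ==> norm (app (Y (lam n)) x-app (Y (lam k)) x) < d" using d unfolding Cauchy_iff by blast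
  have "norm (app (S (lam n) t) x-app (S (lam k) t) x) < e" if n: "N <= n" "N <= k" and t: "t : {0..T}" for n k t
  proof -
   let ?u = "app (Y (lam n)) x-app (Y (lam k)) x"
   have "norm (app (S (lam n) t) x-app (S (lam k) t) x) <= C*ipn (app (S (lam n) t) x-app (S (lam k) t) x)" by (rule C(3))
   also have "... <= C*(t*ipn ?u)" using C(1) t by (intro mult_left_mono S_difference lam_pos) auto
   also have "... <= C*(T*(C*norm ?u))" using C(1) t ipn_nonneg C(4) by (intro mult_left_mono mult_mono) auto
   also have "... <= C*(T*(C*d))" using C(1) T N[OF n] by (intro mult_left_mono) auto
   also have "... = (C*(T*C))*d" by simp
   also have "... < (C*(T*C)+1)*d" using d by (simp add: distrib_right)
   also have "... = e" using p by (simp add: d_def)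
   finally show ?thesis .
  qed
  thus ?thesis by blast
 qed
 show ?thesis unfolding uniformly_Cauchy_on_def
 proof (intro allI impI)
  fix e :: real assume e: "0 < e"
  have "0 < e/(4*C)" using e C(1) by simp
  then obtain z where z: "z : D" "dist z x < e/(4*C)" using D_dense closure_approachable[of x D] by auto
  have "0 < e/4" using e by simp
  from inD[OF z(1) this] obtain N where N0: "ALL n>=N. ALL k>=N. ALL t:{0..T}. norm (app (S (lam n) t) z-app (S (lam k) t) z) < e/4" by (rule exE)
  have N: "norm (app (S (lam n) t) z-app (S (lam k) t) z) < e/4" if "N <= n" "N <= k" "t : {0..T}" for n k t using N0 that by blast
  have "dist (app (S (lam n) t) x) (app (S (lam k) t) x) < e" if n: "N <= n" "N <= k" and t: "t : {0..T}" for n k t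
  proof -
   have c: "norm (app (S (lam j) t) (x-z)) < e/4" for j
   proof -
    have "norm (app (S (lam j) t) (x-z)) <= C*norm (x-z)" by (rule C(2)[OF lam_pos]) (use t in auto)
    also have "... < C*(e/(4*C))" using C(1) z(2) by (intro mult_strict_left_mono) (auto simp: dist_norm norm_minus_commute)
    also have "... = e/4" using C(1) by simp
    finally show ?thesis .
   qed
   have eq: "app (S (lam n) t) x-app (S (lam k) t) x = app (S (lam n) t) (x-z)+(app (S (lam n) t) z-app (S (lam k) t) z)-app (S (lam k) t) (x-z)"
    by (simp add: app.diff_right)
   have "norm (a+b-c) <= norm a+norm b+norm c" for a b c :: 'h using norm_triangle_ineq4[of "a+b" c] norm_triangle_ineq[of a b] by linarith
   hence "norm (app (S (lam n) t) x-app (S (lam k) t) x) <= norm (app (S (lam n) t) (x-z))+norm (app (S (lam n) t) z-app (S (lam k) t) z)+norm (app (S (lam k) t) (x-z))"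
    unfolding eq .
   thus ?thesis using c[of n] c[of k] N[OF n t] e unfolding dist_norm by linarith
  qed
  thus "EX M. ALL t:{0..T}. ALL m>=M. ALL n>=M. dist (app (S (lam m) t) x) (app (S (lam n) t) x) < e" by blast
 qed
qed

definition "duh l G t = app (S l t) (integral {0..t} (%r. app (S l (- r)) (G r)))"

lemma S_cont_comp: "continuous_on A f ==> continuous_on A (%x. S l (f x))" by (rule continuous_on_compose2[OF S_cont[of UNIV]]) auto

lemma duh_cont: "continuous_on {0..T} G ==> t <= T ==> continuous_on {0..t} (%r. app (S l (s-r)) (G r))"
 by (intro app.continuous_on S_cont_comp continuous_intros) (auto intro: continuous_on_subset)

lemma duh_eq: assumes G: "continuous_on {0..T} G" and t: "t : {0..T}" shows "duh l G t = integral {0..t} (%r. app (S l (t-r)) (G r))"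
proof -
 have c: "continuous_on {0..t} (%r. app (S l (- r)) (G r))" using duh_cont[OF G, of t l 0] t by simp
 have "duh l G t = integral {0..t} (app (S l t) \<circ> (%r. app (S l (- r)) (G r)))"
  unfolding duh_def by (rule integral_linear[symmetric, OF integrable_continuous_real[OF c] app.bounded_linear_right])
 also have "app (S l t) \<circ> (%r. app (S l (- r)) (G r)) = (%r. app (S l (t-r)) (G r))"
 proof
  fix r
  have "S l (t-r) = S l t*S l (- r)" using S_add[of l t "- r"] by simp
  thus "(app (S l t) \<circ> (%r. app (S l (- r)) (G r))) r = app (S l (t-r)) (G r)" by (simp add: app_mult)
 qed
 finally show ?thesis .
qed

lemma duh_uniformly_Cauchy: assumes T: "0 <= T" and G: "continuous_on {0..T} G" shows "uniformly_Cauchy_on {0..T} (%n t. duh (lam n) G t)"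
 unfolding uniformly_Cauchy_on_def
proof (intro allI impI)
 fix e :: real assume e: "0 < e"
 obtain C where C: "1 <= C" "!!l t x. 0 < l ==> 0 <= t ==> norm (app (S l t) x) <= C*norm x" using uniform_bound by metis
 have K: "compact (G ` {0..T})" by (rule compact_continuous_image[OF G]) simp
 define d where "d = e/(T+1)"
 have d: "0 < d" using e T by (simp add: d_def)
 have bd: "norm (app (S (lam n) t) x) <= C*norm x" if "t : {0..T}" for n t x by (rule C(2)[OF lam_pos]) (use that in auto)
 from uniform_limit_compact_of_pointwise[OF bd S_uniformly_Cauchy[OF T] K d]
 obtain N where N: "!!n k t x. N <= n ==> N <= k ==> t : {0..T} ==> x : G ` {0..T} ==> norm (app (S (lam n) t) x-app (S (lam k) t) x) < d" by blast
 have "dist (duh (lam n) G t) (duh (lam k) G t) < e" if n: "N <= n" "N <= k" and t: "t : {0..T}" for n k t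
 proof -
  have c: "continuous_on {0..t} (%r. app (S (lam j) (t-r)) (G r))" for j using duh_cont[OF G] t by auto
  have "duh (lam n) G t-duh (lam k) G t = integral {0..t} (%r. app (S (lam n) (t-r)) (G r)-app (S (lam k) (t-r)) (G r))"
   unfolding duh_eq[OF G t] by (rule integral_diff[symmetric]; rule integrable_continuous_real[OF c])
  also have "norm ... <= d*(t-0)"
  proof (rule integral_bound)
   show "continuous_on {0..t} (%r. app (S (lam n) (t-r)) (G r)-app (S (lam k) (t-r)) (G r))" by (intro continuous_on_diff c)
   show "norm (app (S (lam n) (t-r)) (G r)-app (S (lam k) (t-r)) (G r)) <= d" if "r : {0..t}" for r using N[OF n, of "t-r" "G r"] that t by auto
  qed (use t in auto)
  also have "... <= d*T" using d t by (intro mult_left_mono) auto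
  also have "... < d*(T+1)" using d by simp
  also have "... = e" using T by (simp add: d_def)
  finally show ?thesis by (simp add: dist_norm)
 qed
 thus "EX M. ALL t:{0..T}. ALL m>=M. ALL n>=M. dist (duh (lam m) G t) (duh (lam n) G t) < e" by blast
qed

lemma duh_bound: assumes l: "0 < l" and G: "continuous_on {0..T} G" and t: "t : {0..T}" and B: "!!r. r : {0..T} ==> ipn (G r) <= B"
 shows "ipn (duh l G t) <= T*B"
proof -
 let ?v = "duh l G t" and ?f = "%r. app (S l (t-r)) (G r)"
 have c: "continuous_on {0..t} ?f" using duh_cont[OF G] t by auto
 have "ip ?v ?v = ip (integral {0..t} ?f) ?v" by (simp only: duh_eq[OF G t, of l])
 also have "... = integral {0..t} ((%x. ip x ?v) \<circ> ?f)"
  by (rule integral_linear[symmetric, OF integrable_continuous_real[OF c] ip.bounded_linear_left])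
 also have "... <= norm (integral {0..t} ((%x. ip x ?v) \<circ> ?f))" by simp
 also have "... <= (B*ipn ?v)*(t-0)"
 proof (rule integral_bound)
  show "continuous_on {0..t} ((%x. ip x ?v) \<circ> ?f)" unfolding o_def by (intro ip.continuous_on c continuous_intros)
  fix r assume r: "r : {0..t}"
  have "ipn (?f r) <= B" using S_contraction[OF l, of "t-r" "G r"] B[of r] r t by auto
  hence "ipn (?f r)*ipn ?v <= B*ipn ?v" using ipn_nonneg by (intro mult_right_mono) auto
  moreover have "ip (?f r) ?v <= ipn (?f r)*ipn ?v" by (rule ip_cauchy_schwarz)
  moreover have "ip (- ?f r) ?v <= ipn (- ?f r)*ipn ?v" by (rule ip_cauchy_schwarz)
  moreover have "ip (- ?f r) ?v = - ip (?f r) ?v" "ipn (- ?f r) = ipn (?f r)" by (simp_all add: ipn_def ip_simps)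
  ultimately show "norm (((%x. ip x ?v) \<circ> ?f) r) <= B*ipn ?v" by (simp add: abs_le_iff)
 qed (use t in auto)
 also have "... = (t*B)*ipn ?v" by simp
 finally have "ipn ?v * ipn ?v <= (t*B)*ipn ?v" using ipn_sq[of ?v] by (simp add: power2_eq_square)
 moreover have B0: "0 <= B" using B[OF t] ipn_nonneg[of "G t"] by linarith
 ultimately have "ipn ?v <= t*B" using t ipn_nonneg[of ?v] by (cases "ipn ?v = 0") (auto simp: mult_le_cancel_right)
 also have "... <= T*B" using t B0 by (intro mult_right_mono) auto
 finally show ?thesis .
qed

theorem evolution_exists: assumes T: "0 < T" and x0: "x0 : D" and F: "!!t. t : {0..T} ==> (F has_vector_derivative F' t) (at t within {0..T})"
  and F': "continuous_on {0..T} F'"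
 obtains x g where "x 0 = x0" "continuous_on {0..T} g" "!!t. t : {0..T} ==> x t : D"
  "!!t. t : {0..T} ==> (x has_vector_derivative g t) (at t within {0..T})"
  "!!t. t : {0..T} ==> g t+M (x t) = F t"
  "!!B t. (!!r. r : {0..T} ==> ipn (F r) <= B) ==> t : {0..T} ==> ipn (x t) <= ipn x0+T*B"
proof -
 have T0: "0 <= T" using T by simp
 have Fc: "continuous_on {0..T} F" unfolding continuous_on_eq_continuous_within using has_vector_derivative_continuous[OF F] by blast
 obtain C where C: "1 <= C" "!!l t x. 0 < l ==> 0 <= t ==> norm (app (S l t) x) <= C*norm x"
  "!!l x. 0 < l ==> norm (res l x) <= C*norm x" using uniform_bound by metis
 define y where "y n t = app (S (lam n) t) x0+duh (lam n) F t" for n t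
 define g where "g n t = F t-app (Y (lam n)) (y n t)" for n t
 have ycomp: "y n t = app (S (lam n) t) (x0+integral {0..t} (%r. app (S (lam n) (- r)) (F r)))" for n t by (simp add: y_def duh_def app.add_right)
 have cS: "continuous_on {0..T} (%r. app (S (lam n) (- r)) (G r))" if "continuous_on {0..T} G" for n G using duh_cont[OF that, of T "lam n" 0] by simp
 have SS: "app (S (lam n) t) (app (S (lam n) (- t)) z) = z" for n t z using S_inverse(1)[of "lam n" t] by (metis app_mult app_one)
 have yd: "(y n has_vector_derivative g n t) (at t within {0..T})" if t: "t : {0..T}" for n t
 proof -
  let ?I = "%t. x0+integral {0..t} (%r. app (S (lam n) (- r)) (F r))"
  have "((%t. integral {0..t} (%r. app (S (lam n) (- r)) (F r))) has_vector_derivative app (S (lam n) (- t)) (F t)) (at t within {0..T})"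
   by (rule integral_has_vector_derivative[OF cS[OF Fc] t])
  hence "(?I has_vector_derivative 0+app (S (lam n) (- t)) (F t)) (at t within {0..T})"
   by (intro has_vector_derivative_add has_vector_derivative_const)
  from app.has_vector_derivative[OF S_deriv this]
  have "((%t. app (S (lam n) t) (?I t)) has_vector_derivative
   app (S (lam n) t) (0+app (S (lam n) (- t)) (F t))+app (- (Y (lam n)*S (lam n) t)) (?I t)) (at t within {0..T})" .
  moreover have "app (S (lam n) t) (0+app (S (lam n) (- t)) (F t))+app (- (Y (lam n)*S (lam n) t)) (?I t) = g n t"
   by (simp add: g_def ycomp SS app.minus_left app_mult)
  moreover have "(%t. app (S (lam n) t) (?I t)) = y n" by (simp add: fun_eq_iff ycomp)
  ultimately show ?thesis by simp
 qed
 have gd: "(g n has_vector_derivative F' t-app (Y (lam n)) (g n t)) (at t within {0..T})" if t: "t : {0..T}" for n t unfolding g_def[abs_def]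
  by (intro has_vector_derivative_diff F[OF t] bounded_linear.has_vector_derivative[OF app.bounded_linear_right] yd[OF t, unfolded g_def])
 have gform: "g n t = app (S (lam n) t) (F 0-app (Y (lam n)) x0)+duh (lam n) F' t" if t: "t : {0..T}" for n t
 proof -
  let ?w = "%t. app (S (lam n) (- t)) (g n t)"
  have wd: "(?w has_vector_derivative app (S (lam n) (- r)) (F' r)) (at r within {0..t})" if r: "r : {0..t}" for r
  proof -
   have rT: "r : {0..T}" using r t by auto
   have "((%t. exp (t*.Y (lam n))) has_vector_derivative exp (r*.Y (lam n))*Y (lam n)) (at r within {0..T})"
    by (rule exp_scaleR_has_vector_derivative_right)
   hence "((%t. S (lam n) (- t)) has_vector_derivative S (lam n) (- r)*Y (lam n)) (at r within {0..T})" by (simp add: S_def)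
   from app.has_vector_derivative[OF this gd[OF rT]]
   have "(?w has_vector_derivative app (S (lam n) (- r)) (F' r-app (Y (lam n)) (g n r))+app (S (lam n) (- r)*Y (lam n)) (g n r)) (at r within {0..T})" .
   hence "(?w has_vector_derivative app (S (lam n) (- r)) (F' r)) (at r within {0..T})" by (simp add: app.diff_right app_mult)
   thus ?thesis by (rule has_vector_derivative_within_subset) (use t in auto)
  qed
  have "((%r. app (S (lam n) (- r)) (F' r)) has_integral ?w t - ?w 0) {0..t}" by (rule fundamental_theorem_of_calculus[OF _ wd]) (use t in auto)
  hence "integral {0..t} (%r. app (S (lam n) (- r)) (F' r)) = ?w t - ?w 0" by (rule integral_unique)
  hence "duh (lam n) F' t = app (S (lam n) t) (?w t)-app (S (lam n) t) (?w 0)" by (simp add: duh_def app.diff_right)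
  moreover have "app (S (lam n) t) (?w t) = g n t" by (rule SS)
  moreover have "?w 0 = F 0-app (Y (lam n)) x0" by (simp add: g_def y_def duh_def app.zero_right)
  ultimately have "duh (lam n) F' t = g n t-app (S (lam n) t) (F 0-app (Y (lam n)) x0)" by (simp only:)
  thus ?thesis by simp
 qed
 have Slim: "EX f. uniform_limit {0..T} (%n t. app (S (lam n) t) x) f sequentially" for x
  using Cauchy_uniformly_convergent[OF S_uniformly_Cauchy[OF T0]] unfolding uniformly_convergent_on_def by blast
 have duhlim: "EX f. uniform_limit {0..T} (%n t. duh (lam n) G t) f sequentially" if "continuous_on {0..T} G" for G
  using Cauchy_uniformly_convergent[OF duh_uniformly_Cauchy[OF T0 that]] unfolding uniformly_convergent_on_def by blast
 obtain f1 f2 where f12: "uniform_limit {0..T} (%n t. app (S (lam n) t) x0) f1 sequentially"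
  "uniform_limit {0..T} (%n t. duh (lam n) F t) f2 sequentially" using Slim duhlim[OF Fc] by blast
 define x where "x t = f1 t+f2 t" for t
 have ylim: "uniform_limit {0..T} y x sequentially" unfolding y_def[abs_def] x_def[abs_def] by (rule uniform_limit_add[OF f12])
 define z where "z = F 0-M x0"
 obtain f3 f4 where f34: "uniform_limit {0..T} (%n t. app (S (lam n) t) z) f3 sequentially"
  "uniform_limit {0..T} (%n t. duh (lam n) F' t) f4 sequentially" using Slim duhlim[OF F'] by blast
 define gg where "gg t = (0+f3 t)+f4 t" for t
 have null: "uniform_limit {0..T} (%n t. app (S (lam n) t) (M x0-app (Y (lam n)) x0)) (%_. 0) sequentially"
 proof (rule uniform_limitI)
  fix e :: real assume e: "0 < e"
  have "(%n. C*norm (M x0-app (Y (lam n)) x0)) ----> C*norm (M x0-M x0)" by (intro tendsto_intros Y_lim x0)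
  hence "eventually (%n. C*norm (M x0-app (Y (lam n)) x0) < e) sequentially" using e by (intro order_tendstoD(2)) auto
  thus "\<forall>\<^sub>F n in sequentially. ALL t:{0..T}. dist (app (S (lam n) t) (M x0-app (Y (lam n)) x0)) 0 < e"
  proof eventually_elim
   case (elim n)
   have "norm (app (S (lam n) t) (M x0-app (Y (lam n)) x0)) <= C*norm (M x0-app (Y (lam n)) x0)" if "t : {0..T}" for t
    by (rule C(2)[OF lam_pos]) (use that in auto)
   thus ?case using elim by (force simp: dist_norm)
  qed
 qed
 have glim: "uniform_limit {0..T} g gg sequentially"
 proof -
  have "uniform_limit {0..T} (%n t. (app (S (lam n) t) (M x0-app (Y (lam n)) x0)+app (S (lam n) t) z)+duh (lam n) F' t) gg sequentially"
   unfolding gg_def[abs_def] by (intro uniform_limit_add null f34)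
  moreover have "(app (S (lam n) t) (M x0-app (Y (lam n)) x0)+app (S (lam n) t) z)+duh (lam n) F' t = g n t" if "t : {0..T}" for n t
  proof -
   have "app (S (lam n) t) (M x0-app (Y (lam n)) x0)+app (S (lam n) t) z = app (S (lam n) t) (F 0-app (Y (lam n)) x0)"
    by (simp add: z_def app.add_right[symmetric])
   thus ?thesis by (simp only: gform[OF that])
  qed
  ultimately show ?thesis by (subst uniform_limit_cong'[where g="%n t. (app (S (lam n) t) (M x0-app (Y (lam n)) x0)+app (S (lam n) t) z)+duh (lam n) F' t"]) auto
 qed
 have gc: "continuous_on {0..T} (g n)" for n unfolding continuous_on_eq_continuous_within using has_vector_derivative_continuous[OF gd] by blast
 have ggc: "continuous_on {0..T} gg" by (rule uniform_limit_theorem[OF _ glim]) (simp_all add: gc)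
 have xlim: "(%n. y n t) ----> x t" if "t : {0..T}" for t by (rule tendsto_uniform_limitI[OF ylim that])
 have glim': "(%n. g n t) ----> gg t" if "t : {0..T}" for t by (rule tendsto_uniform_limitI[OF glim that])
 have y0: "y n 0 = x0" for n by (simp add: y_def duh_def app.zero_right)
 have xint: "x t = x0+integral {0..t} gg" if t: "t : {0..T}" for t
 proof -
  have yi: "(g n has_integral y n t-y n 0) {0..t}" for n
  proof (rule fundamental_theorem_of_calculus)
   fix r assume "r : {0..t}"
   hence "r : {0..T}" using t by simp
   thus "(y n has_vector_derivative g n r) (at r within {0..t})" by (rule has_vector_derivative_within_subset[OF yd]) (use t in auto)
  qed (use t in auto)
  have sub: "uniform_limit {0..t} g gg sequentially" by (rule uniform_limit_on_subset[OF glim]) (use t in auto)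
  have "continuous_on {0..t} (g n)" for n by (rule continuous_on_subset[OF gc]) (use t in auto)
  then obtain I J where IJ: "!!n. (g n has_integral I n) {0..t}" "(gg has_integral J) {0..t}" "I ----> J"
   using uniform_limit_integral[OF sub] by (metis sequentially_bot)
  have "I n = y n t-x0" for n using has_integral_unique[OF IJ(1) yi] by (simp add: y0)
  hence "I = (%n. y n t-x0)" by (rule ext)
  hence "(%n. y n t-x0) ----> J" using IJ(3) by (simp only:)
  moreover have "(%n. y n t-x0) ----> x t-x0" by (intro tendsto_intros xlim t)
  ultimately have "J = x t-x0" by (rule LIMSEQ_unique)
  thus ?thesis using IJ(2) by (simp add: integral_unique)
 qed
 have xd: "(x has_vector_derivative gg t) (at t within {0..T})" if t: "t : {0..T}" for t
 proof -
  have "((%t. x0+integral {0..t} gg) has_vector_derivative 0+gg t) (at t within {0..T})"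
   by (intro has_vector_derivative_add has_vector_derivative_const integral_has_vector_derivative ggc t)
  hence "((%t. x0+integral {0..t} gg) has_vector_derivative gg t) (at t within {0..T})" by simp
  thus ?thesis by (rule has_vector_derivative_transform[OF t, rotated]) (simp add: xint)
 qed
 have xD: "x t : D & gg t+M (x t) = F t" if t: "t : {0..T}" for t
 proof -
  define a where "a n = res (lam n) (y n t)" for n
  have aD: "a n : D" for n unfolding a_def by (rule res(1)[OF lam_pos])
  have Ma: "M (a n) = F t-g n t" for n by (simp add: a_def g_def app_Y[OF lam_pos, symmetric])
  have "a n = y n t-lam n*.(F t-g n t)" for n
   using res(2)[OF lam_pos, of n "y n t"] unfolding Ma[symmetric] a_def[symmetric] by (metis add_diff_cancel_right')
  hence "a = (%n. y n t-lam n*.(F t-g n t))" by (rule ext)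
  moreover have "(%n. y n t-lam n*.(F t-g n t)) ----> x t-0*.(F t-gg t)" by (intro tendsto_intros xlim[OF t] glim'[OF t] lam_lim)
  ultimately have alim: "a ----> x t" by simp
  have "a n = res 1 (a n+(F t-g n t))" for n using res_unique[of 1 "a n", OF _ aD refl] by (simp add: Ma)
  hence "(%n. res 1 (a n+(F t-g n t))) = a" by (simp add: fun_eq_iff)
  moreover have "(%n. res 1 (a n+(F t-g n t))) ----> res 1 (x t+(F t-gg t))"
   by (intro bounded_linear.tendsto[OF bl_res] tendsto_intros alim glim'[OF t]) simp
  ultimately have "a ----> res 1 (x t+(F t-gg t))" by (simp only:)
  hence eq: "x t = res 1 (x t+(F t-gg t))" using alim LIMSEQ_unique by blast
  note r = res[of 1 "x t+(F t-gg t)", folded eq]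
  show ?thesis using r by (auto simp: algebra_simps)
 qed
 show ?thesis
 proof (rule that[of x gg])
  show "x 0 = x0" using xint[of 0] T by simp
  show "continuous_on {0..T} gg" by (rule ggc)
  show "x t : D" if "t : {0..T}" for t using xD[OF that] by blast
  show "(x has_vector_derivative gg t) (at t within {0..T})" if "t : {0..T}" for t by (rule xd[OF that])
  show "gg t+M (x t) = F t" if "t : {0..T}" for t using xD[OF that] by blast
  show "ipn (x t) <= ipn x0+T*B" if B: "!!r. r : {0..T} ==> ipn (F r) <= B" and t: "t : {0..T}" for B t
  proof (rule LIMSEQ_le_const2[OF ipn_tendsto[OF xlim[OF t]]], intro exI allI impI)
   fix n
   have "ipn (y n t) <= ipn (app (S (lam n) t) x0)+ipn (duh (lam n) F t)" unfolding y_def by (rule ipn_triangle)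
   also have "... <= ipn x0+T*B" using t by (intro add_mono S_contraction lam_pos duh_bound[OF lam_pos Fc t B]) auto
   finally show "ipn (y n t) <= ipn x0+T*B" .
  qed
 qed
qed

theorem evolution_unique: assumes x: "continuous_on {0..T} x" "x 0 = 0"
  and d: "!!t. t : {0<..T} ==> x t : D & (x has_vector_derivative-M (x t)) (at t within {0..T})" and t: "t : {0..T}" shows "x t = 0"
proof (cases "t = 0")
 case False
 hence t0: "0 < t" using t by simp
 have "ip (x t) (x t) <= ip (x 0) (x 0)"
 proof (rule DERIV_nonpos_imp_decreasing_open[OF less_imp_le[OF t0]])
  show "continuous_on {0..t} (%t. ip (x t) (x t))" using t by (intro ip.continuous_on continuous_on_subset[OF x(1)]) auto
  fix r assume r: "0 < r" "r < t"
  have "(x has_vector_derivative-M (x r)) (at r within {0..T})" "x r : D" using d[of r] r t by auto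
  moreover have "at r within {0..T} = at r" using r t by (intro at_within_interior) auto
  ultimately have xd: "(x has_vector_derivative-M (x r)) (at r)" and xD: "x r : D" by simp_all
  have "((%t. ip (x t) (x t)) has_vector_derivative ip (x r) (- M (x r))+ip (- M (x r)) (x r)) (at r)" by (rule ip.has_vector_derivative[OF xd xd])
  hence "((%t. ip (x t) (x t)) has_field_derivative-2*ip (M (x r)) (x r)) (at r)"
   by (simp add: has_real_derivative_iff_has_vector_derivative ip_simps sym[of "x r" "M (x r)"])
  thus "EX y. ((%t. ip (x t) (x t)) has_field_derivative y) (at r) & y <= 0" using mono[OF xD] by (intro exI conjI) auto
 qed
 hence "ip (x t) (x t) = 0" using x(2) ip_nonneg[of "x t"] by (simp add: ip_simps)
 thus ?thesis by (simp add: ip_zero_iff)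
qed (use x in simp)

end

section \<open>The Hilbert space of square integrable functions\<close>

lemma L2_measurable: "u : L2 Om ==> u : borel_measurable (LO Om)" by (simp add: L2_def)

lemma L2_integrable_inner: assumes "u : L2 Om" "v : L2 Om" shows "integrable (LO Om) (%x. u x<.>v x)"
proof (rule Bochner_Integration.integrable_bound)
 show "integrable (LO Om) (%x. (norm (u x))^2+(norm (v x))^2)" using assms by (auto simp: L2_def)
 show "(%x. u x<.>v x) : borel_measurable (LO Om)" using assms by (intro borel_measurable_inner L2_measurable)
 have "norm (u x<.>v x) <= norm ((norm (u x))^2+(norm (v x))^2)" for x
 proof -
  have "abs(u x<.>v x) <= norm (u x)*norm (v x)" by (rule Cauchy_Schwarz_ineq2)
  also have "... <= (norm (u x))^2+(norm (v x))^2"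
   using sum_squares_bound[of "norm (u x)" "norm (v x)"] mult_nonneg_nonneg[OF norm_ge_zero[of "u x"] norm_ge_zero[of "v x"]] by linarith
  finally show ?thesis by simp
 qed
 thus "AE x in LO Om. norm (u x<.>v x) <= norm ((norm (u x))^2+(norm (v x))^2)" by simp
qed

lemma L2_mono_bound: assumes v: "v : L2 Om" and u: "u : borel_measurable (LO Om)" and b: "!!x. norm (u x) <= C*norm (v x)" shows "u : L2 Om"
proof -
 have "integrable (LO Om) (%x. (norm (u x))^2)"
 proof (rule Bochner_Integration.integrable_bound)
  show "integrable (LO Om) (%x. C\<^sup>2*(norm (v x))^2)" using v by (auto simp: L2_def)
  have "norm ((norm (u x))^2) <= norm (C^2*(norm (v x))^2)" for x using power_mono[OF b[of x], of 2] by (simp add: power_mult_distrib)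
  thus "AE x in LO Om. norm ((norm (u x))^2) <= norm (C^2*(norm (v x))^2)" by simp
 qed (use u in measurable)
 thus ?thesis using u by (simp add: L2_def)
qed

lemma L2_linear: assumes u: "u : L2 Om" and f: "bounded_linear f" shows "(%x. f (u x)) : L2 Om"
proof -
 obtain K where K: "!!x. norm (f x) <= norm x*K" using bounded_linear.bounded[OF f] by blast
 have "(%x. f (u x)) : borel_measurable (LO Om)" by (rule borel_measurable_continuous_on[OF linear_continuous_on[OF f] L2_measurable[OF u]])
 thus ?thesis by (rule L2_mono_bound[OF u]) (use K in \<open>simp add: mult.commute\<close>)
qed

lemma L2_add: assumes "u : L2 Om" "v : L2 Om" shows "(%x. u x+v x) : L2 Om"
proof -
 have eq: "(norm (u x+v x))^2 = (norm (u x))^2+2*(u x<.>v x)+(norm (v x))^2" for x by (simp add: power2_norm_eq_inner inner_simps inner_commute)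
 have "integrable (LO Om) (%x. (norm (u x))^2+2*(u x<.>v x)+(norm (v x))^2)"
  using assms by (intro Bochner_Integration.integrable_add integrable_mult_right L2_integrable_inner) (auto simp: L2_def)
 moreover have "(%x. u x+v x) : borel_measurable (LO Om)" using assms by (intro borel_measurable_add L2_measurable)
 ultimately show ?thesis by (simp add: L2_def eq)
qed

lemma L2_scaleR: "u : L2 Om ==> (%x. c*.u x) : L2 Om" by (erule L2_linear) (rule bounded_linear_scaleR_right)

lemma L2_uminus: "u : L2 Om ==> (%x. - u x) : L2 Om" using L2_scaleR[of u Om "- 1"] by simp

lemma L2_diff: "u : L2 Om ==> v : L2 Om ==> (%x. u x-v x) : L2 Om" using L2_add[of u Om "%x. - v x"] L2_uminus[of v] by simp

lemma L2_zero: "(%x. 0) : L2 Om" by (simp add: L2_def)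

lemma L2_Pair:
 fixes u :: "real^'d => 'b::euclidean_space" and v :: "real^'d => 'c::euclidean_space"
 assumes "u : L2 Om" "v : L2 Om" shows "(%x. (u x, v x)) : L2 Om"
proof -
 have "bounded_linear (%y::'b. (y, 0 :: 'c))" by (intro bounded_linear_Pair bounded_linear_ident bounded_linear_zero)
 moreover have "bounded_linear (%y::'c. (0 :: 'b, y))" by (intro bounded_linear_Pair bounded_linear_ident bounded_linear_zero)
 ultimately have "(%x. (u x, 0 :: 'c)+(0 :: 'b, v x)) : L2 Om" using assms by (intro L2_add L2_linear[where f="%y. (y, 0)"] L2_linear[where f="%y. (0, y)"])
 thus ?thesis by simp
qed

lemma L2_AE: assumes u: "u : L2 Om" and m: "v : borel_measurable (LO Om)" and eq: "AE x in LO Om. v x = u x" shows "v : L2 Om"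
proof -
 have "integrable (LO Om) (%x. (norm (v x))^2) = integrable (LO Om) (%x. (norm (u x))^2)"
 proof (rule integrable_cong_AE)
  show "(%x. (norm (v x))^2) : borel_measurable (LO Om)" "(%x. (norm (u x))^2) : borel_measurable (LO Om)" using m L2_measurable[OF u] by measurable
  show "AE x in LO Om. (norm (v x))^2 = (norm (u x))^2" using eq by eventually_elim simp
 qed
 thus ?thesis using u m by (simp add: L2_def)
qed

quotient_type (overloaded) ('d, 'b) lsq = "real^('d::finite) => 'b::euclidean_space" / partial:
 "%f g. f : L2 UNIV & g : L2 UNIV & (AE x in lebesgue. f x = g x)"
proof (rule part_equivpI)
 show "EX x::real^'d => 'b. x : L2 UNIV & x : L2 UNIV & (AE xa in lebesgue. x xa = x xa)" using L2_zero by auto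
 show "symp (%(f::real^'d => 'b) g. f : L2 UNIV & g : L2 UNIV & (AE x in lebesgue. f x = g x))" by (auto intro!: sympI elim: eventually_mono)
 show "transp (%(f::real^'d => 'b) g. f : L2 UNIV & g : L2 UNIV & (AE x in lebesgue. f x = g x))" by (auto intro!: transpI elim: eventually_elim2)
qed

abbreviation (input) rep where "rep \<equiv> rep_lsq"

lemma rep_L2: "rep F : L2 UNIV" using Quotient3_rep_reflp[OF Quotient3_lsq, of F] by simp

lemma abs_rep_lsq: "abs_lsq (rep F) = F" by (rule Quotient3_abs_rep[OF Quotient3_lsq])

lemma abs_lsq_eq_iff: "f : L2 UNIV ==> g : L2 UNIV ==> abs_lsq f = abs_lsq g \<longleftrightarrow> (AE x in lebesgue. f x = g x)"
 using Quotient3_rel[OF Quotient3_lsq, of f g] by auto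

lemma rep_abs_lsq: "f : L2 UNIV ==> AE x in lebesgue. rep (abs_lsq f) x = f x"
 using abs_lsq_eq_iff[OF rep_L2, of f "abs_lsq f"] by (simp add: abs_rep_lsq)

lemma L2_UNIV_measurable [measurable_dest]: "f : L2 UNIV ==> f : borel_measurable lebesgue"
 using L2_measurable[of f UNIV] by (simp add: lebesgue_on_UNIV_eq)

lemma L2_UNIV_integrable_inner: "f : L2 UNIV ==> g : L2 UNIV ==> integrable lebesgue (%x. f x<.>g x)"
 using L2_integrable_inner[of f UNIV g] by (simp add: lebesgue_on_UNIV_eq)

instantiation lsq :: (finite, euclidean_space) real_inner
begin

lift_definition zero_lsq :: "('a, 'b) lsq" is "%x. 0" by (simp add: L2_zero)
lift_definition plus_lsq :: "('a, 'b) lsq => ('a, 'b) lsq => ('a, 'b) lsq" is "%f g x. f x+g x" by (auto simp: L2_add elim: eventually_elim2)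
lift_definition minus_lsq :: "('a, 'b) lsq => ('a, 'b) lsq => ('a, 'b) lsq" is "%f g x. f x-g x" by (auto simp: L2_diff elim: eventually_elim2)
lift_definition uminus_lsq :: "('a, 'b) lsq => ('a, 'b) lsq" is "%f x. - f x" by (auto simp: L2_uminus elim: eventually_mono)
lift_definition scaleR_lsq :: "real => ('a, 'b) lsq => ('a, 'b) lsq" is "%c f x. c*.f x" by (auto simp: L2_scaleR elim: eventually_mono)
lift_definition inner_lsq :: "('a, 'b) lsq => ('a, 'b) lsq => real" is "%f g. LINT x|lebesgue. f x<.>g x"
 by (intro integral_cong_AE borel_measurable_inner L2_UNIV_measurable) (auto elim: eventually_elim2)

definition norm_lsq :: "('a, 'b) lsq => real" where "norm_lsq F = sqrt (inner F F)"
definition dist_lsq :: "('a, 'b) lsq => ('a, 'b) lsq => real" where "dist_lsq a b = norm (a-b)"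
definition sgn_lsq :: "('a, 'b) lsq => ('a, 'b) lsq" where "sgn_lsq x = scaleR (inverse (norm x)) x"
definition uniformity_lsq :: "(('a, 'b) lsq \<times> ('a, 'b) lsq) filter" where
 "uniformity_lsq = (INF e\<in>{0<..}. principal {(x, y). dist x y < e})"
definition open_lsq :: "('a, 'b) lsq set => bool" where
 "open_lsq U = (ALL x:U. eventually (%(x', y). x' = x --> y : U) uniformity)"

instance
proof
 fix a b c :: "('a, 'b) lsq" and r q :: real and U :: "('a, 'b) lsq set"
 show "dist a b = norm (a-b)" by (rule dist_lsq_def)
 show "sgn a = inverse (norm a)*.a" by (rule sgn_lsq_def)
 show "uniformity = (INF e\<in>{0<..}. principal {(x::('a, 'b) lsq, y). dist x y < e})" by (rule uniformity_lsq_def)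
 show "open U = (ALL x:U. \<forall>\<^sub>F (x', y) in uniformity. x' = x --> y : U)" by (rule open_lsq_def)
 show "norm a = sqrt (inner a a)" by (rule norm_lsq_def)
 show "a+b+c = a+(b+c)" "a+b = b+a" "0+a = a" "- a+a = 0" "a-b = a + - b"
  "r*.(a+b) = r*.a+r*.b" "(r+q)*.a = r*.a+q*.a" "r*.q*.a = (r*q)*.a" "1*.a = a"
  by (transfer, simp add: L2_add L2_diff L2_uminus L2_scaleR L2_zero algebra_simps)+
 show "inner a b = inner b a" by transfer (simp add: inner_commute)
 show "inner (a+b) c = inner a c+inner b c" by transfer (simp add: inner_add_left L2_UNIV_integrable_inner)
 show "inner (r*.a) b = r*inner a b" by transfer simp
 show "0 <= inner a a" by transfer simp
 show "inner a a = 0 \<longleftrightarrow> a = 0"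
 proof transfer
  fix f :: "real^'a => 'b" assume f: "f : L2 UNIV & f : L2 UNIV & (AE x in lebesgue. f x = f x)"
  have "(LINT x|lebesgue. f x<.>f x) = 0 \<longleftrightarrow> (AE x in lebesgue. f x<.>f x = 0)"
   by (rule integral_nonneg_eq_0_iff_AE) (use f in \<open>auto simp: L2_UNIV_integrable_inner\<close>)
  thus "((LINT x|lebesgue. f x<.>f x) = 0) = (f : L2 UNIV & (%x. 0) : L2 UNIV & (AE x in lebesgue. f x = 0))" using f by (simp add: L2_zero)
 qed
qed

end

lemma norm_lsq_sq: "(norm F)^2 = (LINT x|lebesgue. (norm (rep F x))^2)"
proof -
 have "inner (abs_lsq (rep F)) (abs_lsq (rep F)) = (LINT x|lebesgue. rep F x<.>rep F x)" by (rule inner_lsq.abs_eq) (simp_all add: rep_L2)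
 thus ?thesis by (simp add: power2_norm_eq_inner abs_rep_lsq)
qed

lemma norm_abs_lsq_sq: "f : L2 UNIV ==> (norm (abs_lsq f))^2 = (LINT x|lebesgue. (norm (f x))^2)" by (simp add: power2_norm_eq_inner inner_lsq.abs_eq)

lemma abs_lsq_diff: "f : L2 UNIV ==> g : L2 UNIV ==> abs_lsq f-abs_lsq g = abs_lsq (%x. f x-g x)" by (rule minus_lsq.abs_eq) auto

lemma nn_integral_L2: "f : L2 UNIV ==> (\<integral>\<^sup>+x. ennreal ((norm (f x))^2) \<partial>lebesgue) = ennreal ((norm (abs_lsq f))^2)"
 by (subst nn_integral_eq_integral) (auto simp: L2_def lebesgue_on_UNIV_eq norm_abs_lsq_sq)

lemma L2_nn_integral_bound: assumes m: "f : borel_measurable lebesgue" and c: "0 <= c"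
  and b: "(\<integral>\<^sup>+x. ennreal ((norm (f x))^2) \<partial>lebesgue) <= ennreal (c^2)" shows "f : L2 UNIV" "norm (abs_lsq f) <= c"
proof -
 have "integrable lebesgue (%x. (norm (f x))^2)"
 proof (rule integrableI_bounded)
  show "(%x. (norm (f x))^2) : borel_measurable lebesgue" using m by measurable
  show "(\<integral>\<^sup>+x. ennreal (norm ((norm (f x))^2)) \<partial>lebesgue) < \<infinity>"
   using b by (simp add: le_less_trans[OF _ ennreal_less_top])
 qed
 thus f: "f : L2 UNIV" using m by (simp add: L2_def lebesgue_on_UNIV_eq)
 have "(norm (abs_lsq f))^2 <= c^2" using b unfolding nn_integral_L2[OF f] by simp
 thus "norm (abs_lsq f) <= c" using c by (rule power2_le_imp_le)
qed

lemma fast_Cauchy_AE_convergent: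
 fixes f :: "nat => real^'d => 'b::euclidean_space" assumes f: "!!k. f k : L2 UNIV"
  and fast: "!!k. norm (abs_lsq (f (Suc k))-abs_lsq (f k)) <= (1/2)^k" shows "AE x in lebesgue. convergent (%k. f k x)"
proof -
 define g where "g k x = 2^k*(norm (f (Suc k) x-f k x))^2" for k x
 have gm: "g k : borel_measurable lebesgue" for k unfolding g_def[abs_def] using f by measurable
 have g0: "0 <= g k x" for k x by (simp add: g_def)
 have gi: "(\<integral>\<^sup>+x. ennreal (g k x) \<partial>lebesgue) <= ennreal ((1/2)^k)" for k
 proof -
  have "(\<integral>\<^sup>+x. ennreal (g k x) \<partial>lebesgue) = ennreal (2^k)*(\<integral>\<^sup>+x. ennreal ((norm (f (Suc k) x-f k x))^2) \<partial>lebesgue)"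
   unfolding g_def by (subst nn_integral_cmult[symmetric]) (use f in \<open>auto simp: ennreal_mult\<close>)
  also have "... = ennreal (2^k)*ennreal ((norm (abs_lsq (f (Suc k))-abs_lsq (f k)))^2)"
   by (subst nn_integral_L2) (simp_all add: L2_diff f abs_lsq_diff)
  also have "... <= ennreal (2^k)*ennreal (((1/2)^k)^2)" by (intro mult_left_mono ennreal_leI power_mono fast) auto
  also have "... = ennreal ((1/2)^k)" by (simp add: ennreal_mult[symmetric] power2_eq_square power_one_over)
  finally show ?thesis .
 qed
 have "(\<integral>\<^sup>+x. (\<Sum>k. ennreal (g k x)) \<partial>lebesgue) = (\<Sum>k. \<integral>\<^sup>+x. ennreal (g k x) \<partial>lebesgue)"
  by (rule nn_integral_suminf) (use gm in measurable)
 also have "... <= (\<Sum>k. ennreal ((1/2)^k))" by (intro suminf_le gi) auto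
 also have "... = ennreal (\<Sum>k. (1/2)^k)" by (rule suminf_ennreal2) (auto intro: summable_geometric)
 finally have "(\<integral>\<^sup>+x. (\<Sum>k. ennreal (g k x)) \<partial>lebesgue) ~= \<infinity>"
  by (metis ennreal_neq_top infinity_ennreal_def neq_top_trans)
 hence "AE x in lebesgue. (\<Sum>k. ennreal (g k x)) ~= \<infinity>" by (rule nn_integral_noteq_infinite[rotated]) (use gm in measurable)
 thus ?thesis
 proof eventually_elim
  case (elim x)
  have "summable (%k. g k x)" by (rule summable_suminf_not_top[OF g0]) (use elim in simp)
  hence "Bseq (%k. g k x)" by (rule convergent_imp_Bseq[OF convergentI[OF summable_LIMSEQ_zero]])
  then obtain K where K: "0 < K" "!!k. norm (g k x) <= K" by (auto elim: BseqE)
  have bd: "norm (f (Suc k) x-f k x) <= sqrt K*(sqrt (1/2))^k" for k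
  proof (rule power2_le_imp_le)
   have "2^k*(norm (f (Suc k) x-f k x))^2 <= K" using K(2)[of k] by (simp add: g_def)
   hence "(norm (f (Suc k) x-f k x))^2 <= K*(1/2)^k" by (simp add: field_simps power_one_over)
   also have "... = (sqrt K*(sqrt (1/2))^k)^2"
    using K(1) by (simp add: power_mult_distrib power_mult[symmetric] mult.commute[of k 2]) (simp add: power_mult real_sqrt_divide power_divide)
   finally show "(norm (f (Suc k) x-f k x))^2 <= (sqrt K*(sqrt (1/2))^k)^2" .
  qed (use K(1) in auto)
  have "summable (%k. sqrt K*(sqrt (1/2))^k)" by (intro summable_mult summable_geometric) (auto simp: real_sqrt_divide)
  hence "summable (%k. f (Suc k) x-f k x)" by (rule summable_norm_cancel[OF summable_comparison_test'[where N=0]]) (use bd in auto)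
  hence "convergent (%n. \<Sum>k<n. f (Suc k) x-f k x)" by (simp add: summable_iff_convergent)
  hence "convergent (%n. (f n x-f 0 x)+f 0 x)" by (intro convergent_add convergent_const) (simp only: sum_lessThan_telescope[of "%n. f n x"])
  thus ?case by simp
 qed
qed

lemma L2_limit:
 fixes f :: "nat => real^'d => 'b::euclidean_space" assumes f: "!!k. f k : L2 UNIV" and g: "g : L2 UNIV" and F: "F : borel_measurable lebesgue"
  and lim: "AE x in lebesgue. (%k. f k x) ----> F x" and e: "0 <= e" and bd: "!!k. N <= k ==> norm (abs_lsq (f k)-abs_lsq g) <= e"
 shows "F : L2 UNIV" "norm (abs_lsq F-abs_lsq g) <= e"
proof -
 have m: "(%x. F x-g x) : borel_measurable lebesgue" using F g by measurable
 have "(\<integral>\<^sup>+x. ennreal ((norm (F x-g x))^2) \<partial>lebesgue) = (\<integral>\<^sup>+x. liminf (%k. ennreal ((norm (f k x-g x))^2)) \<partial>lebesgue)"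
 proof (rule nn_integral_cong_AE)
  show "AE x in lebesgue. ennreal ((norm (F x-g x))^2) = liminf (%k. ennreal ((norm (f k x-g x))^2))" using lim
  proof eventually_elim
   case (elim x)
   have "(%k. ennreal ((norm (f k x-g x))^2)) ----> ennreal ((norm (F x-g x))^2)" by (intro tendsto_ennrealI tendsto_intros elim)
   thus ?case by (metis lim_imp_Liminf sequentially_bot)
  qed
 qed
 also have "... <= liminf (%k. \<integral>\<^sup>+x. ennreal ((norm (f k x-g x))^2) \<partial>lebesgue)"
  by (rule nn_integral_liminf) (use f g in measurable)
 also have "... <= ennreal (e^2)"
 proof (rule Liminf_le)
  show "\<forall>\<^sub>F k in sequentially. (\<integral>\<^sup>+x. ennreal ((norm (f k x-g x))^2) \<partial>lebesgue) <= ennreal (e^2)"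
   unfolding eventually_sequentially
  proof (intro exI allI impI)
   fix k assume "N <= k"
   from bd[OF this] show "(\<integral>\<^sup>+x. ennreal ((norm (f k x-g x))^2) \<partial>lebesgue) <= ennreal (e^2)"
    by (subst nn_integral_L2) (simp_all add: L2_diff f g abs_lsq_diff power_mono)
  qed
 qed simp
 finally have *: "(\<integral>\<^sup>+x. ennreal ((norm (F x-g x))^2) \<partial>lebesgue) <= ennreal (e^2)" .
 note b = L2_nn_integral_bound[OF m e *]
 show "F : L2 UNIV" using L2_add[OF b(1) g] by simp
 thus "norm (abs_lsq F-abs_lsq g) <= e" using b(2) by (simp add: abs_lsq_diff g)
qed

instance lsq :: (finite, euclidean_space) complete_space
proof
 fix X :: "nat => ('a, 'b) lsq" assume X: "Cauchy X"
 have "EX N. ALL m>=N. ALL n>=N. norm (X m-X n) < (1/2)^k" for k :: nat by (rule CauchyD[OF X]) simp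
 then obtain N where N: "!!k m n. N k <= m ==> N k <= n ==> norm (X m-X n) < (1/2)^k" by metis
 define r where "r k = (\<Sum>i\<le>k. N i)+k" for k :: nat
 have rN: "N k <= r k" for k using member_le_sum[of k "{..k}" N] by (simp add: r_def trans_le_add1)
 have rmono: "r k < r (Suc k)" for k by (simp add: r_def)
 define f where "f k = rep (X (r k))" for k
 have f: "f k : L2 UNIV" "abs_lsq (f k) = X (r k)" for k by (simp_all add: f_def rep_L2 abs_rep_lsq)
 have "norm (abs_lsq (f (Suc k))-abs_lsq (f k)) <= (1/2)^k" for k unfolding f by (rule less_imp_le[OF N]) (use rN[of k] rmono[of k] in linarith)+
 from fast_Cauchy_AE_convergent[OF f(1) this] have conv: "AE x in lebesgue. convergent (%k. f k x)" .
 define F where "F x = lim (%k. f k x)" for x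
 have Fm: "F : borel_measurable lebesgue" unfolding F_def[abs_def] by (rule borel_measurable_lim_metric) (rule L2_UNIV_measurable[OF f(1)])
 have lim: "AE x in lebesgue. (%k. f k x) ----> F x" using conv by eventually_elim (simp add: F_def convergent_LIMSEQ_iff)
 have rge: "k <= r k" for k by (simp add: r_def)
 have est: "norm (abs_lsq F-X n) <= (1/2)^k" if "N k <= n" for k n
 proof -
  have "norm (abs_lsq (f j)-abs_lsq (rep (X n))) <= (1/2)^k" if "N k <= j" for j
   unfolding f abs_rep_lsq by (rule less_imp_le[OF N]) (use that rge[of j] \<open>N k <= n\<close> in linarith)+
  from L2_limit(2)[OF f(1) rep_L2 Fm lim _ this] show ?thesis by (simp add: abs_rep_lsq)
 qed
 have "X ----> abs_lsq F"
 proof (rule LIMSEQ_I)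
  fix e :: real assume "0 < e"
  then obtain k where k: "(1/2::real)^k < e" using real_arch_pow_inv[of e "1/2"] by auto
  show "EX no. ALL n>=no. norm (X n-abs_lsq F) < e" using est[of k] k by (intro exI[of _ "N k"]) (auto simp: norm_minus_commute intro: le_less_trans)
 qed
 thus "convergent X" by (rule convergentI)
qed

instance lsq :: (finite, euclidean_space) banach ..

instance lsq :: (finite, euclidean_space) perfect_space
proof
 fix x :: "('a, 'b) lsq"
 obtain b :: 'b where b: "b : Basis" using nonempty_Basis by blast
 define h where "h y = ind (ball 0 1) y*.b" for y :: "real^'a"
 have eq: "(%y. (norm (h y))^2) = ind (ball 0 1)" using b by (auto simp: h_def fun_eq_iff indicator_def)
 have int: "integrable lebesgue (ind (ball (0 :: real^'a) 1) :: _ => real)"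
  by (rule integrable_real_indicator) (use emeasure_bounded_finite[of "ball (0 :: real^'a) 1"] in auto)
 have h: "h : L2 UNIV" unfolding L2_def
 proof (intro CollectI conjI)
  show "h : borel_measurable (LO UNIV)" unfolding h_def[abs_def] lebesgue_on_UNIV_eq
   by (intro borel_measurable_scaleR borel_measurable_indicator borel_measurable_const) simp
  show "integrable (LO UNIV) (%x. (norm (h x))^2)" unfolding eq lebesgue_on_UNIV_eq by (rule int)
 qed
 have "(norm (abs_lsq h))^2 = measure lebesgue (ball (0 :: real^'a) 1)" unfolding norm_abs_lsq_sq[OF h] eq by simp
 also have "... = measure lborel (ball (0 :: real^'a) 1)" by simp
 also have "... > 0" by (rule content_ball_pos) simp
 finally have z: "norm (abs_lsq h) > 0" by simp
 show "\<not> open {x}"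
 proof
  assume "open {x}"
  then obtain e where e: "0 < e" "ball x e \<subseteq> {x}" unfolding open_contains_ball by blast
  have "x+(e/(2*norm (abs_lsq h)))*.abs_lsq h : ball x e" using e(1) z by (simp add: dist_norm)
  thus False using e z by auto
 qed
qed

lemma rep_simps: shows rep_add: "AE x in lebesgue. rep (F+G) x = rep F x+rep G x" and rep_diff: "AE x in lebesgue. rep (F-G) x = rep F x-rep G x"
  and rep_scaleR: "AE x in lebesgue. rep (c*.F) x = c*.rep F x"
proof -
 have "F+G = abs_lsq (%x. rep F x+rep G x)" using plus_lsq.abs_eq[of "rep F" "rep G"] by (simp add: rep_L2 abs_rep_lsq)
 thus "AE x in lebesgue. rep (F+G) x = rep F x+rep G x" by (simp only:) (intro rep_abs_lsq L2_add rep_L2)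
 have "F-G = abs_lsq (%x. rep F x-rep G x)" using minus_lsq.abs_eq[of "rep F" "rep G"] by (simp add: rep_L2 abs_rep_lsq)
 thus "AE x in lebesgue. rep (F-G) x = rep F x-rep G x" by (simp only:) (intro rep_abs_lsq L2_diff rep_L2)
 have "c*.F = abs_lsq (%x. c*.rep F x)" using scaleR_lsq.abs_eq[of "rep F" c] by (simp add: rep_L2 abs_rep_lsq)
 thus "AE x in lebesgue. rep (c*.F) x = c*.rep F x" by (simp only:) (intro rep_abs_lsq L2_scaleR rep_L2)
qed

lemma inner_lsq: "inner F G = (LINT x|lebesgue. rep F x<.>rep G x)" using inner_lsq.abs_eq[of "rep F" "rep G"] by (simp add: rep_L2 abs_rep_lsq)

lemma lsq_eqI: "AE x in lebesgue. rep F x = rep G x ==> F = G" using abs_lsq_eq_iff[OF rep_L2 rep_L2, of F G] by (simp add: abs_rep_lsq)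

lemma AE_lebesgue_on: "Om : sets lebesgue ==> (AE x in LO Om. P x) \<longleftrightarrow> (AE x in lebesgue. x : Om --> P x)"
 by (rule AE_restrict_space_iff) simp

definition lmap :: "('b => 'c) => ('d::finite, 'b::euclidean_space) lsq => ('d, 'c::euclidean_space) lsq" where
 "lmap W F = abs_lsq (%x. W (rep F x))"

definition zext :: "(real^'d) set => (real^'d => 'b::euclidean_space) => ('d::finite, 'b) lsq" where
 "zext Om f = abs_lsq (%x. if x : Om then f x else 0)"

lemma L2_restrict: assumes "Om : sets lebesgue" shows "(%x. if x : Om then f x else 0) : L2 UNIV \<longleftrightarrow> f : L2 Om"
proof -
 have eq: "(norm (if x : Om then f x else 0))^2 = (if x : Om then (norm (f x))\<^sup>2 else 0)" for x by simp
 show ?thesis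
  unfolding L2_def lebesgue_on_UNIV_eq mem_Collect_eq eq Lebesgue_Measure.integrable_restrict_UNIV[OF assms] borel_measurable_if[OF assms] ..
qed

lemma rep_L2_on: assumes "Om : sets lebesgue" shows "rep F : L2 Om"
proof -
 have "(%x. ind Om x*.rep F x) : L2 UNIV"
 proof (rule L2_mono_bound[OF rep_L2[of F]])
  show "(%x. ind Om x*.rep F x) : borel_measurable (LO UNIV)"
   unfolding lebesgue_on_UNIV_eq using assms by (intro borel_measurable_scaleR borel_measurable_indicator L2_UNIV_measurable rep_L2)
  show "norm (ind Om x*.rep F x) <= 1*norm (rep F x)" for x by (simp add: indicator_def)
 qed
 moreover have "(%x. ind Om x*.rep F x) = (%x. if x : Om then rep F x else 0)" by (auto simp: indicator_def)
 ultimately show ?thesis using L2_restrict[OF assms, of "rep F"] by simp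
qed

lemma rep_lmap: "bounded_linear W ==> AE x in lebesgue. rep (lmap W F) x = W (rep F x)"
 unfolding lmap_def by (rule rep_abs_lsq) (rule L2_linear[OF rep_L2])

lemma rep_ext: "Om : sets lebesgue ==> f : L2 Om ==> AE x in lebesgue. rep (zext Om f) x = (if x : Om then f x else 0)"
 unfolding zext_def by (rule rep_abs_lsq) (simp add: L2_restrict)

lemma rep_ext_on: "Om : sets lebesgue ==> f : L2 Om ==> AE x in LO Om. rep (zext Om f) x = f x"
 unfolding AE_lebesgue_on using rep_ext[of Om f] by (auto elim: eventually_mono)

lemma zext_eq_iff: assumes "Om : sets lebesgue" "f : L2 Om" "g : L2 Om" shows "zext Om f = zext Om g \<longleftrightarrow> (AE x in LO Om. f x = g x)"
proof -
 have "zext Om f = zext Om g \<longleftrightarrow> (AE x in lebesgue. (if x : Om then f x else 0) = (if x : Om then g x else 0))"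
  unfolding zext_def by (rule abs_lsq_eq_iff) (simp_all add: L2_restrict assms)
 also have "... \<longleftrightarrow> (AE x in lebesgue. x : Om --> f x = g x)" by (rule AE_cong) simp
 finally show ?thesis by (simp add: AE_lebesgue_on assms)
qed

lemma zext_add: "Om : sets lebesgue ==> f : L2 Om ==> g : L2 Om ==> zext Om f+zext Om g = zext Om (%x. f x+g x)"
 unfolding zext_def by (subst plus_lsq.abs_eq) (auto simp: L2_restrict intro!: arg_cong[where f=abs_lsq])

lemma zext_diff: "Om : sets lebesgue ==> f : L2 Om ==> g : L2 Om ==> zext Om f-zext Om g = zext Om (%x. f x-g x)"
 unfolding zext_def by (subst minus_lsq.abs_eq) (auto simp: L2_restrict intro!: arg_cong[where f=abs_lsq])

lemma zext_scaleR: "Om : sets lebesgue ==> f : L2 Om ==> c*.zext Om f = zext Om (%x. c*.f x)"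
 unfolding zext_def by (subst scaleR_lsq.abs_eq) (auto simp: L2_restrict intro!: arg_cong[where f=abs_lsq])

lemma zext_zero: "zext Om (%x. 0) = 0" by (simp add: zext_def zero_lsq_def cong: if_cong)

lemma lmap_ext: assumes O: "Om : sets lebesgue" and f: "f : L2 Om" and W: "bounded_linear W" shows "lmap W (zext Om f) = zext Om (%x. W (f x))"
proof (rule lsq_eqI)
 show "AE x in lebesgue. rep (lmap W (zext Om f)) x = rep (zext Om (%x. W (f x))) x"
  using rep_lmap[OF W, of "zext Om f"] rep_ext[OF O f] rep_ext[OF O L2_linear[OF f W]] by eventually_elim (simp add: linear_simps(3)[OF W])
qed

lemma zext_inner: assumes O: "Om : sets lebesgue" and f: "f : L2 Om" and g: "g : L2 Om" shows "inner (zext Om f) (zext Om g) = l2_inner Om f g"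
proof -
 have "inner (zext Om f) (zext Om g) = (LINT x|lebesgue. (if x : Om then f x else 0)<.>(if x : Om then g x else 0))"
  unfolding zext_def by (rule inner_lsq.abs_eq) (simp_all add: L2_restrict O f g)
 also have "... = (LINT x|lebesgue. (if x : Om then f x<.>g x else 0))" by (rule Bochner_Integration.integral_cong) simp_all
 also have "... = l2_inner Om f g" unfolding l2_inner_def by (rule Lebesgue_Measure.integral_restrict_UNIV[OF O])
 finally show ?thesis .
qed

lemma zext_norm: "Om : sets lebesgue ==> f : L2 Om ==> norm (zext Om f) = l2_norm Om f" by (simp add: norm_eq_sqrt_inner zext_inner l2_norm_def)

abbreviation restr where "restr Om F \<equiv> zext Om (rep F)"

lemma rep_restr: "Om : sets lebesgue ==> AE x in lebesgue. rep (restr Om F) x = (if x : Om then rep F x else 0)" by (intro rep_ext rep_L2_on)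

lemma lmap_add: "bounded_linear W ==> lmap W (F+G) = lmap W F+lmap W G"
proof (rule lsq_eqI)
 assume W: "bounded_linear W"
 show "AE x in lebesgue. rep (lmap W (F+G)) x = rep (lmap W F+lmap W G) x"
  using rep_lmap[OF W, of "F+G"] rep_lmap[OF W, of F] rep_lmap[OF W, of G] rep_add[of F G] rep_add[of "lmap W F" "lmap W G"]
  by eventually_elim (simp add: linear_simps(1)[OF W])
qed

lemma lmap_scaleR: "bounded_linear W ==> lmap W (c*.F) = c*.lmap W F"
proof (rule lsq_eqI)
 assume W: "bounded_linear W"
 show "AE x in lebesgue. rep (lmap W (c*.F)) x = rep (c*.lmap W F) x"
  using rep_lmap[OF W, of "c*.F"] rep_lmap[OF W, of F] rep_scaleR[of c F] rep_scaleR[of c "lmap W F"]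
  by eventually_elim (simp add: linear_simps(5)[OF W])
qed

lemma norm_lsq_le:
 fixes F :: "('d::finite, 'b::euclidean_space) lsq" and G :: "('d, 'c::euclidean_space) lsq"
 assumes b: "AE x in lebesgue. norm (rep F x) <= K*norm (rep G x)" and K: "0 <= K" shows "norm F <= K*norm G"
proof (rule power2_le_imp_le)
 have i: "integrable lebesgue (%x. (norm (rep F x))^2)" for F :: "('d, 'e::euclidean_space) lsq"
  using rep_L2[of F] by (simp add: L2_def lebesgue_on_UNIV_eq)
 have "(norm F)^2 <= (LINT x|lebesgue. K\<^sup>2*(norm (rep G x))^2)" unfolding norm_lsq_sq
 proof (rule integral_mono_AE)
  show "AE x in lebesgue. (norm (rep F x))^2 <= K^2*(norm (rep G x))^2" using b by eventually_elim (metis power_mult_distrib power_mono norm_ge_zero)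
 qed (auto intro: i)
 thus "(norm F)^2 <= (K*norm G)^2" by (simp add: norm_lsq_sq power_mult_distrib)
qed (use K in simp)

lemma bl_lmap: assumes W: "bounded_linear W" shows "bounded_linear (lmap W)"
proof -
 obtain K where K: "0 < K" "!!x. norm (W x) <= norm x*K" using bounded_linear.pos_bounded[OF W] by blast
 show ?thesis
 proof (rule bounded_linear_intro)
  show "norm (lmap W F) <= norm F*K" for F unfolding mult.commute[of _ K]
  proof (rule norm_lsq_le)
   show "AE x in lebesgue. norm (rep (lmap W F) x) <= K*norm (rep F x)"
    using rep_lmap[OF W, of F] by eventually_elim (simp add: K(2) mult.commute[of K])
  qed (use K(1) in simp)
 qed (simp_all add: lmap_add lmap_scaleR W)
qed

lemmas lmap_simps = linear_simps[OF bl_lmap]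

lemma bl_restr: assumes O: "Om : sets lebesgue" shows "bounded_linear (restr Om)"
proof (rule bounded_linear_intro)
 fix F G :: "('a, 'b) lsq" and c :: real
 show "restr Om (F+G) = restr Om F+restr Om G" by (rule lsq_eqI)
   (use rep_restr[OF O, of "F+G"] rep_restr[OF O, of F] rep_restr[OF O, of G] rep_add[of F G] rep_add[of "restr Om F" "restr Om G"]
   in \<open>eventually_elim, simp\<close>)
 show "restr Om (c*.F) = c*.restr Om F" by (rule lsq_eqI)
   (use rep_restr[OF O, of "c*.F"] rep_restr[OF O, of F] rep_scaleR[of c F] rep_scaleR[of c "restr Om F"] in \<open>eventually_elim, simp\<close>)
 have "norm (restr Om F) <= 1*norm F" by (rule norm_lsq_le) (use rep_restr[OF O, of F] in \<open>auto elim: eventually_mono\<close>)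
 thus "norm (restr Om F) <= norm F*1" by simp
qed

lemma inner_lmap_adjoint: assumes W: "bounded_linear W" and V: "bounded_linear V" and adj: "!!x y. W x<.>y = x<.>V y"
 shows "inner (lmap W F) G = inner F (lmap V G)" unfolding inner_lsq
proof (rule integral_cong_AE)
 show "(%x. rep (lmap W F) x<.>rep G x) : borel_measurable lebesgue" "(%x. rep F x<.>rep (lmap V G) x) : borel_measurable lebesgue"
  by (intro borel_measurable_inner L2_UNIV_measurable rep_L2)+
 show "AE x in lebesgue. rep (lmap W F) x<.>rep G x = rep F x<.>rep (lmap V G) x"
  using rep_lmap[OF W, of F] rep_lmap[OF V, of G] by eventually_elim (simp add: adj)
qed

lemma inner_restr_left: assumes O: "Om : sets lebesgue" shows "inner (restr Om F) G = inner F (restr Om G)" unfolding inner_lsq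
proof (rule integral_cong_AE)
 show "(%x. rep (restr Om F) x<.>rep G x) : borel_measurable lebesgue" "(%x. rep F x<.>rep (restr Om G) x) : borel_measurable lebesgue"
  by (intro borel_measurable_inner L2_UNIV_measurable rep_L2)+
 show "AE x in lebesgue. rep (restr Om F) x<.>rep G x = rep F x<.>rep (restr Om G) x"
  using rep_restr[OF O, of F] rep_restr[OF O, of G] by eventually_elim simp
qed

lemma restr_ext: "Om : sets lebesgue ==> f : L2 Om ==> restr Om (zext Om f) = zext Om f" by (subst zext_eq_iff) (simp_all add: rep_L2_on rep_ext_on)

lemma inner_form_lmap:
 fixes W :: "'b => 'b::euclidean_space" assumes W: "bounded_linear W" and sym: "!!x y. W x<.>y = x<.>W y"
  and m: "0 < m" and pos: "!!x. m*(norm x)^2 <= W x<.>x" shows "inner_form (%F G :: ('d::finite, 'b) lsq. inner (lmap W F) G) m"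
proof (rule inner_form.intro)
 show "bounded_bilinear (%F G :: ('d, 'b) lsq. inner (lmap W F) G)" by (rule bounded_bilinear.comp1[OF bounded_bilinear_inner bl_lmap[OF W]])
 show "inner (lmap W F) G = inner (lmap W G) F" for F G :: "('d, 'b) lsq" using inner_lmap_adjoint[OF W W sym, of F G] by (simp add: inner_commute)
 show "m*(norm F)^2 <= inner (lmap W F) F" for F :: "('d, 'b) lsq"
 proof -
  have i: "integrable lebesgue (%x. (norm (rep F x))^2)" using rep_L2[of F] by (simp add: L2_def lebesgue_on_UNIV_eq)
  have "m*(norm F)^2 = (LINT x|lebesgue. m*(norm (rep F x))^2)" by (simp add: norm_lsq_sq)
  also have "... <= inner (lmap W F) F" unfolding inner_lsq
  proof (rule integral_mono_AE)
   show "AE x in lebesgue. m*(norm (rep F x))^2 <= rep (lmap W F) x<.>rep F x" using rep_lmap[OF W, of F] by eventually_elim (simp add: pos)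
  qed (auto intro: i L2_UNIV_integrable_inner rep_L2)
  finally show ?thesis .
 qed
qed (rule m)

section \<open>Weak derivatives\<close>

lemma smooth_grad_cont: "smooth ph ==> cont (grad ph)"
proof -
 assume "smooth ph"
 hence "Ck 1 ph" by (rule smooth_Ck)
 hence "cont (pd i ph)" for i by simp
 hence "cont (%x. \<chi> i. pd i ph x)" by (rule continuous_on_vec_lambda)
 thus ?thesis unfolding grad_def[abs_def] .
qed

lemma smooth_cont: "smooth ph ==> cont ph" using smooth_Ck Ck_continuous by blast

lemma test_fun_cont: "test_fun Om ph ==> cont ph" "test_fun Om ph ==> cont (pd i ph)"
proof -
 show "test_fun Om ph ==> cont ph" by (simp add: test_fun_def smooth_cont)
 assume "test_fun Om ph"
 hence "Ck 1 ph" by (intro smooth_Ck) (simp add: test_fun_def)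
 thus "cont (pd i ph)" by simp
qed

lemma test_fun_zero: assumes t: "test_fun Om ph" and x: "x \<notin> Om" shows "ph x = 0" "pd i ph x = 0"
proof -
 obtain K where K: "compact K" "K \<subseteq> Om" "!!x. x \<notin> K ==> ph x = 0" using t unfolding test_fun_def by blast
 hence xK: "x : - K" using x by blast
 thus "ph x = 0" using K by simp
 have "pd i ph x = pd i (%_. 0) x" by (rule pd_local[of "- K"]) (use K xK compact_imp_closed in auto)
 thus "pd i ph x = 0" by simp
qed

lemma test_fun_csupp: "test_fun Om ph ==> csupp ph"
proof -
 assume "test_fun Om ph"
 then obtain K where K: "compact K" "!!x. x \<notin> K ==> ph x = 0" unfolding test_fun_def by blast
 obtain B where "!!x. x : K ==> norm x <= B" using compact_imp_bounded[OF K(1)] unfolding bounded_iff by blast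
 thus ?thesis using K(2) by (intro csuppI[of B]) (meson not_le)
qed

lemma l2_inner_nonneg: "0 <= l2_inner Om u u" by (simp add: l2_inner_def)

locale bounded_domain =
 fixes Om :: "(real^'d) set" assumes opn: "open Om" and bdd: "bounded Om"
begin

lemma Om [simp, intro]: "Om : sets lebesgue" using opn by auto

lemma finite_measure_Om: "finite_measure (LO Om)" by (rule finite_measure_lebesgue_on) (rule lmeasurable_open[OF bdd opn])

lemma cont_L2: assumes f: "cont f" shows "f : L2 Om"
proof -
 have "compact (f ` closure Om)"
  by (rule compact_continuous_image[OF continuous_on_subset[OF f]]) (use bdd in \<open>auto simp: compact_closure\<close>)
 from compact_imp_bounded[OF this] obtain B where "ALL y:f ` closure Om. norm y <= B" unfolding bounded_iff by (rule exE)
 hence B: "norm (f x) <= B" if "x : closure Om" for x using that by blast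
 have m: "f : borel_measurable (LO Om)" by (rule continuous_imp_measurable_on_sets_lebesgue[OF continuous_on_subset[OF f]]) auto
 have "integrable (LO Om) (%x. (norm (f x))^2)"
 proof (rule Bochner_Integration.integrable_bound)
  show "integrable (LO Om) (%x. B\<^sup>2)" by (rule finite_measure.integrable_const[OF finite_measure_Om])
  show "(%x. (norm (f x))^2) : borel_measurable (LO Om)" using m by measurable
  show "AE x in LO Om. norm ((norm (f x))^2) <= norm (B^2)"
  proof (rule AE_I2)
   fix x assume "x : space (LO Om)"
   hence "norm (f x) <= B" using B[of x] closure_subset by auto
   hence "(norm (f x))^2 <= B^2" by (intro power_mono) auto
   thus "norm ((norm (f x))^2) <= norm (B^2)" by simp
  qed
 qed
 thus ?thesis using m by (simp add: L2_def)
qed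

lemma test_fun_L2: "test_fun Om ph ==> ph : L2 Om" "test_fun Om ph ==> pd i ph : L2 Om" by (simp_all add: cont_L2 test_fun_cont)

lemma L2_integrable:
 fixes u :: "real^'d => real" assumes u: "u : L2 Om" shows "integrable (LO Om) u" using L2_integrable_inner[OF u cont_L2[of "%_. 1"]] by simp

lemma L2_integrable_mult:
 fixes u v :: "real^'d => real" assumes "u : L2 Om" "v : L2 Om" shows "integrable (LO Om) (%x. u x * v x)" using L2_integrable_inner[OF assms] by simp

lemma L2_nth: "u : L2 Om ==> (%x. u x$i) : L2 Om" by (erule L2_linear) (rule bounded_linear_vec_nth)

lemma lebesgue_on_cont_integral:
 fixes f :: "real^'d => real" assumes f: "cont f" and z: "!!x. x \<notin> Om ==> f x = 0" shows "(LINT x|LO Om. f x) = (LB x. f x)"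
proof -
 have "(LINT x|LO Om. f x) = (LINT x|lebesgue. (if x : Om then f x else 0))" by (rule Lebesgue_Measure.integral_restrict_UNIV[symmetric]) simp
 also have "(%x. if x : Om then f x else 0) = f" using z by auto
 also have "(LINT x|lebesgue. f x) = (LB x. f x)" by (rule integral_completion) (use f borel_measurable_continuous_onI in auto)
 finally show ?thesis .
qed

lemma smooth_weak_grad: assumes s: "smooth ph" shows "is_weak_grad Om ph (grad ph)" unfolding is_weak_grad_def
proof (intro conjI allI impI)
 show "grad ph : L2 Om" by (rule cont_L2[OF smooth_grad_cont[OF s]])
 fix ps i assume t: "test_fun Om ps"
 have c: "cont (pd i ph)" using smooth_Ck[OF s, of 1] by simp
 have "(LINT x|LO Om. ph x*pd i ps x) = (LB x. ph x*pd i ps x)"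
  by (rule lebesgue_on_cont_integral[OF continuous_on_mult[OF smooth_cont[OF s] test_fun_cont(2)[OF t]]]) (simp add: test_fun_zero[OF t])
 also have "... = - (LB x. pd i ph x*ps x)"
 proof (rule integral_by_parts)
  show "Ck 1 ph" by (rule smooth_Ck[OF s])
  show "Ck 1 ps" by (rule smooth_Ck) (use t in \<open>simp add: test_fun_def\<close>)
  show "csupp ph \<or> csupp ps" using test_fun_csupp[OF t] ..
 qed
 also have "(LB x. pd i ph x*ps x) = (LINT x|LO Om. grad ph x$i*ps x)" unfolding grad_nth
  by (rule lebesgue_on_cont_integral[symmetric, OF continuous_on_mult[OF c test_fun_cont(1)[OF t]]]) (simp add: test_fun_zero[OF t])
 finally show "(LINT x|LO Om. ph x*pd i ps x) = - (LINT x|LO Om. grad ph x$i*ps x)" .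
qed

lemma L2_zero_of_test:
 fixes g :: "real^'d => real" assumes "g : L2 Om" "!!ph. test_fun Om ph ==> (LINT x|LO Om. g x*ph x) = 0" shows "AE x in LO Om. g x = 0"
 by (rule fundamental_lemma[OF opn L2_integrable[OF assms(1)] assms(2)])

lemma weak_grad_unique: assumes G: "is_weak_grad Om q G" and G': "is_weak_grad Om q G'" shows "AE x in LO Om. G x = G' x"
proof -
 have L: "G : L2 Om" "G' : L2 Om" using G G' by (auto simp: is_weak_grad_def)
 have "AE x in LO Om. G x$i-G' x$i = 0" for i
 proof (rule L2_zero_of_test)
  show "(%x. G x$i-G' x$i) : L2 Om" by (intro L2_diff L2_nth L)
  fix ph assume t: "test_fun Om ph"
  have "- (LINT x|LO Om. G x$i*ph x) = (LINT x|LO Om. q x*pd i ph x)"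
   "- (LINT x|LO Om. G' x$i*ph x) = (LINT x|LO Om. q x*pd i ph x)" using G G' t by (simp_all add: is_weak_grad_def)
  hence "(LINT x|LO Om. G x$i*ph x) = (LINT x|LO Om. G' x$i*ph x)" by linarith
  thus "(LINT x|LO Om. (G x$i-G' x$i)*ph x) = 0" by (simp add: left_diff_distrib L2_integrable_mult L2_nth L test_fun_L2 t)
 qed
 hence "AE x in LO Om. ALL i:UNIV. G x$i-G' x$i = 0" by (intro AE_finite_allI) auto
 thus ?thesis by eventually_elim (simp add: vec_eq_iff)
qed

lemma weak_div_unique: assumes G: "is_weak_div Om q G" and G': "is_weak_div Om q G'" shows "AE x in LO Om. G x = G' x"
proof -
 have L: "G : L2 Om" "G' : L2 Om" using G G' by (auto simp: is_weak_div_def)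
 have "AE x in LO Om. G x-G' x = 0"
 proof (rule L2_zero_of_test)
  show "(%x. G x-G' x) : L2 Om" by (intro L2_diff L)
  fix ph assume t: "test_fun Om ph"
  have "- (LINT x|LO Om. G x*ph x) = (LINT x|LO Om. (SU i. q x$i*pd i ph x))"
   "- (LINT x|LO Om. G' x*ph x) = (LINT x|LO Om. (SU i. q x$i*pd i ph x))" using G G' t by (simp_all add: is_weak_div_def)
  hence "(LINT x|LO Om. G x*ph x) = (LINT x|LO Om. G' x*ph x)" by linarith
  thus "(LINT x|LO Om. (G x-G' x)*ph x) = 0" by (simp add: left_diff_distrib L2_integrable_mult L test_fun_L2 t)
 qed
 thus ?thesis by simp
qed

lemma weak_grad_eq: "is_weak_grad Om q G ==> AE x in LO Om. weak_grad Om q x = G x" by (rule weak_grad_unique) (simp_all add: weak_grad_def someI)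

lemma weak_div_eq: "is_weak_div Om q G ==> AE x in LO Om. weak_div Om q x = G x" by (rule weak_div_unique) (simp_all add: weak_div_def someI)

lemma is_weak_grad_weak_grad: "is_weak_grad Om q G ==> is_weak_grad Om q (weak_grad Om q)" by (simp add: weak_grad_def someI)

lemma is_weak_div_weak_div: "is_weak_div Om q G ==> is_weak_div Om q (weak_div Om q)" by (simp add: weak_div_def someI)

lemma is_weak_grad_diff: assumes q: "q : L2 Om" "q' : L2 Om" and G: "is_weak_grad Om q G" "is_weak_grad Om q' G'"
 shows "is_weak_grad Om (%x. q x-q' x) (%x. G x-G' x)" unfolding is_weak_grad_def
proof (intro conjI allI impI)
 have L: "G : L2 Om" "G' : L2 Om" using G by (auto simp: is_weak_grad_def)
 show "(%x. G x-G' x) : L2 Om" by (intro L2_diff L)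
 fix ph i assume t: "test_fun Om ph"
 hence "(LINT x|LO Om. q x*pd i ph x) = - (LINT x|LO Om. G x$i*ph x)"
  "(LINT x|LO Om. q' x*pd i ph x) = - (LINT x|LO Om. G' x$i*ph x)" using G unfolding is_weak_grad_def by blast+
 thus "(LINT x|LO Om. (q x-q' x)*pd i ph x) = - (LINT x|LO Om. (G x-G' x)$i*ph x)"
  by (simp add: left_diff_distrib L2_integrable_mult L2_nth L q test_fun_L2 t)
qed

definition jet :: "(real^'d => real) => (real^'d => real^'d) => ('d, real \<times> (real^'d)) lsq" where
 "jet q G = zext Om (%x. (q x, G x))"

lemma inner_jet: assumes "q : L2 Om" "G : L2 Om" "r : L2 Om" "H : L2 Om" shows "inner (jet q G) (jet r H) = l2_inner Om q r+l2_inner Om G H"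
 unfolding jet_def using assms
 by (subst zext_inner) (simp_all add: L2_Pair l2_inner_def Bochner_Integration.integral_add[OF L2_integrable_inner L2_integrable_inner, of q Om r G H, simplified] L2_integrable_mult L2_integrable_inner)

lemma jet_diff: assumes "q : L2 Om" "G : L2 Om" "r : L2 Om" "H : L2 Om" shows "jet q G-jet r H = jet (%x. q x-r x) (%x. G x-H x)"
 unfolding jet_def using assms by (subst zext_diff) (simp_all add: L2_Pair)

lemma norm_jet: "q : L2 Om ==> G : L2 Om ==> norm (jet q G) = sqrt ((l2_norm Om q)^2+(l2_norm Om G)^2)"
 by (simp add: norm_eq_sqrt_inner inner_jet l2_norm_def l2_inner_nonneg)

lemma l2_norm_cong:
 "f : L2 Om ==> g : L2 Om ==> AE x in LO Om. f x = g x ==> l2_norm Om f = l2_norm Om g"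
 using zext_eq_iff[OF Om, of f g] zext_norm[OF Om, of f] zext_norm[OF Om, of g] by simp

lemma h1_norm_eq: assumes q: "q : L2 Om" and G: "is_weak_grad Om q G" shows "h1_norm Om q = norm (jet q G)"
proof -
 have "l2_norm Om (weak_grad Om q) = l2_norm Om G"
  by (rule l2_norm_cong) (use weak_grad_eq[OF G] is_weak_grad_weak_grad[OF G] G in \<open>auto simp: is_weak_grad_def\<close>)
 thus ?thesis using q G by (simp add: h1_norm_def norm_jet is_weak_grad_def)
qed

lemma is_weak_grad_jet: assumes q: "q : L2 Om" and G: "G : L2 Om"
 shows "is_weak_grad Om q G \<longleftrightarrow> (ALL ph i. test_fun Om ph --> inner (jet q G) (jet (pd i ph) (%x. ph x*.axis i 1)) = 0)"
proof -
 have "inner (jet q G) (jet (pd i ph) (%x. ph x*.axis i 1))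
   = (LINT x|LO Om. q x*pd i ph x)+(LINT x|LO Om. G x$i*ph x)" if t: "test_fun Om ph" for ph i
 proof -
  have "(%x. ph x*.axis i 1) : L2 Om" by (rule cont_L2) (intro continuous_intros test_fun_cont[OF t])
  hence "inner (jet q G) (jet (pd i ph) (%x. ph x*.axis i 1)) = l2_inner Om q (pd i ph)+l2_inner Om G (%x. ph x*.axis i 1)"
   by (intro inner_jet q G test_fun_L2 t)
  thus ?thesis by (simp add: l2_inner_def inner_axis mult.commute)
 qed
 thus ?thesis using G by (auto simp: is_weak_grad_def add_eq_0_iff2)
qed

end

section \<open>Boundary conditions as closed subspaces\<close>

lemma row_eq: "row i A = A$i" by (simp add: row_def vec_eq_iff)

lemma smooth_pd_add: "smooth ph ==> smooth ps ==> grad (%x. ph x+ps x) x = grad ph x+grad ps x"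
 using smooth_Ck[of ph 1] smooth_Ck[of ps 1] by (simp add: vec_eq_iff pd_add)

lemma smooth_pd_cmult: "smooth ph ==> grad (%x. c*ph x) x = c*.grad ph x" using smooth_Ck[of ph 1] by (simp add: vec_eq_iff pd_cmult)

context bounded_domain
begin

lemma l2_inner_cong: assumes "f : L2 Om" "f' : L2 Om" "g : L2 Om" "g' : L2 Om" "AE x in LO Om. f x = f' x" "AE x in LO Om. g x = g' x"
 shows "l2_inner Om f g = l2_inner Om f' g'"
proof -
 have "zext Om f = zext Om f'" "zext Om g = zext Om g'" using assms by (simp_all add: zext_eq_iff)
 thus ?thesis using assms zext_inner[of Om f g] zext_inner[of Om f' g'] by simp
qed

definition HD :: "(real^'d) set => ('d, real \<times> (real^'d)) lsq set" where
 "HD S = {F. ALL e>0. EX ph. smooth ph & norm (jet ph (grad ph)-F) < e & (SQ S ph) < ennreal e}"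

lemma HDE: assumes "F : HD S" "0 < e"
 obtains ph where "smooth ph" "norm (jet ph (grad ph)-F) < e" "(SQ S ph) < ennreal e" using assms unfolding HD_def by blast

lemma jet_smooth_L2: "smooth ph ==> ph : L2 Om" "smooth ph ==> grad ph : L2 Om" by (simp_all add: cont_L2 smooth_cont smooth_grad_cont)

lemma jet_add: assumes "q : L2 Om" "G : L2 Om" "r : L2 Om" "H : L2 Om" shows "jet q G+jet r H = jet (%x. q x+r x) (%x. G x+H x)"
 unfolding jet_def using assms by (subst zext_add) (simp_all add: L2_Pair)

lemma jet_scaleR: assumes "q : L2 Om" "G : L2 Om" shows "c*.jet q G = jet (%x. c*q x) (%x. c*.G x)"
 unfolding jet_def using assms by (subst zext_scaleR) (simp_all add: L2_Pair)

lemma HD_closed: "closed (HD S)" unfolding closure_subset_eq[symmetric]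
proof
 fix F assume F: "F : closure (HD S)"
 show "F : HD S" unfolding HD_def
 proof (intro CollectI allI impI)
  fix e :: real assume e: "0 < e"
  hence e2: "0 < e/2" by simp
  with F obtain G where G: "G : HD S" "dist G F < e/2" unfolding closure_approachable by blast
  obtain ph where p: "smooth ph" "norm (jet ph (grad ph)-G) < e/2" "(SQ S ph) < ennreal (e/2)" by (rule HDE[OF G(1) e2])
  have "norm (jet ph (grad ph)-F) < e" using norm_triangle_ineq[of "jet ph (grad ph)-G" "G-F"] p(2) G(2) by (simp add: dist_norm)
  moreover have "(SQ S ph) < ennreal e" by (rule less_trans[OF p(3)]) (use e in \<open>simp add: ennreal_less_iff\<close>)
  ultimately show "EX ph. smooth ph & norm (jet ph (grad ph)-F) < e & (SQ S ph) < ennreal e" using p(1) by blast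
 qed
qed

lemma HD_jetI: assumes s: "smooth ph" and z: "(SQ S ph) = 0" shows "jet ph (grad ph) : HD S"
 unfolding HD_def by (intro CollectI allI impI exI[of _ ph]) (simp add: s z)

lemma HD_subspace: assumes S: "S : sets borel" shows "subspace (HD S)" unfolding subspace_def
proof (intro conjI ballI allI)
 have "jet (%_. 0) (grad (%_. 0)) : HD S" by (rule HD_jetI) (simp_all add: smooth_def)
 moreover have "jet (%_. 0) (grad (%_. 0)) = 0"
  using zext_zero[of Om, where 'b="real \<times> (real^'d)"] by (simp add: jet_def grad_def vec_eq_iff zero_prod_def flip: zero_vec_def)
 ultimately show "0 : HD S" by simp
next
 fix F G assume F: "F : HD S" and G: "G : HD S"
 show "F+G : HD S" unfolding HD_def
 proof (intro CollectI allI impI)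
  fix e :: real assume e: "0 < e"
  hence e8: "0 < e/8" by simp
  obtain ph where p: "smooth ph" "norm (jet ph (grad ph)-F) < e/8" "(SQ S ph) < ennreal (e/8)" by (rule HDE[OF F e8])
  obtain ps where q: "smooth ps" "norm (jet ps (grad ps)-G) < e/8" "(SQ S ps) < ennreal (e/8)" by (rule HDE[OF G e8])
  let ?f = "%x. ph x+ps x"
  have s: "smooth ?f" using p(1) q(1) by (auto simp: smooth_def)
  have "jet ?f (grad ?f) = jet ph (grad ph)+jet ps (grad ps)" by (simp add: jet_add jet_smooth_L2 p(1) q(1) smooth_pd_add[OF p(1) q(1), abs_def])
  hence eq: "jet ?f (grad ?f)-(F+G) = (jet ph (grad ph)-F)+(jet ps (grad ps)-G)" by simp
  have n: "norm (jet ?f (grad ?f)-(F+G)) < e" unfolding eq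
   using norm_triangle_ineq[of "jet ph (grad ph)-F" "jet ps (grad ps)-G"] p(2) q(2) e by linarith
  have [measurable]: "ph : borel_measurable borel" "ps : borel_measurable borel"
   using smooth_cont[OF p(1)] smooth_cont[OF q(1)] by (simp_all add: borel_measurable_continuous_onI)
  have "(SQ S ?f) <=
    (\<integral>\<^sup>+x. 2*(ennreal ((ph x)^2)*ind S x)+2*(ennreal ((ps x)^2)*ind S x) \<partial>surface_measure)"
  proof (rule nn_integral_mono)
   fix x
   have "(ph x+ps x)^2 <= 2*(ph x)^2+2*(ps x)^2" using sum_squares_bound[of "ph x" "ps x"] by (simp add: power2_sum)
   hence "ennreal ((ph x+ps x)^2) <= ennreal (2*(ph x)^2+2*(ps x)^2)" by (rule ennreal_leI)
   also have "... = 2*ennreal ((ph x)^2)+2*ennreal ((ps x)^2)" by (simp add: ennreal_plus ennreal_mult)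
   finally show "ennreal ((ph x+ps x)^2)*ind S x <= 2*(ennreal ((ph x)^2)*ind S x)+2*(ennreal ((ps x)^2)*ind S x)" by (simp add: indicator_def)
  qed
  also have "... = 2*(SQ S ph)+2*(SQ S ps)" using S by (subst nn_integral_add) (simp_all add: nn_integral_cmult)
  also have "... <= 2*ennreal (e/8)+2*ennreal (e/8)" using p(3) q(3) by (intro add_mono mult_left_mono) auto
  also have "2*ennreal (e/8) = ennreal (2*(e/8))" using e by (subst ennreal_mult) auto
  also have "ennreal (2*(e/8))+ennreal (2*(e/8)) = ennreal (2*(e/8)+2*(e/8))" using e by (subst ennreal_plus) auto
  also have "... < ennreal e" using e by (simp add: ennreal_less_iff)
  finally show "EX ph. smooth ph & norm (jet ph (grad ph)-(F+G)) < e & (SQ S ph) < ennreal e" using s n by blast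
 qed
next
 fix c :: real and F assume F: "F : HD S"
 show "c*.F : HD S" unfolding HD_def
 proof (intro CollectI allI impI)
  fix e :: real assume e: "0 < e"
  define d where "d = e/(1 + abs(c) + c^2)"
  have p: "0 < 1 + abs(c) + c^2" by (intro add_pos_nonneg) auto
  have d: "0 < d" using e p by (simp add: d_def)
  have "(1 + abs(c) + c^2)*d = e" using p by (simp add: d_def)
  hence e_eq: "e = d + abs(c)*d+c^2*d" by (simp add: algebra_simps)
  have nn: "0 <= abs(c)*d" "0 <= c^2*d" using d by simp_all
  obtain ph where p: "smooth ph" "norm (jet ph (grad ph)-F) < d" "(SQ S ph) < ennreal d" by (rule HDE[OF F d])
  let ?f = "%x. c*ph x"
  have s: "smooth ?f" using p(1) by (auto simp: smooth_def)
  have "jet ?f (grad ?f) = c*.jet ph (grad ph)" by (simp add: jet_scaleR jet_smooth_L2 p(1) smooth_pd_cmult[OF p(1), abs_def])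
  hence "jet ?f (grad ?f)-c*.F = c*.(jet ph (grad ph)-F)" by (simp add: algebra_simps)
  hence "norm (jet ?f (grad ?f)-c*.F) = abs(c)*norm (jet ph (grad ph)-F)" by simp
  also have "... <= abs(c)*d" using p(2) by (intro mult_left_mono) auto
  also have "... < e" using e_eq nn d by linarith
  finally have n: "norm (jet ?f (grad ?f)-c*.F) < e" .
  have [measurable]: "ph : borel_measurable borel" using smooth_cont[OF p(1)] by (simp add: borel_measurable_continuous_onI)
  have "(SQ S ?f) = (\<integral>\<^sup>+x. ennreal (c^2)*(ennreal ((ph x)^2)*ind S x) \<partial>surface_measure)"
   by (simp add: power_mult_distrib ennreal_mult mult.assoc)
  also have "... = ennreal (c^2)*(SQ S ph)" using S by (simp add: nn_integral_cmult)
  also have "... <= ennreal (c^2)*ennreal d" using p(3) by (intro mult_left_mono) auto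
  also have "... = ennreal (c^2*d)" using d by (simp add: ennreal_mult)
  also have "... < ennreal e"
  proof (rule ennreal_lessI)
   show "c^2*d < e" using e_eq nn d by linarith
  qed (rule e)
  finally show "EX ph. smooth ph & norm (jet ph (grad ph)-c*.F) < e & (SQ S ph) < ennreal e" using s n by blast
 qed
qed

lemma restr_jet: "q : L2 Om ==> G : L2 Om ==> restr Om (jet q G) = jet q G" unfolding jet_def by (intro restr_ext L2_Pair Om)

lemma jet_rep: assumes "restr Om F = F" shows "(%x. fst (rep F x)) : L2 Om" "(%x. snd (rep F x)) : L2 Om"
  "F = jet (%x. fst (rep F x)) (%x. snd (rep F x))"
 using assms by (simp_all add: jet_def L2_linear[OF rep_L2_on[OF Om] bounded_linear_fst] L2_linear[OF rep_L2_on[OF Om] bounded_linear_snd])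

lemma HD_E: assumes "F : HD S"
 obtains q G where "q : L2 Om" "G : L2 Om" "is_weak_grad Om q G" "F = jet q G"
proof -
 let ?t = "%i ph. jet (pd i ph) (%x. ph x*.axis i 1)"
 let ?K = "{F. restr Om F = F} \<inter> (\<Inter>i. \<Inter>ph\<in>{ph. test_fun Om ph}. {F. inner F (?t i ph) = 0})"
 have "closed ?K" by (intro closed_Int closed_INT ballI closed_Collect_eq linear_continuous_on bl_restr continuous_intros Om)
 moreover have "{jet ph (grad ph) |ph. smooth ph} \<subseteq> ?K" using is_weak_grad_jet smooth_weak_grad by (auto simp: restr_jet jet_smooth_L2)
 ultimately have "closure {jet ph (grad ph) |ph. smooth ph} \<subseteq> ?K" by (intro closure_minimal)
 moreover have "F : closure {jet ph (grad ph) |ph. smooth ph}" unfolding closure_approachable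
 proof (intro allI impI)
  fix e :: real assume "0 < e"
  from HDE[OF assms this] obtain ph where "smooth ph" "norm (jet ph (grad ph)-F) < e" by metis
  thus "EX y:{jet ph (grad ph) |ph. smooth ph}. dist y F < e" by (auto simp: dist_norm)
 qed
 ultimately have FK: "F : ?K" by blast
 hence r: "restr Om F = F" by simp
 note j = jet_rep[OF r]
 have "is_weak_grad Om (%x. fst (rep F x)) (%x. snd (rep F x))" unfolding is_weak_grad_jet[OF j(1,2)] j(3)[symmetric] using FK by blast
 thus ?thesis using that j by blast
qed

lemma H1_D_iff: assumes q: "q : L2 Om" and G: "G : L2 Om" shows "jet q G : HD S \<longleftrightarrow> q : H1_D Om S & is_weak_grad Om q G"
proof
 assume F: "jet q G : HD S"
 obtain q' G' where q': "q' : L2 Om" "G' : L2 Om" "is_weak_grad Om q' G'" "jet q G = jet q' G'" by (rule HD_E[OF F])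
 have g: "is_weak_grad Om q G" using q'(3) unfolding is_weak_grad_jet[OF q G] is_weak_grad_jet[OF q'(1,2)] q'(4) .
 have h1: "h1_norm Om (%x. ph x-q x) = norm (jet ph (grad ph)-jet q G)" if "smooth ph" for ph
  by (subst h1_norm_eq[OF _ is_weak_grad_diff[OF _ q smooth_weak_grad g]]) (simp_all add: that jet_smooth_L2 L2_diff q G jet_diff)
 have "EX ph. smooth ph & norm (jet ph (grad ph)-jet q G) < inverse (real (Suc n)) & (SQ S ph) < ennreal (inverse (real (Suc n)))" for n
 proof -
  have "0 < inverse (real (Suc n))" by simp
  from HDE[OF F this] show ?thesis by blast
 qed
 hence "ALL n. EX ph. smooth ph & norm (jet ph (grad ph)-jet q G) < inverse (real (Suc n)) &
  (SQ S ph) < ennreal (inverse (real (Suc n)))" by (rule allI)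
 from choice[OF this] obtain ph where p0: "ALL n. smooth (ph n) & norm (jet (ph n) (grad (ph n))-jet q G) < inverse (real (Suc n)) &
  (\<integral>\<^sup>+x\<in>S. ennreal ((ph n x)^2) \<partial>surface_measure) < ennreal (inverse (real (Suc n)))" by (rule exE)
 have p: "smooth (ph n)" "norm (jet (ph n) (grad (ph n))-jet q G) < inverse (real (Suc n))"
  "(\<integral>\<^sup>+x\<in>S. ennreal ((ph n x)^2) \<partial>surface_measure) < ennreal (inverse (real (Suc n)))" for n using spec[OF p0, of n] by blast+
 have "(%n. h1_norm Om (%x. ph n x-q x)) ----> 0" unfolding h1[OF p(1)]
  by (rule tendsto_sandwich[OF always_eventually[OF allI[OF norm_ge_zero]] always_eventually[OF allI[OF less_imp_le[OF p(2)]]] tendsto_const LIMSEQ_inverse_real_of_nat])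
 moreover have "(%n. \<integral>\<^sup>+x\<in>S. ennreal ((ph n x-0)^2) \<partial>surface_measure) ----> 0" unfolding diff_zero
 proof (rule tendsto_sandwich[OF always_eventually[OF allI[OF zero_le]] always_eventually[OF allI[OF less_imp_le[OF p(3)]]] tendsto_const])
  show "(%n. ennreal (inverse (real (Suc n)))) ----> 0" using tendsto_ennrealI[OF LIMSEQ_inverse_real_of_nat] by (simp del: of_nat_Suc)
 qed
 ultimately have "has_trace Om S q (%_. 0)" unfolding has_trace_def using p(1) by auto
 thus "q : H1_D Om S & is_weak_grad Om q G" using g q by (auto simp: H1_D_def H1_def)
next
 assume *: "q : H1_D Om S & is_weak_grad Om q G"
 hence g: "is_weak_grad Om q G" and "has_trace Om S q (%_. 0)" by (auto simp: H1_D_def)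
 then obtain ph where p: "!!n. smooth (ph n)" "(%n. h1_norm Om (%x. ph n x-q x)) ----> 0"
  "(%n. \<integral>\<^sup>+x\<in>S. ennreal ((ph n x-0)^2) \<partial>surface_measure) ----> 0" unfolding has_trace_def by blast
 have h1: "h1_norm Om (%x. ph x-q x) = norm (jet ph (grad ph)-jet q G)" if "smooth ph" for ph
  by (subst h1_norm_eq[OF _ is_weak_grad_diff[OF _ q smooth_weak_grad g]]) (simp_all add: that jet_smooth_L2 L2_diff q G jet_diff)
 show "jet q G : HD S" unfolding HD_def
 proof (intro CollectI allI impI)
  fix e :: real assume e: "0 < e"
  have "\<forall>\<^sub>F n in sequentially. h1_norm Om (%x. ph n x-q x) < e" by (rule order_tendstoD(2)[OF p(2) e])
  moreover have "\<forall>\<^sub>F n in sequentially. (\<integral>\<^sup>+x\<in>S. ennreal ((ph n x-0)^2) \<partial>surface_measure) < ennreal e"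
   by (rule order_tendstoD(2)[OF p(3)]) (use e in simp)
  ultimately have "\<forall>\<^sub>F n in sequentially. h1_norm Om (%x. ph n x-q x) < e & (\<integral>\<^sup>+x\<in>S. ennreal ((ph n x-0)^2) \<partial>surface_measure) < ennreal e"
   by (rule eventually_conj)
  then obtain n where "h1_norm Om (%x. ph n x-q x) < e" "(\<integral>\<^sup>+x\<in>S. ennreal ((ph n x-0)^2) \<partial>surface_measure) < ennreal e"
   using eventually_happens by force
  thus "EX ph. smooth ph & norm (jet ph (grad ph)-jet q G) < e & (SQ S ph) < ennreal e" using p(1) by (intro exI[of _ "ph n"]) (simp add: h1)
 qed
qed

lemma H1_D_zero: "S : sets borel ==> (%_. 0) : H1_D Om S"
proof -
 assume S: "S : sets borel"
 have "jet (%_. 0) (%_. 0) = 0" using zext_zero[of Om, where 'b="real \<times> (real^'d)"] by (simp add: jet_def zero_prod_def)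
 hence "jet (%_. 0) (%_. 0) : HD S" using subspace_0[OF HD_subspace[OF S]] by simp
 thus ?thesis using H1_D_iff[OF L2_zero L2_zero, of S] by blast
qed

lemma test_fun_HD: assumes S: "S \<subseteq> frontier Om" and t: "test_fun Om ph" shows "jet ph (grad ph) : HD S"
proof (rule HD_jetI)
 show "smooth ph" using t by (simp add: test_fun_def)
 have "ph x = 0" if "x : S" for x by (rule test_fun_zero(1)[OF t]) (use that S opn in \<open>auto simp: frontier_def interior_open\<close>)
 hence "ennreal ((ph x)^2)*ind S x = 0" for x by (auto simp: indicator_def)
 thus "(SQ S ph) = 0" by (simp only: nn_integral_const mult_zero_left)
qed

lemma normal_pairing_eq: assumes v: "v : L2 Om" "w : L2 Om" "is_weak_div Om v w" and q: "q : L2 Om" "G : L2 Om" "is_weak_grad Om q G"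
 shows "normal_pairing Om v q = inner (jet w v) (jet q G)"
proof -
 have 1: "weak_grad Om q : L2 Om" "weak_div Om v : L2 Om"
  using is_weak_grad_weak_grad[OF q(3)] is_weak_div_weak_div[OF v(3)] by (simp_all add: is_weak_grad_def is_weak_div_def)
 have "l2_inner Om v (weak_grad Om q) = l2_inner Om v G" using v q 1 weak_grad_eq[OF q(3)] by (intro l2_inner_cong) auto
 moreover have "l2_inner Om (weak_div Om v) q = l2_inner Om w q" using v q 1 weak_div_eq[OF v(3)] by (intro l2_inner_cong) auto
 ultimately show ?thesis using v q by (simp add: normal_pairing_def inner_jet)
qed

lemma HN_div_iff: assumes S: "S \<subseteq> frontier Om" and v: "v : L2 Om" and w: "w : L2 Om"
 shows "(ALL E:HD S. inner (jet w v) E = 0) \<longleftrightarrow> v : HN_div Om S & is_weak_div Om v w"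
proof
 assume o: "ALL E:HD S. inner (jet w v) E = 0"
 have d: "is_weak_div Om v w" unfolding is_weak_div_def
 proof (intro conjI allI impI w)
  fix ph assume t: "test_fun Om ph"
  hence s: "smooth ph" by (simp add: test_fun_def)
  have "inner (jet w v) (jet ph (grad ph)) = 0" using o test_fun_HD[OF S t] by blast
  hence "l2_inner Om w ph+l2_inner Om v (grad ph) = 0" by (simp add: inner_jet jet_smooth_L2 s v w)
  thus "(LINT x|LO Om. (SU i. v x$i*pd i ph x)) = - (LINT x|LO Om. w x*ph x)" by (simp add: l2_inner_def inner_vec_def)
 qed
 have "normal_pairing Om v q = 0" if q: "q : H1_D Om S" for q
 proof -
  obtain G where G: "is_weak_grad Om q G" using q by (auto simp: H1_D_def H1_def)
  have L: "q : L2 Om" "G : L2 Om" using q G by (auto simp: H1_D_def H1_def is_weak_grad_def)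
  hence "jet q G : HD S" using H1_D_iff q G by blast
  thus ?thesis using normal_pairing_eq[OF v w d L G] o by simp
 qed
 thus "v : HN_div Om S & is_weak_div Om v w" using d v by (auto simp: HN_div_def Hdiv_def)
next
 assume *: "v : HN_div Om S & is_weak_div Om v w"
 hence d: "is_weak_div Om v w" and p: "!!q. q : H1_D Om S ==> normal_pairing Om v q = 0" by (auto simp: HN_div_def)
 show "ALL E:HD S. inner (jet w v) E = 0"
 proof
  fix E assume E: "E : HD S"
  obtain q G where q: "q : L2 Om" "G : L2 Om" "is_weak_grad Om q G" "E = jet q G" by (rule HD_E[OF E])
  hence "q : H1_D Om S" using H1_D_iff E by blast
  thus "inner (jet w v) E = 0" using p normal_pairing_eq[OF v w d q(1-3)] q(4) by simp
 qed
qed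

lemma normal_pairing_mat_eq: assumes t: "\<tau> : L2 Om" "!!i. (%x. row i (\<tau> x)) : Hdiv Om" and v: "v : H1_D_vec Om S"
 shows "normal_pairing_mat Om \<tau> v = (SU i. normal_pairing Om (%x. row i (\<tau> x)) (%x. v x$i))"
proof -
 have g: "weak_grad Om (%x. v x$i) : L2 Om" "(%x. v x$i) : L2 Om" for i
 proof -
  have h: "(%x. v x$i) : H1 Om" using v by (simp add: H1_D_vec_def H1_D_def)
  then obtain G where "is_weak_grad Om (%x. v x$i) G" unfolding H1_def by blast
  from is_weak_grad_weak_grad[OF this] show "weak_grad Om (%x. v x$i) : L2 Om" by (simp add: is_weak_grad_def)
  show "(%x. v x$i) : L2 Om" using h by (simp add: H1_def)
 qed
 have w: "weak_div Om (%x. row i (\<tau> x)) : L2 Om" "(%x. \<tau> x$i) : L2 Om" for i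
 proof -
  obtain y where "is_weak_div Om (%x. row i (\<tau> x)) y" using t(2)[of i] unfolding Hdiv_def by blast
  from is_weak_div_weak_div[OF this] show "weak_div Om (%x. row i (\<tau> x)) : L2 Om" by (simp add: is_weak_div_def)
  show "(%x. \<tau> x$i) : L2 Om" using t(2)[of i] by (simp add: Hdiv_def row_eq)
 qed
 have "l2_inner Om \<tau> (jacobian Om v) = (SU i. l2_inner Om (%x. row i (\<tau> x)) (weak_grad Om (%x. v x$i)))"
  unfolding l2_inner_def jacobian_def row_eq
  by (subst Bochner_Integration.integral_sum[symmetric]) (simp_all add: L2_integrable_inner g w inner_vec_def[of "\<tau> _"])
 moreover have "l2_inner Om (row_div Om \<tau>) v = (SU i. l2_inner Om (weak_div Om (%x. row i (\<tau> x))) (%x. v x$i))"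
  unfolding l2_inner_def row_div_def by (subst Bochner_Integration.integral_sum[symmetric]) (simp_all add: L2_integrable_mult g w inner_vec_def)
 ultimately show ?thesis by (simp add: normal_pairing_mat_def normal_pairing_def sum.distrib)
qed

lemma HN_div_sym_iff: assumes S: "S : sets borel"
 shows "\<tau> : HN_div_sym Om S \<longleftrightarrow> \<tau> : L2_sym Om & (ALL i. (%x. row i (\<tau> x)) : HN_div Om S)"
proof
 assume h: "\<tau> : HN_div_sym Om S"
 hence t: "\<tau> : L2 Om" "!!i. (%x. row i (\<tau> x)) : Hdiv Om" by (auto simp: HN_div_sym_def L2_sym_def)
 have "normal_pairing Om (%x. row i (\<tau> x)) q = 0" if q: "q : H1_D Om S" for i q
 proof -
  let ?v = "%x. (\<chi> k. if k = i then q x else 0) :: real^'d"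
  have c: "(%x. ?v x$k) = (if k = i then q else (%_. 0))" for k by auto
  have v: "?v : H1_D_vec Om S" unfolding H1_D_vec_def mem_Collect_eq c using q H1_D_zero[OF S] by auto
  have z: "normal_pairing Om (%x. row k (\<tau> x)) (%_. 0) = 0" for k
  proof -
   have "jet (%_. 0) (%_. 0) = 0" using zext_zero[of Om, where 'b="real \<times> (real^'d)"] by (simp add: jet_def zero_prod_def)
   moreover have "is_weak_grad Om (%_. 0) (%_. 0)" by (simp add: is_weak_grad_def L2_zero)
   moreover obtain w where "is_weak_div Om (%x. row k (\<tau> x)) w" using t(2)[of k] by (auto simp: Hdiv_def)
   ultimately show ?thesis
    using normal_pairing_eq[of "%x. row k (\<tau> x)" w "%_. 0" "%_. 0"] t(2)[of k] by (simp add: L2_zero Hdiv_def is_weak_div_def)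
  qed
  have "0 = (SU k. normal_pairing Om (%x. row k (\<tau> x)) (%x. ?v x$k))" using h v normal_pairing_mat_eq[OF t v] by (simp add: HN_div_sym_def)
  also have "... = (SU k. if k = i then normal_pairing Om (%x. row i (\<tau> x)) q else 0)" unfolding c by (rule sum.cong) (auto simp: z)
  finally show ?thesis by simp
 qed
 thus "\<tau> : L2_sym Om & (ALL i. (%x. row i (\<tau> x)) : HN_div Om S)" using h t by (auto simp: HN_div_sym_def HN_div_def)
next
 assume h: "\<tau> : L2_sym Om & (ALL i. (%x. row i (\<tau> x)) : HN_div Om S)"
 hence t: "\<tau> : L2 Om" "!!i. (%x. row i (\<tau> x)) : Hdiv Om" by (auto simp: HN_div_def L2_sym_def)
 have "normal_pairing_mat Om \<tau> v = 0" if v: "v : H1_D_vec Om S" for v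
  unfolding normal_pairing_mat_eq[OF t v] by (rule sum.neutral) (use h v in \<open>simp add: HN_div_def H1_D_vec_def\<close>)
 thus "\<tau> : HN_div_sym Om S" using h t by (auto simp: HN_div_sym_def)
qed

end

section \<open>The graph of strain and fluid content\<close>

lemma bl_euclI:
 fixes f :: "'a::euclidean_space => 'b::real_normed_vector" assumes "!!x y. f (x+y) = f x+f y" "!!c x. f (c*.x) = c*.f x" shows "bounded_linear f"
 unfolding linear_conv_bounded_linear[symmetric] linear_iff using assms by blast

lemma lmap_lmap: assumes V: "bounded_linear V" and W: "bounded_linear W" shows "lmap V (lmap W F) = lmap (%x. V (W x)) F"
proof (rule lsq_eqI)
 show "AE x in lebesgue. rep (lmap V (lmap W F)) x = rep (lmap (%x. V (W x)) F) x"
  using rep_lmap[OF V, of "lmap W F"] rep_lmap[OF W, of F] rep_lmap[OF bounded_linear_compose[OF V W], of F] by eventually_elim simp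
qed

lemma lmap_ident: "lmap (%x. x) F = F" by (simp add: lmap_def abs_rep_lsq)

lemma lmap_const0: "lmap (%x. 0) F = 0" by (simp add: lmap_def zero_lsq_def)

lemma restr_lmap: assumes O: "Om : sets lebesgue" and W: "bounded_linear W" shows "restr Om (lmap W F) = lmap W (restr Om F)"
proof (rule lsq_eqI)
 show "AE x in lebesgue. rep (restr Om (lmap W F)) x = rep (lmap W (restr Om F)) x"
  using rep_restr[OF O, of "lmap W F"] rep_lmap[OF W, of F] rep_lmap[OF W, of "restr Om F"] rep_restr[OF O, of F]
  by eventually_elim (simp add: linear_simps(3)[OF W])
qed

definition lpair :: "('d::finite, 'b::euclidean_space) lsq => ('d, 'c::euclidean_space) lsq => ('d, 'b \<times> 'c) lsq" where
 "lpair F G = abs_lsq (%x. (rep F x, rep G x))"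

lemma rep_lpair: "AE x in lebesgue. rep (lpair F G) x = (rep F x, rep G x)" unfolding lpair_def by (rule rep_abs_lsq) (intro L2_Pair rep_L2)

lemma lmap_lpair: "lmap fst (lpair F G) = F" "lmap snd (lpair F G) = G"
proof -
 show "lmap fst (lpair F G) = F"
  by (rule lsq_eqI) (use rep_lmap[OF bounded_linear_fst, of "lpair F G"] rep_lpair[of F G] in \<open>eventually_elim, simp\<close>)
 show "lmap snd (lpair F G) = G"
  by (rule lsq_eqI) (use rep_lmap[OF bounded_linear_snd, of "lpair F G"] rep_lpair[of F G] in \<open>eventually_elim, simp\<close>)
qed

lemma Cauchy_dominated:
 fixes f :: "nat => 'a::real_normed_vector" and g :: "nat => 'b::real_normed_vector"
 assumes g: "Cauchy g" and b: "!!m n. norm (f m-f n) <= C*norm (g m-g n)" shows "Cauchy f"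
proof (rule CauchyI)
 fix e :: real assume e: "0 < e"
 have p: "0 < e/(abs(C) + 1)" using e by (simp add: add_nonneg_pos)
 obtain N where N: "ALL m>=N. ALL n>=N. norm (g m-g n) < e/(abs(C) + 1)" using CauchyD[OF g p] by blast
 have "norm (f m-f n) < e" if "N <= m" "N <= n" for m n
 proof -
  have "norm (f m-f n) <= (abs(C) + 1)*norm (g m-g n)" by (rule order_trans[OF b]) (intro mult_right_mono, simp_all)
  also have "... < (abs(C) + 1)*(e/(abs(C) + 1))" using N that by (intro mult_strict_left_mono) auto
  also have "... = e" by (simp add: add_nonneg_pos[THEN less_imp_neq, symmetric])
  finally show ?thesis .
 qed
 thus "EX M. ALL m>=M. ALL n>=M. norm (f m-f n) < e" by blast
qed

lemma inner_form_inner: "inner_form (inner :: 'h::{banach, real_inner} => 'h => real) 1"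
 by (rule inner_form.intro) (simp_all add: bounded_bilinear_inner inner_commute power2_norm_eq_inner)

definition sympart :: "real^'d^'d => real^'d^'d" where
 "sympart A = (1/2)*.(A+transpose A)"

definition pr :: "'d => (real^'d) \<times> (real^'d^'d) => real \<times> (real^'d)" where
 "pr i p = (fst p$i, snd p$i)"

definition vstrain :: "(real^'d) \<times> (real^'d^'d) => (real^'d) \<times> (real^'d^'d)" where
 "vstrain p = (fst p, sympart (snd p))"

lemma sympart_nth: "sympart A$i$j = (A$i$j+A$j$i)/2" by (simp add: sympart_def transpose_def)

lemma bl_sympart: "bounded_linear sympart" by (rule bl_euclI) (simp_all add: vec_eq_iff sympart_nth field_simps)

lemma bl_pr: "bounded_linear (pr i)" by (rule bl_euclI) (simp_all add: pr_def)

lemma bl_vstrain: "bounded_linear vstrain" by (rule bl_euclI) (simp_all add: vstrain_def linear_simps[OF bl_sympart])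

lemma norm_pr: "(norm p)^2 = (SU i. (norm (pr i p))^2)" by (simp add: power2_norm_eq_inner pr_def inner_vec_def sum.distrib inner_prod_def)

lemma norm_lsq_pr: "(norm F)^2 = (SU i. (norm (lmap (pr i) F))^2)"
proof -
 have i: "integrable lebesgue (%x. (norm (rep (lmap (pr i) F) x))^2)" for i using rep_L2[of "lmap (pr i) F"] by (simp add: L2_def lebesgue_on_UNIV_eq)
 have "(SU i. (norm (lmap (pr i) F))^2) = (LINT x|lebesgue. (SU i. (norm (rep (lmap (pr i) F) x))^2))"
  unfolding norm_lsq_sq by (rule Bochner_Integration.integral_sum[symmetric]) (rule i)
 also have "... = (LINT x|lebesgue. (norm (rep F x))^2)"
 proof (rule integral_cong_AE)
  have "AE x in lebesgue. ALL i:UNIV. rep (lmap (pr i) F) x = pr i (rep F x)" by (rule AE_finite_allI) (simp_all add: rep_lmap bl_pr)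
  thus "AE x in lebesgue. (SU i. (norm (rep (lmap (pr i) F) x))^2) = (norm (rep F x))^2" by eventually_elim (simp add: norm_pr)
  show "(%x. SU i. (norm (rep (lmap (pr i) F) x))^2) : borel_measurable lebesgue" by (intro borel_measurable_sum borel_measurable_integrable[OF i])
  show "(%x. (norm (rep F x))^2) : borel_measurable lebesgue" using L2_UNIV_measurable[OF rep_L2[of F]] by measurable
 qed
 finally show ?thesis by (simp add: norm_lsq_sq)
qed

lemma norm_lsq_pr_le: "norm F <= (SU i. norm (lmap (pr i) F))"
proof (rule power2_le_imp_le)
 show "(norm F)^2 <= (SU i. norm (lmap (pr i) F))^2" unfolding norm_lsq_pr[of F]
  using L2_set_le_sum[of UNIV "%i. norm (lmap (pr i) F)"] by (simp add: L2_set_def sqrt_le_D)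
qed (simp add: sum_nonneg)

context bounded_domain
begin

definition VD :: "(real^'d) set => ('d, (real^'d) \<times> (real^'d^'d)) lsq set" where
 "VD S = {F. ALL i. lmap (pr i) F : HD S}"

definition NN :: "(real^'d) set => ('d, real \<times> (real^'d)) lsq set" where
 "NN S = {E. restr Om E = E & (ALL F:HD S. inner E F = 0)}"

definition NV :: "(real^'d) set => ('d, (real^'d) \<times> (real^'d^'d)) lsq set" where
 "NV S = {F. ALL i. lmap (pr i) F : NN S}"

definition vjet :: "('d => real^'d => real) => ('d, (real^'d) \<times> (real^'d^'d)) lsq" where
 "vjet ph = zext Om (%x. (\<chi> i. ph i x, \<chi> i. grad (ph i) x))"

lemma closed_lmap_vimage: "bounded_linear W ==> closed A ==> closed {F. lmap W F : A}"
 using closed_vimage[OF _ linear_continuous_on[OF bl_lmap], of A W] by (simp add: vimage_def)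

lemma subspace_lmap_vimage: "bounded_linear W ==> subspace A ==> subspace {F. lmap W F : A}"
 using linear_subspace_vimage[OF bounded_linear.linear[OF bl_lmap], of W A] by (simp add: vimage_def)

lemma closed_all: "(!!i. closed {x. P i x}) ==> closed {x. ALL i. P i x}" using closed_INT[of UNIV "%i. {x. P i x}"] by (simp add: INTER_eq)

lemma subspace_all: "(!!i. subspace {x. P i x}) ==> subspace {x. ALL i. P i x}" by (auto simp: subspace_def)

lemma VD_closed: "closed (VD S)" unfolding VD_def by (intro closed_all closed_lmap_vimage bl_pr HD_closed)

lemma VD_subspace: "S : sets borel ==> subspace (VD S)" unfolding VD_def by (intro subspace_all subspace_lmap_vimage bl_pr HD_subspace)

lemma NN_closed: "closed (NN S)"
proof -
 have "NN S = {E. restr Om E = E} \<inter> (\<Inter>F\<in>HD S. {E. inner E F = 0})" by (auto simp: NN_def)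
 also have "closed ..." by (intro closed_Int closed_INT ballI closed_Collect_eq linear_continuous_on bl_restr continuous_intros Om)
 finally show ?thesis .
qed

lemma NN_subspace: "subspace (NN S)" unfolding NN_def subspace_def by (auto simp: inner_simps linear_simps[OF bl_restr[OF Om]])

lemma NV_subspace: "subspace (NV S)" unfolding NV_def by (intro subspace_all subspace_lmap_vimage bl_pr NN_subspace)

lemma HD_restr: "F : HD S ==> restr Om F = F" by (erule HD_E) (simp add: restr_jet)

lemma HD_biorthogonal: assumes S: "S : sets borel" and r: "restr Om F = F" and o: "!!E. E : NN S ==> inner E F = 0" shows "F : HD S"
proof -
 obtain p where p: "p : HD S" "!!v. v : HD S ==> inner (F-p) v = 0"
  by (rule inner_form.projection[OF inner_form_inner HD_subspace[OF S] HD_closed, where y=F], rule that, assumption+)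
 have "F-p : NN S" using p(2) by (simp add: NN_def linear_simps[OF bl_restr[OF Om]] r HD_restr[OF p(1)])
 hence "inner (F-p) (F-p) = 0" using o[of "F-p"] p by (simp add: inner_diff_right)
 thus ?thesis using p(1) by simp
qed

lemma vjet_cont: assumes "!!i. smooth (ph i)" shows "cont (%x. (\<chi> i. ph i x, \<chi> i. grad (ph i) x))"
 by (intro continuous_intros smooth_cont smooth_grad_cont assms)

lemma lmap_pr_vjet: "(!!i. smooth (ph i)) ==> lmap (pr i) (vjet ph) = jet (ph i) (grad (ph i))" unfolding vjet_def jet_def
 by (subst lmap_ext[OF Om _ bl_pr]) (simp_all add: cont_L2[OF vjet_cont] pr_def)

lemma VD_dense: assumes F: "F : VD S" shows "F : closure {vjet ph |ph. ALL i. smooth (ph i)}" unfolding closure_approachable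
proof (intro allI impI)
 fix e :: real assume e: "0 < e"
 define d where "d = e/real CARD('d)"
 have d: "0 < d" using e by (simp add: d_def)
 have "EX ph. smooth ph & norm (jet ph (grad ph)-lmap (pr i) F) < d" for i
 proof -
  have "lmap (pr i) F : HD S" using F by (simp add: VD_def)
  from HDE[OF this d] show ?thesis by blast
 qed
 hence "ALL i. EX ph. smooth ph & norm (jet ph (grad ph)-lmap (pr i) F) < d" by (rule allI)
 from choice[OF this] obtain ph where p0: "ALL i. smooth (ph i) & norm (jet (ph i) (grad (ph i))-lmap (pr i) F) < d" by (rule exE)
 have p: "smooth (ph i)" "norm (jet (ph i) (grad (ph i))-lmap (pr i) F) < d" for i using spec[OF p0, of i] by blast+
 have "norm (vjet ph-F) <= (SU i. norm (lmap (pr i) (vjet ph-F)))" by (rule norm_lsq_pr_le)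
 also have "... = (SU i. norm (jet (ph i) (grad (ph i))-lmap (pr i) F))" by (simp add: lmap_simps(2)[OF bl_pr] lmap_pr_vjet p(1))
 also have "... < (\<Sum>i\<in>(UNIV::'d set). d)" by (rule sum_strict_mono) (simp_all add: p(2))
 also have "... = e" by (simp add: d_def)
 finally show "EX y:{vjet ph |ph. ALL i. smooth (ph i)}. dist y F < e" using p(1) by (intro bexI[of _ "vjet ph"]) (auto simp: dist_norm)
qed

lemma lebesgue_on_lborel:
 fixes f :: "real^'d => real" assumes f: "cont f" shows "(LINT x|LO Om. f x) = (LB x. ind Om x*f x)"
proof -
 have "(LINT x|LO Om. f x) = (LINT x|lebesgue. (if x : Om then f x else 0))" by (rule Lebesgue_Measure.integral_restrict_UNIV[symmetric]) simp
 also have "(%x. if x : Om then f x else 0) = (%x. ind Om x*f x)" by (auto simp: indicator_def)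
 also have "(LINT x|lebesgue. ind Om x*f x) = (LB x. ind Om x*f x)"
  using opn by (intro integral_completion) (simp add: borel_measurable_times borel_measurable_continuous_onI[OF f])
 finally show ?thesis .
qed

lemma norm_zext_cont: assumes f: "cont f" shows "(norm (zext Om f))^2 = (LB x. ind Om x*(norm (f x))^2)"
proof -
 have "cont (%x. (norm (f x))^2)" by (intro continuous_intros f)
 from lebesgue_on_lborel[OF this] show ?thesis by (simp add: power2_norm_eq_inner zext_inner[OF Om cont_L2[OF f] cont_L2[OF f]] l2_inner_def)
qed

end

locale lipschitz_domain = bounded_domain Om for Om :: "(real^'d) set" + assumes lip: "lipschitz_boundary Om"
begin

lemma korn_VD:
 obtains C where "0 <= C" "!!S F. F : VD S ==> norm F <= C*norm (lmap vstrain F)"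
proof -
 obtain K where K: "0 <= K" "!!v. (!!i. Ck 2 (v i)) ==> (LB x. ind Om x*gradsq v x)
  <= K*((LB x. ind Om x*epssq v x)+(LB x. ind Om x * valsq v x))" using korn_domain[OF opn bdd lip] by blast
 have sm: "norm (vjet ph) <= sqrt (1+K)*norm (lmap vstrain (vjet ph))" if s: "!!i. smooth (ph i)" for ph
 proof (rule power2_le_imp_le)
  have C2: "Ck 2 (ph i)" for i by (rule smooth_Ck[OF s])
  note gi = gradsq_integrable(1-3)[OF C2]
  have int: "integrable lborel (%x. ind Om x*f x)" if "cont f" for f :: "real^'d => real"
   by (rule bounded_ind_integrable[OF _ bdd that]) (use opn in auto)
  have sum_eq: "(LB x. ind Om x*(valsq ph x+h x))
   = (LB x. ind Om x * valsq ph x)+(LB x. ind Om x*h x)" if "cont h" for h :: "real^'d => real" by (simp add: distrib_left int gi that)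
  have n1: "(norm (\<chi> i. ph i x, \<chi> i. grad (ph i) x))^2 = valsq ph x+gradsq ph x" for x
   unfolding power2_norm_eq_inner by (simp add: inner_vec_def valsq_def gradsq_def power2_eq_square)
  have a: "(norm (vjet ph))^2 = (LB x. ind Om x * valsq ph x)+(LB x. ind Om x*gradsq ph x)"
   unfolding vjet_def by (simp only: norm_zext_cont[OF vjet_cont[OF s]] n1 sum_eq[OF gi(1)])
  have n2: "(norm (vstrain (\<chi> i. ph i x, \<chi> i. grad (ph i) x)))^2 = valsq ph x+epssq ph x" for x
   unfolding power2_norm_eq_inner by (simp add: inner_vec_def valsq_def epssq_def power2_eq_square vstrain_def sympart_nth)
  have c2: "cont (%x. vstrain (\<chi> i. ph i x, \<chi> i. grad (ph i) x))" by (rule bounded_linear.continuous_on[OF bl_vstrain vjet_cont[OF s]])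
  have "lmap vstrain (vjet ph) = zext Om (%x. vstrain (\<chi> i. ph i x, \<chi> i. grad (ph i) x))"
   unfolding vjet_def by (rule lmap_ext[OF Om cont_L2[OF vjet_cont[OF s]] bl_vstrain])
  hence b: "(norm (lmap vstrain (vjet ph)))^2 = (LB x. ind Om x * valsq ph x)+(LB x. ind Om x*epssq ph x)"
   by (simp only: norm_zext_cont[OF c2] n2 sum_eq[OF gi(2)])
  have "0 <= (LB x. ind Om x * valsq ph x)" "0 <= (LB x. ind Om x*epssq ph x)"
   unfolding valsq_def epssq_def by (intro Bochner_Integration.integral_nonneg mult_nonneg_nonneg sum_nonneg; simp)+
  hence "(norm (vjet ph))^2 <= (1+K)*(norm (lmap vstrain (vjet ph)))^2" unfolding a b using K(2)[of ph, OF C2] by (simp add: algebra_simps)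
  thus "(norm (vjet ph))^2 <= (sqrt (1+K)*norm (lmap vstrain (vjet ph)))^2" using K(1) by (simp add: power_mult_distrib)
 qed (use K(1) in simp)
 have "norm F <= sqrt (1+K)*norm (lmap vstrain F)" if F: "F : VD S" for S F
 proof -
  let ?A = "{F. norm F <= sqrt (1+K)*norm (lmap vstrain F)}"
  have "closed ?A" by (intro closed_Collect_le continuous_intros linear_continuous_on bl_lmap bl_vstrain)
  moreover have "{vjet ph |ph. ALL i. smooth (ph i)} \<subseteq> ?A" using sm by blast
  ultimately have "closure {vjet ph |ph. ALL i. smooth (ph i)} \<subseteq> ?A" by (rule closure_minimal[rotated])
  thus ?thesis using VD_dense[OF F] by blast
 qed
 moreover have "0 <= sqrt (1+K)" using K(1) by simp
 ultimately show ?thesis using that by blast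
qed

end

type_synonym 'd state = "(real^2^'d) \<times> ((real^'d^'d) \<times> real)"

definition gr_s :: "real => (real^'d) \<times> (real^'d^'d) => 'd state" where
 "gr_s al p = (cols (fst p) 0, (sympart (snd p), al*trace (snd p)))"

definition gr_f :: "real \<times> (real^'d) => 'd state" where
 "gr_f p = (cols 0 (snd p), (0, fst p))"

lemma cols_nth: "cols a b$i$j = (if j = 1 then a$i else b$i)" by (simp add: cols_def)

lemma column_cols: "column 1 (cols a b) = a" "column 2 (cols a b) = b" by (simp_all add: column_def cols_nth vec_eq_iff)

lemma column_add: "column i (A+B) = column i A+column i (B :: real^'n^'m)" by (simp add: column_def vec_eq_iff)

lemma column_scaleR: "column i (c*.A) = c*.column i (A :: real^'n^'m)" by (simp add: column_def vec_eq_iff)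

lemma cols_add: "cols (a+a') (b+b') = cols a b+cols a' b'" by (simp add: vec_eq_iff cols_nth)

lemma cols_scaleR: "cols (c*.a) (c*.b) = c*.cols a b" by (simp add: vec_eq_iff cols_nth)

lemma trace_scaleR: "trace (c*.A) = c*trace (A :: real^'n^'n)" by (simp add: trace_def sum_distrib_left)

lemma bl_gr_s: "bounded_linear (gr_s al)" by (rule bl_euclI)
  (simp_all add: gr_s_def linear_simps[OF bl_sympart] trace_add trace_scaleR cols_add[of _ _ 0 0, simplified] cols_scaleR[of _ _ 0, simplified] algebra_simps)

lemma bl_gr_f: "bounded_linear gr_f" by (rule bl_euclI) (simp_all add: gr_f_def cols_add[of 0 0, simplified] cols_scaleR[of _ 0, simplified])

context bounded_domain
begin

definition GR :: "real => (real^'d) set => (real^'d) set => ('d, 'd state) lsq set" where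
 "GR al Ss Sf = {lmap (gr_s al) F+lmap gr_f E |F E. F : VD Ss & E : NN Sf}"

lemma GR_subspace: assumes S: "Ss : sets borel" shows "subspace (GR al Ss Sf)" unfolding subspace_def
proof (intro conjI ballI allI)
 note V = VD_subspace[OF S] and N = NN_subspace
 note l = lmap_simps[OF bl_gr_s] lmap_simps[OF bl_gr_f]
 have "lmap (gr_s al) 0+lmap gr_f 0 : GR al Ss Sf" unfolding GR_def using subspace_0[OF V] subspace_0[OF N] by blast
 thus "0 : GR al Ss Sf" by (simp add: l)
 fix x assume "x : GR al Ss Sf"
 then obtain F E where x: "F : VD Ss" "E : NN Sf" "x = lmap (gr_s al) F+lmap gr_f E" unfolding GR_def by blast
 show "c*.x : GR al Ss Sf" for c
 proof -
  have "c*.x = lmap (gr_s al) (c*.F)+lmap gr_f (c*.E)" by (simp add: x(3) l scaleR_add_right)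
  thus ?thesis unfolding GR_def using subspace_scale[OF V x(1), of c] subspace_scale[OF N x(2), of c] by blast
 qed
 fix y assume "y : GR al Ss Sf"
 then obtain F' E' where y: "F' : VD Ss" "E' : NN Sf" "y = lmap (gr_s al) F' + lmap gr_f E'" unfolding GR_def by blast
 have "x+y = lmap (gr_s al) (F+F')+lmap gr_f (E+E')" by (simp add: x(3) y(3) l)
 thus "x+y : GR al Ss Sf" unfolding GR_def using subspace_add[OF V x(1) y(1)] subspace_add[OF N x(2) y(2)] by blast
qed

end

text \<open>By Korn's inequality the strain controls the whole gradient, so a convergent sequence in the graph
 has convergent Jacobians.\<close>

lemma (in lipschitz_domain) GR_closed: assumes S: "Ss : sets borel" shows "closed (GR al Ss Sf)" unfolding closed_sequential_limits
proof (intro allI impI, elim conjE)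
 fix X x assume X: "ALL n. X n : GR al Ss Sf" and lim: "X ----> x"
 obtain C where C: "0 <= C" "!!S F. F : VD S ==> norm F <= C*norm (lmap vstrain F)" using korn_VD by blast
 have "ALL n. EX p. fst p : VD Ss & snd p : NN Sf & X n = lmap (gr_s al) (fst p)+lmap gr_f (snd p)" using X unfolding GR_def by fastforce
 from choice[OF this] obtain p where p: "ALL n. fst (p n) : VD Ss & snd (p n) : NN Sf & X n = lmap (gr_s al) (fst (p n))+lmap gr_f (snd (p n))" by (rule exE)
 define F E where "F n = fst (p n)" and "E n = snd (p n)" for n
 have F: "F n : VD Ss" and E: "E n : NN Sf" and XFE: "X n = lmap (gr_s al) (F n)+lmap gr_f (E n)" for n
  using spec[OF p, of n] by (simp_all add: F_def E_def)
 define qs :: "'d state => (real^'d) \<times> (real^'d^'d)" where "qs A = (column 1 (fst A), fst (snd A))" for A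
 define qf :: "'d state => real \<times> (real^'d)" where "qf A = (snd (snd A), column 2 (fst A))" for A
 have qs: "bounded_linear qs" by (rule bl_euclI) (simp_all add: qs_def column_add column_scaleR)
 have qf: "bounded_linear qf" by (rule bl_euclI) (simp_all add: qf_def column_add column_scaleR)
 note l = lmap_simps[OF qs] lmap_simps[OF qf]
 have "(%x. qs (gr_s al x)) = vstrain" "(%x. qs (gr_f x)) = (%x. 0)"
  by (simp_all add: fun_eq_iff qs_def gr_s_def gr_f_def column_cols vstrain_def zero_prod_def)
 hence QX: "lmap qs (X n) = lmap vstrain (F n)" for n by (simp add: XFE l lmap_lmap qs bl_gr_s bl_gr_f lmap_const0)
 obtain K where K: "!!x :: ('d, 'd state) lsq. norm (lmap qs x) <= norm x*K" using bounded_linear.bounded[OF bl_lmap[OF qs]] by blast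
 have "norm (F m-F n) <= (C*K)*norm (X m-X n)" for m n
 proof -
  have "norm (F m-F n) <= C*norm (lmap vstrain (F m-F n))" by (rule C(2)[of _ Ss]) (rule subspace_diff[OF VD_subspace[OF S] F F])
  also have "lmap vstrain (F m-F n) = lmap qs (X m-X n)" by (simp add: l QX lmap_simps[OF bl_vstrain])
  also have "C*norm (lmap qs (X m-X n)) <= C*(norm (X m-X n)*K)" by (rule mult_left_mono[OF K C(1)])
  finally show ?thesis by (simp add: algebra_simps)
 qed
 hence "Cauchy F" by (rule Cauchy_dominated[OF LIMSEQ_imp_Cauchy[OF lim]])
 then obtain f where f: "F ----> f" unfolding Cauchy_convergent_iff convergent_def by blast
 have fV: "f : VD Ss" by (rule closed_sequentially[OF VD_closed F f])
 have "(%x. qf (gr_f x)) = (%x. x)" by (simp add: fun_eq_iff qf_def gr_f_def column_cols)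
 hence "lmap qf (X n-lmap (gr_s al) (F n)) = E n" for n by (simp add: XFE lmap_lmap qf bl_gr_f lmap_ident)
 moreover have "(%n. lmap qf (X n-lmap (gr_s al) (F n))) ----> lmap qf (x-lmap (gr_s al) f)"
  by (intro bounded_linear.tendsto[OF bl_lmap[OF qf]] tendsto_diff lim bounded_linear.tendsto[OF bl_lmap[OF bl_gr_s]] f)
 ultimately have e: "E ----> lmap qf (x-lmap (gr_s al) f)" by simp
 have eN: "lmap qf (x-lmap (gr_s al) f) : NN Sf" by (rule closed_sequentially[OF NN_closed E e])
 have "X ----> lmap (gr_s al) f+lmap gr_f (lmap qf (x-lmap (gr_s al) f))" unfolding XFE[abs_def]
  by (intro tendsto_add bounded_linear.tendsto[OF bl_lmap[OF bl_gr_s]] bounded_linear.tendsto[OF bl_lmap[OF bl_gr_f]] f e)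
 hence "x = lmap (gr_s al) f+lmap gr_f (lmap qf (x-lmap (gr_s al) f))" using lim by (rule LIMSEQ_unique[rotated])
 thus "x : GR al Ss Sf" unfolding GR_def using fV eN by blast
qed

section \<open>Coefficients\<close>

lemma coercive_inverse:
 fixes W :: "'a::euclidean_space => 'a" assumes W: "bounded_linear W" and m: "0 < m" and c: "!!x. m*(norm x)^2 <= W x<.>x"
 obtains V where "bounded_linear V" "!!x. W (V x) = x" "!!x. V (W x) = x"
proof -
 have l: "linear W" using W by (rule bounded_linear.linear)
 have "x = 0" if "W x = 0" for x
 proof -
  have "m*(norm x)^2 <= 0" using c[of x] that by simp
  thus ?thesis using m by (simp add: mult_le_0_iff)
 qed
 hence i: "inj W" using linear_injective_0[OF l] by blast
 have s: "surj W" by (rule linear_injective_imp_surjective[OF l i]) (rule refl)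
 have r: "W (inv W x) = x" for x using s by (rule surj_f_inv_f)
 have "bounded_linear (inv W)"
 proof (rule bl_euclI)
  show "inv W (x+y) = inv W x+inv W y" for x y by (rule injD[OF i]) (simp add: r linear_simps[OF W])
  show "inv W (a*.x) = a*.inv W x" for a x by (rule injD[OF i]) (simp add: r linear_simps[OF W])
 qed
 thus ?thesis using that r inv_f_f[OF i] by blast
qed

lemma sympart_in: "sympart A : sym_mats" by (simp add: sym_mats_def vec_eq_iff transpose_def sympart_nth)

lemma sympart_ident: "A : sym_mats ==> sympart A = A" unfolding sym_mats_def sympart_def by (simp flip: scaleR_2)

lemma sympart_inner: "sympart A<.>B = A<.>sympart B"
proof -
 have "(SU i. SU j. A$j$i*B$i$j) = (SU i. SU j. A$i$j*B$j$i)" by (rule sum.swap)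
 thus ?thesis by (simp add: inner_vec_def sympart_nth algebra_simps add_divide_distrib sum.distrib sum_divide_distrib[symmetric])
qed

lemma sym_mats_iff: "A : sym_mats \<longleftrightarrow> sympart A = A" using sympart_in[of A] sympart_ident[of A] by auto

lemma sympart_sympart: "sympart (sympart A) = sympart A" by (rule sympart_ident[OF sympart_in])

lemma sympart_mat1: "sympart (mat 1) = mat 1" by (simp add: vec_eq_iff sympart_nth mat_def)

lemma trace_eq_inner: "trace A = A<.>mat 1"
proof -
 have "(SU j. A$i$j*(if i = j then 1 else 0)) = A$i$i" for i by (simp add: if_distrib cong: if_cong)
 thus ?thesis by (simp add: trace_def inner_vec_def mat_def)
qed

locale poro_coefficients =
 fixes \<C> :: "real^'d^'d => real^'d^'d" and R :: "real^2^2" and cm cp al s be mR :: real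
 assumes C: "spd_tensor cm cp \<C>" and cm: "0 < cm" and s: "0 < s" and beta: "0 < be" and R_sym: "R$1$2 = R$2$1" and mR: "0 < mR"
  and R_pos: "!!x y. mR*(x^2+y^2) <= R$1$1*x^2+2*(R$1$2*(x*y))+R$2$2*y^2"
begin

text \<open>The elasticity tensor, extended by the identity on skew matrices.\<close>

definition Cx :: "real^'d^'d => real^'d^'d" where
 "Cx A = \<C> (sympart A)+(A-sympart A)"

lemma C_simps: "A : sym_mats ==> \<C> A : sym_mats"
 "A : sym_mats ==> B : sym_mats ==> \<C> (A+B) = \<C> A + \<C> B"
 "A : sym_mats ==> \<C> (c*.A) = c *. \<C> A"
 "A : sym_mats ==> B : sym_mats ==> \<C> A<.>B = A <.> \<C> B"
 "A : sym_mats ==> cm*(A<.>A) <= \<C> A<.>A" using C unfolding spd_tensor_def by blast+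

lemma bl_Cx: "bounded_linear Cx" by (rule bl_euclI) (simp_all add: Cx_def linear_simps[OF bl_sympart] C_simps sympart_in algebra_simps)

lemma Cx_sym: "A : sym_mats ==> Cx A = \<C> A" by (simp add: Cx_def sympart_ident)

lemma sympart_Cx: "sympart (Cx A) = Cx (sympart A)"
 by (simp add: Cx_def linear_simps[OF bl_sympart] sympart_sympart sympart_ident C_simps(1) sympart_in)

lemma Cx_inner: "Cx A<.>B = A<.>Cx B"
proof -
 have "\<C> (sympart A)<.>B = \<C> (sympart A)<.>sympart B"
  using sympart_inner[of "\<C> (sympart A)" B] by (simp add: sympart_ident C_simps(1) sympart_in)
 moreover have "A <.> \<C> (sympart B) = sympart A <.> \<C> (sympart B)"
  using sympart_inner[of A "\<C> (sympart B)"] by (simp add: sympart_ident C_simps(1) sympart_in)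
 moreover have "\<C> (sympart A)<.>sympart B = sympart A <.> \<C> (sympart B)" by (intro C_simps sympart_in)
 ultimately show ?thesis by (simp add: Cx_def inner_add_left inner_add_right inner_diff_left inner_diff_right sympart_inner)
qed

definition mC :: real where "mC = min cm 1"

lemma mC: "0 < mC" using cm by (simp add: mC_def)

lemma Cx_coercive: "mC*(norm A)^2 <= Cx A<.>A"
proof -
 let ?s = "sympart A" and ?k = "A-sympart A"
 have o: "S <.> ?k = 0" if "S : sym_mats" for S using sympart_inner[of S A] that by (simp add: sympart_ident inner_diff_right)
 have "A<.>A = (?s + ?k)<.>(?s + ?k)" by simp
 also have "... = ?s <.> ?s + ?k <.> ?k" using o[OF sympart_in, of A] by (simp only: inner_add_left inner_add_right inner_commute[of ?k ?s])
 finally have n: "(norm A)^2 = ?s <.> ?s + ?k <.> ?k" by (simp only: power2_norm_eq_inner)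
 have "Cx A<.>A = (\<C> ?s + ?k)<.>(?s + ?k)" by (simp add: Cx_def)
 also have "... = \<C> ?s <.> ?s + ?k <.> ?k"
  using o[OF sympart_in, of A] o[OF C_simps(1)[OF sympart_in], of A] by (simp only: inner_add_left inner_add_right inner_commute[of ?k ?s])
 also have "... >= cm*(?s <.> ?s) + ?k <.> ?k" by (intro add_right_mono C_simps sympart_in)
 moreover have "mC*(?s <.> ?s) <= cm*(?s <.> ?s)" "mC*(?k <.> ?k) <= 1*(?k <.> ?k)" by (intro mult_right_mono; simp add: mC_def)+
 ultimately show ?thesis unfolding n by (simp add: distrib_left)
qed

definition Ax :: "real^'d^'d => real^'d^'d" where
 "Ax = (SOME V. bounded_linear V & (ALL x. Cx (V x) = x) & (ALL x. V (Cx x) = x))"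

lemma Ax: "bounded_linear Ax" "Cx (Ax A) = A" "Ax (Cx A) = A"
proof -
 have "EX V. bounded_linear V & (ALL x. Cx (V x) = x) & (ALL x. V (Cx x) = x)"
  by (rule coercive_inverse[OF bl_Cx mC Cx_coercive]) (intro exI conjI allI, assumption+)
 from someI_ex[OF this] show "bounded_linear Ax" "Cx (Ax A) = A" "Ax (Cx A) = A" unfolding Ax_def by blast+
qed

lemma Ax_inner: "Ax A<.>B = A<.>Ax B" using Cx_inner[of "Ax A" "Ax B"] by (simp add: Ax(2) inner_commute)

lemma sympart_Ax: "sympart (Ax A) = Ax (sympart A)" using arg_cong[OF sympart_Cx[of "Ax A"], of Ax] by (simp add: Ax)

lemma Ax_compliance: assumes A: "A : sym_mats" shows "compliance \<C> A = Ax A"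
proof -
 have S: "Ax A : sym_mats" using sympart_Ax[of A] A by (simp add: sym_mats_iff)
 have inj: "inj_on \<C> sym_mats" by (rule inj_onI) (metis Ax(3) Cx_sym)
 have "\<C> (Ax A) = A" using Ax(2)[of A] Cx_sym[OF S] by simp
 hence "compliance \<C> A = inv_into sym_mats \<C> (\<C> (Ax A))" by (simp add: compliance_def)
 also have "... = Ax A" by (rule inv_into_f_f[OF inj S])
 finally show ?thesis .
qed

lemma Ax_coercive: obtains m where "0 < m" "!!A. m*(norm A)^2 <= Ax A<.>A"
proof -
 obtain K where K: "0 < K" "!!A. norm (Cx A) <= norm A*K" using bounded_linear.pos_bounded[OF bl_Cx] by blast
 have "mC/K^2*(norm A)^2 <= Ax A<.>A" for A
 proof -
  have "norm A <= norm (Ax A)*K" using K(2)[of "Ax A"] by (simp add: Ax)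
  hence "(norm A)^2 <= (norm (Ax A)*K)^2" by (intro power_mono) auto
  hence "mC/K^2*(norm A)^2 <= mC/K^2*(norm (Ax A)*K)^2" using mC by (intro mult_left_mono) auto
  also have "... = mC*(norm (Ax A))^2" using K(1) by (simp add: power_mult_distrib)
  also have "... <= Cx (Ax A)<.>Ax A" by (rule Cx_coercive)
  finally show ?thesis by (simp add: Ax inner_commute)
 qed
 moreover have "0 < mC/K^2" using mC K(1) by simp
 ultimately show ?thesis using that by blast
qed

lemma mult_R_nth: "(A ** R)$i$k = A$i$1*R$1$k+A$i$2*R$2$k" by (simp add: matrix_matrix_mult_def sum_2)

lemma bl_matrix_mult: "bounded_linear (%A :: real^2^'e. A ** (Q :: real^2^2))"
 by (rule bl_euclI) (simp_all add: vec_eq_iff matrix_matrix_mult_def sum_2 algebra_simps)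

lemma R_inner: "(A ** R)<.>B = A<.>(B ** R)" for A B :: "real^2^'e"
 unfolding inner_vec_def by (rule sum.cong) (simp_all add: inner_vec_def sum_2 mult_R_nth R_sym algebra_simps)

lemma R_coercive: "mR*(norm A)^2 <= (A ** R)<.>A" for A :: "real^2^'e"
proof -
 have "mR*(norm A)^2 = (SU i. mR*((A$i$1)^2+(A$i$2)^2))"
  unfolding power2_norm_eq_inner by (simp add: inner_vec_def sum_2 sum_distrib_left power2_eq_square)
 also have "... <= (SU i. (A ** R)$i<.>A$i)"
 proof (rule sum_mono)
  fix i
  have "(A ** R)$i<.>A$i = R$1$1*(A$i$1)^2+2*(R$1$2*(A$i$1*A$i$2))+R$2$2*(A$i$2)^2"
   by (simp add: inner_vec_def sum_2 mult_R_nth R_sym algebra_simps power2_eq_square)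
  thus "mR*((A$i$1)^2+(A$i$2)^2) <= (A ** R)$i<.>A$i" using R_pos by simp
 qed
 also have "... = (A ** R)<.>A" by (simp add: inner_vec_def)
 finally show ?thesis .
qed

abbreviation "Ri \<equiv> matrix_inv R"

lemma R_invertible: "R ** Ri = mat 1" "Ri ** R = mat 1"
proof -
 have "A = 0" if "A ** R = 0" for A :: "real^2^2"
 proof -
  have "mR*(norm A)^2 <= 0" using R_coercive[of A] that by simp
  thus ?thesis using mR by (simp add: mult_le_0_iff)
 qed
 moreover have lin: "linear (%A :: real^2^2. A ** R)" using bl_matrix_mult by (rule bounded_linear.linear)
 ultimately have "inj (%A :: real^2^2. A ** R)" using linear_injective_0 by blast
 hence "surj (%A :: real^2^2. A ** R)" by (rule linear_injective_imp_surjective[OF lin]) (rule refl)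
 then obtain B :: "real^2^2" where "B ** R = mat 1" by (metis surjD)
 hence "R ** B = mat 1" by (simp add: matrix_left_right_inverse)
 hence "EX B. R ** B = mat 1 & B ** R = mat 1" using \<open>B ** R = mat 1\<close> by blast
 from someI_ex[OF this] show "R ** Ri = mat 1" "Ri ** R = mat 1" by (simp_all add: matrix_inv_def)
qed

lemma mult_Ri_R: "A ** Ri ** R = A" "A ** R ** Ri = A" for A :: "real^2^'e" by (simp_all add: matrix_mul_assoc[symmetric] R_invertible)

text \<open>The weight of the energy inner product.\<close>

definition wt :: "'d state => 'd state" where
 "wt x = (fst x ** R, (Ax (fst (snd x)), s * snd (snd x)))"

lemma bl_wt: "bounded_linear wt" by (rule bl_euclI) (simp_all add: wt_def linear_simps[OF bl_matrix_mult] linear_simps[OF Ax(1)] algebra_simps)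

lemma wt_inner: "wt x<.>y = x<.>wt y" by (simp add: wt_def inner_prod_def R_inner Ax_inner)

lemma norm_triple: "(norm x)^2 = (norm (fst x))^2+((norm (fst (snd x)))^2+(snd (snd x))^2)" for x :: "'d state"
 unfolding power2_norm_eq_inner by (simp add: inner_prod_def power2_eq_square)

definition mW :: real where "mW = (SOME m. 0 < m & (ALL x. m*(norm x)^2 <= wt x<.>x))"

lemma mW: "0 < mW" "mW*(norm x)^2 <= wt x<.>x"
proof -
 obtain mA where mA: "0 < mA" "!!A. mA*(norm A)^2 <= Ax A<.>A" by (rule Ax_coercive, rule that, assumption+)
 define m where "m = min mR (min mA s)"
 have "m*(norm x)^2 <= wt x<.>x" for x
 proof -
  have "m*(norm (fst x))^2 <= mR*(norm (fst x))^2" "m*(norm (fst (snd x)))^2 <= mA*(norm (fst (snd x)))^2"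
   "m*(snd (snd x))^2 <= s*(snd (snd x))^2" by (intro mult_right_mono; simp add: m_def)+
  thus ?thesis using R_coercive[of "fst x"] mA(2)[of "fst (snd x)"]
   unfolding norm_triple by (simp add: wt_def inner_prod_def distrib_left power2_eq_square mult.assoc)
 qed
 moreover have "0 < m" using mR mA(1) s by (simp add: m_def)
 ultimately have "EX m. 0 < m & (ALL x. m*(norm x)^2 <= wt x<.>x)" by blast
 from someI_ex[OF this] show "0 < mW" "mW*(norm x)^2 <= wt x<.>x" unfolding mW_def by blast+
qed

text \<open>The weight of the form in the variational formulation of the resolvent equation.\<close>

definition rw :: "real => 'd state => 'd state" where
 "rw l x = (fst x ** R+cols 0 ((l*be)*.column 2 (fst x)), (l^2*.Cx (fst (snd x)), l^2/s * snd (snd x)))"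

lemma cols_0_inner: "cols 0 b<.>A = b<.>column 2 A" by (simp add: inner_vec_def sum_2 cols_nth column_def)

lemma bl_rw: "bounded_linear (rw l)"
proof (rule bl_euclI)
 fix x y :: "'d state" and c :: real
 have "cols 0 ((l*be)*.column 2 (fst x+fst y)) = cols 0 ((l*be)*.column 2 (fst x))+cols 0 ((l*be)*.column 2 (fst y))"
  by (simp add: vec_eq_iff cols_nth column_def distrib_left)
 thus "rw l (x+y) = rw l x+rw l y" by (simp add: rw_def linear_simps[OF bl_matrix_mult] linear_simps[OF bl_Cx] algebra_simps add_divide_distrib)
 have "cols 0 ((l*be)*.column 2 (c*.fst x)) = c*.cols 0 ((l*be)*.column 2 (fst x))" by (simp add: vec_eq_iff cols_nth column_def)
 thus "rw l (c*.x) = c*.rw l x" by (simp add: rw_def linear_simps[OF bl_matrix_mult] linear_simps[OF bl_Cx] algebra_simps)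
qed

lemma rw_inner: "rw l x<.>y = x<.>rw l y"
 by (simp add: rw_def inner_prod_def inner_add_left inner_add_right R_inner Cx_inner cols_0_inner inner_commute[of "fst x" "cols _ _"] inner_commute[of "column 2 (fst x)"])

lemma rw_coercive: assumes l: "0 < l" obtains m where "0 < m" "!!x. m*(norm x)^2 <= rw l x<.>x"
proof -
 define m where "m = min mR (min (l^2*mC) (l^2/s))"
 have "m*(norm x)^2 <= rw l x<.>x" for x
 proof -
  have a: "m*(norm (fst x))^2 <= mR*(norm (fst x))^2" "m*(norm (fst (snd x)))^2 <= (l^2*mC)*(norm (fst (snd x)))^2"
   "m*(snd (snd x))^2 <= l^2/s*(snd (snd x))^2" by (intro mult_right_mono; simp add: m_def)+
  have "(l^2*mC)*(norm (fst (snd x)))^2 <= l^2*(Cx (fst (snd x))<.>fst (snd x))" unfolding mult.assoc by (intro mult_left_mono Cx_coercive) simp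
  moreover have "0 <= (l*be)*(column 2 (fst x)<.>column 2 (fst x))" using l beta by simp
  moreover have "rw l x<.>x = (fst x ** R)<.>fst x+(l*be)*(column 2 (fst x)<.>column 2 (fst x))
    + (l^2*(Cx (fst (snd x))<.>fst (snd x))+l^2/s*(snd (snd x))^2)"
   by (simp add: rw_def inner_prod_def inner_add_left cols_0_inner power2_eq_square mult.assoc)
  ultimately show ?thesis using R_coercive[of "fst x"] a unfolding norm_triple distrib_left by linarith
 qed
 moreover have "0 < m" using mR mC s l by (simp add: m_def)
 ultimately show ?thesis using that by blast
qed

end

section \<open>The poroelastic operator is maximal monotone\<close>

lemma lmap_inner: assumes V: "bounded_linear V" and W: "bounded_linear W" shows "integrable lebesgue (%x. V (rep F x)<.>W (rep G x))"
  "inner (lmap V F) (lmap W G) = (LINT x|lebesgue. V (rep F x)<.>W (rep G x))"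
proof -
 have L: "(%x. V (rep F x)) : L2 UNIV" "(%x. W (rep G x)) : L2 UNIV" by (intro L2_linear[OF rep_L2] V W)+
 show "integrable lebesgue (%x. V (rep F x)<.>W (rep G x))" by (rule L2_UNIV_integrable_inner[OF L])
 show "inner (lmap V F) (lmap W G) = (LINT x|lebesgue. V (rep F x)<.>W (rep G x))" unfolding lmap_def by (rule inner_lsq.abs_eq) (simp_all add: L)
qed

lemma inner_pr: "p<.>q = (SU i. pr i p<.>pr i q)" by (simp add: pr_def inner_vec_def sum.distrib inner_prod_def)

lemma inner_lsq_pr: "inner F G = (SU i. inner (lmap (pr i) F) (lmap (pr i) G))"
proof -
 have "(SU i. inner (lmap (pr i) F) (lmap (pr i) G)) = (LINT x|lebesgue. (SU i. pr i (rep F x)<.>pr i (rep G x)))"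
  by (subst Bochner_Integration.integral_sum) (simp_all add: lmap_inner bl_pr)
 thus ?thesis by (simp add: inner_lsq inner_pr[symmetric])
qed

lemma lsq_pr_0: "(!!i. lmap (pr i) F = 0) ==> F = 0" using norm_lsq_pr[of F] by simp

definition inj_pr :: "'d => real \<times> (real^'d) => (real^'d) \<times> (real^'d^'d)" where
 "inj_pr i p = (\<chi> k. if k = i then fst p else 0, \<chi> k. if k = i then snd p else 0)"

lemma bl_inj_pr: "bounded_linear (inj_pr i)" by (rule bl_euclI) (simp_all add: inj_pr_def vec_eq_iff)

lemma pr_inj_pr: "pr k (inj_pr i p) = (if k = i then p else 0)" by (simp add: pr_def inj_pr_def zero_prod_def)

lemma inj_pr_inner: "inj_pr i p<.>q = p<.>pr i q"
 unfolding inner_pr[of "inj_pr i p"] pr_inj_pr by (simp add: if_distrib[of "%x. x<.>_"] cong: if_cong)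

context bounded_domain
begin

lemma NN_restr: "E : NN S ==> restr Om E = E" by (simp add: NN_def)

lemma restr_of_pr: assumes "!!i. restr Om (lmap (pr i) F) = lmap (pr i) F" shows "restr Om F = F"
proof -
 have "restr Om F-F = 0" by (rule lsq_pr_0) (simp add: lmap_simps[OF bl_pr] restr_lmap[symmetric] bl_pr assms)
 thus ?thesis by simp
qed

lemma VD_restr: "F : VD S ==> restr Om F = F" by (rule restr_of_pr, rule HD_restr[of _ S]) (simp add: VD_def)

lemma NV_restr: "F : NV S ==> restr Om F = F" by (rule restr_of_pr, rule NN_restr[of _ S]) (simp add: NV_def)

lemma zext_0_iff: "f : L2 Om ==> zext Om f = 0 \<longleftrightarrow> (AE x in LO Om. f x = 0)"
 using zext_eq_iff[OF Om _ L2_zero, of f] by (simp add: zext_zero)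

lemma jet_cong: assumes "q : L2 Om" "G : L2 Om" "q' : L2 Om" "G' : L2 Om" and "AE x in LO Om. q x = q' x" "AE x in LO Om. G x = G' x"
 shows "jet q G = jet q' G'" unfolding jet_def using assms by (subst zext_eq_iff) (auto simp: L2_Pair elim: eventually_elim2)

lemma jet_0: "jet (%_. 0) (%_. 0) = 0" using zext_zero[of Om, where 'b="real \<times> (real^'d)"] by (simp add: jet_def zero_prod_def)

lemma lmap_jet: "q : L2 Om ==> G : L2 Om ==> lmap fst (jet q G) = zext Om q" "q : L2 Om ==> G : L2 Om ==> lmap snd (jet q G) = zext Om G"
 unfolding jet_def by (subst lmap_ext; simp add: L2_Pair bounded_linear_fst bounded_linear_snd)+

lemma HD_fst_0: assumes P: "P : HD S" and z: "lmap fst P = 0" shows "P = 0"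
proof -
 obtain q G where q: "q : L2 Om" "G : L2 Om" "is_weak_grad Om q G" "P = jet q G" by (rule HD_E[OF P])
 have q0: "AE x in LO Om. q x = 0" using z q by (simp add: lmap_jet zext_0_iff)
 have eq: "jet q G = jet (%_. 0) G" using q q0 by (intro jet_cong) (auto simp: L2_zero)
 have "is_weak_grad Om (%_. 0) G" using q(3) unfolding is_weak_grad_jet[OF q(1,2)] is_weak_grad_jet[OF L2_zero q(2)] eq .
 moreover have "is_weak_grad Om (%_. 0) (%_. 0)" by (simp add: is_weak_grad_def L2_zero)
 ultimately have "AE x in LO Om. G x = 0" by (rule weak_grad_unique)
 hence "jet (%_. 0) G = jet (%_. 0) (%_. 0)" using q(2) by (intro jet_cong) (auto simp: L2_zero)
 thus ?thesis using q(4) eq jet_0 by simp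
qed

lemma NN_E: assumes S: "S \<subseteq> frontier Om" and E: "E : NN S"
 obtains w v where "w : L2 Om" "v : L2 Om" "is_weak_div Om v w" "v : HN_div Om S" "E = jet w v"
proof -
 note j = jet_rep[OF NN_restr[OF E]]
 have "ALL F:HD S. inner (jet (%x. fst (rep E x)) (%x. snd (rep E x))) F = 0" using E j(3) by (simp add: NN_def)
 thus ?thesis using that[OF j(1,2) _ _ j(3)] HN_div_iff[OF S j(2,1)] by blast
qed

lemma NN_snd_0: assumes S: "S \<subseteq> frontier Om" and E: "E : NN S" and z: "lmap snd E = 0" shows "E = 0"
proof -
 obtain w v where w: "w : L2 Om" "v : L2 Om" "is_weak_div Om v w" "E = jet w v" by (rule NN_E[OF S E])
 have v0: "AE x in LO Om. v x = 0" using z w by (simp add: lmap_jet zext_0_iff)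
 have eq: "jet w v = jet w (%_. 0)" using w v0 by (intro jet_cong) (auto simp: L2_zero)
 have "ALL F:HD S. inner (jet w (%_. 0)) F = 0" using E w(4) eq by (simp add: NN_def)
 hence "is_weak_div Om (%_. 0) w" using HN_div_iff[OF S L2_zero w(1)] by blast
 moreover have "is_weak_div Om (%_. 0) (%_. 0)" by (simp add: is_weak_div_def L2_zero)
 ultimately have "AE x in LO Om. w x = 0" by (rule weak_div_unique)
 hence "jet w (%_. 0) = jet (%_. 0) (%_. 0)" using w(1) by (intro jet_cong) (auto simp: L2_zero)
 thus ?thesis using w(4) eq jet_0 by simp
qed

lemma VD_fst_0: assumes F: "F : VD S" and z: "lmap fst F = 0" shows "F = 0"
proof (rule lsq_pr_0)
 fix i
 have "lmap fst (lmap (pr i) F) = lmap (%v. v$i) (lmap fst F)" by (simp add: lmap_lmap bl_pr bounded_linear_fst bounded_linear_vec_nth pr_def)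
 also have "... = 0" using lmap_simps(3)[OF bounded_linear_vec_nth] by (simp add: z)
 finally show "lmap (pr i) F = 0" using F by (intro HD_fst_0[of _ S]) (simp_all add: VD_def)
qed

lemma NV_snd_0: assumes S: "S \<subseteq> frontier Om" and F: "F : NV S" and z: "lmap snd F = 0" shows "F = 0"
proof (rule lsq_pr_0)
 fix i
 have "lmap snd (lmap (pr i) F) = lmap (%v. v$i) (lmap snd F)" by (simp add: lmap_lmap bl_pr bounded_linear_snd bounded_linear_vec_nth pr_def)
 also have "... = 0" using lmap_simps(3)[OF bounded_linear_vec_nth] by (simp add: z)
 finally show "lmap (pr i) F = 0" using F by (intro NN_snd_0[OF S]) (simp_all add: NV_def)
qed

lemma VD_NV_orthogonal: "F : VD S ==> Y : NV S ==> inner F Y = 0"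
 unfolding inner_lsq_pr[of F] by (rule sum.neutral) (simp add: VD_def NV_def NN_def inner_commute)

lemma NV_I: assumes S: "S : sets borel" and r: "restr Om Y = Y" and o: "!!F. F : VD S ==> inner Y F = 0" shows "Y : NV S" unfolding NV_def NN_def
proof (intro CollectI allI conjI ballI)
 fix i
 show "restr Om (lmap (pr i) Y) = lmap (pr i) Y" by (simp add: restr_lmap bl_pr r)
 fix F assume F: "F : HD S"
 have "lmap (pr k) (lmap (inj_pr i) F) = (if k = i then F else 0)" for k by (simp add: lmap_lmap bl_pr bl_inj_pr pr_inj_pr lmap_ident lmap_const0)
 hence "lmap (inj_pr i) F : VD S" using F subspace_0[OF HD_subspace[OF S]] by (simp add: VD_def)
 from o[OF this] have "inner (lmap (inj_pr i) F) Y = 0" by (simp add: inner_commute)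
 hence "inner F (lmap (pr i) Y) = 0" using inner_lmap_adjoint[OF bl_inj_pr bl_pr inj_pr_inner, where F=F and G=Y] by simp
 thus "inner (lmap (pr i) Y) F = 0" by (simp add: inner_commute)
qed

end


text \<open>\<open>((v, \<nabla>v), (div w, w)), ((q, \<nabla>q), (div \<tau>, \<tau>))\<close>: solid velocity, fluid velocity,
 pressure and total stress with their derivatives.\<close>

type_synonym 'd fields = "(((real^'d) \<times> (real^'d^'d)) \<times> (real \<times> (real^'d))) \<times> ((real \<times> (real^'d)) \<times> ((real^'d) \<times> (real^'d^'d)))"

definition k1 :: "'d fields => _" where "k1 q = fst (fst q)"
definition k2 :: "'d fields => _" where "k2 q = snd (fst q)"
definition k3 :: "'d fields => _" where "k3 q = fst (snd q)"
definition k4 :: "'d fields => _" where "k4 q = snd (snd q)"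

lemma k_linear: "bounded_linear k1" "bounded_linear k2" "bounded_linear k3" "bounded_linear k4"
 by (rule bl_euclI; simp add: k1_def k2_def k3_def k4_def)+

lemma k_simps: "k1 (p+q) = k1 p+k1 q" "k2 (p+q) = k2 p+k2 q" "k3 (p+q) = k3 p+k3 q" "k4 (p+q) = k4 p+k4 q"
 "k1 (c*.p) = c*.k1 p" "k2 (c*.p) = c*.k2 p" "k3 (c*.p) = c*.k3 p" "k4 (c*.p) = c*.k4 p" by (simp_all add: k1_def k2_def k3_def k4_def)

lemma lsq_k_eqI: assumes "lmap k1 P = lmap k1 Q" "lmap k2 P = lmap k2 Q" "lmap k3 P = lmap k3 Q" "lmap k4 P = lmap k4 Q" shows "P = Q"
proof (rule lsq_eqI)
 show "AE x in lebesgue. rep P x = rep Q x"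
  using rep_lmap[OF k_linear(1), of P] rep_lmap[OF k_linear(1), of Q] rep_lmap[OF k_linear(2), of P] rep_lmap[OF k_linear(2), of Q]
   rep_lmap[OF k_linear(3), of P] rep_lmap[OF k_linear(3), of Q] rep_lmap[OF k_linear(4), of P] rep_lmap[OF k_linear(4), of Q]
  unfolding assms by eventually_elim (simp add: k1_def k2_def k3_def k4_def prod_eq_iff)
qed

lemma lmap_k_lpair:
 fixes F Y :: "('e::finite, (real^'d::finite) \<times> (real^'d^'d)) lsq"
 shows "lmap k1 (lpair (lpair F E) (lpair P Y)) = F" "lmap k2 (lpair (lpair F E) (lpair P Y)) = E"
 "lmap k3 (lpair (lpair F E) (lpair P Y)) = P" "lmap k4 (lpair (lpair F E) (lpair P Y)) = Y"
proof -
 have "lmap k1 Q = lmap fst (lmap fst Q)" "lmap k2 Q = lmap snd (lmap fst Q)" "lmap k3 Q = lmap fst (lmap snd Q)" "lmap k4 Q = lmap snd (lmap snd Q)" for Q :: "('e, 'd fields) lsq"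
  by (simp_all add: lmap_lmap bounded_linear_fst bounded_linear_snd k1_def[abs_def] k2_def[abs_def] k3_def[abs_def] k4_def[abs_def])
 thus "lmap k1 (lpair (lpair F E) (lpair P Y)) = F" "lmap k2 (lpair (lpair F E) (lpair P Y)) = E"
  "lmap k3 (lpair (lpair F E) (lpair P Y)) = P" "lmap k4 (lpair (lpair F E) (lpair P Y)) = Y" by (simp_all only: lmap_lpair)
qed

definition symz :: "'d::finite state => 'd state" where
 "symz x = (fst x, (sympart (fst (snd x)), snd (snd x)))"

lemma bl_symz: "bounded_linear symz" by (rule bl_euclI) (simp_all add: symz_def linear_simps[OF bl_sympart])

lemma symz_inner: "symz x<.>y = x<.>symz y" by (simp add: symz_def inner_prod_def sympart_inner)

lemma symz_symz: "symz (symz x) = symz x" by (simp add: symz_def sympart_sympart)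

locale poro = lipschitz_domain Om + poro_coefficients \<C> R cm cp al s be mR
 for Om :: "(real^'d) set" and \<C> :: "real^'d^'d => real^'d^'d" and R cm cp al s be mR +
 fixes Ss Sf :: "(real^'d) set" assumes Ss: "Ss : sets borel" "Ss \<subseteq> frontier Om" and Sf: "Sf : sets borel" "Sf \<subseteq> frontier Om"
begin

definition KK :: "('d, 'd fields) lsq set" where
 "KK = {Q. lmap k1 Q : VD Ss & lmap k2 Q : NN Sf & lmap k3 Q : HD Sf & lmap k4 Q : NV Ss}"

definition Am :: "'d fields => 'd state" where
 "Am q = (cols (fst (k1 q)) (snd (k2 q)), ((al*fst (k3 q))*.mat 1+snd (k4 q), fst (k3 q)))"

definition Bm :: "'d fields => 'd state" where
 "Bm q = (cols (- fst (k4 q)) (snd (k3 q)+be*.snd (k2 q)) ** Ri,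
  (- Cx (sympart (snd (k1 q))), (al*trace (snd (k1 q))+fst (k2 q))/s))"

lemma bl_Am: "bounded_linear Am" by (rule bl_euclI) (simp_all add: Am_def k_simps cols_add cols_scaleR algebra_simps)

lemma bl_Bm: "bounded_linear Bm"
proof (rule bl_euclI)
 note l = linear_simps[OF bl_matrix_mult[where Q=Ri]] linear_simps[OF bl_Cx] linear_simps[OF bl_sympart]
 fix p q :: "'d fields" and c :: real
 have "cols (- fst (k4 (p+q))) (snd (k3 (p+q))+be*.snd (k2 (p+q)))
   = cols (- fst (k4 p)) (snd (k3 p)+be*.snd (k2 p))+cols (- fst (k4 q)) (snd (k3 q)+be*.snd (k2 q))"
  by (simp add: k_simps cols_add[symmetric] algebra_simps)
 thus "Bm (p+q) = Bm p+Bm q" by (simp add: Bm_def l) (simp add: k_simps l trace_add add_divide_distrib[symmetric] algebra_simps)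
 have "cols (- fst (k4 (c*.q))) (snd (k3 (c*.q))+be*.snd (k2 (c*.q)))
   = c*.cols (- fst (k4 q)) (snd (k3 q)+be*.snd (k2 q))" by (simp add: k_simps cols_scaleR[symmetric] algebra_simps)
 thus "Bm (c*.q) = c*.Bm q" by (simp add: Bm_def l) (simp add: k_simps l trace_scaleR add_divide_distrib[symmetric] algebra_simps)
qed

lemma KK_subspace: "subspace KK"
proof -
 have "KK = {Q. lmap k1 Q : VD Ss} \<inter> {Q. lmap k2 Q : NN Sf} \<inter> {Q. lmap k3 Q : HD Sf} \<inter> {Q. lmap k4 Q : NV Ss}"
  by (auto simp: KK_def)
 also have "subspace ..." by (intro subspace_Int subspace_inter subspace_lmap_vimage k_linear VD_subspace NN_subspace HD_subspace NV_subspace Ss Sf)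
 finally show ?thesis .
qed

lemma KK_restr: assumes Q: "Q : KK" shows "restr Om Q = Q"
proof -
 have k: "lmap k1 Q : VD Ss" "lmap k2 Q : NN Sf" "lmap k3 Q : HD Sf" "lmap k4 Q : NV Ss" using Q by (simp_all add: KK_def)
 show ?thesis
  by (rule lsq_k_eqI) (simp_all add: restr_lmap[OF Om, symmetric] k_linear VD_restr[OF k(1)] NN_restr[OF k(2)] HD_restr[OF k(3)] NV_restr[OF k(4)])
qed

definition PI :: "('d, 'd state) lsq => ('d, 'd state) lsq" where "PI X = restr Om (lmap symz X)"

lemma bl_PI: "bounded_linear PI" unfolding PI_def[abs_def] by (rule bounded_linear_compose[OF bl_restr[OF Om] bl_lmap[OF bl_symz]])

lemma restr_restr: "restr Om (restr Om X) = restr Om X" by (rule restr_ext[OF Om rep_L2_on[OF Om]])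

lemma PI_PI: "PI (PI X) = PI X" by (simp add: PI_def restr_lmap[OF Om bl_symz] restr_restr lmap_lmap bl_symz symz_symz)

lemma PI_Bm: "Q : KK ==> PI (lmap Bm Q) = lmap Bm Q"
proof -
 assume Q: "Q : KK"
 have "symz (Bm q) = Bm q" for q by (simp add: symz_def Bm_def linear_simps[OF bl_sympart] sympart_Cx sympart_sympart)
 thus ?thesis by (simp add: PI_def lmap_lmap bl_symz bl_Bm restr_lmap[OF Om bl_Bm] KK_restr[OF Q])
qed

lemma Am_unique: assumes Q: "Q : KK" and z: "lmap Am Q = 0" shows "Q = 0"
proof -
 have k: "lmap k1 Q : VD Ss" "lmap k2 Q : NN Sf" "lmap k3 Q : HD Sf" "lmap k4 Q : NV Ss" using Q by (simp_all add: KK_def)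
 have 0: "lmap W (lmap Am Q) = 0" if "bounded_linear W" for W :: "'d state => 'z::euclidean_space" using lmap_simps(3)[OF that] by (simp add: z)
 have b: "bounded_linear (%x :: 'd state. column 1 (fst x))" "bounded_linear (%x :: 'd state. column 2 (fst x))"
  "bounded_linear (%x :: 'd state. snd (snd x))" "bounded_linear (%x :: 'd state. fst (snd x)-(al * snd (snd x))*.mat 1)"
  by (rule bl_euclI; simp add: column_add column_scaleR algebra_simps)+
 have "lmap fst (lmap k1 Q) = lmap (%x. column 1 (fst x)) (lmap Am Q)" by (simp add: lmap_lmap k_linear b bounded_linear_fst bl_Am Am_def column_cols)
 hence 1: "lmap k1 Q = 0" using VD_fst_0[OF k(1)] 0[OF b(1)] by simp
 have "lmap snd (lmap k2 Q) = lmap (%x. column 2 (fst x)) (lmap Am Q)" by (simp add: lmap_lmap k_linear b bounded_linear_snd bl_Am Am_def column_cols)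
 hence 2: "lmap k2 Q = 0" using NN_snd_0[OF Sf(2) k(2)] 0[OF b(2)] by simp
 have "lmap fst (lmap k3 Q) = lmap (%x. snd (snd x)) (lmap Am Q)" by (simp add: lmap_lmap k_linear b bounded_linear_fst bl_Am Am_def)
 hence 3: "lmap k3 Q = 0" using HD_fst_0[OF k(3)] 0[OF b(3)] by simp
 have "lmap snd (lmap k4 Q) = lmap (%x. fst (snd x)-(al * snd (snd x))*.mat 1) (lmap Am Q)"
  by (simp add: lmap_lmap k_linear b bounded_linear_snd bl_Am Am_def)
 hence 4: "lmap k4 Q = 0" using NV_snd_0[OF Ss(2) k(4)] 0[OF b(4)] by simp
 show "Q = 0" by (rule lsq_k_eqI) (simp_all add: 1 2 3 4 lmap_simps(3) k_linear)
qed

definition DD :: "('d, 'd state) lsq set" where "DD = {X. EX Q:KK. PI X = lmap Am Q}"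

definition MM :: "('d, 'd state) lsq => ('d, 'd state) lsq" where
 "MM X = lmap Bm (SOME Q. Q : KK & PI X = lmap Am Q)"

lemma MM_eq: assumes Q: "Q : KK" and X: "PI X = lmap Am Q" shows "MM X = lmap Bm Q"
proof -
 let ?Q = "SOME Q. Q : KK & PI X = lmap Am Q"
 have Q': "?Q : KK & PI X = lmap Am ?Q" by (rule someI[of _ Q]) (use Q X in blast)
 hence "?Q-Q : KK" using subspace_diff[OF KK_subspace _ Q] by blast
 moreover have "lmap Am (?Q-Q) = 0" using Q' X by (simp add: lmap_simps[OF bl_Am])
 ultimately have "?Q-Q = 0" by (rule Am_unique)
 thus ?thesis by (simp add: MM_def)
qed

lemma DD_E: assumes "X : DD" obtains Q where "Q : KK" "PI X = lmap Am Q" "MM X = lmap Bm Q" using assms MM_eq unfolding DD_def by blast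

lemma MM_monotone: assumes X: "X : DD" shows "0 <= inner (lmap wt (MM X)) X"
proof -
 obtain Q where Q: "Q : KK" "PI X = lmap Am Q" "MM X = lmap Bm Q" by (rule DD_E[OF X])
 define V :: "'d fields => 'd state" where
  "V q = (cols (- fst (k4 q)) (snd (k3 q)+be*.snd (k2 q)), (- snd (k1 q), al*trace (snd (k1 q))+fst (k2 q)))" for q
 have V: "bounded_linear V"
 proof (rule bl_euclI)
  fix p q :: "'d fields" and c :: real
  show "V (p+q) = V p+V q" by (simp add: V_def k_simps trace_add algebra_simps cols_add[symmetric])
  show "V (c*.q) = c*.V q" by (simp add: V_def k_simps trace_scaleR algebra_simps cols_scaleR[symmetric])
 qed
 have "wt (Bm q) = symz (V q)" for q
  using s by (simp add: wt_def Bm_def V_def symz_def mult_Ri_R Ax linear_simps[OF bl_sympart] linear_simps[OF Ax(1)])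
 hence "lmap wt (MM X) = lmap symz (lmap V Q)" by (simp add: Q(3) lmap_lmap bl_wt bl_Bm bl_symz V)
 hence "inner (lmap wt (MM X)) X = inner (lmap V (restr Om Q)) (lmap symz X)"
  by (simp add: inner_lmap_adjoint[OF bl_symz bl_symz symz_inner] KK_restr[OF Q(1)])
 also have "... = inner (lmap V Q) (lmap Am Q)" by (simp add: restr_lmap[OF Om V, symmetric] inner_restr_left[OF Om] PI_def[symmetric] Q(2))
 also have "... = - inner (lmap k1 Q) (lmap k4 Q)+inner (lmap k2 Q) (lmap k3 Q)+be*inner (lmap (%q. snd (k2 q)) Q) (lmap (%q. snd (k2 q)) Q)"
 proof -
  have k5: "bounded_linear (%q. snd (k2 q :: real \<times> (real^'d)))" by (rule bounded_linear_compose[OF bounded_linear_snd k_linear(2)])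
  have "V q<.>Am q = - (k1 q<.>k4 q)+k2 q<.>k3 q+be*(snd (k2 q)<.>snd (k2 q))" for q
  proof -
   have c: "cols a b<.>cols a' b' = a<.>a' + b<.>b'" for a b a' b' :: "real^'d" by (simp add: inner_vec_def sum_2 cols_nth sum.distrib)
   show ?thesis
    by (simp add: V_def Am_def inner_prod_def c trace_eq_inner inner_add_left inner_add_right algebra_simps inner_commute[of "fst (k4 q)"] inner_commute[of "snd (k3 q)"])
  qed
  thus ?thesis
   using lmap_inner(1)[OF k_linear(1) k_linear(4), of Q Q] lmap_inner(1)[OF k_linear(2) k_linear(3), of Q Q] lmap_inner(1)[OF k5 k5, of Q Q]
   by (simp add: lmap_inner(2) bl_Am V k_linear k5)
 qed
 also have "inner (lmap k1 Q) (lmap k4 Q) = 0" using Q(1) by (intro VD_NV_orthogonal[of _ Ss]) (simp_all add: KK_def)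
 also have "inner (lmap k2 Q) (lmap k3 Q) = 0" using Q(1) by (simp add: KK_def NN_def)
 finally show ?thesis using beta by simp
qed

lemma MM_range: assumes l: "0 < l" shows "EX X:DD. X+l*.MM X = G"
proof -
 define h :: "'d state => 'd state" where "h x = (fst x ** R, (- l*.fst (snd x), l * snd (snd x)))" for x
 have h: "bounded_linear h" by (rule bl_euclI) (simp_all add: h_def linear_simps[OF bl_matrix_mult] algebra_simps)
 obtain m where m: "0 < m" "!!x. m*(norm x)^2 <= rw l x<.>x" by (rule rw_coercive[OF l], rule that, assumption+)
 obtain V where V: "bounded_linear V" "!!x. rw l (V x) = x" by (rule coercive_inverse[OF bl_rw m], rule that, assumption+)
 note ipf = inner_form_lmap[OF bl_rw rw_inner m]
 obtain U where U: "U : GR al Ss Sf" "!!W. W : GR al Ss Sf ==> inner (lmap (rw l) (lmap (%x. V (h x)) (PI G)-U)) W = 0"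
  by (rule inner_form.projection[OF ipf GR_subspace[OF Ss(1)] GR_closed[OF Ss(1)], where y="lmap (%x. V (h x)) (PI G)"], rule that, assumption+)
 obtain F E where FE: "F : VD Ss" "E : NN Sf" "U = lmap (gr_s al) F+lmap gr_f E" using U(1) unfolding GR_def by blast
 define H where "H = lmap (rw l) U-lmap h (PI G)"
 have "lmap (rw l) (lmap (%x. V (h x)) (PI G)) = lmap h (PI G)" by (simp add: lmap_lmap bl_rw bounded_linear_compose[OF V(1) h] V(2))
 hence "lmap (rw l) (lmap (%x. V (h x)) (PI G)-U) = - H" by (simp add: H_def lmap_simps[OF bl_rw])
 hence HO: "inner H W = 0" if "W : GR al Ss Sf" for W using U(2)[OF that] by simp
 have PIr: "restr Om (PI G) = PI G" unfolding PI_def by (rule restr_restr)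
 have Hr: "restr Om H = H" by (simp add: H_def FE(3) linear_simps[OF bl_restr[OF Om]] restr_lmap[OF Om] bl_rw h PIr
    bl_gr_s bl_gr_f VD_restr[OF FE(1)] NN_restr[OF FE(2)])
 define gt :: "'d state => real \<times> (real^'d)" where "gt x = (snd (snd x), column 2 (fst x))" for x
 define st :: "'d state => (real^'d) \<times> (real^'d^'d)" where "st x = (column 1 (fst x), sympart (fst (snd x))+(al * snd (snd x))*.mat 1)" for x
 have gt: "bounded_linear gt" by (rule bl_euclI) (simp_all add: gt_def column_add column_scaleR)
 have st: "bounded_linear st" by (rule bl_euclI) (simp_all add: st_def column_add column_scaleR linear_simps[OF bl_sympart] algebra_simps)
 have gt_adj: "gt x<.>y = x<.>gr_f y" for x y
  by (simp add: gt_def gr_f_def inner_prod_def inner_commute[of "fst x"] cols_0_inner inner_commute[of "column 2 (fst x)"])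
 have cols_0': "cols a 0<.>A = a<.>column 1 A" for a :: "real^'d" and A by (simp add: inner_vec_def sum_2 cols_nth column_def)
 have st_adj: "st x<.>y = x<.>gr_s al y" for x y
  by (simp add: st_def gr_s_def inner_prod_def inner_commute[of "fst x"] cols_0' inner_commute[of "column 1 (fst x)"]
    inner_add_left sympart_inner trace_eq_inner inner_commute[of "snd y" "mat 1"])
 have "lmap gt H : HD Sf"
 proof (rule HD_biorthogonal[OF Sf(1)])
  show "restr Om (lmap gt H) = lmap gt H" by (simp add: restr_lmap[OF Om gt] Hr)
  fix E' assume E': "E' : NN Sf"
  have "lmap (gr_s al) 0+lmap gr_f E' : GR al Ss Sf" unfolding GR_def using E' subspace_0[OF VD_subspace[OF Ss(1)]] by blast
  hence "inner H (lmap gr_f E') = 0" using HO by (simp add: lmap_simps(3)[OF bl_gr_s])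
  thus "inner E' (lmap gt H) = 0" using inner_lmap_adjoint[OF gt bl_gr_f gt_adj, of H E'] by (simp add: inner_commute)
 qed
 define P0 where "P0 = (- (1/l))*.lmap gt H"
 have P: "P0 : HD Sf" unfolding P0_def by (rule subspace_scale[OF HD_subspace[OF Sf(1)] \<open>lmap gt H \<in> HD Sf\<close>])
 have "lmap st H : NV Ss"
 proof (rule NV_I[OF Ss(1)])
  show "restr Om (lmap st H) = lmap st H" by (simp add: restr_lmap[OF Om st] Hr)
  fix F' assume F': "F' : VD Ss"
  have "lmap (gr_s al) F' + lmap gr_f 0 : GR al Ss Sf" unfolding GR_def using F' subspace_0[OF NN_subspace] by blast
  hence "inner H (lmap (gr_s al) F') = 0" using HO by (simp add: lmap_simps(3)[OF bl_gr_f])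
  thus "inner (lmap st H) F' = 0" using inner_lmap_adjoint[OF st bl_gr_s st_adj, of H F'] by simp
 qed
 define Y0 where "Y0 = (1/l)*.lmap st H"
 have Y: "Y0 : NV Ss" unfolding Y0_def by (rule subspace_scale[OF NV_subspace \<open>lmap st H \<in> NV Ss\<close>])
 define Q where "Q = lpair (lpair F E) (lpair P0 Y0)"
 have QK: "Q : KK" using FE(1,2) P Y unfolding KK_def Q_def by (simp only: lmap_k_lpair mem_Collect_eq)
 have sym: "lmap symz (PI G) = PI G" by (simp add: PI_def restr_lmap[OF Om bl_symz] lmap_lmap bl_symz symz_symz)
 have main: "lmap Am Q+l*.lmap Bm Q = PI G"
 proof (rule lsq_eqI)
  show "AE x in lebesgue. rep (lmap Am Q+l*.lmap Bm Q) x = rep (PI G) x"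
   using rep_add[of "lmap Am Q" "l*.lmap Bm Q"] rep_scaleR[of l "lmap Bm Q"] rep_lmap[OF bl_Am, of Q] rep_lmap[OF bl_Bm, of Q]
    rep_lpair[of "lpair F E" "lpair P0 Y0"] rep_lpair[of F E] rep_lpair[of P0 Y0] rep_scaleR[of "- (1/l)" "lmap gt H"] rep_scaleR[of "1/l" "lmap st H"]
    rep_lmap[OF gt, of H] rep_lmap[OF st, of H] rep_diff[of "lmap (rw l) U" "lmap h (PI G)"] rep_lmap[OF bl_rw, of l U] rep_lmap[OF h, of "PI G"]
    rep_add[of "lmap (gr_s al) F" "lmap gr_f E"] rep_lmap[OF bl_gr_s, of al F] rep_lmap[OF bl_gr_f, of E] rep_lmap[OF bl_symz, of "PI G"]
   unfolding Q_def[symmetric] H_def[symmetric] FE(3)[symmetric] sym P0_def[symmetric] Y0_def[symmetric]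
  proof eventually_elim
   case (elim x)
   obtain v J where v: "rep F x = (v, J)" by fastforce
   obtain w f where w: "rep E x = (w, f)" by fastforce
   obtain A \<tau> q where g: "rep (PI G) x = (A, (\<tau>, q))" by (metis surj_pair)
   have \<tau>: "sympart \<tau> = \<tau>" using elim(18) by (simp add: g symz_def)
   define B where "B = cols v f ** R+cols 0 ((l*be)*.f)-A ** R"
   define e where "e = Cx (sympart J)"
   have e: "sympart e = e" by (simp add: e_def sympart_Cx sympart_sympart)
   have cc: "cols v 0+cols 0 f = cols v f" by (simp add: cols_add[symmetric])
   have rU: "rep U x = (cols v f, (sympart J, al*trace J+w))" using elim(15-17) by (simp add: v w gr_s_def gr_f_def cc)
   have rH: "rep H x = (B, (l^2*.e+l *. \<tau>, l^2/s*(al*trace J+w)-l*q))" using elim(12-14) by (simp add: rU g rw_def h_def column_cols B_def e_def)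
   define p where "p = q-l/s*(al*trace J+w)"
   have rP: "rep P0 x = (p, - (1/l)*.column 2 B)" using elim(8,10) l by (simp add: rH gt_def p_def field_simps power2_eq_square)
   have "al*(l^2/s*(al*trace J+w)-l*q) = - (l*al*p)" by (simp add: p_def algebra_simps power2_eq_square)
   hence rY: "rep Y0 x = ((1/l)*.column 1 B, l*.e + \<tau> - (al*p)*.mat 1)"
    using elim(9,11) l by (simp add: rH st_def linear_simps[OF bl_sympart] e \<tau> scaleR_add_right scaleR_diff_right power2_eq_square)
   have rQ: "rep Q x = (((v, J), (w, f)), ((p, - (1/l)*.column 2 B), ((1/l)*.column 1 B, l*.e + \<tau> - (al*p)*.mat 1)))"
    using elim(5-7) by (simp add: v w rP rY)
   have am: "Am (rep Q x) = (cols v f, (l*.e + \<tau>, p))" by (simp add: Am_def rQ k1_def k2_def k3_def k4_def)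
   have "l*.cols (- ((1/l)*.column 1 B)) (- (1/l)*.column 2 B+be*.f) = cols 0 ((l*be)*.f)-B"
    using l by (simp add: vec_eq_iff cols_nth column_def forall_2 algebra_simps)
   also have "... = (A-cols v f) ** R" by (simp add: B_def linear_simps(2)[OF bl_matrix_mult])
   finally have "l*.(cols (- ((1/l)*.column 1 B)) (- (1/l)*.column 2 B+be*.f) ** Ri) = A-cols v f"
    by (simp only: linear_simps(5)[OF bl_matrix_mult, symmetric] mult_Ri_R)
   hence bm: "l*.Bm (rep Q x) = (A-cols v f, (- l*.e, q-p))" by (simp add: Bm_def rQ k1_def k2_def k3_def k4_def e_def p_def)
   show ?case using elim(1-4) am bm by (simp add: g)
  qed
 qed
 define X where "X = lmap Am Q+(G-PI G)"
 have "PI (lmap Am Q) = PI (PI G-l*.lmap Bm Q)" by (simp add: main[symmetric])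
 also have "... = PI G-l*.lmap Bm Q" by (simp only: linear_simps[OF bl_PI] PI_Bm[OF QK] PI_PI)
 also have "... = lmap Am Q" unfolding main[symmetric] by simp
 finally have PA: "PI (lmap Am Q) = lmap Am Q" .
 have PX: "PI X = lmap Am Q" by (simp add: X_def linear_simps[OF bl_PI] PA PI_PI)
 have "X : DD" unfolding DD_def using QK PX by blast
 moreover have "X+l*.MM X = (lmap Am Q+l*.lmap Bm Q)+(G-PI G)" unfolding MM_eq[OF QK PX] by (simp add: X_def)
 hence "X+l*.MM X = G" unfolding main by simp
 ultimately show ?thesis by blast
qed

sublocale max_monotone "%F G :: ('d, 'd state) lsq. inner (lmap wt F) G" mW DD MM
proof (intro max_monotone.intro max_monotone_axioms.intro)
 show "inner_form (%F G :: ('d, 'd state) lsq. inner (lmap wt F) G) mW" by (rule inner_form_lmap[OF bl_wt wt_inner mW])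
 note la = lmap_simps[OF bl_Am] and lb = lmap_simps[OF bl_Bm] and lp = linear_simps[OF bl_PI]
 have add: "X+Y : DD & MM (X+Y) = MM X+MM Y" if X: "X : DD" and Y: "Y : DD" for X Y
 proof -
  obtain Q where Q: "Q : KK" "PI X = lmap Am Q" "MM X = lmap Bm Q" by (rule DD_E[OF X])
  obtain P where P: "P : KK" "PI Y = lmap Am P" "MM Y = lmap Bm P" by (rule DD_E[OF Y])
  have k: "Q+P : KK" by (rule subspace_add[OF KK_subspace Q(1) P(1)])
  have e: "PI (X+Y) = lmap Am (Q+P)" by (simp add: la lp Q P)
  show ?thesis using k e MM_eq[OF k e] by (auto simp: DD_def lb Q P)
 qed
 have scale: "c*.X : DD & MM (c*.X) = c*.MM X" if X: "X : DD" for X c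
 proof -
  obtain Q where Q: "Q : KK" "PI X = lmap Am Q" "MM X = lmap Bm Q" by (rule DD_E[OF X])
  have k: "c*.Q : KK" by (rule subspace_scale[OF KK_subspace Q(1)])
  have e: "PI (c*.X) = lmap Am (c*.Q)" by (simp add: la lp Q)
  show ?thesis using k e MM_eq[OF k e] by (auto simp: DD_def lb Q)
 qed
 have "0 : DD" unfolding DD_def using subspace_0[OF KK_subspace] by (auto intro!: bexI[of _ 0] simp: la(3) lp(3))
 thus "subspace DD" unfolding subspace_def using add scale by blast
 show "MM (X+Y) = MM X+MM Y" if "X : DD" "Y : DD" for X Y using add[OF that] by blast
 show "MM (a*.X) = a*.MM X" if "X : DD" for a X using scale[OF that] by blast
 show "0 <= inner (lmap wt (MM X)) X" if "X : DD" for X by (rule MM_monotone[OF that])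
 show "EX X:DD. X+l*.MM X = G" if "0 < l" for l G by (rule MM_range[OF that])
qed

end

section \<open>From classes back to functions\<close>

context bounded_domain
begin

lemma H1_D_E: assumes "q : H1_D Om S" shows "q : L2 Om" "weak_grad Om q : L2 Om" "is_weak_grad Om q (weak_grad Om q)" "jet q (weak_grad Om q) : HD S"
proof -
 obtain G where G: "is_weak_grad Om q G" using assms by (auto simp: H1_D_def H1_def)
 show q: "q : L2 Om" using assms by (simp add: H1_D_def H1_def)
 show g: "is_weak_grad Om q (weak_grad Om q)" by (rule is_weak_grad_weak_grad[OF G])
 thus L: "weak_grad Om q : L2 Om" by (simp add: is_weak_grad_def)
 show "jet q (weak_grad Om q) : HD S" unfolding H1_D_iff[OF q L] using assms g by blast
qed

lemma HN_div_E: assumes "v : HN_div Om S" shows "v : L2 Om" "weak_div Om v : L2 Om" "is_weak_div Om v (weak_div Om v)"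
  "S \<subseteq> frontier Om ==> jet (weak_div Om v) v : NN S"
proof -
 obtain w where w: "is_weak_div Om v w" using assms by (auto simp: HN_div_def Hdiv_def)
 show v: "v : L2 Om" using assms by (simp add: HN_div_def Hdiv_def)
 show d: "is_weak_div Om v (weak_div Om v)" by (rule is_weak_div_weak_div[OF w])
 thus L: "weak_div Om v : L2 Om" by (simp add: is_weak_div_def)
 assume "S \<subseteq> frontier Om"
 from HN_div_iff[OF this v L] show "jet (weak_div Om v) v : NN S" using assms d by (simp add: NN_def restr_jet v L)
qed

lemma weak_div_trace: assumes v: "!!i. (%x. v x$i) : L2 Om" and J: "J : L2 Om" "!!i. is_weak_grad Om (%x. v x$i) (%x. J x$i)"
 shows "is_weak_div Om v (%x. trace (J x))" unfolding is_weak_div_def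
proof (intro conjI allI impI)
 have "bounded_linear (trace :: real^'d^'d => real)" by (rule bl_euclI) (simp_all add: trace_add trace_scaleR)
 thus "(%x. trace (J x)) : L2 Om" by (rule L2_linear[OF J(1)])
 fix ph assume t: "test_fun Om ph"
 have JL: "(%x. J x$i$i) : L2 Om" for i by (intro L2_nth J)
 have "(LINT x|LO Om. (SU i. v x$i*pd i ph x)) = (SU i. LINT x|LO Om. v x$i*pd i ph x)"
  by (rule Bochner_Integration.integral_sum) (intro L2_integrable_mult v test_fun_L2 t)
 also have "... = (SU i. - (LINT x|LO Om. J x$i$i*ph x))" using J(2) t by (intro sum.cong refl) (simp add: is_weak_grad_def)
 also have "... = - (SU i. LINT x|LO Om. J x$i$i*ph x)" by (simp add: sum_negf)
 also have "(SU i. LINT x|LO Om. J x$i$i*ph x) = (LINT x|LO Om. (SU i. J x$i$i*ph x))"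
  by (rule Bochner_Integration.integral_sum[symmetric]) (intro L2_integrable_mult JL test_fun_L2 t)
 finally show "(LINT x|LO Om. (SU i. v x$i*pd i ph x)) = - (LINT x|LO Om. trace (J x)*ph x)" by (simp add: trace_def sum_distrib_right)
qed

end

context poro
begin

definition adm :: "(real^'d => 'd fields) => bool" where
 "adm q \<longleftrightarrow> q : L2 Om & zext Om q : KK & (AE x in LO Om. fst (snd (Am (q x))) : sym_mats)"

lemma adm_XX: assumes a: "adm q"
 defines "u \<equiv> %x. fst (Am (q x))" and "w \<equiv> %x. snd (Am (q x))" shows "u : XX1 Om Ss Sf" "w : XX2 Om Ss Sf al"
  "AE x in LO Om. strain Om (col_s u) x = sympart (snd (k1 (q x)))"
  "AE x in LO Om. fluid_content Om al u x = al*trace (snd (k1 (q x)))+fst (k2 (q x))"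
  "AE x in LO Om. weak_grad Om (%y. snd (w y)) x = snd (k3 (q x))"
  "AE x in LO Om. row_div Om (total_stress al w) x = fst (k4 (q x))"
proof -
 have q: "q : L2 Om" and k: "zext Om q : KK" and sy: "AE x in LO Om. fst (snd (Am (q x))) : sym_mats" using a by (simp_all add: adm_def)
 have us: "col_s u = (%x. fst (k1 (q x)))" and uf: "col_f u = (%x. snd (k2 (q x)))"
  by (simp_all add: fun_eq_iff col_s_def col_f_def u_def Am_def column_cols)
 have wp: "(%x. snd (w x)) = (%x. fst (k3 (q x)))" and ts: "total_stress al w = (%x. snd (k4 (q x)))"
  by (simp_all add: fun_eq_iff total_stress_def w_def Am_def)
 have kq: "(%x. k1 (q x)) : L2 Om" "(%x. k2 (q x)) : L2 Om" "(%x. k3 (q x)) : L2 Om" "(%x. k4 (q x)) : L2 Om" by (intro L2_linear[OF q] k_linear)+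
 note fL = L2_linear[OF _ bounded_linear_fst] and sL = L2_linear[OF _ bounded_linear_snd]
 have L: "(%x. fst (k1 (q x))$i) : L2 Om" "(%x. snd (k1 (q x))$i) : L2 Om"
  "(%x. fst (k4 (q x))$i) : L2 Om" "(%x. snd (k4 (q x))$i) : L2 Om" for i
  using L2_linear[OF fL[OF kq(1)] bounded_linear_vec_nth] L2_linear[OF sL[OF kq(1)] bounded_linear_vec_nth]
   L2_linear[OF fL[OF kq(4)] bounded_linear_vec_nth] L2_linear[OF sL[OF kq(4)] bounded_linear_vec_nth] by simp_all
 have "lmap (pr i) (lmap k1 (zext Om q)) : HD Ss" for i using k by (simp add: KK_def VD_def)
 hence "jet (%x. fst (k1 (q x))$i) (%x. snd (k1 (q x))$i) : HD Ss" for i by (simp add: lmap_ext q kq k_linear bl_pr jet_def pr_def)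
 hence 1: "(%x. fst (k1 (q x))$i) : H1_D Om Ss" "is_weak_grad Om (%x. fst (k1 (q x))$i) (%x. snd (k1 (q x))$i)" for i
  using H1_D_iff[OF L(1) L(2)] by blast+
 have "lmap k2 (zext Om q) : NN Sf" using k by (simp add: KK_def)
 hence "ALL F:HD Sf. inner (jet (%x. fst (k2 (q x))) (%x. snd (k2 (q x)))) F = 0" by (simp add: lmap_ext q k_linear jet_def NN_def)
 hence 2: "(%x. snd (k2 (q x))) : HN_div Om Sf" "is_weak_div Om (%x. snd (k2 (q x))) (%x. fst (k2 (q x)))"
  using HN_div_iff[OF Sf(2) sL[OF kq(2)] fL[OF kq(2)]] by blast+
 have "lmap k3 (zext Om q) : HD Sf" using k by (simp add: KK_def)
 hence "jet (%x. fst (k3 (q x))) (%x. snd (k3 (q x))) : HD Sf" by (simp add: lmap_ext q k_linear jet_def)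
 hence 3: "(%x. fst (k3 (q x))) : H1_D Om Sf" "is_weak_grad Om (%x. fst (k3 (q x))) (%x. snd (k3 (q x)))"
  using H1_D_iff[OF fL[OF kq(3)] sL[OF kq(3)]] by blast+
 have "lmap (pr i) (lmap k4 (zext Om q)) : NN Ss" for i using k by (simp add: KK_def NV_def)
 hence "ALL F:HD Ss. inner (jet (%x. fst (k4 (q x))$i) (%x. snd (k4 (q x))$i)) F = 0" for i
  by (simp add: lmap_ext q kq k_linear bl_pr jet_def pr_def NN_def)
 hence 4: "(%x. snd (k4 (q x))$i) : HN_div Om Ss" "is_weak_div Om (%x. snd (k4 (q x))$i) (%x. fst (k4 (q x))$i)" for i
  using HN_div_iff[OF Ss(2) L(4) L(3)] by blast+
 show "u : XX1 Om Ss Sf" using 1(1) 2(1) by (simp add: XX1_def H1_D_vec_def us uf)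
 have AmL: "(%x. Am (q x)) : L2 Om" by (rule L2_linear[OF q bl_Am])
 have wL: "(%x. fst (w x)) : L2_sym Om" using fL[OF sL[OF AmL]] sy by (simp add: L2_sym_def w_def)
 have pL: "(%x. fst (k3 (q x))) : L2 Om" by (rule fL[OF kq(3)])
 have "AE x in LO Om. snd (k4 (q x)) : sym_mats" using sy
 proof eventually_elim
  case (elim x)
  hence "sympart ((al*fst (k3 (q x)))*.mat 1+snd (k4 (q x))) = (al*fst (k3 (q x)))*.mat 1+snd (k4 (q x))" by (simp add: Am_def sym_mats_iff)
  thus ?case by (simp add: sym_mats_iff linear_simps[OF bl_sympart] sympart_mat1)
 qed
 hence "total_stress al w : HN_div_sym Om Ss" unfolding HN_div_sym_iff[OF Ss(1)] ts row_eq using 4(1) sL[OF kq(4)] by (simp add: L2_sym_def)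
 thus "w : XX2 Om Ss Sf al" using wL 3(1) by (simp add: XX2_def wp)
 have "AE x in LO Om. ALL i:UNIV. weak_grad Om (%y. fst (k1 (q y))$i) x = snd (k1 (q x))$i" by (rule AE_finite_allI) (auto intro: weak_grad_eq 1(2))
 hence J: "AE x in LO Om. jacobian Om (col_s u) x = snd (k1 (q x))" by eventually_elim (simp add: us jacobian_def vec_eq_iff)
 thus "AE x in LO Om. strain Om (col_s u) x = sympart (snd (k1 (q x)))" by eventually_elim (simp add: strain_def sympart_def)
 have "is_weak_div Om (%x. fst (k1 (q x))) (%x. trace (snd (k1 (q x))))" by (rule weak_div_trace[OF L(1) sL[OF kq(1)] 1(2)])
 from weak_div_eq[OF this] weak_div_eq[OF 2(2)]
 show "AE x in LO Om. fluid_content Om al u x = al*trace (snd (k1 (q x)))+fst (k2 (q x))" by eventually_elim (simp add: fluid_content_def us uf)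
 show "AE x in LO Om. weak_grad Om (%y. snd (w y)) x = snd (k3 (q x))" unfolding wp by (rule weak_grad_eq[OF 3(2)])
 have "AE x in LO Om. ALL i:UNIV. weak_div Om (%y. snd (k4 (q y))$i) x = fst (k4 (q x))$i" by (rule AE_finite_allI) (auto intro: weak_div_eq 4(2))
 thus "AE x in LO Om. row_div Om (total_stress al w) x = fst (k4 (q x))" by eventually_elim (simp add: ts row_div_def row_eq vec_eq_iff)
qed

lemma XX_adm: assumes u: "u : XX1 Om Ss Sf" and w: "w : XX2 Om Ss Sf al"
 obtains q where "adm q" "!!x. Am (q x) = (u x, w x)"
proof -
 let ?t = "total_stress al w" and ?p = "%x. snd (w x)" and ?J = "jacobian Om (col_s u)"
 define q :: "real^'d => 'd fields" where "q x = (((col_s u x, ?J x), (weak_div Om (col_f u) x, col_f u x)),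
  ((?p x, weak_grad Om ?p x), (row_div Om ?t x, ?t x)))" for x
 have us: "(%x. col_s u x$i) : H1_D Om Ss" for i using u by (simp add: XX1_def H1_D_vec_def)
 have uf: "col_f u : HN_div Om Sf" using u by (simp add: XX1_def)
 have p: "?p : H1_D Om Sf" using w by (simp add: XX2_def)
 have t: "?t : HN_div_sym Om Ss" and sL: "(%x. fst (w x)) : L2_sym Om" using w by (simp_all add: XX2_def)
 have tr: "(%x. ?t x$i) : HN_div Om Ss" for i using t by (simp add: HN_div_sym_iff Ss row_eq)
 have L2_vec: "v : L2 Om" if c: "!!i. (%x. v x$i) : L2 Om" for v :: "real^'d => 'z::euclidean_space^'d"
 proof -
  have l: "bounded_linear (%y. (\<chi> k. if k = i then y else 0) :: 'z^'d)" for i by (rule bl_euclI) (simp_all add: vec_eq_iff)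
  have "(%x. \<Sum>i\<in>I. (\<chi> k. if k = i then v x$i else 0) :: 'z^'d) : L2 Om" if "finite I" for I
   using that by (induction I) (simp_all add: L2_zero L2_add L2_linear[OF c l])
  hence "(%x. SU i. (\<chi> k. if k = i then v x$i else 0) :: 'z^'d) : L2 Om" by simp
  moreover have "(%x. SU i. (\<chi> k. if k = i then v x$i else 0) :: 'z^'d) = v" by (simp add: fun_eq_iff vec_eq_iff)
  ultimately show ?thesis by simp
 qed
 have JL: "?J : L2 Om" by (rule L2_vec) (simp add: jacobian_def H1_D_E(2)[OF us])
 have sLs: "col_s u : L2 Om" by (rule L2_vec) (rule H1_D_E(1)[OF us])
 have tL: "?t : L2 Om" by (rule L2_vec) (rule HN_div_E(1)[OF tr])
 have dL: "row_div Om ?t : L2 Om" by (rule L2_vec) (simp add: row_div_def row_eq HN_div_E(2)[OF tr])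
 have q: "q : L2 Om" unfolding q_def[abs_def] by (intro L2_Pair JL sLs tL dL H1_D_E[OF p] HN_div_E[OF uf])
 have lp: "lmap (pr i) (lmap k1 (zext Om q)) = zext Om (%x. pr i (k1 (q x)))" "lmap (pr i) (lmap k4 (zext Om q)) = zext Om (%x. pr i (k4 (q x)))" for i
  by (simp_all add: bl_pr k_linear lmap_ext q L2_linear[OF q])
 have "lmap (pr i) (lmap k1 (zext Om q)) = jet (%x. col_s u x$i) (weak_grad Om (%x. col_s u x$i))" for i
  unfolding lp by (simp add: jet_def pr_def k1_def q_def jacobian_def)
 hence 1: "lmap k1 (zext Om q) : VD Ss" using H1_D_E(4)[OF us] by (simp add: VD_def)
 have "lmap k2 (zext Om q) = jet (weak_div Om (col_f u)) (col_f u)" by (simp add: k_linear lmap_ext q jet_def k2_def q_def)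
 hence 2: "lmap k2 (zext Om q) : NN Sf" using HN_div_E(4)[OF uf Sf(2)] by simp
 have "lmap k3 (zext Om q) = jet ?p (weak_grad Om ?p)" by (simp add: k_linear lmap_ext q jet_def k3_def q_def)
 hence 3: "lmap k3 (zext Om q) : HD Sf" using H1_D_E(4)[OF p] by simp
 have "lmap (pr i) (lmap k4 (zext Om q)) = jet (weak_div Om (%x. ?t x$i)) (%x. ?t x$i)" for i
  unfolding lp by (simp add: jet_def pr_def k4_def q_def row_div_def row_eq)
 hence 4: "lmap k4 (zext Om q) : NV Ss" using HN_div_E(4)[OF tr Ss(2)] by (simp add: NV_def)
 have am: "Am (q x) = (u x, w x)" for x
 proof -
  have "cols (col_s u x) (col_f u x) = u x" using exhaust_2 by (auto simp: vec_eq_iff cols_nth col_s_def col_f_def column_def)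
  thus ?thesis by (simp add: Am_def q_def k1_def k2_def k3_def k4_def total_stress_def prod_eq_iff)
 qed
 have "adm q" using q 1 2 3 4 sL by (simp add: adm_def KK_def am L2_sym_def)
 thus ?thesis using that am by blast
qed

lemma adm_diff: assumes p: "adm p" and q: "adm q" shows "adm (%x. p x-q x)"
proof -
 have L: "p : L2 Om" "q : L2 Om" and K: "zext Om p-zext Om q : KK" using p q subspace_diff[OF KK_subspace] by (simp_all add: adm_def)
 have "AE x in LO Om. fst (snd (Am (p x))) : sym_mats" "AE x in LO Om. fst (snd (Am (q x))) : sym_mats" using p q by (simp_all add: adm_def)
 hence "AE x in LO Om. fst (snd (Am (p x-q x))) : sym_mats"
  by eventually_elim (simp add: linear_simps[OF bl_Am] sym_mats_iff linear_simps[OF bl_sympart])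
 thus ?thesis using L K by (simp add: adm_def L2_diff zext_diff)
qed

lemma adm_state: assumes a: "adm q" shows "zext Om (%x. Am (q x)) : DD" "MM (zext Om (%x. Am (q x))) = zext Om (%x. Bm (q x))"
  "PI (zext Om (%x. Am (q x))) = zext Om (%x. Am (q x))"
proof -
 have q: "q : L2 Om" and k: "zext Om q : KK" and sy: "AE x in LO Om. fst (snd (Am (q x))) : sym_mats" using a by (simp_all add: adm_def)
 have e: "lmap Am (zext Om q) = zext Om (%x. Am (q x))" by (simp add: lmap_ext q bl_Am)
 have AmL: "(%x. Am (q x)) : L2 Om" by (rule L2_linear[OF q bl_Am])
 have "PI (zext Om (%x. Am (q x))) = lmap symz (zext Om (%x. Am (q x)))" by (simp add: PI_def restr_lmap bl_symz restr_ext AmL)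
 also have "... = zext Om (%x. symz (Am (q x)))" by (simp add: lmap_ext AmL bl_symz)
 also have "... = zext Om (%x. Am (q x))"
 proof (subst zext_eq_iff)
  show "AE x in LO Om. symz (Am (q x)) = Am (q x)" using sy by eventually_elim (simp add: symz_def sym_mats_iff prod_eq_iff)
 qed (auto intro: AmL L2_linear[OF AmL bl_symz])
 finally show PIe: "PI (zext Om (%x. Am (q x))) = zext Om (%x. Am (q x))" .
 hence PI: "PI (zext Om (%x. Am (q x))) = lmap Am (zext Om q)" by (simp add: e)
 thus "zext Om (%x. Am (q x)) : DD" unfolding DD_def using k by blast
 show "MM (zext Om (%x. Am (q x))) = zext Om (%x. Bm (q x))" using MM_eq[OF k PI] by (simp add: lmap_ext q bl_Bm)
qed

lemma DD_adm: assumes X: "X : DD" and P: "PI X = X"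
 obtains q where "adm q" "X = zext Om (%x. Am (q x))"
proof -
 obtain Q where Q: "Q : KK" "PI X = lmap Am Q" using X unfolding DD_def by blast
 have qL: "rep Q : L2 Om" by (rule rep_L2_on) simp
 have e: "X = zext Om (%x. Am (rep Q x))" using Q(2) lmap_ext[OF Om qL bl_Am] KK_restr[OF Q(1)] by (simp add: P)
 have AmL: "(%x. Am (rep Q x)) : L2 Om" by (rule L2_linear[OF qL bl_Am])
 have "lmap symz X = X" using arg_cong[OF P, of "lmap symz"] P by (simp add: PI_def restr_lmap[OF Om bl_symz] lmap_lmap bl_symz symz_symz)
 hence "zext Om (%x. symz (Am (rep Q x))) = zext Om (%x. Am (rep Q x))" by (simp add: e lmap_ext AmL bl_symz)
 hence "AE x in LO Om. symz (Am (rep Q x)) = Am (rep Q x)" by (subst (asm) zext_eq_iff) (auto intro: AmL L2_linear[OF AmL bl_symz])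
 hence "AE x in LO Om. fst (snd (Am (rep Q x))) : sym_mats" by eventually_elim (simp add: symz_def sym_mats_iff prod_eq_iff)
 hence "adm (rep Q)" using qL Q(1) KK_restr[OF Q(1)] by (simp add: adm_def)
 thus ?thesis using that e by blast
qed

end

section \<open>Time-dependent problem\<close>

lemma lebesgue_measurable_AE:
 fixes f g :: "'a::euclidean_space => 'b::topological_space" assumes f: "f : borel_measurable lebesgue" and eq: "AE x in lebesgue. g x = f x"
 shows "g : borel_measurable lebesgue"
proof (rule measurableI)
 fix A :: "'b set" assume A: "A : sets borel"
 obtain N where N: "{x : space lebesgue. \<not> g x = f x} \<subseteq> N" "emeasure lebesgue N = 0" "N : sets lebesgue" by (rule AE_E[OF eq])
 hence N0: "N : null_sets (completion lborel)" by (simp add: null_sets_def)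
 have "g -` A \<inter> N : null_sets (completion lborel)" by (rule null_sets_completion_subset[OF _ N0]) simp
 hence s: "g -` A \<inter> N : sets lebesgue" by (simp add: null_sets_def)
 have "f -` A \<inter> space lebesgue : sets lebesgue" by (rule measurable_sets[OF f A])
 hence "(f -` A \<inter> space lebesgue-N) \<union> (g -` A \<inter> N) : sets lebesgue" using s N(3) by (intro sets.Un sets.Diff)
 moreover have "g -` A \<inter> space lebesgue = (f -` A \<inter> space lebesgue-N) \<union> (g -` A \<inter> N)" using N(1) by auto
 ultimately show "g -` A \<inter> space lebesgue : sets lebesgue" by simp
qed simp

lemma has_vector_derivative_quotient:
 fixes X :: "real => 'a::real_normed_vector" shows "(X has_vector_derivative X') (at t within S) \<longleftrightarrow>
  ((%r. norm ((1/(r-t))*.(X r-X t)-X')) ---> 0) (at t within S)"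
proof -
 have "\<forall>\<^sub>F r in at t within S. norm (X r-X t-(r-t)*.X')/norm (r-t) = norm ((1/(r-t))*.(X r-X t)-X')" unfolding eventually_at_filter
 proof (rule always_eventually, intro allI impI)
  fix r assume r: "r ~= t"
  hence "(1/(r-t))*.(X r-X t)-X' = (1/(r-t))*.(X r-X t-(r-t)*.X')" by (simp add: scaleR_diff_right)
  thus "norm (X r-X t-(r-t)*.X')/norm (r-t) = norm ((1/(r-t))*.(X r-X t)-X')" by simp
 qed
 thus ?thesis unfolding has_vector_derivative_def has_derivative_iff_norm
  using tendsto_cong[of _ _ "at t within S"] by (simp add: bounded_linear_scaleR_left)
qed

context bounded_domain
begin

lemma L2_AE_eq:
 fixes u v :: "real^'d => 'b::euclidean_space" assumes u: "u : L2 Om" and eq: "AE x in LO Om. v x = u x" shows "v : L2 Om"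
proof (rule L2_AE[OF u _ eq])
 have "(%x. if x : Om then u x else 0) : borel_measurable lebesgue" using u by (simp add: borel_measurable_if[OF Om] L2_measurable)
 moreover have "AE x in lebesgue. (if x : Om then v x else 0) = (if x : Om then u x else 0)"
  using eq unfolding AE_lebesgue_on[OF Om] by eventually_elim simp
 ultimately have "(%x. if x : Om then v x else 0) : borel_measurable lebesgue" by (rule lebesgue_measurable_AE)
 thus "v : borel_measurable (LO Om)" by (simp add: borel_measurable_if[OF Om])
qed

lemma l2_norm_quotient: assumes "a : L2 Om" "b : L2 Om" "w' : L2 Om"
 shows "norm (c*.(zext Om a-zext Om b)-zext Om w') = l2_norm Om (%x. c*.(a x-b x)-w' x)"
 using assms by (simp add: zext_diff zext_scaleR zext_norm L2_diff L2_scaleR)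

lemma has_time_deriv_l2: assumes w: "!!r. r : {0..T} ==> w r : L2 Om" and t: "t : {0..T}" and w': "w' : L2 Om"
 shows "has_time_deriv T (l2_norm Om) w w' t \<longleftrightarrow> ((%r. zext Om (w r)) has_vector_derivative zext Om w') (at t within {0..T})"
 unfolding has_time_deriv_def has_vector_derivative_quotient
proof (rule tendsto_cong, unfold eventually_at_filter, intro always_eventually allI impI)
 fix r assume r: "r : {0..T}"
 show "l2_norm Om (%x. (1/(r-t))*.(w r x-w t x)-w' x) = norm ((1/(r-t))*.(zext Om (w r)-zext Om (w t))-zext Om w')"
  by (rule l2_norm_quotient[OF w[OF r] w[OF t] w', symmetric])
qed

lemma C_time_l2_continuous: assumes "C_time 0 T (L2 Om) (l2_norm Om) w" shows "continuous_on {0..T} (%t. zext Om (w t))" unfolding continuous_on_def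
proof
 fix t assume t: "t : {0..T}"
 have w: "!!r. r : {0..T} ==> w r : L2 Om" and lim: "((%r. l2_norm Om (%x. w r x-w t x)) ---> 0) (at t within {0..T})" using assms t by simp_all
 have "\<forall>\<^sub>F r in at t within {0..T}. l2_norm Om (%x. w r x-w t x) = norm (zext Om (w r)-zext Om (w t))" unfolding eventually_at_filter
 proof (intro always_eventually allI impI)
  fix r assume r: "r : {0..T}"
  show "l2_norm Om (%x. w r x-w t x) = norm (zext Om (w r)-zext Om (w t))"
   by (simp only: zext_diff[OF Om w[OF r] w[OF t]] zext_norm[OF Om L2_diff[OF w[OF r] w[OF t]]])
 qed
 hence "((%r. norm (zext Om (w r)-zext Om (w t))) ---> 0) (at t within {0..T})" using lim by (simp add: tendsto_cong)
 thus "((%t. zext Om (w t)) ---> zext Om (w t)) (at t within {0..T})" using LIM_zero_cancel tendsto_norm_zero_iff by blast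
qed

end

context poro
begin

lemma HH2_L2: "w : HH2 Om ==> w : L2 Om" using L2_Pair[of "%x. fst (w x)" Om "%x. snd (w x)"] by (simp add: HH2_def L2_sym_def)

lemma HH_L2: "u : HH1 Om ==> w : HH2 Om ==> (%x. (u x, w x)) : L2 Om" by (intro L2_Pair HH2_L2) (simp add: HH1_def)

lemma HH_quotient:
 "a : HH1 Om ==> b : HH1 Om ==> u : HH1 Om ==> (%x. c*.(a x-b x)-u x) : HH1 Om"
 "a' : HH2 Om ==> b' : HH2 Om ==> w : HH2 Om ==> (%x. c*.(a' x-b' x)-w x) : HH2 Om"
proof -
 show "a : HH1 Om ==> b : HH1 Om ==> u : HH1 Om ==> (%x. c*.(a x-b x)-u x) : HH1 Om" unfolding HH1_def by (intro L2_diff L2_scaleR)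
 assume h: "a' : HH2 Om" "b' : HH2 Om" "w : HH2 Om"
 have "AE x in LO Om. fst (a' x) : sym_mats" "AE x in LO Om. fst (b' x) : sym_mats" "AE x in LO Om. fst (w x) : sym_mats"
  using h by (simp_all add: HH2_def L2_sym_def)
 hence "AE x in LO Om. c*.(fst (a' x)-fst (b' x))-fst (w x) : sym_mats" by eventually_elim (simp add: sym_mats_iff linear_simps[OF bl_sympart])
 moreover have "(%x. c*.(fst (a' x)-fst (b' x))-fst (w x)) : L2 Om" "(%x. c*.(snd (a' x)-snd (b' x))-snd (w x)) : L2 Om"
  using h by (auto simp: HH2_def L2_sym_def intro!: L2_diff L2_scaleR simp del: real_scaleR_def)
 ultimately show "(%x. c*.(a' x-b' x)-w x) : HH2 Om" by (simp add: HH2_def L2_sym_def)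
qed

lemma compliance_measurable: "compliance \<C> : borel_measurable borel"
proof -
 have cl: "closed (sym_mats :: (real^'d^'d) set)"
 proof -
  have "(sym_mats :: (real^'d^'d) set) = {A. sympart A = A}" by (auto simp: sym_mats_iff)
  moreover have "closed {A :: real^'d^'d. sympart A = A}" by (intro closed_Collect_eq linear_continuous_on bl_sympart continuous_on_id)
  ultimately show ?thesis by (simp only:)
 qed
 have "compliance \<C> A = (SOME x. False)" if "A \<notin> sym_mats" for A
 proof -
  have "(%y. y : sym_mats & \<C> y = A) = (%_. False)" using C_simps(1) that by (auto simp: fun_eq_iff)
  thus ?thesis by (simp only: compliance_def inv_into_def)
 qed
 hence "compliance \<C> = (%A. if A : sym_mats then Ax A else (SOME x. False))" by (auto simp: Ax_compliance)
 moreover have "(%A. if A : sym_mats then Ax A else (SOME x. False)) : borel_measurable borel"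
  by (rule measurable_If_set) (use cl linear_continuous_on[OF Ax(1)] in \<open>auto intro: borel_measurable_continuous_onI\<close>)
 ultimately show ?thesis by simp
qed

lemma HH_norms: assumes u: "u : HH1 Om" and w: "w : HH2 Om"
 defines "X \<equiv> zext Om (%x. (u x, w x))"
 shows "(HH1_norm Om R u)^2+(HH2_norm Om \<C> s w)^2 = inner (lmap wt X) X" "0 <= HH1_norm Om R u" "0 <= HH2_norm Om \<C> s w"
proof -
 have uL: "u : L2 Om" and tL: "(%x. fst (w x)) : L2 Om" and qL: "(%x. snd (w x)) : L2 Om" and sy: "AE x in LO Om. fst (w x) : sym_mats"
  using u w by (simp_all add: HH1_def HH2_def L2_sym_def)
 have z: "(%x. (u x, w x)) : L2 Om" by (rule HH_L2[OF u w])
 have int: "integrable (LO Om) (%x. (u x ** R)<.>u x)" "integrable (LO Om) (%x. Ax (fst (w x))<.>fst (w x))"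
  "integrable (LO Om) (%x. (s*.snd (w x))<.>snd (w x))"
  by (intro L2_integrable_inner L2_linear[OF uL bl_matrix_mult] L2_linear[OF tL Ax(1)] L2_scaleR uL tL qL)+
 have "inner (lmap wt X) X = l2_inner Om (%x. wt (u x, w x)) (%x. (u x, w x))"
  unfolding X_def by (simp add: lmap_ext z bl_wt zext_inner L2_linear[OF z bl_wt])
 also have "... = (LINT x|LO Om. (u x ** R)<.>u x+(Ax (fst (w x))<.>fst (w x)+(s*.snd (w x))<.>snd (w x)))"
  by (simp add: l2_inner_def wt_def inner_prod_def)
 also have "... = (LINT x|LO Om. (u x ** R)<.>u x)+((LINT x|LO Om. Ax (fst (w x))<.>fst (w x))+(LINT x|LO Om. (s*.snd (w x))<.>snd (w x)))"
  using int by simp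
 also have "(LINT x|LO Om. Ax (fst (w x))<.>fst (w x)) = (LINT x|LO Om. compliance \<C> (fst (w x))<.>fst (w x))"
 proof (rule integral_cong_AE)
  show "(%x. Ax (fst (w x))<.>fst (w x)) : borel_measurable (LO Om)" using int(2) by (rule borel_measurable_integrable)
  have "(%x. compliance \<C> (fst (w x))) : borel_measurable (LO Om)" by (rule measurable_compose[OF L2_measurable[OF tL] compliance_measurable])
  thus "(%x. compliance \<C> (fst (w x))<.>fst (w x)) : borel_measurable (LO Om)" by (rule borel_measurable_inner[OF _ L2_measurable[OF tL]])
  show "AE x in LO Om. Ax (fst (w x))<.>fst (w x) = compliance \<C> (fst (w x))<.>fst (w x)" using sy by eventually_elim (simp add: Ax_compliance)
 qed
 finally have eq: "inner (lmap wt X) X = HH1_inner Om R u u+HH2_inner Om \<C> s w w" by (simp add: HH1_inner_def HH2_inner_def l2_inner_def)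
 have "0 <= (u x ** R)<.>u x" for x using R_coercive[of "u x"] mR by (meson mult_nonneg_nonneg less_imp_le order_trans zero_le_power2)
 hence 1: "0 <= HH1_inner Om R u u" by (simp add: HH1_inner_def l2_inner_def)
 have "AE x in LO Om. 0 <= compliance \<C> (fst (w x))<.>fst (w x)" using sy
 proof eventually_elim
  case (elim x)
  obtain m where m: "0 < m" "!!A. m*(norm A)^2 <= Ax A<.>A" by (rule Ax_coercive, rule that, assumption+)
  have "0 <= m*(norm (fst (w x)))^2" using m(1) by simp
  thus ?case using m(2)[of "fst (w x)"] elim by (simp add: Ax_compliance)
 qed
 hence "0 <= l2_inner Om (%x. compliance \<C> (fst (w x))) (%x. fst (w x))" unfolding l2_inner_def by (rule integral_nonneg_AE)
 moreover have "0 <= l2_inner Om (%x. s * snd (w x)) (%x. snd (w x))" using s by (simp add: l2_inner_def mult.assoc)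
 ultimately have 2: "0 <= HH2_inner Om \<C> s w w" by (simp add: HH2_inner_def)
 show "(HH1_norm Om R u)^2+(HH2_norm Om \<C> s w)^2 = inner (lmap wt X) X" using 1 2 eq by (simp add: HH1_norm_def HH2_norm_def)
 show "0 <= HH1_norm Om R u" "0 <= HH2_norm Om \<C> s w" using 1 2 by (simp_all add: HH1_norm_def HH2_norm_def)
qed

lemma HH_norm_le_ipn: assumes "u : HH1 Om" "w : HH2 Om"
 shows "HH1_norm Om R u <= ipn (zext Om (%x. (u x, w x)))" "HH2_norm Om \<C> s w <= ipn (zext Om (%x. (u x, w x)))"
  "ipn (zext Om (%x. (u x, w x))) <= HH1_norm Om R u+HH2_norm Om \<C> s w"
proof -
 note h = HH_norms[OF assms]
 have e: "ipn (zext Om (%x. (u x, w x))) = sqrt ((HH1_norm Om R u)^2+(HH2_norm Om \<C> s w)^2)" by (simp only: ipn_def h(1))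
 show "HH1_norm Om R u <= ipn (zext Om (%x. (u x, w x)))" "HH2_norm Om \<C> s w <= ipn (zext Om (%x. (u x, w x)))"
  unfolding e by (rule real_le_rsqrt; simp)+
 show "ipn (zext Om (%x. (u x, w x))) <= HH1_norm Om R u+HH2_norm Om \<C> s w" unfolding e by (rule sqrt_sum_squares_le_sum[OF h(2,3)])
qed

lemma HH_null_iff:
 fixes V :: "'z => ('d, 'd state) lsq" assumes ev: "\<forall>\<^sub>F r in Fl. u r : HH1 Om & w r : HH2 Om & V r = zext Om (%x. (u r x, w r x))"
 shows "((%r. HH1_norm Om R (u r)) ---> 0) Fl & ((%r. HH2_norm Om \<C> s (w r)) ---> 0) Fl \<longleftrightarrow> ((%r. norm (V r)) ---> 0) Fl"
proof (intro iffI conjI; (elim conjE)?)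
 let ?a = "%r. HH1_norm Om R (u r)" and ?b = "%r. HH2_norm Om \<C> s (w r)"
 obtain c where c: "0 < c" "!!x. ipn x <= c*norm x" by (rule ipn_le_norm, rule that, assumption+)
 {
  assume "(?a ---> 0) Fl" "(?b ---> 0) Fl"
  hence "((%r. (?a r + ?b r)/sqrt mW) ---> (0+0)/sqrt mW) Fl" by (intro tendsto_intros) (use mW(1) in auto)
  hence l: "((%r. (?a r + ?b r)/sqrt mW) ---> 0) Fl" by simp
  have le: "\<forall>\<^sub>F r in Fl. norm (V r) <= (?a r + ?b r)/sqrt mW" using ev
  proof eventually_elim
   case (elim r)
   have "norm (V r) <= ipn (V r)/sqrt mW" by (rule norm_le_ipn)
   also have "... <= (?a r + ?b r)/sqrt mW" using elim HH_norm_le_ipn(3)[of "u r" "w r"] mW(1) by (intro divide_right_mono) auto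
   finally show ?case .
  qed
  show "((%r. norm (V r)) ---> 0) Fl" by (rule tendsto_sandwich[OF _ le tendsto_const l]) simp
 next
  assume "((%r. norm (V r)) ---> 0) Fl"
  hence "((%r. c*norm (V r)) ---> c*0) Fl" by (intro tendsto_intros)
  hence l: "((%r. c*norm (V r)) ---> 0) Fl" by simp
  have ab: "\<forall>\<^sub>F r in Fl. 0 <= ?a r & 0 <= ?b r & ?a r <= c*norm (V r) & ?b r <= c*norm (V r)" using ev
  proof eventually_elim
   case (elim r)
   hence h: "u r : HH1 Om" "w r : HH2 Om" and V: "zext Om (%x. (u r x, w r x)) = V r" by simp_all
   show ?case using HH_norms(2,3)[OF h] HH_norm_le_ipn(1,2)[OF h] c(2)[of "V r"] unfolding V by linarith
  qed
  have a: "\<forall>\<^sub>F r in Fl. 0 <= ?a r" "\<forall>\<^sub>F r in Fl. 0 <= ?b r" "\<forall>\<^sub>F r in Fl. ?a r <= c*norm (V r)" "\<forall>\<^sub>F r in Fl. ?b r <= c*norm (V r)"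
   using ab by (simp_all add: eventually_conj_iff)
  show "(?a ---> 0) Fl" by (rule tendsto_sandwich[OF a(1) a(3) tendsto_const l])
  show "(?b ---> 0) Fl" by (rule tendsto_sandwich[OF a(2) a(4) tendsto_const l])
 }
qed

lemma zext_pair_quotient: assumes "a : HH1 Om" "b : HH1 Om" "u : HH1 Om" "a' : HH2 Om" "b' : HH2 Om" "w : HH2 Om"
 shows "c*.(zext Om (%x. (a x, a' x))-zext Om (%x. (b x, b' x)))-zext Om (%x. (u x, w x))
  = zext Om (%x. (c*.(a x-b x)-u x, c*.(a' x-b' x)-w x))"
proof -
 note A = HH_L2[OF assms(1,4)] and B = HH_L2[OF assms(2,5)] and U = HH_L2[OF assms(3,6)]
 have "c*.(zext Om (%x. (a x, a' x))-zext Om (%x. (b x, b' x)))-zext Om (%x. (u x, w x))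
  = zext Om (%x. c*.((a x, a' x)-(b x, b' x))-(u x, w x))"
  by (simp only: zext_diff[OF Om A B] zext_scaleR[OF Om L2_diff[OF A B]] zext_diff[OF Om L2_scaleR[OF L2_diff[OF A B]] U])
 thus ?thesis by simp
qed

lemma has_time_deriv_HH: assumes h: "!!r. r : {0..T} ==> u r : HH1 Om & w r : HH2 Om" and t: "t : {0..T}" and h': "u' : HH1 Om" "w' : HH2 Om"
 shows "has_time_deriv T (HH1_norm Om R) u u' t & has_time_deriv T (HH2_norm Om \<C> s) w w' t \<longleftrightarrow>
  ((%r. zext Om (%x. (u r x, w r x))) has_vector_derivative zext Om (%x. (u' x, w' x))) (at t within {0..T})"
 unfolding has_time_deriv_def has_vector_derivative_quotient
 by (rule HH_null_iff, unfold eventually_at_filter, rule always_eventually) (use h t h' in \<open>simp add: HH_quotient zext_pair_quotient\<close>)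

lemma C_time_HH: assumes h: "!!r. r : {0..T} ==> u r : HH1 Om & w r : HH2 Om"
 shows "C_time 0 T (HH1 Om) (HH1_norm Om R) u & C_time 0 T (HH2 Om) (HH2_norm Om \<C> s) w \<longleftrightarrow>
  continuous_on {0..T} (%r. zext Om (%x. (u r x, w r x)))"
proof -
 let ?X = "%r. zext Om (%x. (u r x, w r x))"
 have "((%r. HH1_norm Om R (%x. u r x-u t x)) ---> 0) (at t within {0..T}) & ((%r. HH2_norm Om \<C> s (%x. w r x-w t x)) ---> 0) (at t within {0..T})
  \<longleftrightarrow> (?X ---> ?X t) (at t within {0..T})" if t: "t : {0..T}" for t
 proof -
  have z: "(%x. 0) : HH1 Om" "(%x. 0) : HH2 Om" by (simp_all add: HH1_def HH2_def L2_sym_def L2_zero sym_mats_iff linear_simps(3)[OF bl_sympart])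
  have "(%x. (0, 0)) = (%x :: real^'d. 0 :: 'd state)" by (simp add: zero_prod_def)
  hence z0: "zext Om (%x. (0, 0)) = (0 :: ('d, 'd state) lsq)" by (simp only: zext_zero)
  have "\<forall>\<^sub>F r in at t within {0..T}. (%x. u r x-u t x) : HH1 Om & (%x. w r x-w t x) : HH2 Om & ?X r - ?X t = zext Om (%x. (u r x-u t x, w r x-w t x))"
   unfolding eventually_at_filter
  proof (rule always_eventually, intro allI impI)
   fix r assume r: "r : {0..T}"
   show "(%x. u r x-u t x) : HH1 Om & (%x. w r x-w t x) : HH2 Om & ?X r - ?X t = zext Om (%x. (u r x-u t x, w r x-w t x))"
    using HH_quotient(1)[of "u r" "u t" "%x. 0" 1] HH_quotient(2)[of "w r" "w t" "%x. 0" 1]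
     zext_pair_quotient[of "u r" "u t" "%x. 0" "w r" "w t" "%x. 0" 1] h[OF r] h[OF t] z z0 by simp
  qed
  from HH_null_iff[OF this] show ?thesis by (simp add: tendsto_norm_zero_iff LIM_zero_iff)
 qed
 thus ?thesis using h unfolding continuous_on_def by auto
qed

end

context poro
begin

definition e1 :: "'d state => real^'d^'d" where "e1 b = - Ax (fst (snd b))"
definition e2 :: "'d state => real" where "e2 b = s * snd (snd b)"
definition e3 :: "'d state => real^2^'d" where "e3 b = cols (- column 1 (fst b ** R)) (column 2 (fst b ** R))"
definition e4 :: "'d state => real^2^'d" where "e4 a = cols 0 (- be*.column 2 (fst a))"

lemma e_linear: "bounded_linear e1" "bounded_linear e2" "bounded_linear e3" "bounded_linear e4"
proof -
 show "bounded_linear e1" by (rule bl_euclI) (simp_all add: e1_def linear_simps[OF Ax(1)])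
 show "bounded_linear e2" by (rule bl_euclI) (simp_all add: e2_def algebra_simps)
 show "bounded_linear e3"
  by (rule bl_euclI) (simp_all add: e3_def linear_simps[OF bl_matrix_mult] column_add column_scaleR cols_add[symmetric] cols_scaleR[symmetric])
 show "bounded_linear e4" by (rule bl_euclI) (simp_all add: e4_def vec_eq_iff cols_nth column_def algebra_simps)
qed

lemma e_Bm: "e1 (Bm q) = sympart (snd (k1 q))" "e2 (Bm q) = al*trace (snd (k1 q))+fst (k2 q)"
 "e3 (Bm q)+e4 (Am q) = cols (fst (k4 q)) (snd (k3 q))"
 using s by (simp_all add: e1_def e2_def e3_def e4_def Bm_def Am_def linear_simps[OF Ax(1)] Ax mult_Ri_R column_cols cols_add[symmetric])

lemma adm_HH: assumes a: "adm q" shows "(%x. fst (Am (q x))) : HH1 Om" "(%x. snd (Am (q x))) : HH2 Om"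
proof -
 have L: "(%x. Am (q x)) : L2 Om" using a by (simp add: adm_def L2_linear[OF _ bl_Am])
 show "(%x. fst (Am (q x))) : HH1 Om" unfolding HH1_def by (rule L2_linear[OF L bounded_linear_fst])
 have sL: "(%x. snd (Am (q x))) : L2 Om" by (rule L2_linear[OF L bounded_linear_snd])
 show "(%x. snd (Am (q x))) : HH2 Om"
  using a L2_linear[OF sL bounded_linear_fst] L2_linear[OF sL bounded_linear_snd] by (simp add: HH2_def L2_sym_def adm_def)
qed

lemma zext_AE:
 "u : L2 Om ==> AE x in LO Om. v x = u x ==> v : L2 Om & zext Om v = zext Om u" using L2_AE_eq[of u v] by (simp add: zext_eq_iff)

lemma l2_inner_zext: "u : L2 Om ==> l2_inner Om u u = (norm (zext Om u))^2" by (simp add: power2_norm_eq_inner zext_inner)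

lemma XX_norms: assumes a: "adm q"
 defines "u \<equiv> %x. fst (Am (q x))" and "w \<equiv> %x. snd (Am (q x))" and "X \<equiv> zext Om (%x. Am (q x))"
 shows "XX1_norm Om R s al u = sqrt ((HH1_norm Om R u)^2+(norm (lmap e1 (MM X)))^2+1/s*(norm (lmap e2 (MM X)))^2)" (is ?A)
  "XX2_norm Om R \<C> s al w = sqrt ((HH2_norm Om \<C> s w)^2
   + inner (lmap (%A. A ** Ri) (lmap e3 (MM X)+lmap e4 X)) (lmap e3 (MM X)+lmap e4 X))" (is ?B)
proof -
 have qL: "q : L2 Om" using a by (simp add: adm_def)
 have AL: "(%x. Am (q x)) : L2 Om" and BL: "(%x. Bm (q x)) : L2 Om" by (intro L2_linear[OF qL] bl_Am bl_Bm)+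
 note x = adm_XX[OF a, folded u_def w_def]
 have x5: "AE x in LO Om. weak_grad Om (%y. snd (w y)) x = snd (k3 (q x))" using adm_XX(5)[OF a] unfolding w_def .
 have M: "MM X = zext Om (%x. Bm (q x))" unfolding X_def by (rule adm_state(2)[OF a])
 have uH: "u : HH1 Om" "w : HH2 Om" unfolding u_def w_def by (rule adm_HH[OF a])+
 note n = HH_norms(2,3)[OF uH]
 have H1: "HH1_inner Om R u u = (HH1_norm Om R u)^2" and H2: "HH2_inner Om \<C> s w w = (HH2_norm Om \<C> s w)^2"
  using n by (simp_all add: HH1_norm_def HH2_norm_def)
 have "AE x in LO Om. strain Om (col_s u) x = e1 (Bm (q x))" using x(3) by (simp add: e_Bm)
 from zext_AE[OF L2_linear[OF BL e_linear(1)] this]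
 have s1: "l2_inner Om (strain Om (col_s u)) (strain Om (col_s u)) = (norm (lmap e1 (MM X)))^2" by (simp add: l2_inner_zext M lmap_ext BL e_linear)
 have "AE x in LO Om. fluid_content Om al u x = e2 (Bm (q x))" using x(4) by (simp add: e_Bm)
 from zext_AE[OF L2_linear[OF BL e_linear(2)] this]
 have s2: "l2_inner Om (fluid_content Om al u) (fluid_content Om al u) = (norm (lmap e2 (MM X)))^2"
  by (simp add: l2_inner_zext M lmap_ext BL e_linear)
 have "l2_inner Om (%x. 1/s*fluid_content Om al u x) (fluid_content Om al u) = 1/s*l2_inner Om (fluid_content Om al u) (fluid_content Om al u)"
  by (simp add: l2_inner_def mult.assoc)
 thus ?A by (simp add: XX1_norm_def XX1_inner_def H1 s1 s2)
 have fL: "(%x. e3 (Bm (q x))+e4 (Am (q x))) : L2 Om" by (intro L2_add L2_linear[OF AL] L2_linear[OF BL] e_linear)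
 have "AE x in LO Om. XX2_flux Om al w x = e3 (Bm (q x))+e4 (Am (q x))" using x5 x(6) by eventually_elim (simp add: XX2_flux_def e_Bm)
 note F0 = zext_AE[OF fL this]
 have "zext Om (%x. e3 (Bm (q x))+e4 (Am (q x))) = lmap e3 (MM X)+lmap e4 X"
  unfolding M unfolding X_def by (simp add: lmap_ext AL BL e_linear zext_add L2_linear[OF AL] L2_linear[OF BL])
 hence F: "XX2_flux Om al w : L2 Om" "zext Om (XX2_flux Om al w) = lmap e3 (MM X)+lmap e4 X" using F0 by simp_all
 have "l2_inner Om (%x. XX2_flux Om al w x ** Ri) (XX2_flux Om al w) = inner (lmap (%A. A ** Ri) (zext Om (XX2_flux Om al w))) (zext Om (XX2_flux Om al w))"
  by (simp add: lmap_ext F(1) bl_matrix_mult zext_inner[OF Om L2_linear[OF F(1) bl_matrix_mult] F(1)])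
 thus ?B by (simp add: XX2_norm_def XX2_inner_def H2 F(2))
qed

lemma XX_null:
 fixes Fl :: "real filter"
 assumes ev: "\<forall>\<^sub>F r in Fl. adm (q r)" and X: "((%r. zext Om (%x. Am (q r x))) ---> 0) Fl" and M: "((%r. MM (zext Om (%x. Am (q r x)))) ---> 0) Fl"
 shows "((%r. XX1_norm Om R s al (%x. fst (Am (q r x)))) ---> 0) Fl" "((%r. XX2_norm Om R \<C> s al (%x. snd (Am (q r x)))) ---> 0) Fl"
proof -
 let ?X = "%r. zext Om (%x. Am (q r x))"
 have "\<forall>\<^sub>F r in Fl. (%x. fst (Am (q r x))) : HH1 Om & (%x. snd (Am (q r x))) : HH2 Om & ?X r = zext Om (%x. (fst (Am (q r x)), snd (Am (q r x))))"
  using ev by eventually_elim (simp add: adm_HH)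
 from HH_null_iff[OF this] X
 have h: "((%r. HH1_norm Om R (%x. fst (Am (q r x)))) ---> 0) Fl" "((%r. HH2_norm Om \<C> s (%x. snd (Am (q r x)))) ---> 0) Fl"
  by (simp_all add: tendsto_norm_zero_iff)
 have l: "((%r. lmap W (MM (?X r))) ---> 0) Fl" "((%r. lmap W (?X r)) ---> 0) Fl" if W: "bounded_linear W" for W :: "'d state => 'z::euclidean_space"
  using bounded_linear.tendsto[OF bl_lmap[OF W] M] bounded_linear.tendsto[OF bl_lmap[OF W] X] by (simp_all add: lmap_simps(3)[OF W])
 have "((%r. sqrt ((HH1_norm Om R (%x. fst (Am (q r x))))^2+(norm (lmap e1 (MM (?X r))))^2+1/s*(norm (lmap e2 (MM (?X r))))^2))
  ---> sqrt (0^2+(norm (0 :: ('d, real^'d^'d) lsq))^2+1/s*(norm (0 :: ('d, real) lsq))^2)) Fl" by (intro tendsto_intros h l e_linear)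
 moreover have "\<forall>\<^sub>F r in Fl. sqrt ((HH1_norm Om R (%x. fst (Am (q r x))))^2+(norm (lmap e1 (MM (?X r))))^2+1/s*(norm (lmap e2 (MM (?X r))))^2)
  = XX1_norm Om R s al (%x. fst (Am (q r x)))" using ev by eventually_elim (simp only: XX_norms(1))
 ultimately show "((%r. XX1_norm Om R s al (%x. fst (Am (q r x)))) ---> 0) Fl" using tendsto_cong by force
 have f: "((%r. lmap e3 (MM (?X r))+lmap e4 (?X r)) ---> 0+0) Fl" by (intro tendsto_add l e_linear)
 hence f': "((%r. lmap (%A. A ** Ri) (lmap e3 (MM (?X r))+lmap e4 (?X r))) ---> lmap (%A. A ** Ri) (0+0)) Fl"
  by (rule bounded_linear.tendsto[OF bl_lmap[OF bl_matrix_mult]])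
 have "((%r. sqrt ((HH2_norm Om \<C> s (%x. snd (Am (q r x))))^2
   + inner (lmap (%A. A ** Ri) (lmap e3 (MM (?X r))+lmap e4 (?X r))) (lmap e3 (MM (?X r))+lmap e4 (?X r))))
  ---> sqrt (0^2+inner (lmap (%A. A ** Ri) (0+0)) (0+0 :: ('d, real^2^'d) lsq))) Fl"
  by (intro tendsto_real_sqrt tendsto_add tendsto_power h tendsto_inner f f')
 moreover have "\<forall>\<^sub>F r in Fl. sqrt ((HH2_norm Om \<C> s (%x. snd (Am (q r x))))^2
   + inner (lmap (%A. A ** Ri) (lmap e3 (MM (?X r))+lmap e4 (?X r))) (lmap e3 (MM (?X r))+lmap e4 (?X r)))
  = XX2_norm Om R \<C> s al (%x. snd (Am (q r x)))" using ev by eventually_elim (simp only: XX_norms(2))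
 ultimately show "((%r. XX2_norm Om R \<C> s al (%x. snd (Am (q r x)))) ---> 0) Fl" using tendsto_cong by force
qed

definition src :: "(real => real^'d => real^2^'d) => (real => real^'d => real) => real => ('d, 'd state) lsq" where
 "src f g t = zext Om (%x. (f t x ** Ri, (0, 1/s*g t x)))"

lemma src_L2: "f t : L2 Om ==> g t : L2 Om ==> (%x. (f t x ** Ri, (0 :: real^'d^'d, 1/s*g t x))) : L2 Om"
 using L2_scaleR[of "g t" Om "1/s"] by (intro L2_Pair L2_zero) (simp_all add: L2_linear[OF _ bl_matrix_mult])

definition src_f :: "real^2^'d => 'd state" where "src_f A = (A ** Ri, 0)"
definition src_g :: "real => 'd state" where "src_g r = (0, (0, 1/s*r))"

lemma src_linear: "bounded_linear src_f" "bounded_linear src_g"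
 by (rule bl_euclI; simp add: src_f_def src_g_def linear_simps[OF bl_matrix_mult] add_divide_distrib)+

lemma src_eq: "f t : L2 Om ==> g t : L2 Om ==> src f g t = lmap src_f (zext Om (f t))+lmap src_g (zext Om (g t))"
 by (simp add: src_def lmap_ext src_linear zext_add L2_linear[OF _ src_linear(1)] L2_linear[OF _ src_linear(2)])
  (simp add: src_f_def src_g_def zero_prod_def)

lemma equations_iff: assumes a: "adm q" and f: "f t : L2 Om" and g: "g t : L2 Om" and u': "u' : HH1 Om" and w': "w' : HH2 Om"
 defines "u \<equiv> %x. fst (Am (q x))" and "w \<equiv> %x. snd (Am (q x))" and "X \<equiv> zext Om (%x. Am (q x))"
 shows "(AE x in LO Om. u' x+cols (- row_div Om (total_stress al w) x) (weak_grad Om (%y. snd (w y)) x) ** Ri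
     + cols 0 (be*.col_f u x) ** Ri = f t x ** Ri) &
    (AE x in LO Om. w' x+(- \<C> (strain Om (col_s u) x), 1/s*fluid_content Om al u x) = (0, 1/s*g t x))
  \<longleftrightarrow> zext Om (%x. (u' x, w' x))+MM X = src f g t"
proof -
 have qL: "q : L2 Om" using a by (simp add: adm_def)
 have BL: "(%x. Bm (q x)) : L2 Om" by (intro L2_linear[OF qL] bl_Bm)
 note x = adm_XX[OF a, folded u_def w_def]
 have x5: "AE x in LO Om. weak_grad Om (%y. snd (w y)) x = snd (k3 (q x))" using adm_XX(5)[OF a] unfolding w_def .
 have M: "MM X = zext Om (%x. Bm (q x))" unfolding X_def by (rule adm_state(2)[OF a])
 have L: "(%x. (u' x, w' x)) : L2 Om" by (rule HH_L2[OF u' w'])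
 have cf: "col_f u x = snd (k2 (q x))" for x by (simp add: col_f_def u_def Am_def column_cols)
 have "zext Om (%x. (u' x, w' x))+MM X = src f g t \<longleftrightarrow> (AE x in LO Om. (u' x, w' x)+Bm (q x) = (f t x ** Ri, (0, 1/s*g t x)))"
  by (simp only: M src_def zext_add[OF Om L BL] zext_eq_iff[OF Om L2_add[OF L BL] src_L2[where f=f and g=g and t=t, OF f g]])
 also have "... \<longleftrightarrow> (AE x in LO Om. (u' x+cols (- row_div Om (total_stress al w) x) (weak_grad Om (%y. snd (w y)) x) ** Ri
     + cols 0 (be*.col_f u x) ** Ri = f t x ** Ri) &
     w' x+(- \<C> (strain Om (col_s u) x), 1/s*fluid_content Om al u x) = (0, 1/s*g t x))"
 proof -
  have "AE x in LO Om. (u' x, w' x)+Bm (q x) = (f t x ** Ri, (0, 1/s*g t x)) \<longleftrightarrow>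
   (u' x+cols (- row_div Om (total_stress al w) x) (weak_grad Om (%y. snd (w y)) x) ** Ri
     + cols 0 (be*.col_f u x) ** Ri = f t x ** Ri) &
     w' x+(- \<C> (strain Om (col_s u) x), 1/s*fluid_content Om al u x) = (0, 1/s*g t x)" using x(3,4) x5 x(6)
  proof eventually_elim
   case (elim x)
   have "cols (- fst (k4 (q x))) (snd (k3 (q x))+be*.snd (k2 (q x))) ** Ri
    = cols (- fst (k4 (q x))) (snd (k3 (q x))) ** Ri+cols 0 (be*.snd (k2 (q x))) ** Ri"
    by (simp add: linear_simps(1)[OF bl_matrix_mult, symmetric] cols_add[symmetric])
   hence B: "Bm (q x) = (cols (- fst (k4 (q x))) (snd (k3 (q x))) ** Ri+cols 0 (be*.snd (k2 (q x))) ** Ri,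
     (- \<C> (sympart (snd (k1 (q x)))), 1/s*(al*trace (snd (k1 (q x)))+fst (k2 (q x)))))" by (simp add: Bm_def Cx_sym sympart_in)
   show ?case unfolding elim cf B by (simp add: add.assoc)
  qed
  thus ?thesis by (rule eventually_subst)
 qed
 finally show ?thesis by (simp add: AE_conj_iff)
qed

lemma solution_state: assumes T: "0 < T" and sol: "is_solution T Om Ss Sf R \<C> s al be f g u0 w0 u w"
  and fg: "ALL t:{0..T}. f t : L2 Om" "ALL t:{0..T}. g t : L2 Om" and i: "u0 : XX1 Om Ss Sf" "w0 : XX2 Om Ss Sf al"
 defines "X \<equiv> %t. zext Om (%x. (u t x, w t x))" shows "continuous_on {0..T} X" "X 0 = zext Om (%x. (u0 x, w0 x))"
  "!!t. t : {0<..T} ==> X t : DD & (X has_vector_derivative src f g t-MM (X t)) (at t within {0..T})"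
  "!!t. t : {0..T} ==> (%x. (u t x, w t x)) : L2 Om"
proof -
 have c1: "C_time 1 T (HH1 Om) (HH1_norm Om R) u" "C_time 1 T (HH2 Om) (HH2_norm Om \<C> s) w"
  and c0: "C_time 0 T (XX1 Om Ss Sf) (XX1_norm Om R s al) u" "C_time 0 T (XX2 Om Ss Sf al) (XX2_norm Om R \<C> s al) w"
  and ini: "AE x in LO Om. u 0 x = u0 x" "AE x in LO Om. w 0 x = w0 x" using sol unfolding is_solution_def by blast+
 obtain u' w' where eqs: "ALL t:{0<..T}.
    u' t : HH1 Om & has_time_deriv T (HH1_norm Om R) u (u' t) t &
    w' t : HH2 Om & has_time_deriv T (HH2_norm Om \<C> s) w (w' t) t & (AE x in LO Om.
     u' t x
     + cols (- row_div Om (total_stress al (w t)) x) (weak_grad Om (%y. snd (w t y)) x) ** matrix_inv R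
     + cols 0 (be*.col_f (u t) x) ** matrix_inv R
     = f t x ** matrix_inv R) & (AE x in LO Om.
     w' t x+(- \<C> (strain Om (col_s (u t)) x), 1/s*fluid_content Om al (u t) x)
     = (0, 1/s*g t x))" using sol unfolding is_solution_def by blast
 have h: "u r : HH1 Om & w r : HH2 Om" if "r : {0..T}" for r using c1 that by simp
 show L: "!!t. t : {0..T} ==> (%x. (u t x, w t x)) : L2 Om" using h HH_L2 by blast
 obtain u1 where u1: "C_time 0 T (HH1 Om) (HH1_norm Om R) u1" "ALL t:{0..T}. has_time_deriv T (HH1_norm Om R) u (u1 t) t"
  using c1(1) unfolding One_nat_def C_time.simps(2) by blast
 obtain w1 where w1: "C_time 0 T (HH2 Om) (HH2_norm Om \<C> s) w1" "ALL t:{0..T}. has_time_deriv T (HH2_norm Om \<C> s) w (w1 t) t"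
  using c1(2) unfolding One_nat_def C_time.simps(2) by blast
 have "(X has_vector_derivative zext Om (%x. (u1 t x, w1 t x))) (at t within {0..T})" if t: "t : {0..T}" for t
  unfolding X_def using has_time_deriv_HH[where u=u and w=w and T=T, OF h t, of "u1 t" "w1 t"] u1 w1 t by simp
 thus "continuous_on {0..T} X" unfolding continuous_on_eq_continuous_within using has_vector_derivative_continuous by blast
 have i0: "(%x. (u0 x, w0 x)) : L2 Om"
 proof -
  obtain q where q: "adm q" "!!x. Am (q x) = (u0 x, w0 x)" by (rule XX_adm[OF i], rule that, assumption+)
  have "q : L2 Om" using q(1) by (simp add: adm_def)
  from L2_linear[OF this bl_Am] show ?thesis by (simp add: q(2))
 qed
 have z: "0 : {0..T}" using T by simp
 show "X 0 = zext Om (%x. (u0 x, w0 x))" unfolding X_def zext_eq_iff[OF Om L[OF z] i0] using ini by eventually_elim simp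
 fix t assume t: "t : {0<..T}"
 hence t': "t : {0..T}" by simp
 have uX: "u t : XX1 Om Ss Sf" and wX: "w t : XX2 Om Ss Sf al" using c0 t' by simp_all
 obtain q where q: "adm q" "!!x. Am (q x) = (u t x, w t x)" by (rule XX_adm[OF uX wX], rule that, assumption+)
 have Xq: "X t = zext Om (%x. Am (q x))" by (simp add: X_def q(2))
 have e: "u' t : HH1 Om" "w' t : HH2 Om" "has_time_deriv T (HH1_norm Om R) u (u' t) t & has_time_deriv T (HH2_norm Om \<C> s) w (w' t) t"
  using eqs t by blast+
 have d: "(X has_vector_derivative zext Om (%x. (u' t x, w' t x))) (at t within {0..T})"
  unfolding X_def using has_time_deriv_HH[where u=u and w=w and T=T, OF h t' e(1,2)] e(3) by blast
 have "zext Om (%x. (u' t x, w' t x))+MM (X t) = src f g t"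
  unfolding Xq using equations_iff[where f=f and g=g and t=t, OF q(1) bspec[OF fg(1) t'] bspec[OF fg(2) t'] e(1,2)] eqs t by (simp add: q(2))
 hence "zext Om (%x. (u' t x, w' t x)) = src f g t-MM (X t)" by (simp add: eq_diff_eq)
 thus "X t : DD & (X has_vector_derivative src f g t-MM (X t)) (at t within {0..T})" using d adm_state(1)[OF q(1)] by (simp add: Xq)
qed

lemma MM_diff: "x : DD ==> y : DD ==> MM (x-y) = MM x-MM y" using M_add[of x "- 1*.y"] M_scale[of y "- 1"] subspace_scale[OF D, of y "- 1"] by simp

lemma solution_unique:
 assumes T: "0 < T" and sol: "is_solution T Om Ss Sf R \<C> s al be f g u0 w0 u w" "is_solution T Om Ss Sf R \<C> s al be f g u0 w0 v z"
  and fg: "ALL t:{0..T}. f t : L2 Om" "ALL t:{0..T}. g t : L2 Om" and i: "u0 : XX1 Om Ss Sf" "w0 : XX2 Om Ss Sf al" and t: "t : {0..T}"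
 shows "AE x in LO Om. v t x = u t x & z t x = w t x"
proof -
 note a = solution_state[OF T sol(1) fg i] and b = solution_state[OF T sol(2) fg i]
 let ?X = "%t. zext Om (%x. (u t x, w t x))" and ?Z = "%t. zext Om (%x. (v t x, z t x))"
 have "?Z t - ?X t = 0"
 proof (rule evolution_unique[of T "%t. ?Z t - ?X t", OF _ _ _ t])
  show "continuous_on {0..T} (%t. ?Z t - ?X t)" by (intro continuous_on_diff a(1) b(1))
  show "?Z 0 - ?X 0 = 0" by (simp only: a(2) b(2) diff_self)
  fix r assume r: "r : {0<..T}"
  note a' = a(3)[OF r] and b' = b(3)[OF r]
  have "((%t. ?Z t - ?X t) has_vector_derivative (src f g r-MM (?Z r))-(src f g r-MM (?X r))) (at r within {0..T})"
   using a' b' by (intro has_vector_derivative_diff) blast+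
  moreover have "(src f g r-MM (?Z r))-(src f g r-MM (?X r)) = - MM (?Z r - ?X r)" using a' b' by (simp add: MM_diff)
  ultimately show "?Z r - ?X r : DD & ((%t. ?Z t - ?X t) has_vector_derivative-MM (?Z r - ?X r)) (at r within {0..T})"
   using a' b' subspace_diff[OF D] by simp
 qed
 hence "?Z t = ?X t" by simp
 thus ?thesis unfolding zext_eq_iff[OF Om b(4)[OF t] a(4)[OF t]] by simp
qed

end

context poro
begin

lemma PI_rep: assumes P: "PI G = G" shows "(%x. fst (rep G x)) : HH1 Om" "(%x. snd (rep G x)) : HH2 Om"
  "zext Om (%x. (fst (rep G x), snd (rep G x))) = G"
proof -
 have L: "rep G : L2 Om" by (rule rep_L2_on) simp
 have sL: "(%x. snd (rep G x)) : L2 Om" by (rule L2_linear[OF L bounded_linear_snd])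
 have r: "restr Om G = G" using P by (metis PI_def restr_restr)
 have "lmap symz G = G" using arg_cong[OF P, of "lmap symz"] P by (simp add: PI_def restr_lmap[OF Om bl_symz] lmap_lmap bl_symz symz_symz)
 hence "AE x in lebesgue. rep G x = symz (rep G x)" using rep_lmap[OF bl_symz, of G] by simp
 hence "AE x in LO Om. fst (snd (rep G x)) : sym_mats"
  unfolding AE_lebesgue_on[OF Om] by eventually_elim (simp add: symz_def sym_mats_iff prod_eq_iff)
 thus "(%x. snd (rep G x)) : HH2 Om" using L2_linear[OF sL bounded_linear_fst] L2_linear[OF sL bounded_linear_snd] by (simp add: HH2_def L2_sym_def)
 show "(%x. fst (rep G x)) : HH1 Om" unfolding HH1_def by (rule L2_linear[OF L bounded_linear_fst])
 show "zext Om (%x. (fst (rep G x), snd (rep G x))) = G" using r by simp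
qed

lemma PI_src: assumes f: "f t : L2 Om" and g: "g t : L2 Om" shows "PI (src f g t) = src f g t"
proof -
 note L = src_L2[where f=f and g=g and t=t, OF f g]
 have "symz (f t x ** Ri, (0, 1/s*g t x)) = (f t x ** Ri, (0, 1/s*g t x))" for x by (simp add: symz_def linear_simps(3)[OF bl_sympart])
 hence l: "lmap symz (src f g t) = src f g t" unfolding src_def by (simp only: lmap_ext[OF Om L bl_symz])
 show ?thesis unfolding PI_def l unfolding src_def by (rule restr_ext[OF Om L])
qed

lemma PI_DD: assumes X: "X : DD" shows "PI (MM X) = MM X"
proof -
 obtain Q where "Q : KK" "MM X = lmap Bm Q" by (rule DD_E[OF X])
 thus ?thesis by (simp add: PI_Bm)
qed

lemma src_derivative: assumes f: "C_time 1 T (L2 Om) (l2_norm Om) f" and g: "C_time 1 T (L2 Om) (l2_norm Om) g"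
 obtains F' where "!!t. t : {0..T} ==> (src f g has_vector_derivative F' t) (at t within {0..T})" "continuous_on {0..T} F'"
proof -
 obtain f' where f': "C_time 0 T (L2 Om) (l2_norm Om) f'" "ALL t:{0..T}. has_time_deriv T (l2_norm Om) f (f' t) t"
  using f unfolding One_nat_def C_time.simps(2) by blast
 obtain g' where g': "C_time 0 T (L2 Om) (l2_norm Om) g'" "ALL t:{0..T}. has_time_deriv T (l2_norm Om) g (g' t) t"
  using g unfolding One_nat_def C_time.simps(2) by blast
 have fL: "f t : L2 Om" "g t : L2 Om" "f' t : L2 Om" "g' t : L2 Om" if "t : {0..T}" for t using f g f'(1) g'(1) that by simp_all
 define F' where "F' t = lmap src_f (zext Om (f' t))+lmap src_g (zext Om (g' t))" for t
 have "(src f g has_vector_derivative F' t) (at t within {0..T})" if t: "t : {0..T}" for t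
 proof -
  have "((%t. zext Om (f t)) has_vector_derivative zext Om (f' t)) (at t within {0..T})"
   using has_time_deriv_l2[where w=f and T=T, OF fL(1) t fL(3)[OF t]] f'(2) t by blast
  moreover have "((%t. zext Om (g t)) has_vector_derivative zext Om (g' t)) (at t within {0..T})"
   using has_time_deriv_l2[where w=g and T=T, OF fL(2) t fL(4)[OF t]] g'(2) t by blast
  ultimately have "((%t. lmap src_f (zext Om (f t))+lmap src_g (zext Om (g t))) has_vector_derivative F' t) (at t within {0..T})" unfolding F'_def
   by (intro has_vector_derivative_add bounded_linear.has_vector_derivative[OF bl_lmap] src_linear)
  thus ?thesis by (rule has_vector_derivative_transform[OF t, rotated]) (simp add: src_eq fL)
 qed
 moreover have "continuous_on {0..T} F'" unfolding F'_def[abs_def]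
  by (intro continuous_on_add bounded_linear.continuous_on[OF bl_lmap] src_linear C_time_l2_continuous f'(1) g'(1))
 ultimately show ?thesis using that by blast
qed

lemma solution_exists: assumes T: "0 < T" and f: "C_time 1 T (L2 Om) (l2_norm Om) f" and g: "C_time 1 T (L2 Om) (l2_norm Om) g"
  and i: "u0 : XX1 Om Ss Sf" "w0 : XX2 Om Ss Sf al"
 obtains u w where "is_solution T Om Ss Sf R \<C> s al be f g u0 w0 u w"
  "!!t. t : {0..T} ==> u t : HH1 Om" "!!t. t : {0..T} ==> w t : HH2 Om"
  "!!B t. (!!r. r : {0..T} ==> ipn (src f g r) <= B) ==> t : {0..T} ==>
   ipn (zext Om (%x. (u t x, w t x))) <= ipn (zext Om (%x. (u0 x, w0 x)))+T*B"
proof -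
 have fL: "f t : L2 Om" "g t : L2 Om" if "t : {0..T}" for t using f g that by simp_all
 obtain q0 where q0: "adm q0" "!!x. Am (q0 x) = (u0 x, w0 x)" by (rule XX_adm[OF i], rule that, assumption+)
 define X0 where "X0 = zext Om (%x. (u0 x, w0 x))"
 have X0: "X0 : DD" "PI X0 = X0" using adm_state(1,3)[OF q0(1)] by (simp_all add: X0_def q0(2))
 obtain F' where F': "!!t. t : {0..T} ==> (src f g has_vector_derivative F' t) (at t within {0..T})" "continuous_on {0..T} F'"
  by (rule src_derivative[OF f g], rule that, assumption+)
 obtain x gg where x: "x 0 = X0" "continuous_on {0..T} gg" "!!t. t : {0..T} ==> x t : DD"
  "!!t. t : {0..T} ==> (x has_vector_derivative gg t) (at t within {0..T})"
  "!!t. t : {0..T} ==> gg t+MM (x t) = src f g t"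
  "!!B t. (!!r. r : {0..T} ==> ipn (src f g r) <= B) ==> t : {0..T} ==> ipn (x t) <= ipn X0+T*B"
 proof (rule evolution_exists[OF T X0(1), of "src f g" F'])
  fix x gg
  assume "x 0 = X0" "continuous_on {0..T} gg" "!!t. t : {0..T} ==> x t : DD"
   "!!t. t : {0..T} ==> (x has_vector_derivative gg t) (at t within {0..T})"
   "!!t. t : {0..T} ==> gg t+MM (x t) = src f g t"
   "!!B t. (!!r. r : {0..T} ==> ipn (src f g r) <= B) ==> t : {0..T} ==> ipn (x t) <= ipn X0+T*B"
  thus thesis by (rule that)
 qed (use F' in auto)
 have z: "0 : {0..T}" using T by simp
 have Pg: "PI (gg t) = gg t" if t: "t : {0..T}" for t
 proof -
  have e: "gg t = src f g t-MM (x t)" using x(5)[OF t] by (simp add: eq_diff_eq)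
  show ?thesis unfolding e by (simp add: linear_simps(2)[OF bl_PI] PI_src[where f=f and g=g and t=t, OF fL[OF t]] PI_DD[OF x(3)[OF t]])
 qed
 have Px: "PI (x t) = x t" if t: "t : {0..T}" for t
 proof -
  have "EX c. ALL r:{0..T}. x r-PI (x r) = c"
  proof (rule has_derivative_zero_constant)
   fix r assume r: "r : {0..T}"
   have "((%r. x r-PI (x r)) has_vector_derivative gg r-PI (gg r)) (at r within {0..T})"
    by (intro has_vector_derivative_diff x(4)[OF r] bounded_linear.has_vector_derivative[OF bl_PI])
   thus "((%r. x r-PI (x r)) has_derivative (%h. 0)) (at r within {0..T})" by (simp add: Pg[OF r] has_vector_derivative_def)
  qed simp
  then obtain c where c: "ALL r:{0..T}. x r-PI (x r) = c" by (rule exE)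
  have "c = 0" using bspec[OF c z] by (simp add: x(1) X0(2))
  thus ?thesis using bspec[OF c t] by simp
 qed
 have "ALL t:{0..T}. EX q. adm q & x t = zext Om (%y. Am (q y))"
 proof
  fix t assume t: "t : {0..T}"
  show "EX q. adm q & x t = zext Om (%y. Am (q y))" by (rule DD_adm[OF x(3)[OF t] Px[OF t]]) (intro exI conjI, assumption+)
 qed
 from bchoice[OF this] obtain q where q0': "ALL t:{0..T}. adm (q t) & x t = zext Om (%y. Am (q t y))" by (rule exE)
 have q: "adm (q t)" "x t = zext Om (%y. Am (q t y))" if "t : {0..T}" for t using bspec[OF q0' that] by blast+
 define u where "u t y = fst (Am (q t y))" for t y
 define w where "w t y = snd (Am (q t y))" for t y
 define u' where "u' t y = fst (rep (gg t) y)" for t y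
 define w' where "w' t y = snd (rep (gg t) y)" for t y
 have uw: "u t : HH1 Om & w t : HH2 Om" if "t : {0..T}" for t using adm_HH[OF q(1)[OF that]] by (simp add: u_def[abs_def] w_def[abs_def])
 have Xe: "zext Om (%y. (u t y, w t y)) = x t" if "t : {0..T}" for t using q(2)[OF that] by (simp add: u_def w_def)
 have uw': "u' t : HH1 Om & w' t : HH2 Om" and Ge: "zext Om (%y. (u' t y, w' t y)) = gg t" if "t : {0..T}" for t
  using PI_rep[OF Pg[OF that]] by (simp_all add: u'_def[abs_def] w'_def[abs_def])
 have der: "has_time_deriv T (HH1_norm Om R) u (u' t) t & has_time_deriv T (HH2_norm Om \<C> s) w (w' t) t" if t: "t : {0..T}" for t
 proof -
  have "((%r. zext Om (%y. (u r y, w r y))) has_vector_derivative gg t) (at t within {0..T})"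
   by (rule has_vector_derivative_transform[OF t _ x(4)[OF t]]) (simp add: Xe)
  thus ?thesis using has_time_deriv_HH[where u=u and w=w and T=T, OF uw t conjunct1[OF uw'[OF t]] conjunct2[OF uw'[OF t]]] by (simp add: Ge[OF t])
 qed
 have "continuous_on {0..T} (%t. zext Om (%y. (u' t y, w' t y)))" by (subst continuous_on_cong[OF refl Ge]) (auto intro: x(2))
 hence C0: "C_time 0 T (HH1 Om) (HH1_norm Om R) u' & C_time 0 T (HH2 Om) (HH2_norm Om \<C> s) w'"
  using C_time_HH[where u=u' and w=w' and T=T, OF uw'] by blast
 have C1: "C_time 1 T (HH1 Om) (HH1_norm Om R) u" "C_time 1 T (HH2 Om) (HH2_norm Om \<C> s) w"
  unfolding One_nat_def C_time.simps(2) using C0 der uw by blast+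
 have xc: "continuous_on {0..T} x" unfolding continuous_on_eq_continuous_within using has_vector_derivative_continuous[OF x(4)] by blast
 have sc: "continuous_on {0..T} (src f g)" unfolding continuous_on_eq_continuous_within using has_vector_derivative_continuous[OF F'(1)] by blast
 have Mc: "continuous_on {0..T} (%t. MM (x t))"
 proof -
  have e: "src f g t-gg t = MM (x t)" if "t : {0..T}" for t using x(5)[OF that] by (simp add: diff_eq_eq add.commute)
  show ?thesis by (rule continuous_on_eq[OF continuous_on_diff[OF sc x(2)] e])
 qed
 have XXn: "((%r. XX1_norm Om R s al (%y. u r y-u t y)) ---> 0) (at t within {0..T})"
  "((%r. XX2_norm Om R \<C> s al (%y. w r y-w t y)) ---> 0) (at t within {0..T})" if t: "t : {0..T}" for t
 proof -
  let ?q = "%r y. q r y-q t y"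
  have a: "adm (?q r)" if "r : {0..T}" for r by (rule adm_diff[OF q(1)[OF that] q(1)[OF t]])
  have L: "(%y. Am (q r y)) : L2 Om" if "r : {0..T}" for r using q(1)[OF that] by (simp add: adm_def L2_linear[OF _ bl_Am])
  have X: "zext Om (%y. Am (?q r y)) = x r-x t" if r: "r : {0..T}" for r
   by (simp add: linear_simps(2)[OF bl_Am] zext_diff[OF Om L[OF r] L[OF t], symmetric] q(2)[OF r, symmetric] q(2)[OF t, symmetric])
  have M: "MM (zext Om (%y. Am (?q r y))) = MM (x r)-MM (x t)" if r: "r : {0..T}" for r by (simp add: X[OF r] MM_diff x(3)[OF r] x(3)[OF t])
  have ev: "\<forall>\<^sub>F r in at t within {0..T}. P r" if "!!r. r : {0..T} ==> P r" for P
   unfolding eventually_at_filter using that by (auto intro: always_eventually)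
  have ea: "\<forall>\<^sub>F r in at t within {0..T}. adm (?q r)" by (rule ev) (rule a)
  have eX: "\<forall>\<^sub>F r in at t within {0..T}. zext Om (%y. Am (?q r y)) = x r-x t" by (rule ev) (rule X)
  have eM: "\<forall>\<^sub>F r in at t within {0..T}. MM (zext Om (%y. Am (?q r y))) = MM (x r)-MM (x t)" by (rule ev) (rule M)
  have "((%r. x r-x t) ---> x t-x t) (at t within {0..T})" "((%r. MM (x r)-MM (x t)) ---> MM (x t)-MM (x t)) (at t within {0..T})"
   by (rule tendsto_diff[OF bspec[OF xc[unfolded continuous_on_def] t] tendsto_const],
     rule tendsto_diff[OF bspec[OF Mc[unfolded continuous_on_def] t] tendsto_const])
  hence "((%r. zext Om (%y. Am (?q r y))) ---> 0) (at t within {0..T})" "((%r. MM (zext Om (%y. Am (?q r y)))) ---> 0) (at t within {0..T})"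
   unfolding tendsto_cong[OF eX] tendsto_cong[OF eM] by simp_all
  from XX_null[OF ea this]
  show "((%r. XX1_norm Om R s al (%y. u r y-u t y)) ---> 0) (at t within {0..T})"
   "((%r. XX2_norm Om R \<C> s al (%y. w r y-w t y)) ---> 0) (at t within {0..T})" by (simp_all add: u_def w_def linear_simps(2)[OF bl_Am])
 qed
 have XXm: "u t : XX1 Om Ss Sf" "w t : XX2 Om Ss Sf al" if "t : {0..T}" for t
  using adm_XX(1,2)[OF q(1)[OF that]] by (simp_all add: u_def[abs_def] w_def[abs_def])
 have C2: "C_time 0 T (XX1 Om Ss Sf) (XX1_norm Om R s al) u" "C_time 0 T (XX2 Om Ss Sf al) (XX2_norm Om R \<C> s al) w" using XXm XXn by simp_all
 have eqs: "(AE y in LO Om. u' t y+cols (- row_div Om (total_stress al (w t)) y) (weak_grad Om (%y. snd (w t y)) y) ** Ri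
     + cols 0 (be*.col_f (u t) y) ** Ri = f t y ** Ri) &
    (AE y in LO Om. w' t y+(- \<C> (strain Om (col_s (u t)) y), 1/s*fluid_content Om al (u t) y) = (0, 1/s*g t y))" if t: "t : {0..T}" for t
  using equations_iff[where f=f and g=g and t=t, OF q(1)[OF t] fL[OF t] conjunct1[OF uw'[OF t]] conjunct2[OF uw'[OF t]]] x(5)[OF t]
  by (simp add: Ge[OF t] q(2)[OF t, symmetric] u_def[abs_def] w_def[abs_def])
 have "AE y in LO Om. (u 0 y, w 0 y) = (u0 y, w0 y)"
 proof -
  have L0: "(%y. (u0 y, w0 y)) : L2 Om" using q0 L2_linear[OF _ bl_Am, of q0 Om] by (simp add: adm_def)
  have "zext Om (%y. (u 0 y, w 0 y)) = zext Om (%y. (u0 y, w0 y))" by (simp add: Xe[OF z] x(1) X0_def)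
  thus ?thesis using zext_eq_iff[OF Om HH_L2[OF conjunct1[OF uw[OF z]] conjunct2[OF uw[OF z]]] L0] by blast
 qed
 hence ini: "AE y in LO Om. u 0 y = u0 y" "AE y in LO Om. w 0 y = w0 y" by (auto elim: eventually_mono)
 have "is_solution T Om Ss Sf R \<C> s al be f g u0 w0 u w" unfolding is_solution_def
 proof (intro conjI C1 C2 ini exI[of _ u'] exI[of _ w'] ballI)
  fix t assume "t : {0<..T}"
  hence t: "t : {0..T}" by simp
  show "u' t : HH1 Om" "w' t : HH2 Om" using uw'[OF t] by blast+
  show "has_time_deriv T (HH1_norm Om R) u (u' t) t" "has_time_deriv T (HH2_norm Om \<C> s) w (w' t) t" using der[OF t] by blast+
  note e = eqs[OF t]
  show "AE y in LO Om. u' t y+cols (- row_div Om (total_stress al (w t)) y) (weak_grad Om (%y. snd (w t y)) y) ** Ri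
     + cols 0 (be*.col_f (u t) y) ** Ri = f t y ** Ri" by (rule conjunct1[OF e])
  show "AE y in LO Om. w' t y+(- \<C> (strain Om (col_s (u t)) y), 1/s*fluid_content Om al (u t) y) = (0, 1/s*g t y)" by (rule conjunct2[OF e])
 qed
 moreover have "ipn (zext Om (%y. (u t y, w t y))) <= ipn (zext Om (%y. (u0 y, w0 y)))+T*B"
  if "!!r. r : {0..T} ==> ipn (src f g r) <= B" "t : {0..T}" for B t using x(6)[OF that] by (simp add: Xe[OF that(2)] X0_def)
 ultimately show ?thesis using that[of u w] uw by blast
qed

lemma src_bound:
 obtains K0 where "0 <= K0" "!!f g t. f t : L2 Om ==> g t : L2 Om ==> ipn (src f g t) <= K0*(l2_norm Om (f t)+l2_norm Om (g t))"
proof -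
 obtain c where c: "0 < c" "!!x. ipn x <= c*norm x" by (rule ipn_le_norm, rule that, assumption+)
 obtain a where a: "0 < a" "!!x :: ('d, real^2^'d) lsq. norm (lmap src_f x) <= norm x*a"
  using bounded_linear.pos_bounded[OF bl_lmap[OF src_linear(1)]] by blast
 obtain b where b: "0 < b" "!!x :: ('d, real) lsq. norm (lmap src_g x) <= norm x*b"
  using bounded_linear.pos_bounded[OF bl_lmap[OF src_linear(2)]] by blast
 have "ipn (src f g t) <= (c*(a+b))*(l2_norm Om (f t)+l2_norm Om (g t))" if fg: "f t : L2 Om" "g t : L2 Om" for f g t
 proof -
  let ?F = "zext Om (f t)" and ?G = "zext Om (g t)"
  have "ipn (src f g t) <= c*norm (src f g t)" by (rule c(2))
  also have "... <= c*(norm ?F*a+norm ?G*b)"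
   unfolding src_eq[where f=f and g=g and t=t, OF fg] using c(1) a(2)[of ?F] b(2)[of ?G] norm_triangle_ineq[of "lmap src_f ?F" "lmap src_g ?G"]
   by (intro mult_left_mono) linarith+
  also have "... <= c*((a+b)*(norm ?F+norm ?G))"
  proof (rule mult_left_mono)
   have "0 <= norm ?F*b" "0 <= norm ?G*a" using a(1) b(1) by simp_all
   thus "norm ?F*a+norm ?G*b <= (a+b)*(norm ?F+norm ?G)" by (simp add: algebra_simps)
  qed (use c(1) in simp)
  finally show ?thesis by (simp add: zext_norm fg)
 qed
 moreover have "0 <= c*(a+b)" using a(1) b(1) c(1) by simp
 ultimately show ?thesis using that by blast
qed

lemma l2_norm_sup: assumes T: "0 < T" and w: "C_time 1 T (L2 Om) (l2_norm Om) w" and t: "t : {0..T}"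
 shows "l2_norm Om (w t) <= (SUP t\<in>{0..T}. l2_norm Om (w t))"
proof (rule cSUP_upper[OF t])
 obtain w' where w': "C_time 0 T (L2 Om) (l2_norm Om) w'" "ALL t:{0..T}. has_time_deriv T (l2_norm Om) w (w' t) t"
  using w unfolding One_nat_def C_time.simps(2) by blast
 have L: "w t : L2 Om" "w' t : L2 Om" if "t : {0..T}" for t using w w'(1) that by simp_all
 have "((%t. zext Om (w t)) has_vector_derivative zext Om (w' t)) (at t within {0..T})" if t: "t : {0..T}" for t
  using has_time_deriv_l2[where w=w and T=T, OF L(1) t L(2)[OF t]] w'(2) t by blast
 hence "continuous_on {0..T} (%t. zext Om (w t))" unfolding continuous_on_eq_continuous_within using has_vector_derivative_continuous by blast
 hence "continuous_on {0..T} (%t. norm (zext Om (w t)))" by (rule continuous_on_norm)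
 hence "continuous_on {0..T} (%t. l2_norm Om (w t))" by (rule continuous_on_eq) (simp add: zext_norm L)
 hence "compact ((%t. l2_norm Om (w t)) ` {0..T})" by (rule compact_continuous_image) simp
 thus "bdd_above ((%t. l2_norm Om (w t)) ` {0..T})" by (intro bounded_imp_bdd_above compact_imp_bounded)
qed

end

lemma density_matrix_positive: assumes "0 < ros" "0 < rof" "0 < ph" "ph < 1" "1 < \<nu>"
 defines "R \<equiv> density_matrix ph \<nu> ros rof"
 obtains m where "R$1$2 = R$2$1" "0 < m"
  "!!x y. m*(x^2+y^2) <= R$1$1*x^2+2*(R$1$2*(x*y))+R$2$2*y^2"
proof -
 define a b c where "a = ph*rof+(1-ph)*ros" and "b = rof" and "c = \<nu>/ph*rof"
 have R: "R$1$1 = a" "R$1$2 = b" "R$2$1 = b" "R$2$2 = c" by (simp_all add: R_def density_matrix_def a_def b_def c_def)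
 have p: "0 < a" "0 < c" using assms by (simp_all add: a_def c_def add_pos_pos)
 have "a*c-b\<^sup>2 = rof^2*(\<nu> - 1)+(1-ph)*ros*(\<nu>/ph*rof)" using assms(3) by (simp add: a_def b_def c_def field_simps power2_eq_square)
 also have "... > 0" using assms by (intro add_pos_pos mult_pos_pos) simp_all
 finally have det: "0 < a*c-b\<^sup>2" .
 define m where "m = (a*c-b\<^sup>2)/(a+c)"
 have m: "0 < m" using det p by (simp add: m_def)
 have mm: "m*(a+c) = a*c-b\<^sup>2" using p by (simp add: m_def)
 have "m*(a+c) < a*(a+c)"   proof -
  have "a*c-b\<^sup>2 < a*(a+c)" using mult_pos_pos[OF p(1) p(1)] zero_le_power2[of b] unfolding distrib_left by linarith
  thus ?thesis by (simp only: mm)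
 qed
 hence am: "0 < a-m" using p by simp
 have "m*(x^2+y^2) <= a*x^2+2*(b*(x*y))+c*y^2" for x y
 proof -
  have "(a-m)*((a*x^2+2*(b*(x*y))+c*y^2)-m*(x^2+y^2))
    = ((a-m)*x+b*y)^2+(a*c-m*(a+c)+m^2-b\<^sup>2)*y^2" by (simp add: power2_eq_square algebra_simps)
  also have "... = ((a-m)*x+b*y)^2+m^2*y^2" unfolding mm by simp
  also have "... >= 0" by simp
  finally show ?thesis using am by (simp add: zero_le_mult_iff)
 qed
 thus ?thesis using that[of m] m by (simp add: R)
qed

theorem theorem1:
  fixes \<Omega> \<Gamma>sD \<Gamma>sN \<Gamma>fD \<Gamma>fN :: "(real ^ 'd) set"
    and \<C> :: "real ^ 'd ^ 'd \<Rightarrow> real ^ 'd ^ 'd"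
    and R :: "real ^ 2 ^ 2"
    and T \<alpha> s \<beta> \<eta> \<kappa> cm cp \<phi> \<nu> \<rho>s \<rho>f :: real
  assumes "CARD('d) \<in> {2, 3}"
    and "polyhedral_lipschitz_domain \<Omega>"
    and "boundary_partition \<Omega> \<Gamma>sD \<Gamma>sN"
    and "boundary_partition \<Omega> \<Gamma>fD \<Gamma>fN"
    and "emeasure surface_measure \<Gamma>sD > 0"
    and "emeasure surface_measure \<Gamma>fD > 0"
    and "T > 0"
    and "0 < \<alpha>" and "\<alpha> \<le> 1" and "s > 0"
    and "\<eta> > 0" and "\<kappa> > 0" and "\<beta> = \<eta> / \<kappa>"
    and "0 < cm" and "cm < cp" and "spd_tensor cm cp \<C>"
    and "\<rho>s > 0" and "\<rho>f > 0" and "0 < \<phi>" and "\<phi> < 1" and "\<nu> > 1"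
    and "R = density_matrix \<phi> \<nu> \<rho>s \<rho>f"
  shows "\<exists>K>0. \<forall>f g u0 \<sigma>0 p0.
     C_time 1 T (L2 \<Omega>) (l2_norm \<Omega>) f \<longrightarrow>
     C_time 1 T (L2 \<Omega>) (l2_norm \<Omega>) g \<longrightarrow>
     u0 \<in> XX1 \<Omega> \<Gamma>sD \<Gamma>fD \<longrightarrow>
     (\<lambda>x. (\<sigma>0 x, p0 x)) \<in> XX2 \<Omega> \<Gamma>sD \<Gamma>fD \<alpha> \<longrightarrow>
     (\<exists>u \<sigma> p.
        is_solution T \<Omega> \<Gamma>sD \<Gamma>fD R \<C> s \<alpha> \<beta> f g u0 (\<lambda>x. (\<sigma>0 x, p0 x)) u (\<lambda>t x. (\<sigma> t x, p t x)) \<and>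
        (\<forall>v \<tau> q.
           is_solution T \<Omega> \<Gamma>sD \<Gamma>fD R \<C> s \<alpha> \<beta> f g u0 (\<lambda>x. (\<sigma>0 x, p0 x)) v (\<lambda>t x. (\<tau> t x, q t x)) \<longrightarrow>
           (\<forall>t\<in>{0..T}. AE x in lebesgue_on \<Omega>. v t x = u t x \<and> \<tau> t x = \<sigma> t x \<and> q t x = p t x)) \<and>
        (SUP t\<in>{0..T}. HH1_norm \<Omega> R (u t)) + (SUP t\<in>{0..T}. HH2_norm \<Omega> \<C> s (\<lambda>x. (\<sigma> t x, p t x)))
          \<le> K * ((SUP t\<in>{0..T}. l2_norm \<Omega> (f t)) + (SUP t\<in>{0..T}. l2_norm \<Omega> (g t)))
             + 2 * (HH1_norm \<Omega> R u0 + HH2_norm \<Omega> \<C> s (\<lambda>x. (\<sigma>0 x, p0 x))))"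
proof -
 have dom: "open \<Omega>" "bounded \<Omega>" "lipschitz_boundary \<Omega>" using assms(2) by (simp_all add: polyhedral_lipschitz_domain_def)
 have part: "\<Gamma>sD : sets borel" "\<Gamma>sD \<subseteq> frontier \<Omega>" "\<Gamma>fD : sets borel" "\<Gamma>fD \<subseteq> frontier \<Omega>"
  using assms(3,4) by (auto simp: boundary_partition_def)
 obtain m where m: "R$1$2 = R$2$1" "0 < m"
  "!!x y. m*(x^2+y^2) <= R$1$1*x^2+2*(R$1$2*(x*y))+R$2$2*y^2" using density_matrix_positive[of \<rho>s \<rho>f \<phi> \<nu>] assms(17-22) by metis
 have "0 < \<beta>" using assms(11-13) by simp
 then interpret poro \<Omega> \<C> R cm cp \<alpha> s \<beta> m \<Gamma>sD \<Gamma>fD by unfold_locales (use dom part m assms(10,14,16) in auto)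
 have T: "0 < T" by (rule assms(7))
 obtain K0 where K0: "0 <= K0" "!!f g t. f t : L2 \<Omega> ==> g t : L2 \<Omega> ==> ipn (src f g t) <= K0*(l2_norm \<Omega> (f t)+l2_norm \<Omega> (g t))"
  by (rule src_bound, rule that, assumption+)
 define K where "K = 2*(T*K0)+1"
 have "0 < K" using T K0(1) by (simp add: K_def add_nonneg_pos)
 show ?thesis
 proof (intro exI[of _ K] conjI allI impI \<open>0 < K\<close>)
  fix f :: "real => real^'d => real^2^'d" and g :: "real => real^'d => real" and u0 :: "real^'d => real^2^'d"
   and \<sigma>0 :: "real^'d => real^'d^'d" and p0 :: "real^'d => real"
  assume f: "C_time 1 T (L2 \<Omega>) (l2_norm \<Omega>) f" and g: "C_time 1 T (L2 \<Omega>) (l2_norm \<Omega>) g"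
   and u0: "u0 : XX1 \<Omega> \<Gamma>sD \<Gamma>fD" and w0: "(%x. (\<sigma>0 x, p0 x)) : XX2 \<Omega> \<Gamma>sD \<Gamma>fD \<alpha>"
  let ?w0 = "%x. (\<sigma>0 x, p0 x)"
  have fL: "ALL t:{0..T}. f t : L2 \<Omega>" "ALL t:{0..T}. g t : L2 \<Omega>" using f g by simp_all
  obtain u w where sol: "is_solution T \<Omega> \<Gamma>sD \<Gamma>fD R \<C> s \<alpha> \<beta> f g u0 ?w0 u w"
   and H: "!!t. t : {0..T} ==> u t : HH1 \<Omega>" "!!t. t : {0..T} ==> w t : HH2 \<Omega>"
   and bound: "!!B t. (!!r. r : {0..T} ==> ipn (src f g r) <= B) ==> t : {0..T} ==>
    ipn (zext \<Omega> (%x. (u t x, w t x))) <= ipn (zext \<Omega> (%x. (u0 x, ?w0 x)))+T*B"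
  proof (rule solution_exists[OF T f g u0 w0])
   fix u w
   assume "is_solution T \<Omega> \<Gamma>sD \<Gamma>fD R \<C> s \<alpha> \<beta> f g u0 ?w0 u w"
    "!!t. t : {0..T} ==> u t : HH1 \<Omega>" "!!t. t : {0..T} ==> w t : HH2 \<Omega>"
    "!!B t. (!!r. r : {0..T} ==> ipn (src f g r) <= B) ==> t : {0..T} ==>
    ipn (zext \<Omega> (%x. (u t x, w t x))) <= ipn (zext \<Omega> (%x. (u0 x, ?w0 x)))+T*B"
   thus thesis by (rule that)
  qed
  define \<sigma> where "\<sigma> t x = fst (w t x)" for t x
  define p where "p t x = snd (w t x)" for t x
  have w: "(%t x. (\<sigma> t x, p t x)) = w" "!!t. (%x. (\<sigma> t x, p t x)) = w t" by (simp_all add: \<sigma>_def p_def)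
  define SF SG where "SF = (SUP t\<in>{0..T}. l2_norm \<Omega> (f t))" and "SG = (SUP t\<in>{0..T}. l2_norm \<Omega> (g t))"
  have z: "0 : {0..T}" using T by simp
  have sup: "l2_norm \<Omega> (f t) <= SF" "l2_norm \<Omega> (g t) <= SG" if "t : {0..T}" for t
   unfolding SF_def SG_def using l2_norm_sup[OF T f that] l2_norm_sup[OF T g that] .
  have S0: "0 <= SF+SG" using sup[OF z] by (smt (verit) l2_inner_nonneg l2_norm_def real_sqrt_ge_zero)
  have B: "ipn (src f g r) <= K0*(SF+SG)" if r: "r : {0..T}" for r
  proof -
   have "ipn (src f g r) <= K0*(l2_norm \<Omega> (f r)+l2_norm \<Omega> (g r))" by (rule K0(2)) (use fL r in auto)
   also have "... <= K0*(SF+SG)" using sup[OF r] K0(1) by (intro mult_left_mono) auto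
   finally show ?thesis .
  qed
  let ?I = "HH1_norm \<Omega> R u0+HH2_norm \<Omega> \<C> s ?w0"
  obtain q0 where q0: "adm q0" "!!x. Am (q0 x) = (u0 x, ?w0 x)" by (rule XX_adm[OF u0 w0], rule that, assumption+)
  have h0: "u0 : HH1 \<Omega>" "?w0 : HH2 \<Omega>" using adm_HH[OF q0(1)] by (simp_all add: q0(2))
  have est: "ipn (zext \<Omega> (%x. (u t x, w t x))) <= ?I+T*(K0*(SF+SG))" if t: "t : {0..T}" for t
   using bound[OF B t] HH_norm_le_ipn(3)[OF h0] by linarith
  have "(SUP t\<in>{0..T}. HH1_norm \<Omega> R (u t)) <= ?I+T*(K0*(SF+SG))"
  proof (rule cSUP_least)
   fix t assume t: "t : {0..T}"
   show "HH1_norm \<Omega> R (u t) <= ?I+T*(K0*(SF+SG))" using HH_norm_le_ipn(1)[OF H(1)[OF t] H(2)[OF t]] est[OF t] by linarith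
  qed (use z in auto)
  moreover have "(SUP t\<in>{0..T}. HH2_norm \<Omega> \<C> s (w t)) <= ?I+T*(K0*(SF+SG))"
  proof (rule cSUP_least)
   fix t assume t: "t : {0..T}"
   show "HH2_norm \<Omega> \<C> s (w t) <= ?I+T*(K0*(SF+SG))" using HH_norm_le_ipn(2)[OF H(1)[OF t] H(2)[OF t]] est[OF t] by linarith
  qed (use z in auto)
  moreover have "K*(SF+SG) = 2*(T*(K0*(SF+SG)))+(SF+SG)" by (simp add: K_def algebra_simps)
  moreover have "a+b <= kz+2*i" if "a <= i+A" "b <= i+A" "kz = 2*A+z" "0 <= z" for a b i A kz z :: real using that by linarith
  ultimately have energy: "(SUP t\<in>{0..T}. HH1_norm \<Omega> R (u t))+(SUP t\<in>{0..T}. HH2_norm \<Omega> \<C> s (w t)) <= K*(SF+SG)+2*?I"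
   using S0 by blast
  have unique: "AE x in LO \<Omega>. v t x = u t x & \<tau> t x = \<sigma> t x & q t x = p t x"
   if v: "is_solution T \<Omega> \<Gamma>sD \<Gamma>fD R \<C> s \<alpha> \<beta> f g u0 ?w0 v (%t x. (\<tau> t x, q t x))" and t: "t : {0..T}" for v \<tau> q t
   using solution_unique[OF T sol v fL u0 w0 t] by eventually_elim (simp add: \<sigma>_def p_def prod_eq_iff)
  show "EX u \<sigma> p.
    is_solution T \<Omega> \<Gamma>sD \<Gamma>fD R \<C> s \<alpha> \<beta> f g u0 (%x. (\<sigma>0 x, p0 x)) u (%t x. (\<sigma> t x, p t x)) &
    (ALL v \<tau> q.
     is_solution T \<Omega> \<Gamma>sD \<Gamma>fD R \<C> s \<alpha> \<beta> f g u0 (%x. (\<sigma>0 x, p0 x)) v (%t x. (\<tau> t x, q t x)) -->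
     (ALL t:{0..T}. AE x in LO \<Omega>. v t x = u t x & \<tau> t x = \<sigma> t x & q t x = p t x)) &
    (SUP t\<in>{0..T}. HH1_norm \<Omega> R (u t))+(SUP t\<in>{0..T}. HH2_norm \<Omega> \<C> s (%x. (\<sigma> t x, p t x)))
     <= K*((SUP t\<in>{0..T}. l2_norm \<Omega> (f t))+(SUP t\<in>{0..T}. l2_norm \<Omega> (g t)))
      + 2*(HH1_norm \<Omega> R u0+HH2_norm \<Omega> \<C> s (%x. (\<sigma>0 x, p0 x)))"
  proof (intro exI[of _ u] exI[of _ \<sigma>] exI[of _ p] conjI)
   show "is_solution T \<Omega> \<Gamma>sD \<Gamma>fD R \<C> s \<alpha> \<beta> f g u0 ?w0 u (%t x. (\<sigma> t x, p t x))" unfolding w(1) by (rule sol)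
   show "ALL v \<tau> q. is_solution T \<Omega> \<Gamma>sD \<Gamma>fD R \<C> s \<alpha> \<beta> f g u0 ?w0 v (%t x. (\<tau> t x, q t x)) -->
     (ALL t:{0..T}. AE x in LO \<Omega>. v t x = u t x & \<tau> t x = \<sigma> t x & q t x = p t x)" using unique by blast
   show "(SUP t\<in>{0..T}. HH1_norm \<Omega> R (u t))+(SUP t\<in>{0..T}. HH2_norm \<Omega> \<C> s (%x. (\<sigma> t x, p t x)))
     <= K*((SUP t\<in>{0..T}. l2_norm \<Omega> (f t))+(SUP t\<in>{0..T}. l2_norm \<Omega> (g t)))+2*?I"
    unfolding w(2) using energy unfolding SF_def SG_def .
  qed
 qed
qed

end
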